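(* Let $q\in\langle\cdot\rangle^{-2}H^s(\mathbb{R}^2)$ for some $s\in\,]1,2]$ (or $q=1_\Omega$ with $\Omega$ a bounded strictly convex domain with smooth boundary), $\sigma\in\{\pm1\}$, $\epsilon\in\,]0,1]$, and $h=1/|k|$ sufficiently small. Then the system $h\overline\partial\phi_1=e^{\overline{kz}-kz}\frac{hq}{2}\phi_2$, $h\partial\phi_2=\sigma e^{kz-\overline{kz}}\frac{h\overline q}{2}\phi_1$ has a solution of the form $\phi_1=1+\phi_1^1$, $\phi_2=0+\phi_2^1$ with $\phi_1^1,\phi_2^1\in\langle\cdot\rangle^\epsilon L^2$, given by $$\phi_1^1=(1-AB)^{-1}A\,\sigma F e^{kz-\overline{kz}}\frac{h\overline q}{2}=(1-AB)^{-1}AB(1),\qquad \phi_2^1=(1-BA)^{-1}\sigma F e^{kz-\overline{kz}}\frac{h\overline q}{2}=(1-BA)^{-1}B(1),$$ where $B(1)=\sigma Fe^{kz-\overline{kz}}h\overline q/2$ and $AB(1)$ are $\mathcal{O}(1)$ in $\langle\cdot\rangle^\epsilon L^2$; this is the unique solution with $\phi_1^1,\phi_2^1\in\langle\cdot\rangle^\epsilon L^2$.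
   Context: $\langle z\rangle=(1+|z|^2)^{1/2}$, $\langle\cdot\rangle^{\alpha}X=\{\langle\cdot\rangle^\alpha v:v\in X\}$, $H^s$ the Sobolev space. $\partial=\frac12(\partial_x-i\partial_y)$, $\overline\partial=\frac12(\partial_x+i\partial_y)$. $Eu(z)=\frac{1}{\pi h}\int\frac{u(w)}{z-w}L(dw)$, $Fu(z)=\frac{1}{\pi h}\int\frac{u(w)}{\overline z-\overline w}L(dw)$ (inverses of $h\overline\partial$, $h\partial$), $A=Ee^{\overline{kz}-kz}\frac{hq}{2}$, $B=\sigma Fe^{kz-\overline{kz}}\frac{h\overline q}{2}$, where $L(dw)$ is Lebesgue measure. *)

theory Defs
  imports "HOL-Analysis.Analysis"
begin

definition jbr :: "complex \<Rightarrow> real" where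
  "jbr z = sqrt (1 + (cmod z)\<^sup>2)"

fun Ck :: "nat \<Rightarrow> ('a::euclidean_space \<Rightarrow> 'b::real_normed_vector) \<Rightarrow> bool" where
  "Ck 0 f \<longleftrightarrow> continuous_on UNIV f"
| "Ck (Suc n) f \<longleftrightarrow> continuous_on UNIV f \<and> (\<forall>x. f differentiable (at x)) \<and>
      (\<forall>v. Ck n (\<lambda>x. frechet_derivative f (at x) v))"

definition smooth :: "('a::euclidean_space \<Rightarrow> 'b::real_normed_vector) \<Rightarrow> bool" where
  "smooth f \<longleftrightarrow> (\<forall>n. Ck n f)"

definition test_fun :: "(complex \<Rightarrow> complex) \<Rightarrow> bool" where
  "test_fun \<psi> \<longleftrightarrow> smooth \<psi> \<and> compact (closure {z. \<psi> z \<noteq> 0})"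

definition dbar :: "(complex \<Rightarrow> complex) \<Rightarrow> complex \<Rightarrow> complex" where
  "dbar f z = (frechet_derivative f (at z) 1 + \<i> * frechet_derivative f (at z) \<i>) / 2"

definition dz :: "(complex \<Rightarrow> complex) \<Rightarrow> complex \<Rightarrow> complex" where
  "dz f z = (frechet_derivative f (at z) 1 - \<i> * frechet_derivative f (at z) \<i>) / 2"

definition L2 :: "(complex \<Rightarrow> complex) set" where
  "L2 = {u. u \<in> borel_measurable lborel \<and> integrable lborel (\<lambda>z. (cmod (u z))\<^sup>2)}"

definition wL2 :: "real \<Rightarrow> (complex \<Rightarrow> complex) set" where
  "wL2 a = {u. \<exists>v\<in>L2. \<forall>z. u z = of_real (jbr z powr a) * v z}"

definition wnorm :: "real \<Rightarrow> (complex \<Rightarrow> complex) \<Rightarrow> real" where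
  "wnorm a u = sqrt (\<integral>z. (cmod (u z) / jbr z powr a)\<^sup>2 \<partial>lborel)"

definition fourier :: "(complex \<Rightarrow> complex) \<Rightarrow> complex \<Rightarrow> complex" where
  "fourier \<psi> \<xi> = (\<integral>x. \<psi> x * exp (- \<i> * of_real (x \<bullet> \<xi>)) \<partial>lborel)"

text \<open>Sobolev space H^s(R^2): u in L^2 whose (distributional) Fourier transform
  is a function F with <xi>^s F in L^2.  The distributional Fourier transform is
  characterised by <F, psi> = <u, psi^> for all test functions psi.\<close>
definition Hs :: "real \<Rightarrow> (complex \<Rightarrow> complex) set" where
  "Hs s = {u. u \<in> L2 \<and> (\<exists>F. F \<in> borel_measurable lborel \<and>
      integrable lborel (\<lambda>\<xi>. (jbr \<xi> powr s * cmod (F \<xi>))\<^sup>2) \<and>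
      (\<forall>\<psi>. test_fun \<psi> \<longrightarrow>
          (\<integral>\<xi>. F \<xi> * \<psi> \<xi> \<partial>lborel) = (\<integral>x. u x * fourier \<psi> x \<partial>lborel)))}"

definition smooth_strictly_convex_domain :: "complex set \<Rightarrow> bool" where
  "smooth_strictly_convex_domain \<Omega> \<longleftrightarrow>
     open \<Omega> \<and> connected \<Omega> \<and> \<Omega> \<noteq> {} \<and> bounded \<Omega> \<and>
     (\<exists>\<rho>::complex \<Rightarrow> real. smooth \<rho> \<and> \<Omega> = {z. \<rho> z < 0} \<and> frontier \<Omega> = {z. \<rho> z = 0} \<and>
        (\<forall>z. \<rho> z = 0 \<longrightarrow> frechet_derivative \<rho> (at z) \<noteq> (\<lambda>_. 0))) \<and>
     (\<forall>x\<in>closure \<Omega>. \<forall>y\<in>closure \<Omega>. x \<noteq> y \<longrightarrow> open_segment x y \<subseteq> \<Omega>)"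

definition opE :: "real \<Rightarrow> (complex \<Rightarrow> complex) \<Rightarrow> complex \<Rightarrow> complex" where
  "opE h u z = (1 / of_real (pi * h)) * (\<integral>w. u w / (z - w) \<partial>lborel)"

definition opF :: "real \<Rightarrow> (complex \<Rightarrow> complex) \<Rightarrow> complex \<Rightarrow> complex" where
  "opF h u z = (1 / of_real (pi * h)) * (\<integral>w. u w / (cnj z - cnj w) \<partial>lborel)"

definition opA :: "complex \<Rightarrow> (complex \<Rightarrow> complex) \<Rightarrow> (complex \<Rightarrow> complex) \<Rightarrow> complex \<Rightarrow> complex" where
  "opA k q u = opE (1 / cmod k)
     (\<lambda>w. exp (cnj (k * w) - k * w) * (of_real (1 / cmod k) * q w / 2) * u w)"

definition opB :: "complex \<Rightarrow> complex \<Rightarrow> (complex \<Rightarrow> complex) \<Rightarrow> (complex \<Rightarrow> complex) \<Rightarrow> complex \<Rightarrow> complex" where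
  "opB \<sigma> k q u = (\<lambda>z. \<sigma> * opF (1 / cmod k)
     (\<lambda>w. exp (k * w - cnj (k * w)) * (of_real (1 / cmod k) * cnj (q w) / 2) * u w) z)"

text \<open>h dbar phi1 = e^{conj(kz)-kz} hq/2 phi2 and h d phi2 = sigma e^{kz-conj(kz)} h conj(q)/2 phi1,
  tested against all psi in C_c^infinity (integration by parts moves the derivative to psi).\<close>
definition solves_system :: "complex \<Rightarrow> complex \<Rightarrow> (complex \<Rightarrow> complex) \<Rightarrow>
    (complex \<Rightarrow> complex) \<Rightarrow> (complex \<Rightarrow> complex) \<Rightarrow> bool" where
  "solves_system \<sigma> k q \<phi>1 \<phi>2 \<longleftrightarrow>
     (\<forall>\<psi>. test_fun \<psi> \<longrightarrow>
        - of_real (1 / cmod k) * (\<integral>z. \<phi>1 z * dbar \<psi> z \<partial>lborel)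
          = (\<integral>z. exp (cnj (k * z) - k * z) * (of_real (1 / cmod k) * q z / 2) * \<phi>2 z * \<psi> z \<partial>lborel)
      \<and> - of_real (1 / cmod k) * (\<integral>z. \<phi>2 z * dz \<psi> z \<partial>lborel)
          = (\<integral>z. \<sigma> * exp (k * z - cnj (k * z)) * (of_real (1 / cmod k) * cnj (q z) / 2) * \<phi>1 z * \<psi> z \<partial>lborel))"

end

(*
  Writing Q = <z>^2 q, all that matters is that Q is square integrable and essentially bounded:
  obvious for an indicator, and for H^s with s > 1 because u * K_t stays bounded as t -> 0, K being
  the Fourier transform of a bump function.  Up to the constant 1/(2 pi), A is the Cauchy kernel
  1/(z - w) composed with multiplication by e_k q, where e_k(w) = exp(conj(kw) - kw), and
  B u = sigma conj(A(conj u)), so that BA is conjugate to AB.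

  AB tends to 0 in norm as |k| -> oo: the part of the kernel with |z - w| < d has norm O(d) by Young's
  inequality, and the composition of the two far parts is a Hilbert-Schmidt operator whose kernel
  is int e_k(w) J(z - w) q(w) conj(J(w - w')) dw, which tends to 0 by the Riemann-Lebesgue lemma and
  dominated convergence.  Hence 1 - AB and 1 - BA are inverted by Neumann series.

  By the Cauchy-Pompeiu formula the integral equations imply the differential system.  Conversely a
  weak solution of dbar f = 0 in <z> L^2 vanishes: testing with conj(z - a) b(|z - a|^2 / r^2) shows
  that r^(-2) int f(z) b(|z - a|^2 / r^2) dz does not depend on r, and it tends to 0 as r -> oo.
*)
theory Submission
  imports Defs
begin

section \<open>Weighted norms and the Cauchy kernel\<close>

text \<open>The phase by itself gains nothing: \<open>phase k\<close> is unimodular, so it can be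
  absorbed into the function to which A is applied, and the norm of A does not depend on k. In AB
  the phase at the intermediate point stands between two kernels and cannot be absorbed, which is
  why only the compositions become small. The two properties of Q have different tasks. Near the
  diagonal the kernel is integrable but not square integrable, so Young's inequality is used and
  needs Q bounded. Far away it decays like 1/|z|, which just misses square integrability in the
  plane; the factor <z>^(-\<epsilon>) and Q in L2 make that part Hilbert-Schmidt. Accordingly A and
  B map <z>^2 L2, which contains the constant 1, into <z>^\<epsilon> L2, which does not, as
  \<epsilon> \<le> 1. The same bound on \<epsilon> enters through the Liouville theorem, whose
  borderline is <z> L2: constants belong to <z>^a L2 for every a > 1. Bochner integrals are 0 where
  they diverge, so additivity of the operators and the inverses are stated almost
  everywhere.\<close>

lemma jbr_ge_1: "1 \<le> jbr z"
  by (simp add: jbr_def)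

lemma jbr_pos [simp]: "0 < jbr z"
  using jbr_ge_1[of z] by linarith

lemma jbr_nonneg [simp]: "0 \<le> jbr z"
  using jbr_pos[of z] by linarith

lemma jbr_nonzero [simp]: "jbr z \<noteq> 0"
  using jbr_pos[of z] by linarith

lemma jbr_power2: "(jbr z)\<^sup>2 = 1 + (cmod z)\<^sup>2"
  by (simp add: jbr_def)

lemma cmod_le_jbr: "cmod z \<le> jbr z"
  by (simp add: jbr_def real_le_rsqrt)

lemma jbr_measurable [measurable]: "jbr \<in> borel_measurable borel"
  unfolding jbr_def[abs_def] by measurable

lemma jbr_powr_antimono: "a \<le> b \<Longrightarrow> jbr z powr a \<le> jbr z powr b"
  using jbr_ge_1[of z] by (intro powr_mono) auto

lemma jbr_powr_le_1: "a \<le> 0 \<Longrightarrow> jbr z powr a \<le> 1"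
  using jbr_powr_antimono[of a 0 z] jbr_pos[of z] by simp

section \<open>Nonnegative integrals under affine maps, and powers of the weight\<close>

lemma nn_integral_lborel_translate:
  fixes c :: "'a::euclidean_space"
  assumes [measurable]: "f \<in> borel_measurable borel"
  shows "(\<integral>\<^sup>+x. f (c + x) \<partial>lborel) = (\<integral>\<^sup>+x. f x \<partial>lborel)"
proof -
  have "(\<integral>\<^sup>+x. f x \<partial>distr lborel borel ((+) c)) = (\<integral>\<^sup>+x. f (c + x) \<partial>lborel)"
    by (subst nn_integral_distr) auto
  then show ?thesis by (simp add: lborel_distr_plus)
qed

lemma nn_integral_lborel_affine:
  fixes c :: "'a::euclidean_space"
  assumes [measurable]: "f \<in> borel_measurable borel" and "t \<noteq> 0"
  shows "(\<integral>\<^sup>+x. f x \<partial>lborel) = ennreal (\<bar>t\<bar> ^ DIM('a)) * (\<integral>\<^sup>+x. f (c + t *\<^sub>R x) \<partial>lborel)"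
  by (subst lborel_affine[OF assms(2), of c])
     (simp add: nn_integral_density nn_integral_distr nn_integral_cmult)

lemma nn_integral_lborel_reflect:
  fixes c :: "'a::euclidean_space"
  assumes [measurable]: "f \<in> borel_measurable borel"
  shows "(\<integral>\<^sup>+x. f (c - x) \<partial>lborel) = (\<integral>\<^sup>+x. f x \<partial>lborel)"
  using nn_integral_lborel_affine[OF assms, of "-1" c] by simp

lemma nn_integral_lborel_shift:
  fixes c :: "'a::euclidean_space"
  assumes [measurable]: "f \<in> borel_measurable borel"
  shows "(\<integral>\<^sup>+x. f (x - c) \<partial>lborel) = (\<integral>\<^sup>+x. f x \<partial>lborel)"
  using nn_integral_lborel_translate[OF assms, of "-c"] by simp

lemma emeasure_complex_ball:
  "0 \<le> r \<Longrightarrow> emeasure lborel (ball (c::complex) r) = ennreal (pi * r\<^sup>2)"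
  using unit_ball_vol_even[of 1] by (simp add: emeasure_ball)

lemma ennreal_le_suminf: "f n \<le> (\<Sum>n. f n)" for f :: "nat \<Rightarrow> ennreal"
  using sum_le_suminf[of f "{n}"] by simp

text \<open>Dyadic shells: where 2^n \<le> <z> < 2^(n+1) the integrand is at most 2^(-an), and the
  shell lies in a disc of area 4 pi 4^n. The sum is geometric with ratio \<open>x\<close>, and this
  ratio is below 1 exactly when a > 2.\<close>

lemma nn_integral_jbr_powr_finite:
  assumes "2 < a"
  shows "(\<integral>\<^sup>+z. ennreal (jbr z powr - a) \<partial>lborel) < \<infinity>"
proof -
  define x where "x = 4 * 2 powr - a"
  have x: "0 < x" "x < 1"
  proof -
    have "2 powr - a < 2 powr (-2::real)" using assms by (intro powr_less_mono) auto
    then show "x < 1" by (simp add: x_def powr_minus powr_numeral)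
  qed (simp add: x_def)
  have pointwise: "ennreal (jbr z powr - a) \<le> (\<Sum>n. ennreal ((2 powr - a) ^ n) * indicator (ball 0 (2 ^ Suc n)) z)" for z
  proof -
    define n where "n = nat \<lfloor>log 2 (jbr z)\<rfloor>"
    have l0: "0 \<le> log 2 (jbr z)" using jbr_ge_1[of z] by simp
    have n: "real n \<le> log 2 (jbr z)" "log 2 (jbr z) < real n + 1"
      using l0 unfolding n_def by linarith+
    have lo: "2 powr real n \<le> jbr z" using n(1) by (simp add: le_log_iff)
    have hi: "jbr z < 2 powr (real n + 1)" using n(2) by (simp add: log_less_iff)
    have hi': "cmod z < 2 ^ Suc n"
      using hi cmod_le_jbr[of z] by (simp add: powr_add powr_realpow)
    have "jbr z powr - a \<le> (2 powr real n) powr - a"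
      using lo assms by (intro powr_mono2') auto
    also have "\<dots> = (2 powr - a) ^ n"
      by (simp add: powr_powr powr_realpow[symmetric] mult.commute)
    finally have "ennreal (jbr z powr - a) \<le> ennreal ((2 powr - a) ^ n) * indicator (ball 0 (2 ^ Suc n)) z"
      using hi' by (simp add: ennreal_leI)
    also have "\<dots> \<le> (\<Sum>n. ennreal ((2 powr - a) ^ n) * indicator (ball 0 (2 ^ Suc n)) z)"
      by (rule ennreal_le_suminf)
    finally show ?thesis .
  qed
  have "(\<integral>\<^sup>+z. ennreal (jbr z powr - a) \<partial>lborel)
      \<le> (\<integral>\<^sup>+z. (\<Sum>n. ennreal ((2 powr - a) ^ n) * indicator (ball (0::complex) (2 ^ Suc n)) z) \<partial>lborel)"
    by (intro nn_integral_mono pointwise)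
  also have "\<dots> = (\<Sum>n. \<integral>\<^sup>+z. ennreal ((2 powr - a) ^ n) * indicator (ball (0::complex) (2 ^ Suc n)) z \<partial>lborel)"
    by (intro nn_integral_suminf borel_measurable_times_ennreal borel_measurable_indicator borel_measurable_const) simp
  also have "\<dots> = (\<Sum>n. ennreal ((2 powr - a) ^ n) * ennreal (pi * (2 ^ Suc n)\<^sup>2))"
    by (simp add: nn_integral_cmult_indicator emeasure_complex_ball)
  also have "\<dots> = (\<Sum>n. ennreal (4 * pi * x ^ n))"
  proof (intro suminf_cong)
    fix n
    have "(2 ^ Suc n)\<^sup>2 = 4 * (4::real) ^ n"
      by (simp add: power2_eq_square flip: power_mult_distrib)
    then show "ennreal ((2 powr - a) ^ n) * ennreal (pi * (2 ^ Suc n)\<^sup>2) = ennreal (4 * pi * x ^ n)"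
      by (simp add: ennreal_mult[symmetric] x_def power_mult_distrib mult_ac)
  qed
  also have "\<dots> < \<infinity>"
    using x by (subst suminf_ennreal2) (auto intro!: summable_mult summable_geometric)
  finally show ?thesis .
qed

section \<open>The kernel 1/|z| cut at distance \<delta>\<close>

definition near_kernel :: "real \<Rightarrow> complex \<Rightarrow> real" where
  "near_kernel \<delta> z = (if cmod z < \<delta> then 1 / cmod z else 0)"

definition far_kernel :: "real \<Rightarrow> complex \<Rightarrow> real" where
  "far_kernel \<delta> z = (if cmod z < \<delta> then 0 else 1 / cmod z)"

lemma kernel_measurable [measurable]:
  "near_kernel \<delta> \<in> borel_measurable borel" "far_kernel \<delta> \<in> borel_measurable borel"
  unfolding near_kernel_def[abs_def] far_kernel_def[abs_def] by measurable

lemma kernel_nonneg [simp]: "0 \<le> near_kernel \<delta> z" "0 \<le> far_kernel \<delta> z"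
  by (auto simp: near_kernel_def far_kernel_def)

lemma near_far_kernel: "near_kernel \<delta> z + far_kernel \<delta> z = 1 / cmod z"
  by (simp add: near_kernel_def far_kernel_def)

text \<open>On the shell \<delta>/2^(n+1) \<le> |z| < \<delta>/2^n the kernel is at most
  2^(n+1)/\<delta>, and the disc containing it has area pi (\<delta>/2^n)^2; the sum is 4 pi
  \<delta>. Polar coordinates would give 2 pi \<delta>, but only the linear rate in \<delta>
  matters.\<close>

lemma nn_integral_near_kernel:
  assumes "0 < \<delta>"
  shows "(\<integral>\<^sup>+z. ennreal (near_kernel \<delta> z) \<partial>lborel) \<le> ennreal (4 * pi * \<delta>)"
proof -
  have pointwise: "ennreal (near_kernel \<delta> z) \<le> (\<Sum>n. ennreal (2 ^ Suc n / \<delta>) * indicator (ball 0 (\<delta> / 2 ^ n)) z)" for z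
  proof (cases "z = 0 \<or> \<delta> \<le> cmod z")
    case False
    then have z: "0 < cmod z" "cmod z < \<delta>" by auto
    \<comment> \<open>The ceiling minus one makes the lower inequality strict, 2^n < \<delta>/|z|
      \<le> 2^(n+1), so that z lies in the open disc of radius \<delta>/2^n. The logarithm is
      positive, so the subtraction is not truncated.\<close>
    define n where "n = nat \<lceil>log 2 (\<delta> / cmod z)\<rceil> - 1"
    have l1: "1 < \<delta> / cmod z" using z by simp
    then have l0: "0 < log 2 (\<delta> / cmod z)" by simp
    have n: "real n < log 2 (\<delta> / cmod z)" "log 2 (\<delta> / cmod z) \<le> real n + 1"
      using l0 unfolding n_def by linarith+
    have lo: "2 ^ n < \<delta> / cmod z" using n(1) z assms by (simp add: less_log_iff powr_realpow)
    have hi: "\<delta> / cmod z \<le> 2 ^ Suc n" using n(2) z assms by (simp add: log_le_iff powr_realpow powr_add)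
    have lo': "cmod z < \<delta> / 2 ^ n" using lo z by (simp add: field_simps)
    have "1 / cmod z \<le> 2 ^ Suc n / \<delta>" using hi z assms by (simp add: field_simps)
    then have "ennreal (near_kernel \<delta> z) \<le> ennreal (2 ^ Suc n / \<delta>) * indicator (ball 0 (\<delta> / 2 ^ n)) z"
      using lo' z by (simp add: ennreal_leI near_kernel_def)
    also have "\<dots> \<le> (\<Sum>n. ennreal (2 ^ Suc n / \<delta>) * indicator (ball 0 (\<delta> / 2 ^ n)) z)"
      by (rule ennreal_le_suminf)
    finally show ?thesis .
  qed (auto simp: near_kernel_def)
  have s: "(\<lambda>n. 2 * pi * \<delta> * (1/2) ^ n) sums (2 * pi * \<delta> * 2)"
    using geometric_sums[of "1/2::real"] by (intro sums_mult) simp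
  have "(\<integral>\<^sup>+z. ennreal (near_kernel \<delta> z) \<partial>lborel)
      \<le> (\<integral>\<^sup>+z. (\<Sum>n. ennreal (2 ^ Suc n / \<delta>) * indicator (ball (0::complex) (\<delta> / 2 ^ n)) z) \<partial>lborel)"
    by (intro nn_integral_mono pointwise)
  also have "\<dots> = (\<Sum>n. \<integral>\<^sup>+z. ennreal (2 ^ Suc n / \<delta>) * indicator (ball (0::complex) (\<delta> / 2 ^ n)) z \<partial>lborel)"
    by (intro nn_integral_suminf borel_measurable_times_ennreal borel_measurable_indicator borel_measurable_const) simp
  also have "\<dots> = (\<Sum>n. ennreal (2 ^ Suc n / \<delta>) * ennreal (pi * (\<delta> / 2 ^ n)\<^sup>2))"
    using assms by (simp add: nn_integral_cmult_indicator emeasure_complex_ball)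
  also have "\<dots> = (\<Sum>n. ennreal (2 * pi * \<delta> * (1/2) ^ n))"
    using assms by (intro suminf_cong)
      (simp add: ennreal_mult[symmetric] power2_eq_square field_simps)
  also have "\<dots> = ennreal (2 * pi * \<delta> * 2)"
    using s assms by (intro suminf_ennreal_eq) auto
  finally show ?thesis by (simp add: mult_ac)
qed

text \<open>For |z| \<ge> \<delta> the ratio (1 + |z|^2)/|z|^2 is at most 1 + 1/\<delta>^2. The
  comparison function <z>^(-2) just fails to be integrable over the plane, so a further negative
  power of the weight has to be supplied when this is integrated.\<close>

lemma far_kernel_sq_le:
  assumes "0 < \<delta>"
  shows "(far_kernel \<delta> z)\<^sup>2 \<le> (1 + 1 / \<delta>\<^sup>2) * jbr z powr - 2"
proof (cases "cmod z < \<delta>")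
  case False
  then have d: "\<delta> \<le> cmod z" "0 < cmod z" using assms by linarith+
  have "\<delta>\<^sup>2 \<le> (cmod z)\<^sup>2" using d assms by (intro power_mono) auto
  then have "(1 + (cmod z)\<^sup>2) / (cmod z)\<^sup>2 \<le> 1 + 1 / \<delta>\<^sup>2"
    using d assms by (simp add: field_simps)
  then have "1 / (cmod z)\<^sup>2 \<le> (1 + 1 / \<delta>\<^sup>2) / (1 + (cmod z)\<^sup>2)"
    using d by (subst pos_le_divide_eq) (auto simp: add_pos_nonneg)
  moreover have "jbr z powr - 2 = 1 / (1 + (cmod z)\<^sup>2)"
    by (simp add: powr_minus_divide jbr_power2 powr_numeral)
  ultimately show ?thesis using False
    by (simp add: far_kernel_def power_divide)
qed (use assms in \<open>auto simp: far_kernel_def\<close>)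

text \<open>Cauchy-Schwarz with respect to the measure \<kappa>(z - w) dw, whose mass is the
  integral of \<kappa> for every z, bounds the square by that mass times the convolution of \<kappa>
  with v^2; Tonelli then yields the mass a second time.\<close>

lemma young_L2:
  fixes \<kappa> v :: "complex \<Rightarrow> ennreal"
  assumes [measurable]: "\<kappa> \<in> borel_measurable borel" "v \<in> borel_measurable borel"
  shows "(\<integral>\<^sup>+z. (\<integral>\<^sup>+w. \<kappa> (z - w) * v w \<partial>lborel)\<^sup>2 \<partial>lborel)
     \<le> (\<integral>\<^sup>+z. \<kappa> z \<partial>lborel)\<^sup>2 * (\<integral>\<^sup>+z. (v z)\<^sup>2 \<partial>lborel)"
proof -
  let ?c = "\<integral>\<^sup>+z. \<kappa> z \<partial>lborel"
  have cs: "(\<integral>\<^sup>+w. \<kappa> (z - w) * v w \<partial>lborel)\<^sup>2 \<le> ?c * (\<integral>\<^sup>+w. \<kappa> (z - w) * (v w)\<^sup>2 \<partial>lborel)" for z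
  proof -
    let ?D = "density lborel (\<lambda>w. \<kappa> (z - w))"
    have "(\<integral>\<^sup>+w. 1 * v w \<partial>?D)\<^sup>2 \<le> (\<integral>\<^sup>+w. 1 ^ 2 \<partial>?D) * (\<integral>\<^sup>+w. (v w)\<^sup>2 \<partial>?D)"
      by (intro Cauchy_Schwarz_nn_integral) auto
    then show ?thesis
      by (simp add: nn_integral_density nn_integral_lborel_reflect emeasure_density)
  qed
  have "(\<integral>\<^sup>+z. (\<integral>\<^sup>+w. \<kappa> (z - w) * v w \<partial>lborel)\<^sup>2 \<partial>lborel)
     \<le> (\<integral>\<^sup>+z. ?c * (\<integral>\<^sup>+w. \<kappa> (z - w) * (v w)\<^sup>2 \<partial>lborel) \<partial>lborel)"
    by (intro nn_integral_mono cs)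
  also have "\<dots> = ?c * (\<integral>\<^sup>+z. (\<integral>\<^sup>+w. \<kappa> (z - w) * (v w)\<^sup>2 \<partial>lborel) \<partial>lborel)"
    by (intro nn_integral_cmult) measurable
  also have "(\<integral>\<^sup>+z. (\<integral>\<^sup>+w. \<kappa> (z - w) * (v w)\<^sup>2 \<partial>lborel) \<partial>lborel)
     = (\<integral>\<^sup>+w. (\<integral>\<^sup>+z. \<kappa> (z - w) * (v w)\<^sup>2 \<partial>lborel) \<partial>lborel)"
    by (intro lborel_pair.Fubini') measurable
  also have "\<dots> = (\<integral>\<^sup>+w. ?c * (v w)\<^sup>2 \<partial>lborel)"
    by (intro nn_integral_cong) (simp add: nn_integral_multc nn_integral_lborel_shift)
  also have "\<dots> = ?c * (\<integral>\<^sup>+w. (v w)\<^sup>2 \<partial>lborel)"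
    by (intro nn_integral_cmult) auto
  finally show ?thesis by (simp add: power2_eq_square mult_ac)
qed

text \<open>Cauchy-Schwarz in w for each fixed z. Working with extended nonnegative kernels spares
  all integrability checks; an infinite right-hand side is allowed.\<close>

lemma hilbert_schmidt_L2:
  fixes k :: "complex \<Rightarrow> complex \<Rightarrow> ennreal"
  assumes [measurable]: "case_prod k \<in> borel_measurable (borel \<Otimes>\<^sub>M borel)" "v \<in> borel_measurable borel"
  shows "(\<integral>\<^sup>+z. (\<integral>\<^sup>+w. k z w * v w \<partial>lborel)\<^sup>2 \<partial>lborel)
     \<le> (\<integral>\<^sup>+z. (\<integral>\<^sup>+w. (k z w)\<^sup>2 \<partial>lborel) \<partial>lborel) * (\<integral>\<^sup>+z. (v z)\<^sup>2 \<partial>lborel)"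
proof -
  have [measurable]: "(\<lambda>x. k (f x) (g x)) \<in> borel_measurable N" if "f \<in> measurable N borel" "g \<in> measurable N borel" for f g N
    using measurable_compose[OF measurable_Pair[OF that] assms(1)] by simp
  have "(\<integral>\<^sup>+z. (\<integral>\<^sup>+w. k z w * v w \<partial>lborel)\<^sup>2 \<partial>lborel)
      \<le> (\<integral>\<^sup>+z. (\<integral>\<^sup>+w. (k z w)\<^sup>2 \<partial>lborel) * (\<integral>\<^sup>+z. (v z)\<^sup>2 \<partial>lborel) \<partial>lborel)"
    by (intro nn_integral_mono Cauchy_Schwarz_nn_integral) auto
  also have "\<dots> = (\<integral>\<^sup>+z. (\<integral>\<^sup>+w. (k z w)\<^sup>2 \<partial>lborel) \<partial>lborel) * (\<integral>\<^sup>+z. (v z)\<^sup>2 \<partial>lborel)"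
    by (intro nn_integral_multc) measurable
  finally show ?thesis .
qed

text \<open>In the product <z>^(-2b) <z-w>^(-2) the larger of the two bases may be replaced by the
  smaller one, so the product is at most the sum of the powers -(2b+2) of both. These have the same
  integral, finite because 2b + 2 > 2, and hence the bound does not depend on w.\<close>

lemma weighted_far_bound:
  assumes "0 < b" "0 < \<delta>"
  obtains D where "D < \<infinity>"
    "\<And>w. (\<integral>\<^sup>+z. ennreal (jbr z powr - (2 * b)) * ennreal ((far_kernel \<delta> (z - w))\<^sup>2) \<partial>lborel) \<le> D"
proof -
  let ?I = "\<integral>\<^sup>+z. ennreal (jbr z powr - (2 * b + 2)) \<partial>lborel"
  let ?c = "1 + 1 / \<delta>\<^sup>2"
  have fin: "?I < \<infinity>" using assms by (intro nn_integral_jbr_powr_finite) auto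
  have "(\<integral>\<^sup>+z. ennreal (jbr z powr - (2 * b)) * ennreal ((far_kernel \<delta> (z - w))\<^sup>2) \<partial>lborel) \<le> ennreal ?c * (?I + ?I)" for w
  proof -
    have pt: "jbr z powr - (2 * b) * (far_kernel \<delta> (z - w))\<^sup>2
       \<le> ?c * (jbr z powr - (2 * b + 2) + jbr (z - w) powr - (2 * b + 2))" for z
    proof -
      have "jbr z powr - (2 * b) * jbr (z - w) powr - 2 \<le> jbr z powr - (2 * b + 2) + jbr (z - w) powr - (2 * b + 2)"
      proof (cases "jbr z \<le> jbr (z - w)")
        case True
        have "jbr z powr - (2 * b) * jbr (z - w) powr - 2 \<le> jbr z powr - (2 * b) * jbr z powr - 2"
          using True by (intro mult_left_mono powr_mono2') auto
        also have "\<dots> = jbr z powr - (2 * b + 2)" by (simp add: powr_add[symmetric])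
        finally show ?thesis by (simp add: add_increasing2)
      next
        case False
        then have "jbr z powr - (2 * b) * jbr (z - w) powr - 2 \<le> jbr (z - w) powr - (2 * b) * jbr (z - w) powr - 2"
          using assms by (intro mult_right_mono powr_mono2') auto
        also have "\<dots> = jbr (z - w) powr - (2 * b + 2)" by (simp add: powr_add[symmetric])
        finally show ?thesis by (simp add: add_increasing)
      qed
      then have 1: "?c * (jbr z powr - (2 * b) * jbr (z - w) powr - 2) \<le> ?c * (jbr z powr - (2 * b + 2) + jbr (z - w) powr - (2 * b + 2))"
        using assms by (intro mult_left_mono) (auto simp: add_nonneg_nonneg)
      have "jbr z powr - (2 * b) * (far_kernel \<delta> (z - w))\<^sup>2 \<le> jbr z powr - (2 * b) * (?c * jbr (z - w) powr - 2)"
        using assms by (intro mult_left_mono far_kernel_sq_le) auto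
      also have "\<dots> = ?c * (jbr z powr - (2 * b) * jbr (z - w) powr - 2)" by (rule mult.left_commute)
      finally show ?thesis using 1 by (rule order_trans)
    qed
    have "(\<integral>\<^sup>+z. ennreal (jbr z powr - (2 * b)) * ennreal ((far_kernel \<delta> (z - w))\<^sup>2) \<partial>lborel)
      \<le> (\<integral>\<^sup>+z. ennreal ?c * (ennreal (jbr z powr - (2 * b + 2)) + ennreal (jbr (z - w) powr - (2 * b + 2))) \<partial>lborel)"
      using pt by (intro nn_integral_mono)
        (simp add: ennreal_mult[symmetric] ennreal_plus[symmetric] add_nonneg_nonneg ennreal_leI del: ennreal_plus)
    also have "\<dots> = ennreal ?c * (?I + (\<integral>\<^sup>+z. ennreal (jbr (z - w) powr - (2 * b + 2)) \<partial>lborel))"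
      by (simp add: nn_integral_cmult nn_integral_add)
    also have "(\<integral>\<^sup>+z. ennreal (jbr (z - w) powr - (2 * b + 2)) \<partial>lborel) = ?I"
      by (rule nn_integral_lborel_shift[where f="\<lambda>z. ennreal (jbr z powr - (2 * b + 2))"]) measurable
    finally show ?thesis .
  qed
  moreover have "ennreal ?c * (?I + ?I) < \<infinity>"
    using fin by (auto simp: ennreal_mult_less_top)
  ultimately show thesis using that by blast
qed

lemma ennreal_square_add_le: "((a::ennreal) + b)\<^sup>2 \<le> 2 * a\<^sup>2 + 2 * b\<^sup>2"
proof (cases "a = \<infinity> \<or> b = \<infinity>")
  case True
  then show ?thesis by (auto simp: ennreal_top_mult ennreal_mult_top)
next
  case False
  then obtain x y where "a = ennreal x" "0 \<le> x" "b = ennreal y" "0 \<le> y"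
    by (metis ennreal_cases infinity_ennreal_def)
  moreover have "(x + y)\<^sup>2 \<le> 2 * x\<^sup>2 + 2 * y\<^sup>2" 
    using sum_squares_bound[of x y] by (simp add: power2_sum)
  ultimately show ?thesis
    by (simp add: ennreal_plus[symmetric] ennreal_power ennreal_leI del: ennreal_plus
       flip: ennreal_mult'' ennreal_numeral)
qed

text \<open>The common ground of the two kinds of potential. \<open>q_bounded\<close> serves the
  near part of the kernel, \<open>q_L2\<close> the far part. The bound is only almost everywhere
  because membership in H^s constrains a function only up to null sets.\<close>

locale admissible =
  fixes q :: "complex \<Rightarrow> complex" and M \<epsilon> :: real
  assumes q_measurable [measurable]: "q \<in> borel_measurable borel"
    and M_nonneg: "0 \<le> M"
    and q_bounded: "AE z in lborel. (jbr z)\<^sup>2 * cmod (q z) \<le> M"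
    and q_L2: "(\<integral>\<^sup>+z. (ennreal ((jbr z)\<^sup>2 * cmod (q z)))\<^sup>2 \<partial>lborel) < \<infinity>"
    and eps: "0 < \<epsilon>" "\<epsilon> \<le> 1"
begin

abbreviation "Q \<equiv> \<lambda>z. (jbr z)\<^sup>2 * cmod (q z)"

text \<open>In the applications v is <w>^(-2) |u|, so that Q v = |q u|. The mass of the near kernel
  is at most 4 pi \<delta>, and Young's inequality produces its square; no weight in z is spent
  here.\<close>

lemma near_bound:
  assumes [measurable]: "v \<in> borel_measurable borel" and "0 < \<delta>"
  shows "(\<integral>\<^sup>+z. (\<integral>\<^sup>+w. ennreal (near_kernel \<delta> (z - w)) * (ennreal (Q w) * v w) \<partial>lborel)\<^sup>2 \<partial>lborel)
     \<le> (ennreal (4 * pi * \<delta> * M))\<^sup>2 * (\<integral>\<^sup>+z. (v z)\<^sup>2 \<partial>lborel)"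
proof -
  have "(\<integral>\<^sup>+z. (\<integral>\<^sup>+w. ennreal (near_kernel \<delta> (z - w)) * (ennreal (Q w) * v w) \<partial>lborel)\<^sup>2 \<partial>lborel)
     \<le> (\<integral>\<^sup>+z. (\<integral>\<^sup>+w. ennreal (near_kernel \<delta> (z - w)) * (ennreal M * v w) \<partial>lborel)\<^sup>2 \<partial>lborel)"
    using q_bounded by (intro nn_integral_mono power_mono nn_integral_mono_AE)
       (auto elim!: eventually_mono intro!: mult_left_mono mult_right_mono ennreal_leI)
  also have "\<dots> \<le> (\<integral>\<^sup>+z. ennreal (near_kernel \<delta> z) \<partial>lborel)\<^sup>2 * (\<integral>\<^sup>+z. (ennreal M * v z)\<^sup>2 \<partial>lborel)"
    by (rule young_L2) auto
  also have "\<dots> \<le> (ennreal (4 * pi * \<delta>))\<^sup>2 * ((ennreal M)\<^sup>2 * (\<integral>\<^sup>+z. (v z)\<^sup>2 \<partial>lborel))"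
    using assms by (intro mult_mono power_mono nn_integral_near_kernel)
      (auto simp: power_mult_distrib nn_integral_cmult)
  finally show ?thesis using assms M_nonneg
    by (simp add: ennreal_mult power_mult_distrib mult_ac)
qed

definition LQ :: ennreal where "LQ = (\<integral>\<^sup>+z. (ennreal (Q z))\<^sup>2 \<partial>lborel)"

text \<open>Integrating the squared kernel over z leaves a bound uniform in w by
  \<open>weighted_far_bound\<close>, and the remaining factor Q(w)^2 has the finite integral
  \<open>LQ\<close>. The constant depends on \<delta> and is not small.\<close>

lemma far_bound:
  assumes "0 < \<delta>"
  obtains D where "D < \<infinity>"
   "\<And>v. v \<in> borel_measurable borel \<Longrightarrow>
     (\<integral>\<^sup>+z. (\<integral>\<^sup>+w. ennreal (jbr z powr - \<epsilon> * far_kernel \<delta> (z - w)) * (ennreal (Q w) * v w) \<partial>lborel)\<^sup>2 \<partial>lborel)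
     \<le> D * (\<integral>\<^sup>+z. (v z)\<^sup>2 \<partial>lborel)"
proof -
  obtain D where D: "D < \<infinity>"
    "\<And>w. (\<integral>\<^sup>+z. ennreal (jbr z powr - (2 * \<epsilon>)) * ennreal ((far_kernel \<delta> (z - w))\<^sup>2) \<partial>lborel) \<le> D"
    using weighted_far_bound[OF eps(1) assms] by blast
  have hs: "(\<integral>\<^sup>+z. (\<integral>\<^sup>+w. (ennreal (jbr z powr - \<epsilon> * far_kernel \<delta> (z - w)) * ennreal (Q w))\<^sup>2 \<partial>lborel) \<partial>lborel) \<le> D * LQ"
  proof -
    have sq: "(ennreal (jbr z powr - \<epsilon> * far_kernel \<delta> (z - w)) * ennreal (Q w))\<^sup>2 =
       ennreal (jbr z powr - (2 * \<epsilon>)) * ennreal ((far_kernel \<delta> (z - w))\<^sup>2) * (ennreal (Q w))\<^sup>2" for z w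
    proof -
      have "(jbr z powr - \<epsilon>)\<^sup>2 = jbr z powr - (2 * \<epsilon>)"
        by (simp add: power2_eq_square powr_add[symmetric])
      then show ?thesis
        by (simp add: power_mult_distrib ennreal_power ennreal_mult[symmetric])
    qed
    have "(\<integral>\<^sup>+z. (\<integral>\<^sup>+w. (ennreal (jbr z powr - \<epsilon> * far_kernel \<delta> (z - w)) * ennreal (Q w))\<^sup>2 \<partial>lborel) \<partial>lborel)
       = (\<integral>\<^sup>+w. (\<integral>\<^sup>+z. ennreal (jbr z powr - (2 * \<epsilon>)) * ennreal ((far_kernel \<delta> (z - w))\<^sup>2) * (ennreal (Q w))\<^sup>2 \<partial>lborel) \<partial>lborel)"
      unfolding sq by (intro lborel_pair.Fubini') measurable
    also have "\<dots> = (\<integral>\<^sup>+w. (\<integral>\<^sup>+z. ennreal (jbr z powr - (2 * \<epsilon>)) * ennreal ((far_kernel \<delta> (z - w))\<^sup>2) \<partial>lborel) * (ennreal (Q w))\<^sup>2 \<partial>lborel)"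
      by (intro nn_integral_cong nn_integral_multc) measurable
    also have "\<dots> \<le> (\<integral>\<^sup>+w. D * (ennreal (Q w))\<^sup>2 \<partial>lborel)"
      by (intro nn_integral_mono mult_right_mono D) auto
    finally show ?thesis by (simp add: nn_integral_cmult LQ_def)
  qed
  show thesis
  proof (rule that)
    show "D * LQ < \<infinity>" using D q_L2 by (simp add: LQ_def ennreal_mult_less_top)
    fix v :: "complex \<Rightarrow> ennreal" assume [measurable]: "v \<in> borel_measurable borel"
    have "(\<integral>\<^sup>+z. (\<integral>\<^sup>+w. ennreal (jbr z powr - \<epsilon> * far_kernel \<delta> (z - w)) * (ennreal (Q w) * v w) \<partial>lborel)\<^sup>2 \<partial>lborel)
     = (\<integral>\<^sup>+z. (\<integral>\<^sup>+w. (ennreal (jbr z powr - \<epsilon> * far_kernel \<delta> (z - w)) * ennreal (Q w)) * v w \<partial>lborel)\<^sup>2 \<partial>lborel)"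
      by (simp add: mult_ac)
    also have "\<dots> \<le> (\<integral>\<^sup>+z. (\<integral>\<^sup>+w. (ennreal (jbr z powr - \<epsilon> * far_kernel \<delta> (z - w)) * ennreal (Q w))\<^sup>2 \<partial>lborel) \<partial>lborel) * (\<integral>\<^sup>+z. (v z)\<^sup>2 \<partial>lborel)"
      by (rule hilbert_schmidt_L2) measurable
    also have "\<dots> \<le> (D * LQ) * (\<integral>\<^sup>+z. (v z)\<^sup>2 \<partial>lborel)"
      by (intro mult_right_mono hs) auto
    finally show "(\<integral>\<^sup>+z. (\<integral>\<^sup>+w. ennreal (jbr z powr - \<epsilon> * far_kernel \<delta> (z - w)) * (ennreal (Q w) * v w) \<partial>lborel)\<^sup>2 \<partial>lborel) \<le> \<dots>" .
  qed
qed

text \<open>For mere boundedness the cut may be made at distance 1. In the near part the weight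
  <z>^(-\<epsilon>) \<le> 1 is dropped; in the far part it is what makes the kernel square
  integrable.\<close>

lemma cauchy_bound:
  obtains C where "C < \<infinity>"
   "\<And>v. v \<in> borel_measurable borel \<Longrightarrow>
     (\<integral>\<^sup>+z. (\<integral>\<^sup>+w. ennreal (jbr z powr - \<epsilon> * (1 / cmod (z - w))) * (ennreal (Q w) * v w) \<partial>lborel)\<^sup>2 \<partial>lborel)
     \<le> C * (\<integral>\<^sup>+z. (v z)\<^sup>2 \<partial>lborel)"
proof -
  obtain D where D: "D < \<infinity>" "\<And>v. v \<in> borel_measurable borel \<Longrightarrow>
     (\<integral>\<^sup>+z. (\<integral>\<^sup>+w. ennreal (jbr z powr - \<epsilon> * far_kernel 1 (z - w)) * (ennreal (Q w) * v w) \<partial>lborel)\<^sup>2 \<partial>lborel)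
     \<le> D * (\<integral>\<^sup>+z. (v z)\<^sup>2 \<partial>lborel)" using far_bound[of 1] using far_bound[OF zero_less_one] by blast
  let ?n = "(ennreal (4 * pi * 1 * M))\<^sup>2"
  show thesis
  proof (rule that)
    show "2 * ?n + 2 * D < \<infinity>" using D M_nonneg by (auto simp: ennreal_mult_less_top ennreal_power)
    fix v :: "complex \<Rightarrow> ennreal" assume v[measurable]: "v \<in> borel_measurable borel"
    let ?N = "\<lambda>z. \<integral>\<^sup>+w. ennreal (near_kernel 1 (z - w)) * (ennreal (Q w) * v w) \<partial>lborel"
    let ?F = "\<lambda>z. \<integral>\<^sup>+w. ennreal (jbr z powr - \<epsilon> * far_kernel 1 (z - w)) * (ennreal (Q w) * v w) \<partial>lborel"
    have "(\<integral>\<^sup>+w. ennreal (jbr z powr - \<epsilon> * (1 / cmod (z - w))) * (ennreal (Q w) * v w) \<partial>lborel) \<le> ?N z + ?F z" for z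
    proof -
      have "ennreal (jbr z powr - \<epsilon> * (1 / cmod (z - w))) \<le> ennreal (near_kernel 1 (z - w)) + ennreal (jbr z powr - \<epsilon> * far_kernel 1 (z - w))" for w
      proof -
        have "jbr z powr - \<epsilon> * near_kernel 1 (z - w) \<le> 1 * near_kernel 1 (z - w)"
          using eps by (intro mult_right_mono jbr_powr_le_1) auto
        then show ?thesis unfolding near_far_kernel[of 1, symmetric]
          by (simp add: ennreal_plus[symmetric] ennreal_leI distrib_left del: ennreal_plus)
      qed
      then have "(\<integral>\<^sup>+w. ennreal (jbr z powr - \<epsilon> * (1 / cmod (z - w))) * (ennreal (Q w) * v w) \<partial>lborel)
        \<le> (\<integral>\<^sup>+w. (ennreal (near_kernel 1 (z - w)) + ennreal (jbr z powr - \<epsilon> * far_kernel 1 (z - w))) * (ennreal (Q w) * v w) \<partial>lborel)"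
        by (intro nn_integral_mono mult_right_mono) auto
      also have "\<dots> = ?N z + ?F z"
        by (simp add: distrib_right nn_integral_add)
      finally show ?thesis .
    qed
    then have "(\<integral>\<^sup>+z. (\<integral>\<^sup>+w. ennreal (jbr z powr - \<epsilon> * (1 / cmod (z - w))) * (ennreal (Q w) * v w) \<partial>lborel)\<^sup>2 \<partial>lborel)
       \<le> (\<integral>\<^sup>+z. 2 * (?N z)\<^sup>2 + 2 * (?F z)\<^sup>2 \<partial>lborel)"
      by (intro nn_integral_mono order_trans[OF power_mono ennreal_square_add_le]) auto
    also have "\<dots> = 2 * (\<integral>\<^sup>+z. (?N z)\<^sup>2 \<partial>lborel) + 2 * (\<integral>\<^sup>+z. (?F z)\<^sup>2 \<partial>lborel)"
      by (subst nn_integral_add) (auto simp: nn_integral_cmult)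
    also have "\<dots> \<le> 2 * (?n * (\<integral>\<^sup>+z. (v z)\<^sup>2 \<partial>lborel)) + 2 * (D * (\<integral>\<^sup>+z. (v z)\<^sup>2 \<partial>lborel))"
      by (intro add_mono mult_left_mono D(2)[OF v] near_bound[OF v]) auto
    finally show "(\<integral>\<^sup>+z. (\<integral>\<^sup>+w. ennreal (jbr z powr - \<epsilon> * (1 / cmod (z - w))) * (ennreal (Q w) * v w) \<partial>lborel)\<^sup>2 \<partial>lborel)
      \<le> (2 * ?n + 2 * D) * (\<integral>\<^sup>+z. (v z)\<^sup>2 \<partial>lborel)"
      by (simp add: distrib_right mult.assoc)
  qed
qed

end

section \<open>Neumann series\<close>

text \<open>The square of the L2 norm, kept as an extended nonnegative number and without the root:
  it makes sense for every function, and the price is the factor 2 in the triangle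
  inequality.\<close>

definition sq_norm :: "'a measure \<Rightarrow> ('a \<Rightarrow> complex) \<Rightarrow> ennreal" where
  "sq_norm M f = (\<integral>\<^sup>+z. (ennreal (cmod (f z)))\<^sup>2 \<partial>M)"

lemma sq_norm_add_le:
  assumes [measurable]: "f \<in> borel_measurable M" "g \<in> borel_measurable M"
  shows "sq_norm M (\<lambda>z. f z + g z) \<le> 2 * sq_norm M f + 2 * sq_norm M g"
proof -
  have "sq_norm M (\<lambda>z. f z + g z) \<le> (\<integral>\<^sup>+z. 2 * (ennreal (cmod (f z)))\<^sup>2 + 2 * (ennreal (cmod (g z)))\<^sup>2 \<partial>M)"
    unfolding sq_norm_def
  proof (intro nn_integral_mono order_trans[OF power_mono ennreal_square_add_le])
    show "ennreal (cmod (f z + g z)) \<le> ennreal (cmod (f z)) + ennreal (cmod (g z))" for z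
      by (simp add: ennreal_plus[symmetric] ennreal_leI norm_triangle_ineq del: ennreal_plus)
  qed simp
  also have "\<dots> = 2 * sq_norm M f + 2 * sq_norm M g"
    unfolding sq_norm_def by (subst nn_integral_add) (auto simp: nn_integral_cmult)
  finally show ?thesis .
qed

lemma sq_norm_cong_AE: "AE z in M. f z = g z \<Longrightarrow> sq_norm M f = sq_norm M g"
  unfolding sq_norm_def by (intro nn_integral_cong_AE) (auto elim: eventually_mono)

lemma sq_norm_uminus [simp]: "sq_norm M (\<lambda>z. - f z) = sq_norm M f"
  by (simp add: sq_norm_def)

lemma sq_norm_diff_le:
  assumes [measurable]: "f \<in> borel_measurable M" "g \<in> borel_measurable M"
  shows "sq_norm M (\<lambda>z. f z - g z) \<le> 2 * sq_norm M f + 2 * sq_norm M g"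
  using sq_norm_add_le[of f M "\<lambda>z. - g z"] by simp

lemma sq_norm_eq_0:
  assumes [measurable]: "f \<in> borel_measurable M" and "sq_norm M f = 0"
  shows "AE z in M. f z = 0"
  using assms(2) unfolding sq_norm_def by (subst (asm) nn_integral_0_iff_AE) auto

definition sq_int :: "'a measure \<Rightarrow> ('a \<Rightarrow> complex) set" where
  "sq_int M = {f \<in> borel_measurable M. sq_norm M f < \<infinity>}"

lemma sq_int_add: "f \<in> sq_int M \<Longrightarrow> g \<in> sq_int M \<Longrightarrow> (\<lambda>z. f z + g z) \<in> sq_int M"
  using sq_norm_add_le[of f M g] by (auto simp: sq_int_def ennreal_mult_less_top le_less_trans)

lemma sq_int_diff: "f \<in> sq_int M \<Longrightarrow> g \<in> sq_int M \<Longrightarrow> (\<lambda>z. f z - g z) \<in> sq_int M"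
  using sq_norm_diff_le[of f M g] by (auto simp: sq_int_def ennreal_mult_less_top le_less_trans)

text \<open>The factor 16 on squares means operator norm at most 1/4, which leaves room for the
  weights 4^n used in summing the Neumann series. Compatibility with differences is asked almost
  everywhere, the form in which integral operators on functions have it; with the contraction bound
  it also yields independence of representatives.\<close>

locale L2_contraction =
  fixes M :: "'a measure" and P :: "('a \<Rightarrow> complex) \<Rightarrow> 'a \<Rightarrow> complex"
  assumes P_meas: "\<And>f. f \<in> sq_int M \<Longrightarrow> P f \<in> borel_measurable M"
    and P_contr: "\<And>f. f \<in> sq_int M \<Longrightarrow> 16 * sq_norm M (P f) \<le> sq_norm M f"
    and P_diff: "\<And>f g. f \<in> sq_int M \<Longrightarrow> g \<in> sq_int M \<Longrightarrow> AE z in M. P (\<lambda>z. f z - g z) z = P f z - P g z"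
begin

lemma P_le: "f \<in> sq_int M \<Longrightarrow> sq_norm M (P f) \<le> sq_norm M f"
proof -
  assume "f \<in> sq_int M"
  have "1 * sq_norm M (P f) \<le> 16 * sq_norm M (P f)" by (intro mult_right_mono) auto
  also have "\<dots> \<le> sq_norm M f" by (rule P_contr) fact
  finally show ?thesis by simp
qed

lemma P_sq_int: "f \<in> sq_int M \<Longrightarrow> P f \<in> sq_int M"
  using P_meas P_le by (auto simp: sq_int_def intro: le_less_trans)

text \<open>A finite x with 16 x \<le> x vanishes; finiteness comes from membership of d in
  \<open>sq_int M\<close>.\<close>

lemma fixed_point_zero:
  assumes d: "d \<in> sq_int M" and eq: "AE z in M. d z = P d z"
  shows "AE z in M. d z = 0"
proof -
  have "16 * sq_norm M d = 16 * sq_norm M (P d)" using sq_norm_cong_AE[OF eq] by simp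
  also have "\<dots> \<le> sq_norm M d" by (rule P_contr[OF d])
  finally have le: "16 * sq_norm M d \<le> sq_norm M d" .
  have "sq_norm M d = 0"
  proof -
    obtain x where x: "sq_norm M d = ennreal x" "0 \<le> x"
      using d by (cases "sq_norm M d") (auto simp: sq_int_def)
    then have "ennreal (16 * x) \<le> ennreal x" using le by (simp add: ennreal_mult)
    then show ?thesis using x by (simp add: ennreal_le_iff)
  qed
  then show ?thesis using d by (intro sq_norm_eq_0) (auto simp: sq_int_def)
qed

lemma one_minus_inj:
  assumes "f \<in> sq_int M" "g \<in> sq_int M" and eq: "AE z in M. f z - P f z = g z - P g z"
  shows "AE z in M. f z = g z"
proof -
  have "AE z in M. f z - g z = P (\<lambda>z. f z - g z) z"
    using eq P_diff[OF assms(1,2)]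
  proof eventually_elim
    case (elim z)
    have "f z - g z = (f z - P f z) - (g z - P g z) + (P f z - P g z)" by simp
    then show ?case using elim by simp
  qed
  from fixed_point_zero[OF sq_int_diff[OF assms(1,2)] this] show ?thesis by simp
qed

text \<open>The Neumann series is summed pointwise almost everywhere rather than in norm: a weighted
  square sum \<open>T\<close> of its terms is integrable, hence finite almost everywhere, and where
  it is finite the terms decay geometrically.\<close>

lemma one_minus_surj:
  assumes f: "f \<in> sq_int M"
  shows "\<exists>g\<in>sq_int M. AE z in M. g z - P g z = f z"
proof -
  define F where "F n = (P ^^ n) f" for n
  have F_int: "F n \<in> sq_int M" for n
    unfolding F_def by (induction n) (auto simp: f P_sq_int)
  have F_Suc: "F (Suc n) = P (F n)" for n by (simp add: F_def)
  have [measurable]: "F n \<in> borel_measurable M" for n using F_int[of n] by (simp add: sq_int_def)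
  have F_norm: "16 ^ n * sq_norm M (F (n + m)) \<le> sq_norm M (F m)" for n m
  proof (induction n)
    case (Suc n)
    have "16 ^ Suc n * sq_norm M (F (Suc n + m)) = 16 ^ n * (16 * sq_norm M (P (F (n + m))))"
      by (simp add: F_Suc mult_ac)
    also have "\<dots> \<le> 16 ^ n * sq_norm M (F (n + m))" by (intro mult_left_mono P_contr F_int) auto
    finally show ?case using Suc by (rule order_trans)
  qed simp
  \<comment> \<open>The weight 4^n lies strictly between 1 and 16: against the decay 16^(-n) of the
    squared norms the integrals still sum, with ratio 1/4, while finiteness at z bounds the n-th
    term by a multiple of 2^(-n).\<close>
  define T where "T N z = (\<Sum>n. (4::ennreal) ^ n * (ennreal (cmod (F (n + N) z)))\<^sup>2)" for N z
  have T_int: "(\<integral>\<^sup>+z. T N z \<partial>M) \<le> 2 * sq_norm M (F N)" for N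
  proof -
    obtain x where x: "sq_norm M (F N) = ennreal x" "0 \<le> x"
      using F_int[of N] by (cases "sq_norm M (F N)") (auto simp: sq_int_def)
    have "(\<integral>\<^sup>+z. T N z \<partial>M) = (\<Sum>n. 4 ^ n * sq_norm M (F (n + N)))"
      unfolding T_def sq_norm_def by (subst nn_integral_suminf) (auto simp: nn_integral_cmult)
    also have "\<dots> \<le> (\<Sum>n. ennreal (x * (1/4) ^ n))"
    proof (intro suminf_le)
      fix n
      have fin: "sq_norm M (F (n + N)) < \<infinity>" using F_int by (simp add: sq_int_def)
      then obtain y where y: "sq_norm M (F (n + N)) = ennreal y" "0 \<le> y"
        by (cases "sq_norm M (F (n + N))") auto
      have "ennreal (16 ^ n * y) \<le> ennreal x" using F_norm[of n N] x y by (simp add: ennreal_mult ennreal_power[symmetric])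
      then have "16 ^ n * y \<le> x" using x by (simp add: ennreal_le_iff)
      then have "4 ^ n * (4 ^ n * y) \<le> x" by (simp add: mult.assoc[symmetric] power_mult_distrib[symmetric])
      then have "4 ^ n * y \<le> x * (1/4) ^ n" by (simp add: field_simps)
      then have "ennreal (4 ^ n * y) \<le> ennreal (x * (1/4) ^ n)" by (rule ennreal_leI)
      then show "4 ^ n * sq_norm M (F (n + N)) \<le> ennreal (x * (1/4) ^ n)"
        using y by (simp add: ennreal_mult ennreal_power[symmetric])
    qed auto
    also have "\<dots> = ennreal (x * (4/3))"
      using x geometric_sums[of "1/4::real"] by (intro suminf_ennreal_eq sums_mult) auto
    also have "\<dots> \<le> ennreal (2 * x)" using x by (intro ennreal_leI) auto
    also have "\<dots> = 2 * sq_norm M (F N)" using x by (simp add: ennreal_mult)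
    finally show ?thesis .
  qed
  have T_fin: "AE z in M. T N z < \<infinity>" for N
  proof -
    have "(\<integral>\<^sup>+z. T N z \<partial>M) \<noteq> \<infinity>" using T_int[of N] F_int[of N]
      by (auto simp: sq_int_def ennreal_mult_eq_top_iff top_unique simp flip: less_top)
    moreover have "T N \<in> borel_measurable M" unfolding T_def by measurable
    ultimately show ?thesis using nn_integral_PInf_AE[of "T N" M] by (auto simp: less_top)
  qed
  have tail: "summable (\<lambda>n. F (n + N) z) \<and> (ennreal (cmod (\<Sum>n. F (n + N) z)))\<^sup>2 \<le> 4 * T N z" if "T N z < \<infinity>" for N z
  proof -
    obtain t where t: "T N z = ennreal t" "0 \<le> t" using \<open>T N z < \<infinity>\<close> by (cases "T N z") auto
    have b: "cmod (F (n + N) z) \<le> sqrt t * (1/2) ^ n" for n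
    proof -
      have "4 ^ n * (ennreal (cmod (F (n + N) z)))\<^sup>2 \<le> ennreal t"
        unfolding t(1)[symmetric] T_def by (rule ennreal_le_suminf)
      then have "ennreal (4 ^ n * (cmod (F (n + N) z))\<^sup>2) \<le> ennreal t"
        by (simp add: ennreal_mult ennreal_power[symmetric])
      then have "4 ^ n * (cmod (F (n + N) z))\<^sup>2 \<le> t" using t by (simp add: ennreal_le_iff)
      then have "(2 ^ n * cmod (F (n + N) z))\<^sup>2 \<le> t"
        using power_mult_distrib[of 2 "2::real" n] by (simp add: power2_eq_square mult_ac)
      then have "2 ^ n * cmod (F (n + N) z) \<le> sqrt t" by (rule real_le_rsqrt)
      then show ?thesis by (simp add: field_simps)
    qed
    have s: "(\<lambda>n. sqrt t * (1/2) ^ n) sums (sqrt t * 2)" using geometric_sums[of "1/2::real"] by (intro sums_mult) simp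
    have sF: "summable (\<lambda>n. norm (F (n + N) z))"
      by (rule summable_comparison_test'[OF sums_summable[OF s], of 0]) (use b in auto)
    have "cmod (\<Sum>n. F (n + N) z) \<le> (\<Sum>n. cmod (F (n + N) z))" by (rule summable_norm[OF sF])
    also have "\<dots> \<le> (\<Sum>n. sqrt t * (1/2) ^ n)" by (rule suminf_le[OF b sF sums_summable[OF s]])
    also have "\<dots> = sqrt t * 2" using s by (rule sums_unique[symmetric])
    finally have "(cmod (\<Sum>n. F (n + N) z))\<^sup>2 \<le> (sqrt t * 2)\<^sup>2" by (intro power_mono) auto
    also have "\<dots> = 4 * t" using t by (simp add: power_mult_distrib)
    finally have "(ennreal (cmod (\<Sum>n. F (n + N) z)))\<^sup>2 \<le> ennreal (4 * t)"
      by (simp add: ennreal_power ennreal_leI)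
    also have "\<dots> = 4 * T N z" using t by (simp add: ennreal_mult)
    finally show ?thesis using summable_norm_cancel[OF sF] by simp
  qed
  \<comment> \<open>Tail of the series from index \<open>N\<close> on. \<open>r 0\<close> is the
    solution; the other tails serve to justify applying P to an infinite sum.\<close>
  define r where "r N z = (\<Sum>n. F (n + N) z)" for N z
  have [measurable]: "r N \<in> borel_measurable M" for N unfolding r_def by measurable
  have r_norm: "sq_norm M (r N) \<le> 8 * sq_norm M (F N)" for N
  proof -
    have [measurable]: "T N \<in> borel_measurable M" unfolding T_def by measurable
    have "sq_norm M (r N) \<le> (\<integral>\<^sup>+z. 4 * T N z \<partial>M)" unfolding sq_norm_def
    proof (rule nn_integral_mono_AE)
      show "AE z in M. (ennreal (cmod (r N z)))\<^sup>2 \<le> 4 * T N z"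
        using T_fin[of N] by eventually_elim (use tail in \<open>simp add: r_def\<close>)
    qed
    also have "\<dots> = 4 * (\<integral>\<^sup>+z. T N z \<partial>M)" by (rule nn_integral_cmult) auto
    also have "\<dots> \<le> 4 * (2 * sq_norm M (F N))" by (intro mult_left_mono T_int) auto
    finally show ?thesis by (simp add: mult.assoc[symmetric])
  qed
  have r_int: "r N \<in> sq_int M" for N
    using r_norm[of N] F_int[of N] by (auto simp: sq_int_def ennreal_mult_less_top le_less_trans)
  have r_step: "AE z in M. r (Suc N) z = r N z - F N z" for N
    using T_fin[of N]
  proof eventually_elim
    case (elim z)
    from tail[OF this] have "summable (\<lambda>n. F (n + N) z)" by simp
    from suminf_split_head[OF this] show ?case by (simp add: r_def)
  qed
  \<comment> \<open>P maps the null function a - b to a null function by the contraction bound, so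
    it respects equality almost everywhere.\<close>
  have P_cong: "AE z in M. P a z = P b z" if "a \<in> sq_int M" "b \<in> sq_int M" "AE z in M. a z = b z" for a b
  proof -
    have "sq_norm M (\<lambda>z. a z - b z) = 0"
      using sq_norm_cong_AE[of "\<lambda>z. a z - b z" "\<lambda>_. 0" M] that(3) by (auto simp: sq_norm_def)
    then have "sq_norm M (P (\<lambda>z. a z - b z)) = 0"
      using P_le[OF sq_int_diff[OF that(1,2)]] by simp
    from sq_norm_eq_0[OF P_meas[OF sq_int_diff[OF that(1,2)]] this] P_diff[OF that(1,2)]
    show ?thesis by eventually_elim simp
  qed
  \<comment> \<open>To apply P to the infinite sum, the defect P (r N) - r (Suc N) is followed. It
    is the same for every N, because the same term is removed from both of its parts, and its norm
    is bounded by those of the tails, which tend to 0.\<close>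
  have d_step: "AE z in M. P (r N) z - r (Suc N) z = P (r (Suc N)) z - r (Suc (Suc N)) z" for N
    using P_cong[OF r_int sq_int_diff[OF r_int F_int] r_step[of N]] P_diff[OF r_int[of N] F_int[of N]] r_step[of "Suc N"]
    by eventually_elim (simp add: F_Suc)
  have d_all: "AE z in M. P (r 0) z - r (Suc 0) z = P (r N) z - r (Suc N) z" for N
  proof (induction N)
    case (Suc N)
    then show ?case using d_step[of N] by eventually_elim simp
  qed simp
  have d0: "AE z in M. P (r 0) z - r (Suc 0) z = 0"
  proof (rule sq_norm_eq_0)
    show "(\<lambda>z. P (r 0) z - r (Suc 0) z) \<in> borel_measurable M" using P_meas[OF r_int] by measurable
    let ?d = "sq_norm M (\<lambda>z. P (r 0) z - r (Suc 0) z)"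
    obtain x where x: "sq_norm M (F 0) = ennreal x" "0 \<le> x"
      using F_int[of 0] by (cases "sq_norm M (F 0)") (auto simp: sq_int_def)
    have "?d \<le> ennreal (32 * x * (1/16) ^ N)" for N
    proof -
      have [measurable]: "P (r N) \<in> borel_measurable M" by (rule P_meas[OF r_int])
      have "?d = sq_norm M (\<lambda>z. P (r N) z - r (Suc N) z)" by (rule sq_norm_cong_AE[OF d_all])
      also have "\<dots> \<le> 2 * sq_norm M (P (r N)) + 2 * sq_norm M (r (Suc N))" by (rule sq_norm_diff_le) auto
      also have "\<dots> \<le> 2 * (8 * sq_norm M (F N)) + 2 * (8 * sq_norm M (F N))"
        by (intro add_mono mult_left_mono order_trans[OF P_le r_norm] order_trans[OF r_norm] r_int)
           (auto simp: F_Suc intro: P_le F_int)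
      also have "\<dots> = 32 * sq_norm M (F N)"
        by (simp add: mult.assoc[symmetric] distrib_right[symmetric])
      finally have 1: "?d \<le> 32 * sq_norm M (F N)" .
      obtain y where y: "sq_norm M (F N) = ennreal y" "0 \<le> y"
        using F_int[of N] by (cases "sq_norm M (F N)") (auto simp: sq_int_def)
      have "ennreal (16 ^ N * y) \<le> ennreal x" using F_norm[of N 0] x y by (simp add: ennreal_mult ennreal_power[symmetric])
      then have "16 ^ N * y \<le> x" using x by (simp add: ennreal_le_iff)
      then have "32 * y \<le> 32 * x * (1/16) ^ N" by (simp add: field_simps)
      then have "ennreal (32 * y) \<le> ennreal (32 * x * (1/16) ^ N)" by (rule ennreal_leI)
      moreover have "?d \<le> ennreal (32 * y)" using 1 y by (simp add: ennreal_mult)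
      ultimately show ?thesis by (rule order_trans[rotated])
    qed
    moreover have "(\<lambda>N. ennreal (32 * x * (1/16) ^ N)) \<longlonglongrightarrow> ennreal 0"
      by (intro tendsto_ennrealI tendsto_mult_right_zero LIMSEQ_power_zero) simp
    ultimately show "?d = 0" using LIMSEQ_le_const[of "\<lambda>N. ennreal (32 * x * (1/16) ^ N)" 0 ?d] by auto
  qed
  show ?thesis
  proof (intro bexI[of _ "r 0"] r_int)
    show "AE z in M. r 0 z - P (r 0) z = f z" using d0 r_step[of 0]
      by eventually_elim (simp add: F_def)
  qed
qed

end

section \<open>The Riemann-Lebesgue lemma\<close>

lemma integrable_lborel_translate:
  fixes f :: "'a::euclidean_space \<Rightarrow> 'b::{banach, second_countable_topology}"
  shows "integrable lborel (\<lambda>x. f (x + c)) \<longleftrightarrow> integrable lborel f"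
proof -
  have 1: "integrable lborel (\<lambda>x. f (x + c))" if f: "integrable lborel f" for f :: "'a \<Rightarrow> 'b" and c
  proof -
    have "integrable (distr lborel borel ((+) c)) f" using f by (simp add: lborel_distr_plus)
    then show ?thesis using f by (subst (asm) integrable_distr_eq) (auto simp: add.commute)
  qed
  show ?thesis using 1[of f c] 1[of "\<lambda>x. f (x + c)" "-c"] by auto
qed

lemma integral_lborel_translate:
  fixes f :: "'a::euclidean_space \<Rightarrow> 'b::{banach, second_countable_topology}"
  shows "(\<integral>x. f (x + c) \<partial>lborel) = (\<integral>x. f x \<partial>lborel)"
proof (cases "integrable lborel f")
  case True
  have "(\<integral>x. f x \<partial>lborel) = (\<integral>x. f x \<partial>distr lborel borel ((+) c))" by (simp add: lborel_distr_plus)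
  also have "\<dots> = (\<integral>x. f (x + c) \<partial>lborel)" using True by (subst integral_distr) (auto simp: add.commute)
  finally show ?thesis ..
qed (simp add: not_integrable_integral_eq integrable_lborel_translate)

text \<open>By translation invariance the error of f exceeds that of g by at most twice the L1
  distance of f and g. The reduction serves both to replace a measurable set by an open one and to
  pass to limits.\<close>

lemma L1_translation_approx:
  fixes f :: "'a::euclidean_space \<Rightarrow> 'b::{banach, second_countable_topology}"
  assumes f: "integrable lborel f"
    and approx: "\<And>e. 0 < e \<Longrightarrow> \<exists>g. integrable lborel g \<and> (\<lambda>n. \<integral>z. norm (g (z + \<tau> n) - g z) \<partial>lborel) \<longlonglongrightarrow> 0
       \<and> (\<integral>z. norm (f z - g z) \<partial>lborel) < e"
  shows "(\<lambda>n. \<integral>z. norm (f (z + \<tau> n) - f z) \<partial>lborel) \<longlonglongrightarrow> 0"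
proof (rule LIMSEQ_I)
  fix r :: real assume r: "0 < r"
  obtain g where g: "integrable lborel g" "(\<lambda>n. \<integral>z. norm (g (z + \<tau> n) - g z) \<partial>lborel) \<longlonglongrightarrow> 0"
     "(\<integral>z. norm (f z - g z) \<partial>lborel) < r / 3" using approx[of "r / 3"] r by auto
  obtain N where N: "\<And>n. N \<le> n \<Longrightarrow> (\<integral>z. norm (g (z + \<tau> n) - g z) \<partial>lborel) < r / 3"
    using LIMSEQ_D[OF g(2), of "r / 3"] r by auto
  have "norm ((\<integral>z. norm (f (z + \<tau> n) - f z) \<partial>lborel) - 0) < r" if n: "N \<le> n" for n
  proof -
    have i: "integrable lborel (\<lambda>z. norm (f z - g z))" using f g by auto
    have it: "integrable lborel (\<lambda>z. norm (f (z + \<tau> n) - g (z + \<tau> n)))"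
      using i integrable_lborel_translate[of "\<lambda>z. norm (f z - g z)"] by simp
    have ig: "integrable lborel (\<lambda>z. norm (g (z + \<tau> n) - g z))" using g integrable_lborel_translate[of g] by auto
    have "(\<integral>z. norm (f (z + \<tau> n) - f z) \<partial>lborel)
      \<le> (\<integral>z. norm (f (z + \<tau> n) - g (z + \<tau> n)) + norm (g (z + \<tau> n) - g z) + norm (f z - g z) \<partial>lborel)"
    proof (rule integral_mono)
      show "integrable lborel (\<lambda>z. norm (f (z + \<tau> n) - f z))" using f integrable_lborel_translate[of f] by auto
      show "integrable lborel (\<lambda>z. norm (f (z + \<tau> n) - g (z + \<tau> n)) + norm (g (z + \<tau> n) - g z) + norm (f z - g z))"
        by (intro Bochner_Integration.integrable_add i it ig)
      fix z
      have "f (z + \<tau> n) - f z = (f (z + \<tau> n) - g (z + \<tau> n)) + (g (z + \<tau> n) - g z) - (f z - g z)" by simp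
      then show "norm (f (z + \<tau> n) - f z) \<le> norm (f (z + \<tau> n) - g (z + \<tau> n)) + norm (g (z + \<tau> n) - g z) + norm (f z - g z)"
        by (metis (no_types, lifting) add_mono_thms_linordered_semiring(3) norm_triangle_ineq norm_triangle_ineq4 order_trans)
    qed
    also have "\<dots> = (\<integral>z. norm (f (z + \<tau> n) - g (z + \<tau> n)) \<partial>lborel) + (\<integral>z. norm (g (z + \<tau> n) - g z) \<partial>lborel) + (\<integral>z. norm (f z - g z) \<partial>lborel)"
      using i it ig by simp
    also have "(\<integral>z. norm (f (z + \<tau> n) - g (z + \<tau> n)) \<partial>lborel) = (\<integral>z. norm (f z - g z) \<partial>lborel)"
      by (rule integral_lborel_translate[where f="\<lambda>z. norm (f z - g z)"])
    finally show ?thesis using N[OF n] g(3) by simp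
  qed
  then show "\<exists>no. \<forall>n\<ge>no. norm ((\<integral>z. norm (f (z + \<tau> n) - f z) \<partial>lborel) - 0) < r" by blast
qed

text \<open>Up to the norm of c the distance of the two indicators is twice the measure of U minus
  twice the measure of the overlap. Openness makes the overlap integrand converge at each point of
  U, and points outside U contribute 0, so the boundary causes no trouble.\<close>

lemma L1_translation_open:
  fixes U :: "'a::euclidean_space set" and c :: "'b::{banach, second_countable_topology}"
  assumes U: "open U" "emeasure lborel U < \<infinity>" and \<tau>: "\<tau> \<longlonglongrightarrow> 0"
  shows "(\<lambda>n. \<integral>z. norm (indicator U (z + \<tau> n) *\<^sub>R c - indicator U z *\<^sub>R c) \<partial>lborel) \<longlonglongrightarrow> 0"
proof -
  let ?i = "\<lambda>z. indicator U z :: real"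
  have [measurable]: "U \<in> sets borel" using U by auto
  have iU: "integrable lborel ?i" using U by auto
  have iUt: "integrable lborel (\<lambda>z. ?i (z + \<tau> n))" for n using iU integrable_lborel_translate[of ?i] by simp
  have ip: "integrable lborel (\<lambda>z. ?i z * ?i (z + \<tau> n))" for n
    by (rule Bochner_Integration.integrable_bound[OF iU]) (auto simp: indicator_def)
  have eq: "(\<integral>z. norm (indicator U (z + \<tau> n) *\<^sub>R c - indicator U z *\<^sub>R c) \<partial>lborel)
     = (2 * (\<integral>z. ?i z \<partial>lborel) - 2 * (\<integral>z. ?i z * ?i (z + \<tau> n) \<partial>lborel)) * norm c" for n
  proof -
    have "(\<integral>z. norm (indicator U (z + \<tau> n) *\<^sub>R c - indicator U z *\<^sub>R c) \<partial>lborel)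
      = (\<integral>z. (?i (z + \<tau> n) + ?i z - 2 * (?i z * ?i (z + \<tau> n))) * norm c \<partial>lborel)"
      by (intro Bochner_Integration.integral_cong) (auto simp: indicator_def)
    also have "\<dots> = ((\<integral>z. ?i (z + \<tau> n) \<partial>lborel) + (\<integral>z. ?i z \<partial>lborel) - 2 * (\<integral>z. ?i z * ?i (z + \<tau> n) \<partial>lborel)) * norm c"
      using iU iUt[of n] ip[of n] by simp
    finally show ?thesis using integral_lborel_translate[of ?i "\<tau> n"] by simp
  qed
  have "(\<lambda>n. \<integral>z. ?i z * ?i (z + \<tau> n) \<partial>lborel) \<longlonglongrightarrow> (\<integral>z. ?i z \<partial>lborel)"
  proof (rule integral_dominated_convergence[where w="?i"])
    show "AE z in lborel. (\<lambda>n. ?i z * ?i (z + \<tau> n)) \<longlonglongrightarrow> ?i z"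
    proof (intro AE_I2)
      fix z
      show "(\<lambda>n. ?i z * ?i (z + \<tau> n)) \<longlonglongrightarrow> ?i z"
      proof (cases "z \<in> U")
        case True
        have "(\<lambda>n. z + \<tau> n) \<longlonglongrightarrow> z + 0" by (intro tendsto_intros \<tau>)
        then have "\<forall>\<^sub>F n in sequentially. z + \<tau> n \<in> U" using U(1) True
          by (simp add: topological_tendstoD)
        then show ?thesis by (intro tendsto_eventually) (auto elim!: eventually_mono simp: indicator_def)
      qed simp
    qed
  qed (use iU in \<open>auto simp: indicator_def\<close>)
  then have "(\<lambda>n. (2 * (\<integral>z. ?i z \<partial>lborel) - 2 * (\<integral>z. ?i z * ?i (z + \<tau> n) \<partial>lborel)) * norm c)
     \<longlonglongrightarrow> (2 * (\<integral>z. ?i z \<partial>lborel) - 2 * (\<integral>z. ?i z \<partial>lborel)) * norm c"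
    by (intro tendsto_intros)
  then show ?thesis unfolding eq by simp
qed

text \<open>Induction over integrable functions: outer regularity replaces a measurable set by an
  open superset of small excess, and a limit of functions bounded by 2 |f| is approximated in L1 by
  dominated convergence, with majorant 3 |f|.\<close>

lemma L1_translation:
  fixes f :: "'a::euclidean_space \<Rightarrow> 'b::{banach, second_countable_topology}"
  assumes f: "integrable lborel f" and \<tau>: "\<tau> \<longlonglongrightarrow> 0"
  shows "(\<lambda>n. \<integral>z. norm (f (z + \<tau> n) - f z) \<partial>lborel) \<longlonglongrightarrow> 0"
  using f
proof (induction rule: integrable_induct)
  case (base A c)
  then have [measurable]: "A \<in> sets borel" by simp
  show ?case
  proof (rule L1_translation_approx)
    show "integrable lborel (\<lambda>z. indicator A z *\<^sub>R c)" using base by auto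
    fix e :: real assume e: "0 < e"
    \<comment> \<open>The summand 1 keeps the denominator positive when c = 0.\<close>
    define e' where "e' = e / (norm c + 1)"
    have e': "0 < e'" using e by (simp add: e'_def add_nonneg_pos)
    obtain U where U: "open U" "A \<subseteq> U" "emeasure lborel (U - A) < ennreal e'"
      using outer_regular_lborel[of A e'] e' by auto
    have [measurable]: "U \<in> sets borel" using U by auto
    have "emeasure lborel U \<le> emeasure lborel (U - A) + emeasure lborel A"
      using emeasure_subadditive[of "U - A" lborel A] U(2) by (simp add: Un_absorb2)
    also have "\<dots> < \<infinity>" using U(3) base(2) ennreal_less_top[of e'] by (auto simp: less_top intro: less_trans)
    finally have fin: "emeasure lborel U < \<infinity>" .
    have m: "measure lborel (U - A) < e'"
    proof -
      have "emeasure lborel (U - A) \<noteq> \<infinity>" using U(3) by auto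
      then have "emeasure lborel (U - A) = ennreal (measure lborel (U - A))"
        by (simp add: emeasure_eq_ennreal_measure)
      then show ?thesis using U(3) by (simp add: ennreal_less_iff)
    qed
    have "(\<integral>z. norm (indicator A z *\<^sub>R c - indicator U z *\<^sub>R c) \<partial>lborel) = (\<integral>z. indicator (U - A) z * norm c \<partial>lborel)"
      using U(2) by (intro Bochner_Integration.integral_cong) (auto simp: indicator_def)
    also have "\<dots> = measure lborel (U - A) * norm c" by simp
    also have "\<dots> \<le> e' * norm c" using m by (intro mult_right_mono) auto
    also have "\<dots> < e" using e by (simp add: e'_def add_nonneg_pos pos_divide_less_eq[of "norm c + 1"] distrib_left)
    finally have lt: "(\<integral>z. norm (indicator A z *\<^sub>R c - indicator U z *\<^sub>R c) \<partial>lborel) < e" .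
    show "\<exists>g. integrable lborel g \<and> (\<lambda>n. \<integral>z. norm (g (z + \<tau> n) - g z) \<partial>lborel) \<longlonglongrightarrow> 0
       \<and> (\<integral>z. norm (indicator A z *\<^sub>R c - g z) \<partial>lborel) < e"
      using L1_translation_open[OF U(1) fin \<tau>, of c] lt fin
      by (intro exI[of _ "\<lambda>z. indicator U z *\<^sub>R c"]) auto
  qed
next
  case (add f g)
  have "(\<lambda>n. (\<integral>z. norm (f (z + \<tau> n) - f z) \<partial>lborel) + (\<integral>z. norm (g (z + \<tau> n) - g z) \<partial>lborel)) \<longlonglongrightarrow> 0"
    using tendsto_add[OF add.IH] by simp
  then show ?case
  proof (rule Lim_null_comparison[rotated], intro always_eventually allI)
    fix n
    have i: "integrable lborel (\<lambda>z. norm (f (z + \<tau> n) - f z))" "integrable lborel (\<lambda>z. norm (g (z + \<tau> n) - g z))"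
      using add integrable_lborel_translate[of f] integrable_lborel_translate[of g] by auto
    have "(\<integral>z. norm (f (z + \<tau> n) + g (z + \<tau> n) - (f z + g z)) \<partial>lborel) \<le> (\<integral>z. norm (f (z + \<tau> n) - f z) + norm (g (z + \<tau> n) - g z) \<partial>lborel)"
      by (rule integral_mono')
         (use i in \<open>auto intro: norm_diff_triangle_ineq\<close>)
    then show "norm (\<integral>z. norm (f (z + \<tau> n) + g (z + \<tau> n) - (f z + g z)) \<partial>lborel)
         \<le> (\<integral>z. norm (f (z + \<tau> n) - f z) \<partial>lborel) + (\<integral>z. norm (g (z + \<tau> n) - g z) \<partial>lborel)"
      using i by simp
  qed
next
  case (lim f s)
  show ?case
  proof (rule L1_translation_approx)
    fix e :: real assume e: "0 < e"
    have [measurable]: "f \<in> borel_measurable borel" "\<And>i. s i \<in> borel_measurable borel"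
      using lim(1,4) by (auto dest!: borel_measurable_integrable)
    have "(\<lambda>i. \<integral>z. norm (f z - s i z) \<partial>lborel) \<longlonglongrightarrow> (\<integral>z. 0 \<partial>(lborel::'a measure))"
    proof (rule integral_dominated_convergence[where w="\<lambda>z. 3 * norm (f z)"])
      show "AE z in lborel. (\<lambda>i. norm (f z - s i z)) \<longlonglongrightarrow> 0"
      proof (intro AE_I2)
        fix z
        have "(\<lambda>i. norm (f z - s i z)) \<longlonglongrightarrow> norm (f z - f z)"
          using lim(2)[of z] by (intro tendsto_intros) auto
        then show "(\<lambda>i. norm (f z - s i z)) \<longlonglongrightarrow> 0" by simp
      qed
      show "AE z in lborel. norm (norm (f z - s i z)) \<le> 3 * norm (f z)" for i
      proof (intro AE_I2)
        fix z show "norm (norm (f z - s i z)) \<le> 3 * norm (f z)"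
          using norm_triangle_ineq4[of "f z" "s i z"] lim(3)[of z i] by simp
      qed
    qed (use lim in auto)
    then have "(\<lambda>i. \<integral>z. norm (f z - s i z) \<partial>lborel) \<longlonglongrightarrow> 0" by simp
    from LIMSEQ_D[OF this e] obtain i where "(\<integral>z. norm (f z - s i z) \<partial>lborel) < e" by auto
    then show "\<exists>g. integrable lborel g \<and> (\<lambda>n. \<integral>z. norm (g (z + \<tau> n) - g z) \<partial>lborel) \<longlonglongrightarrow> 0
       \<and> (\<integral>z. norm (f z - g z) \<partial>lborel) < e" using lim by (intro exI[of _ "s i"]) auto
  qed (rule lim)
qed

text \<open>Equal to exp(-2 i Im(kz)): a unimodular character of the additive group of the plane
  whose frequency grows with |k|.\<close>

definition phase :: "complex \<Rightarrow> complex \<Rightarrow> complex" where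
  "phase k z = exp (cnj (k * z) - k * z)"

lemma norm_phase [simp]: "cmod (phase k z) = 1"
  by (simp add: phase_def norm_exp_eq_Re)

lemma phase_measurable [measurable]: "phase k \<in> borel_measurable borel"
  unfolding phase_def[abs_def] by (intro borel_measurable_continuous_onI continuous_intros)

lemma phase_add: "phase k (z + w) = phase k z * phase k w"
  by (simp add: phase_def algebra_simps exp_add[symmetric])

lemma cnj_phase: "cnj (phase k z) = exp (k * z - cnj (k * z))"
  by (simp add: phase_def exp_cnj)

lemma phase_half_period: "k \<noteq> 0 \<Longrightarrow> phase k (\<i> * pi / (2 * k)) = -1"
  by (simp add: phase_def exp_minus)

text \<open>Shifting by the half period i pi/(2k) turns the phase into its negative, so twice the
  integral equals that of the phase times f minus its translate. The shift tends to 0, and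
  translation is continuous in L1.\<close>

lemma riemann_lebesgue:
  assumes f: "integrable lborel f" and k: "filterlim (\<lambda>n. cmod (k n)) at_top sequentially"
  shows "(\<lambda>n. \<integral>z. phase (k n) z * f z \<partial>lborel) \<longlonglongrightarrow> 0"
proof -
  define \<tau> where "\<tau> n = \<i> * pi / (2 * k n)" for n
  have "(\<lambda>n. (pi / 2) / cmod (k n)) \<longlonglongrightarrow> 0"
    by (rule tendsto_divide_0[OF tendsto_const]) (rule filterlim_at_top_imp_at_infinity[OF k])
  then have "\<tau> \<longlonglongrightarrow> 0"
    by (subst tendsto_norm_zero_iff[symmetric]) (simp add: \<tau>_def norm_divide norm_mult)
  from L1_translation[OF f this]
  have lim: "(\<lambda>n. (1/2) * (\<integral>z. norm (f (z + \<tau> n) - f z) \<partial>lborel)) \<longlonglongrightarrow> 0"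
    by (rule tendsto_mult_right_zero)
  have "\<forall>\<^sub>F n in sequentially. cmod (k n) > 0" using k unfolding filterlim_at_top_dense by blast
  then have ev: "\<forall>\<^sub>F n in sequentially. norm (\<integral>z. phase (k n) z * f z \<partial>lborel) \<le> (1/2) * (\<integral>z. norm (f (z + \<tau> n) - f z) \<partial>lborel)"
  proof (rule eventually_mono)
    fix n assume "0 < cmod (k n)"
    then have kn: "k n \<noteq> 0" by auto
    have [measurable]: "f \<in> borel_measurable borel" using f by (auto dest: borel_measurable_integrable)
    have i1: "integrable lborel (\<lambda>z. phase (k n) z * f z)"
      by (rule Bochner_Integration.integrable_bound[OF f]) (auto simp: norm_mult)
    have ft: "integrable lborel (\<lambda>z. f (z + \<tau> n))" using f integrable_lborel_translate[of f] by simp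
    have i2: "integrable lborel (\<lambda>z. phase (k n) z * f (z + \<tau> n))"
      by (rule Bochner_Integration.integrable_bound[OF ft]) (auto simp: norm_mult)
    have "(\<integral>z. phase (k n) z * f z \<partial>lborel) = (\<integral>z. phase (k n) (z + \<tau> n) * f (z + \<tau> n) \<partial>lborel)"
      by (rule integral_lborel_translate[symmetric, where f="\<lambda>z. phase (k n) z * f z"])
    also have "\<dots> = (\<integral>z. - (phase (k n) z * f (z + \<tau> n)) \<partial>lborel)"
      using phase_half_period[OF kn] by (simp add: phase_add \<tau>_def)
    finally have "2 * (\<integral>z. phase (k n) z * f z \<partial>lborel) = (\<integral>z. phase (k n) z * f z \<partial>lborel) - (\<integral>z. phase (k n) z * f (z + \<tau> n) \<partial>lborel)"
      by simp
    also have "\<dots> = (\<integral>z. phase (k n) z * f z - phase (k n) z * f (z + \<tau> n) \<partial>lborel)"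
      using i1 i2 by simp
    also have "cmod \<dots> \<le> (\<integral>z. cmod (phase (k n) z * f z - phase (k n) z * f (z + \<tau> n)) \<partial>lborel)"
      by (rule integral_norm_bound)
    also have "\<dots> = (\<integral>z. norm (f (z + \<tau> n) - f z) \<partial>lborel)"
      by (simp add: right_diff_distrib[symmetric] norm_mult norm_minus_commute)
    finally show "norm (\<integral>z. phase (k n) z * f z \<partial>lborel) \<le> (1/2) * (\<integral>z. norm (f (z + \<tau> n) - f z) \<partial>lborel)"
      by (simp add: norm_mult)
  qed
  show ?thesis by (rule Lim_null_comparison[OF ev lim])
qed

section \<open>Smallness of the composed operators\<close>

text \<open>With this density <z>^a L2 becomes the plain L2 space of a measure, to which the Neumann
  series applies as it stands. The density is positive, so the null sets are those of Lebesgue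
  measure.\<close>

definition weighted :: "real \<Rightarrow> complex measure" where
  "weighted a = density lborel (\<lambda>z. ennreal (jbr z powr - (2 * a)))"

lemma sets_weighted [simp, measurable_cong]: "sets (weighted a) = sets borel"
  by (simp add: weighted_def)

lemma space_weighted [simp]: "space (weighted a) = UNIV"
  by (simp add: weighted_def)

lemma measurable_weighted [simp]: "borel_measurable (weighted a) = borel_measurable borel"
  by (rule measurable_cong_sets) simp_all

lemma AE_weighted_iff: "(AE z in weighted a. P z) \<longleftrightarrow> (AE z in lborel. P z)"
  unfolding weighted_def by (subst AE_density) auto

lemma sq_norm_weighted:
  assumes [measurable]: "u \<in> borel_measurable borel"
  shows "sq_norm (weighted a) u = (\<integral>\<^sup>+z. (ennreal (jbr z powr - a * cmod (u z)))\<^sup>2 \<partial>lborel)"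
proof -
  have "ennreal (jbr z powr - (2 * a)) * (ennreal (cmod (u z)))\<^sup>2 = (ennreal (jbr z powr - a * cmod (u z)))\<^sup>2" for z
  proof -
    have "jbr z powr - (2 * a) = (jbr z powr - a)\<^sup>2" by (simp add: power2_eq_square powr_add[symmetric])
    then show ?thesis by (simp add: ennreal_power ennreal_mult[symmetric] power_mult_distrib)
  qed
  then show ?thesis unfolding sq_norm_def weighted_def by (subst nn_integral_density) auto
qed

lemma ennreal_power2_less_topD: "a\<^sup>2 < \<infinity> \<Longrightarrow> (a::ennreal) < \<infinity>"
  by (cases "a = \<infinity>") (auto simp: less_top power2_eq_square)

lemma cnj_measurable [measurable]: "cnj \<in> borel_measurable borel"
  by (intro borel_measurable_continuous_onI continuous_intros)

lemma sq_norm_weighted_antimono: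
  assumes "a \<le> b" and [measurable]: "u \<in> borel_measurable borel"
  shows "sq_norm (weighted b) u \<le> sq_norm (weighted a) u"
  using assms(1) by (subst (1 2) sq_norm_weighted)
    (auto intro!: nn_integral_mono power_mono ennreal_leI mult_right_mono jbr_powr_antimono)

lemma sq_norm_cnj [simp]: "sq_norm M (\<lambda>z. cnj (f z)) = sq_norm M f"
  by (simp add: sq_norm_def)

lemma sq_norm_cmult: "f \<in> borel_measurable M \<Longrightarrow> sq_norm M (\<lambda>z. c * f z) = ennreal ((cmod c)\<^sup>2) * sq_norm M f"
  by (simp add: sq_norm_def norm_mult ennreal_mult power_mult_distrib nn_integral_cmult ennreal_power)

lemma wL2_eq: "wL2 a = sq_int (weighted a)"
proof (intro set_eqI iffI)
  fix u assume "u \<in> wL2 a"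
  then obtain v where v: "v \<in> L2" and u: "\<And>z. u z = of_real (jbr z powr a) * v z" by (auto simp: wL2_def)
  have [measurable]: "v \<in> borel_measurable borel" using v by (simp add: L2_def)
  have "u = (\<lambda>z. of_real (jbr z powr a) * v z)" using u by auto
  then have um[measurable]: "u \<in> borel_measurable borel" by simp
  have "sq_norm (weighted a) u = (\<integral>\<^sup>+z. ennreal ((cmod (v z))\<^sup>2) \<partial>lborel)"
    unfolding sq_norm_weighted[OF um]
    by (intro nn_integral_cong) (simp add: u norm_mult ennreal_power powr_minus mult.assoc[symmetric])
  also have "\<dots> < \<infinity>" using v by (auto simp: L2_def integrable_iff_bounded)
  finally show "u \<in> sq_int (weighted a)" using um by (simp add: sq_int_def)
next
  fix u assume u: "u \<in> sq_int (weighted a)"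
  then have um[measurable]: "u \<in> borel_measurable borel" by (simp add: sq_int_def)
  define v where "v z = of_real (jbr z powr - a) * u z" for z
  have vm[measurable]: "v \<in> borel_measurable borel" unfolding v_def by measurable
  have "(\<integral>\<^sup>+z. ennreal ((cmod (v z))\<^sup>2) \<partial>lborel) = sq_norm (weighted a) u"
    unfolding sq_norm_weighted[OF um] by (intro nn_integral_cong) (simp add: v_def norm_mult ennreal_power)
  then have "v \<in> L2" using u by (simp add: L2_def integrable_iff_bounded sq_int_def)
  moreover have "u z = of_real (jbr z powr a) * v z" for z
    by (simp add: v_def powr_minus mult.assoc[symmetric] of_real_mult[symmetric] del: of_real_mult)
  ultimately show "u \<in> wL2 a" by (auto simp: wL2_def)
qed

lemma wnorm_eq:
  assumes [measurable]: "u \<in> borel_measurable borel"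
  shows "wnorm a u = sqrt (enn2real (sq_norm (weighted a) u))"
  unfolding wnorm_def
  by (subst integral_eq_nn_integral)
     (auto simp: sq_norm_weighted powr_minus ennreal_power divide_inverse mult.commute)

section \<open>Convolution form of the operators A and B\<close>

definition conv :: "(complex \<Rightarrow> complex) \<Rightarrow> (complex \<Rightarrow> complex) \<Rightarrow> complex \<Rightarrow> complex" where
  "conv J g z = (\<integral>w. J (z - w) * g w \<partial>lborel)"

lemma conv_measurable [measurable]:
  assumes [measurable]: "J \<in> borel_measurable borel" "g \<in> borel_measurable borel"
  shows "conv J g \<in> borel_measurable borel"
  unfolding conv_def[abs_def] by measurable

text \<open>Valid without integrability, since a divergent Bochner integral is 0.\<close>

lemma ennreal_norm_integral_le:
  fixes f :: "'a \<Rightarrow> 'b::{banach, second_countable_topology}"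
  shows "ennreal (norm (\<integral>x. f x \<partial>M)) \<le> (\<integral>\<^sup>+x. ennreal (norm (f x)) \<partial>M)"
  by (cases "integrable M f") (auto simp: integral_norm_bound_ennreal not_integrable_integral_eq)

lemma norm_conv_le: "ennreal (cmod (conv J g z)) \<le> (\<integral>\<^sup>+w. ennreal (cmod (J (z - w))) * ennreal (cmod (g w)) \<partial>lborel)"
  unfolding conv_def by (rule order_trans[OF ennreal_norm_integral_le]) (simp add: norm_mult ennreal_mult)

lemma conv_cong_AE:
  assumes [measurable]: "J \<in> borel_measurable borel" "g \<in> borel_measurable borel" "g' \<in> borel_measurable borel"
    and "AE w in lborel. g w = g' w"
  shows "conv J g = conv J g'"
  unfolding conv_def using assms(4) by (intro ext integral_cong_AE) (auto elim: eventually_mono)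

definition cker :: "complex \<Rightarrow> complex" where "cker z = 1 / z"
definition nearc :: "real \<Rightarrow> complex \<Rightarrow> complex" where "nearc \<delta> z = (if cmod z < \<delta> then 1 / z else 0)"
definition farc :: "real \<Rightarrow> complex \<Rightarrow> complex" where "farc \<delta> z = (if cmod z < \<delta> then 0 else 1 / z)"

lemma cker_measurable [measurable]: "cker \<in> borel_measurable borel"
  "nearc \<delta> \<in> borel_measurable borel" "farc \<delta> \<in> borel_measurable borel"
  unfolding cker_def[abs_def] nearc_def[abs_def] farc_def[abs_def] by measurable

lemma cmod_cker: "cmod (cker z) = 1 / cmod z" "cmod (nearc \<delta> z) = near_kernel \<delta> z" "cmod (farc \<delta> z) = far_kernel \<delta> z"
  by (auto simp: cker_def nearc_def farc_def near_kernel_def far_kernel_def norm_divide)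

lemma cker_split: "cker z = nearc \<delta> z + farc \<delta> z"
  by (auto simp: cker_def nearc_def farc_def)

lemma far_kernel_le: "0 < \<delta> \<Longrightarrow> far_kernel \<delta> z \<le> 1 / \<delta>"
  by (auto simp: far_kernel_def not_less intro!: frac_le)

text \<open>The factor 1/h of E cancels the h in front of the potential, so k survives only in the
  phase.\<close>

lemma opA_eq_conv:
  assumes "k \<noteq> 0"
  shows "opA k q u z = of_real (1 / (2 * pi)) * conv cker (\<lambda>w. phase k w * q w * u w) z"
proof -
  have "opA k q u z = (1 / of_real (pi * (1 / cmod k))) * (\<integral>w. of_real (1 / cmod k) / 2 * (cker (z - w) * (phase k w * q w * u w)) \<partial>lborel)"
    unfolding opA_def opE_def cker_def phase_def by (intro arg_cong2[where f="(*)"] refl Bochner_Integration.integral_cong) auto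
  also have "\<dots> = (1 / of_real (pi * (1 / cmod k))) * (of_real (1 / cmod k) / 2 * conv cker (\<lambda>w. phase k w * q w * u w) z)"
    by (simp only: integral_mult_right_zero conv_def)
  finally show ?thesis using assms by simp
qed

text \<open>The phase, the potential and the kernel of B are the conjugates of those of A. Through
  this identity the estimates and the weak equation for A yield those for B.\<close>

lemma opB_eq:
  shows "opB \<sigma> k q u z = \<sigma> * cnj (opA k q (\<lambda>w. cnj (u w)) z)"
proof -
  let ?f = "\<lambda>w. exp (cnj (k * w) - k * w) * (of_real (1 / cmod k) * q w / 2) * cnj (u w) / (z - w)"
  have "(\<integral>w. exp (k * w - cnj (k * w)) * (of_real (1 / cmod k) * cnj (q w) / 2) * u w / (cnj z - cnj w) \<partial>lborel)
    = (\<integral>w. cnj (?f w) \<partial>lborel)"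
    by (intro Bochner_Integration.integral_cong) (simp_all add: exp_cnj)
  also have "\<dots> = cnj (\<integral>w. ?f w \<partial>lborel)" by (rule Bochner_Integration.integral_cnj)
  finally show ?thesis unfolding opA_def opB_def opE_def opF_def by simp
qed

section \<open>The Cauchy transform and its truncated forms on the weighted spaces\<close>

context admissible
begin

text \<open>The kernel is a parameter so that the full Cauchy kernel and its near and far parts can
  share the same bounds.\<close>

definition kernel_op :: "(complex \<Rightarrow> complex) \<Rightarrow> complex \<Rightarrow> (complex \<Rightarrow> complex) \<Rightarrow> complex \<Rightarrow> complex" where
  "kernel_op J k u = conv J (\<lambda>w. phase k w * q w * u w)"

lemma kernel_op_measurable [measurable]:
  assumes [measurable]: "J \<in> borel_measurable borel" "u \<in> borel_measurable borel"
  shows "kernel_op J k u \<in> borel_measurable borel"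
  unfolding kernel_op_def by measurable

text \<open>The pairing of norms originates here: a factor <w>^2 goes to q and forms Q, its inverse
  goes to u, which is therefore measured in \<open>weighted 2\<close>.\<close>

lemma cmod_density: "ennreal (cmod (phase k w * q w * u w)) = ennreal (Q w) * ennreal (jbr w powr - 2 * cmod (u w))"
  by (simp add: norm_mult ennreal_mult[symmetric] powr_minus powr_numeral)

text \<open>The constant is uniform in k and in all kernels dominated by 1/|z|, since only absolute
  values enter the estimate. The last bound keeps the modulus inside the integral; it gives
  convergence almost everywhere and, later, a majorant.\<close>

lemma kernel_op_norm_bound:
  obtains C where "0 \<le> C"
   "\<And>J k u. J \<in> borel_measurable borel \<Longrightarrow> u \<in> borel_measurable borel \<Longrightarrow> (\<And>z. cmod (J z) \<le> 1 / cmod z) \<Longrightarrow>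
     sq_norm (weighted \<epsilon>) (kernel_op J k u) \<le> ennreal C * sq_norm (weighted 2) u"
   "\<And>u. u \<in> borel_measurable borel \<Longrightarrow>
     (\<integral>\<^sup>+z. (\<integral>\<^sup>+w. ennreal (jbr z powr - \<epsilon> * (1 / cmod (z - w))) * ennreal (cmod (q w * u w)) \<partial>lborel)\<^sup>2 \<partial>lborel)
     \<le> ennreal C * sq_norm (weighted 2) u"
proof -
  obtain C where C: "C < \<infinity>"
   "\<And>v. v \<in> borel_measurable borel \<Longrightarrow>
     (\<integral>\<^sup>+z. (\<integral>\<^sup>+w. ennreal (jbr z powr - \<epsilon> * (1 / cmod (z - w))) * (ennreal (Q w) * v w) \<partial>lborel)\<^sup>2 \<partial>lborel)
     \<le> C * (\<integral>\<^sup>+z. (v z)\<^sup>2 \<partial>lborel)" using cauchy_bound by blast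
  obtain c where c: "C = ennreal c" "0 \<le> c" using C(1) by (cases C) auto
  have main: "(\<integral>\<^sup>+z. (\<integral>\<^sup>+w. ennreal (jbr z powr - \<epsilon> * (1 / cmod (z - w))) * ennreal (cmod (phase k w * q w * u w)) \<partial>lborel)\<^sup>2 \<partial>lborel)
     \<le> C * sq_norm (weighted 2) u" if [measurable]: "u \<in> borel_measurable borel" for u k
    unfolding cmod_density sq_norm_weighted[OF that] by (rule C(2)) measurable
  show thesis
  proof (rule that[OF c(2)])
    fix J u :: "complex \<Rightarrow> complex" and k
    assume [measurable]: "J \<in> borel_measurable borel" and u[measurable]: "u \<in> borel_measurable borel"
      and J: "\<And>z. cmod (J z) \<le> 1 / cmod z"
    have "ennreal (jbr z powr - \<epsilon> * cmod (kernel_op J k u z)) \<le> (\<integral>\<^sup>+w. ennreal (jbr z powr - \<epsilon> * (1 / cmod (z - w))) * ennreal (cmod (phase k w * q w * u w)) \<partial>lborel)" for z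
    proof -
      have "ennreal (jbr z powr - \<epsilon> * cmod (kernel_op J k u z)) \<le> ennreal (jbr z powr - \<epsilon>) * (\<integral>\<^sup>+w. ennreal (cmod (J (z - w))) * ennreal (cmod (phase k w * q w * u w)) \<partial>lborel)"
        unfolding kernel_op_def ennreal_mult[OF powr_ge_zero norm_ge_zero] by (intro mult_left_mono norm_conv_le) simp
      also have "\<dots> = (\<integral>\<^sup>+w. ennreal (jbr z powr - \<epsilon>) * (ennreal (cmod (J (z - w))) * ennreal (cmod (phase k w * q w * u w))) \<partial>lborel)"
        by (rule nn_integral_cmult[symmetric]) measurable
      also have "\<dots> \<le> (\<integral>\<^sup>+w. ennreal (jbr z powr - \<epsilon> * (1 / cmod (z - w))) * ennreal (cmod (phase k w * q w * u w)) \<partial>lborel)"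
      proof (rule nn_integral_mono)
        fix w
        have "ennreal (jbr z powr - \<epsilon>) * ennreal (cmod (J (z - w))) \<le> ennreal (jbr z powr - \<epsilon> * (1 / cmod (z - w)))"
          unfolding ennreal_mult[OF powr_ge_zero norm_ge_zero, symmetric] by (intro ennreal_leI mult_left_mono J) simp
        then show "ennreal (jbr z powr - \<epsilon>) * (ennreal (cmod (J (z - w))) * ennreal (cmod (phase k w * q w * u w)))
          \<le> ennreal (jbr z powr - \<epsilon> * (1 / cmod (z - w))) * ennreal (cmod (phase k w * q w * u w))"
          unfolding mult.assoc[symmetric] by (rule mult_right_mono) simp
      qed
      finally show ?thesis .
    qed
    then have "sq_norm (weighted \<epsilon>) (kernel_op J k u) \<le> (\<integral>\<^sup>+z. (\<integral>\<^sup>+w. ennreal (jbr z powr - \<epsilon> * (1 / cmod (z - w))) * ennreal (cmod (phase k w * q w * u w)) \<partial>lborel)\<^sup>2 \<partial>lborel)"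
      by (subst sq_norm_weighted) (auto intro!: nn_integral_mono power_mono)
    also have "\<dots> \<le> C * sq_norm (weighted 2) u" by (rule main[OF u])
    finally show "sq_norm (weighted \<epsilon>) (kernel_op J k u) \<le> ennreal c * sq_norm (weighted 2) u" using c by simp
  next
    fix u :: "complex \<Rightarrow> complex" assume u: "u \<in> borel_measurable borel"
    show "(\<integral>\<^sup>+z. (\<integral>\<^sup>+w. ennreal (jbr z powr - \<epsilon> * (1 / cmod (z - w))) * ennreal (cmod (q w * u w)) \<partial>lborel)\<^sup>2 \<partial>lborel)
     \<le> ennreal c * sq_norm (weighted 2) u" using main[OF u, of 0] c by (simp add: norm_mult)
  qed
qed

text \<open>The truncated kernel gains the small factor \<delta> and needs no weight on the
  output.\<close>

lemma kernel_op_near_bound: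
  assumes u[measurable]: "u \<in> borel_measurable borel" and "0 < \<delta>"
  shows "sq_norm (weighted 0) (kernel_op (nearc \<delta>) k u) \<le> ennreal ((4 * pi * \<delta> * M)\<^sup>2) * sq_norm (weighted 2) u"
proof -
  have "sq_norm (weighted 0) (kernel_op (nearc \<delta>) k u)
     \<le> (\<integral>\<^sup>+z. (\<integral>\<^sup>+w. ennreal (near_kernel \<delta> (z - w)) * (ennreal (Q w) * ennreal (jbr w powr - 2 * cmod (u w))) \<partial>lborel)\<^sup>2 \<partial>lborel)"
    unfolding cmod_density[symmetric, where k=k] kernel_op_def
    by (subst sq_norm_weighted) (auto intro!: nn_integral_mono power_mono order_trans[OF norm_conv_le] simp: cmod_cker jbr_pos[THEN less_imp_neq, symmetric])
  also have "\<dots> \<le> (ennreal (4 * pi * \<delta> * M))\<^sup>2 * sq_norm (weighted 2) u"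
    unfolding sq_norm_weighted[OF u] by (rule near_bound[OF _ assms(2)]) measurable
  finally show ?thesis using assms(2) M_nonneg by (simp add: ennreal_power)
qed

text \<open>Cauchy-Schwarz pairs Q in L2 with <w>^(-2) u in L2. Integrability of the density is what
  Fubini needs, both for composing the far parts and for the weak derivative.\<close>

lemma kernel_op_density_integrable:
  assumes u: "u \<in> sq_int (weighted 2)"
  shows "integrable lborel (\<lambda>w. phase k w * q w * u w)"
proof -
  have [measurable]: "u \<in> borel_measurable borel" using u by (simp add: sq_int_def)
  have "(\<integral>\<^sup>+w. ennreal (Q w) * ennreal (jbr w powr - 2 * cmod (u w)) \<partial>lborel)\<^sup>2
    \<le> (\<integral>\<^sup>+w. (ennreal (Q w))\<^sup>2 \<partial>lborel) * sq_norm (weighted 2) u"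
    by (subst sq_norm_weighted) (auto intro!: Cauchy_Schwarz_nn_integral)
  also have "\<dots> < \<infinity>" using q_L2 u by (auto simp: sq_int_def ennreal_mult_less_top)
  finally have "(\<integral>\<^sup>+w. ennreal (Q w) * ennreal (jbr w powr - 2 * cmod (u w)) \<partial>lborel) < \<infinity>"
    by (rule ennreal_power2_less_topD)
  then show ?thesis unfolding cmod_density[symmetric, where k=k]
    by (intro integrableI_bounded) auto
qed

text \<open>A function with finite square integral is finite almost everywhere. At such z the
  integral defining the operator converges absolutely, which makes it additive there in the kernel
  and in u.\<close>

lemma kernel_op_integrable_AE:
  assumes u: "u \<in> sq_int (weighted 2)"
    and J[measurable]: "J \<in> borel_measurable borel" "\<And>z. cmod (J z) \<le> 1 / cmod z"
  shows "AE z in lborel. integrable lborel (\<lambda>w. J (z - w) * (phase k w * q w * u w))"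
proof -
  have um[measurable]: "u \<in> borel_measurable borel" using u by (simp add: sq_int_def)
  obtain C where C: "0 \<le> C" "(\<integral>\<^sup>+z. (\<integral>\<^sup>+w. ennreal (jbr z powr - \<epsilon> * (1 / cmod (z - w))) * ennreal (cmod (q w * u w)) \<partial>lborel)\<^sup>2 \<partial>lborel)
     \<le> ennreal C * sq_norm (weighted 2) u" by (rule kernel_op_norm_bound) (use um in auto)
  have "(\<integral>\<^sup>+z. (\<integral>\<^sup>+w. ennreal (jbr z powr - \<epsilon> * (1 / cmod (z - w))) * ennreal (cmod (q w * u w)) \<partial>lborel)\<^sup>2 \<partial>lborel) \<noteq> \<infinity>"
  proof -
    have "ennreal C * sq_norm (weighted 2) u < \<infinity>" using u by (auto simp: sq_int_def ennreal_mult_less_top)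
    from le_less_trans[OF C(2) this] show ?thesis by simp
  qed
  from nn_integral_PInf_AE[OF _ this]
  have "AE z in lborel. (\<integral>\<^sup>+w. ennreal (jbr z powr - \<epsilon> * (1 / cmod (z - w))) * ennreal (cmod (q w * u w)) \<partial>lborel)\<^sup>2 \<noteq> \<infinity>"
    by auto
  then show ?thesis
  proof eventually_elim
    case (elim z)
    let ?I = "\<integral>\<^sup>+w. ennreal (1 / cmod (z - w)) * ennreal (cmod (q w * u w)) \<partial>lborel"
    have "(\<integral>\<^sup>+w. ennreal (jbr z powr - \<epsilon> * (1 / cmod (z - w))) * ennreal (cmod (q w * u w)) \<partial>lborel)
      = (\<integral>\<^sup>+w. ennreal (jbr z powr - \<epsilon>) * (ennreal (1 / cmod (z - w)) * ennreal (cmod (q w * u w))) \<partial>lborel)"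
      by (intro nn_integral_cong) (simp add: ennreal_mult[symmetric] mult.assoc)
    also have "\<dots> = ennreal (jbr z powr - \<epsilon>) * ?I" by (rule nn_integral_cmult) measurable
    finally have "(ennreal (jbr z powr - \<epsilon>) * ?I)\<^sup>2 \<noteq> \<infinity>" using elim by simp
    then have fin: "?I < \<infinity>"
      by (auto simp: power2_eq_square less_top ennreal_mult_eq_top_iff jbr_pos[THEN less_imp_neq, symmetric])
    have "(\<integral>\<^sup>+w. ennreal (norm (J (z - w) * (phase k w * q w * u w))) \<partial>lborel) \<le> ?I"
    proof (rule nn_integral_mono)
      fix w
      have "ennreal (norm (J (z - w) * (phase k w * q w * u w))) = ennreal (cmod (J (z - w))) * ennreal (cmod (q w * u w))"
        by (simp add: norm_mult ennreal_mult)
      also have "\<dots> \<le> ennreal (1 / cmod (z - w)) * ennreal (cmod (q w * u w))"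
        by (intro mult_right_mono ennreal_leI J(2)) simp
      finally show "ennreal (norm (J (z - w) * (phase k w * q w * u w))) \<le> \<dots>" .
    qed
    then show ?case using fin by (intro integrableI_bounded) auto
  qed
qed

lemma kernel_op_add_kernel:
  assumes u: "u \<in> sq_int (weighted 2)" and J[measurable]: "J \<in> borel_measurable borel" "\<And>z. cmod (J z) \<le> 1 / cmod z"
    and J'[measurable]: "J' \<in> borel_measurable borel" "\<And>z. cmod (J' z) \<le> 1 / cmod z"
  shows "AE z in lborel. kernel_op (\<lambda>z. J z + J' z) k u z = kernel_op J k u z + kernel_op J' k u z"
  using kernel_op_integrable_AE[OF u J, of k] kernel_op_integrable_AE[OF u J', of k]
  by eventually_elim (simp add: kernel_op_def conv_def distrib_right)

lemma kernel_op_add: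
  assumes u: "u \<in> sq_int (weighted 2)" and v: "v \<in> sq_int (weighted 2)"
    and J[measurable]: "J \<in> borel_measurable borel" "\<And>z. cmod (J z) \<le> 1 / cmod z"
  shows "AE z in lborel. kernel_op J k (\<lambda>z. u z + v z) z = kernel_op J k u z + kernel_op J k v z"
  using kernel_op_integrable_AE[OF u J, of k] kernel_op_integrable_AE[OF v J, of k]
  by eventually_elim (simp add: kernel_op_def conv_def distrib_left)

lemma kernel_op_diff:
  assumes u: "u \<in> sq_int (weighted 2)" and v: "v \<in> sq_int (weighted 2)"
    and J[measurable]: "J \<in> borel_measurable borel" "\<And>z. cmod (J z) \<le> 1 / cmod z"
  shows "AE z in lborel. kernel_op J k (\<lambda>z. u z - v z) z = kernel_op J k u z - kernel_op J k v z"
  using kernel_op_integrable_AE[OF u J, of k] kernel_op_integrable_AE[OF v J, of k]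
  by eventually_elim (simp add: kernel_op_def conv_def right_diff_distrib)

text \<open>Equality at every point: u enters only under an integral sign, so the value depends only
  on its class.\<close>

lemma kernel_op_cong_AE:
  assumes [measurable]: "J \<in> borel_measurable borel" "u \<in> borel_measurable borel" "v \<in> borel_measurable borel"
    and "AE z in lborel. u z = v z"
  shows "kernel_op J k u = kernel_op J k v"
  unfolding kernel_op_def using assms(4) by (intro conv_cong_AE) (auto elim: eventually_mono)

text \<open>The part of the composed kernel that involves the intermediate point w. The factor at
  w', the conjugate of phase times q, is split off and has modulus |q(w')|. For fixed z and w' this
  is an oscillatory integral in w.\<close>

definition far_far_kernel :: "real \<Rightarrow> complex \<Rightarrow> complex \<Rightarrow> complex \<Rightarrow> complex" where
  "far_far_kernel \<delta> k z w' = (\<integral>w. phase k w * (farc \<delta> (z - w) * q w * cnj (farc \<delta> (w - w'))) \<partial>lborel)"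

text \<open>The square of a Hilbert-Schmidt norm for maps from <z>^2 L2 to <z>^\<epsilon> L2: the
  output weight stands on z, and Q contains the input weight <w'>^2.\<close>

definition far_far_hs :: "real \<Rightarrow> complex \<Rightarrow> ennreal" where
  "far_far_hs \<delta> k = (\<integral>\<^sup>+z. (\<integral>\<^sup>+w'. (ennreal (jbr z powr - \<epsilon> * cmod (far_far_kernel \<delta> k z w')) * ennreal (Q w'))\<^sup>2 \<partial>lborel) \<partial>lborel)"

text \<open><z>^(-4) is integrable over the plane. The constant lies in <z>^2 L2 but not in
  <z>^\<epsilon> L2 for \<epsilon> \<le> 1, so the operators have to act on the larger space for
  B(1) to be covered.\<close>

lemma one_sq_int: "(\<lambda>_. 1) \<in> sq_int (weighted 2)"
proof -
  have "sq_norm (weighted 2) (\<lambda>_. 1) = (\<integral>\<^sup>+z. ennreal (jbr z powr - 4) \<partial>lborel)"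
    by (simp add: sq_norm_weighted power2_eq_square ennreal_mult[symmetric] powr_add[symmetric])
  then show ?thesis using nn_integral_jbr_powr_finite[of 4] by (simp add: sq_int_def)
qed

lemma q_integrable: "integrable lborel q"
proof -
  have "integrable lborel (\<lambda>w. phase 0 w * q w * 1)" by (rule kernel_op_density_integrable[OF one_sq_int])
  then show ?thesis by (simp add: phase_def)
qed

lemma far_far_kernel_measurable [measurable]:
  assumes [measurable]: "f \<in> borel_measurable N" "g \<in> borel_measurable N"
  shows "(\<lambda>x. far_far_kernel \<delta> k (f x) (g x)) \<in> borel_measurable N"
proof -
  have "(\<lambda>x. far_far_kernel \<delta> k (fst x) (snd x)) \<in> borel_measurable (borel \<Otimes>\<^sub>M borel)"
    unfolding far_far_kernel_def by measurable
  from measurable_compose[OF measurable_Pair[OF assms] this] show ?thesis by simp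
qed

text \<open>Exchanging the two integrations turns the composition into a single integral operator,
  to which the Hilbert-Schmidt bound applies.\<close>

lemma farfar_bound:
  assumes x: "x \<in> sq_int (weighted 2)" and \<delta>: "0 < \<delta>"
  shows "sq_norm (weighted \<epsilon>) (kernel_op (farc \<delta>) k (\<lambda>w. cnj (kernel_op (farc \<delta>) k x w))) \<le> far_far_hs \<delta> k * sq_norm (weighted 2) x"
proof -
  have xm[measurable]: "x \<in> borel_measurable borel" using x by (simp add: sq_int_def)
  define g where "g w = phase k w * q w * x w" for w
  have g: "integrable lborel g" unfolding g_def by (rule kernel_op_density_integrable[OF x])
  have [measurable]: "g \<in> borel_measurable borel" unfolding g_def by measurable
  have eq: "kernel_op (farc \<delta>) k (\<lambda>w. cnj (kernel_op (farc \<delta>) k x w)) z = (\<integral>w'. far_far_kernel \<delta> k z w' * cnj (g w') \<partial>lborel)" for z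
  proof -
    define a where "a w = farc \<delta> (z - w) * (phase k w * q w)" for w
    have [measurable]: "a \<in> borel_measurable borel" unfolding a_def by measurable
    have "kernel_op (farc \<delta>) k (\<lambda>w. cnj (kernel_op (farc \<delta>) k x w)) z = (\<integral>w. a w * cnj (\<integral>w'. farc \<delta> (w - w') * g w' \<partial>lborel) \<partial>lborel)"
      by (simp add: kernel_op_def conv_def a_def g_def mult_ac)
    also have "\<dots> = (\<integral>w. (\<integral>w'. a w * cnj (farc \<delta> (w - w') * g w') \<partial>lborel) \<partial>lborel)"
      unfolding Bochner_Integration.integral_cnj[symmetric] integral_mult_right_zero[symmetric] ..
    \<comment> \<open>Fubini is available because both far kernels are bounded by 1/\<delta> and
      both q and \<open>g\<close> are integrable.\<close>
    also have "\<dots> = (\<integral>w'. (\<integral>w. a w * cnj (farc \<delta> (w - w') * g w') \<partial>lborel) \<partial>lborel)"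
    proof (rule lborel_pair.Fubini_integral[symmetric])
      have "integrable (lborel \<Otimes>\<^sub>M lborel) (\<lambda>(w, w'). complex_of_real ((1/\<delta>) * (1/\<delta>)) * (q w * g w'))"
      proof -
        have "integrable (lborel \<Otimes>\<^sub>M lborel) (\<lambda>x. q (fst x) * g (snd x))"
        proof (rule lborel_pair.Fubini_integrable)
          show "integrable lborel (\<lambda>x. \<integral>y. norm (q (fst (x, y)) * g (snd (x, y))) \<partial>lborel)"
            using q_integrable by (simp add: norm_mult)
          show "AE x in lborel. integrable lborel (\<lambda>y. q (fst (x, y)) * g (snd (x, y)))" using g by simp
        qed measurable
        then show ?thesis unfolding case_prod_beta by (rule integrable_mult_right)
      qed
      then show "integrable (lborel \<Otimes>\<^sub>M lborel) (\<lambda>(w, w'). a w * cnj (farc \<delta> (w - w') * g w'))"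
      proof (rule Bochner_Integration.integrable_bound)
        show "AE p in lborel \<Otimes>\<^sub>M lborel. norm (case p of (w, w') \<Rightarrow> a w * cnj (farc \<delta> (w - w') * g w'))
          \<le> norm (case p of (w, w') \<Rightarrow> complex_of_real ((1/\<delta>) * (1/\<delta>)) * (q w * g w'))"
        proof (intro AE_I2)
          fix p :: "complex \<times> complex"
          obtain w w' where p: "p = (w, w')" by (cases p)
          have "far_kernel \<delta> (z - w) * far_kernel \<delta> (w - w') \<le> (1/\<delta>) * (1/\<delta>)"
            using \<delta> by (intro mult_mono far_kernel_le) auto
          then have "(far_kernel \<delta> (z - w) * far_kernel \<delta> (w - w')) * (cmod (q w) * cmod (g w')) \<le> ((1/\<delta>) * (1/\<delta>)) * (cmod (q w) * cmod (g w'))"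
            by (rule mult_right_mono) auto
          then show "norm (case p of (w, w') \<Rightarrow> a w * cnj (farc \<delta> (w - w') * g w'))
             \<le> norm (case p of (w, w') \<Rightarrow> complex_of_real ((1/\<delta>) * (1/\<delta>)) * (q w * g w'))"
            using \<delta> by (simp add: p a_def norm_mult norm_divide cmod_cker mult_ac)
        qed
      qed measurable
    qed
    also have "\<dots> = (\<integral>w'. far_far_kernel \<delta> k z w' * cnj (g w') \<partial>lborel)"
      by (simp add: far_far_kernel_def a_def mult_ac integral_mult_right_zero[symmetric] del: integral_mult_right_zero integral_mult_left_zero)
    finally show ?thesis .
  qed
  have "sq_norm (weighted \<epsilon>) (kernel_op (farc \<delta>) k (\<lambda>w. cnj (kernel_op (farc \<delta>) k x w)))
    \<le> (\<integral>\<^sup>+z. (\<integral>\<^sup>+w'. (ennreal (jbr z powr - \<epsilon> * cmod (far_far_kernel \<delta> k z w')) * ennreal (Q w')) * ennreal (jbr w' powr - 2 * cmod (x w')) \<partial>lborel)\<^sup>2 \<partial>lborel)"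
  proof (subst sq_norm_weighted, measurable, intro nn_integral_mono power_mono)
    fix z
    have "ennreal (cmod (\<integral>w'. far_far_kernel \<delta> k z w' * cnj (g w') \<partial>lborel)) \<le> (\<integral>\<^sup>+w'. ennreal (cmod (far_far_kernel \<delta> k z w' * cnj (g w'))) \<partial>lborel)"
      by (rule ennreal_norm_integral_le)
    then have "ennreal (jbr z powr - \<epsilon> * cmod (\<integral>w'. far_far_kernel \<delta> k z w' * cnj (g w') \<partial>lborel))
       \<le> ennreal (jbr z powr - \<epsilon>) * (\<integral>\<^sup>+w'. ennreal (cmod (far_far_kernel \<delta> k z w' * cnj (g w'))) \<partial>lborel)"
      by (simp add: ennreal_mult mult_left_mono)
    also have "\<dots> = (\<integral>\<^sup>+w'. ennreal (jbr z powr - \<epsilon>) * ennreal (cmod (far_far_kernel \<delta> k z w' * cnj (g w'))) \<partial>lborel)"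
      by (rule nn_integral_cmult[symmetric]) measurable
    also have "\<dots> = (\<integral>\<^sup>+w'. (ennreal (jbr z powr - \<epsilon> * cmod (far_far_kernel \<delta> k z w')) * ennreal (Q w')) * ennreal (jbr w' powr - 2 * cmod (x w')) \<partial>lborel)"
      using cmod_density[of k _ x] by (simp add: g_def norm_mult ennreal_mult mult.assoc)
    finally show "ennreal (jbr z powr - \<epsilon> * cmod (kernel_op (farc \<delta>) k (\<lambda>w. cnj (kernel_op (farc \<delta>) k x w)) z)) \<le> \<dots>"
      unfolding eq .
  qed auto
  also have "\<dots> \<le> far_far_hs \<delta> k * sq_norm (weighted 2) x"
    unfolding far_far_hs_def sq_norm_weighted[OF xm] by (rule hilbert_schmidt_L2) measurable
  finally show ?thesis .
qed

text \<open>Pointwise convergence in (z, w') is the Riemann-Lebesgue lemma; the task is a square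
  integrable majorant in both variables, which is \<open>m\<close> in z times Q in w'.\<close>

lemma far_far_hs_tendsto_0:
  assumes \<delta>: "0 < \<delta>" and k: "filterlim (\<lambda>n. cmod (k n)) at_top sequentially"
  shows "(\<lambda>n. far_far_hs \<delta> (k n)) \<longlonglongrightarrow> 0"
proof -
  \<comment> \<open>Estimating the second far kernel by 1/\<delta> leaves the weighted absolute
    Cauchy transform of q, which is the norm bound at u = 1. It depends neither on k nor on
    w'.\<close>
  define m where "m z = ennreal (1/\<delta>) * (\<integral>\<^sup>+w. ennreal (jbr z powr - \<epsilon> * (1 / cmod (z - w))) * ennreal (cmod (q w * 1)) \<partial>lborel)" for z
  have m_meas[measurable]: "m \<in> borel_measurable borel" unfolding m_def by measurable
  obtain C where C0: "0 \<le> C" "\<And>u. u \<in> borel_measurable borel \<Longrightarrow>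
     (\<integral>\<^sup>+z. (\<integral>\<^sup>+w. ennreal (jbr z powr - \<epsilon> * (1 / cmod (z - w))) * ennreal (cmod (q w * u w)) \<partial>lborel)\<^sup>2 \<partial>lborel)
     \<le> ennreal C * sq_norm (weighted 2) u"
  proof (rule kernel_op_norm_bound)
    fix C assume "0 \<le> C" "\<And>u. u \<in> borel_measurable borel \<Longrightarrow>
     (\<integral>\<^sup>+z. (\<integral>\<^sup>+w. ennreal (jbr z powr - \<epsilon> * (1 / cmod (z - w))) * ennreal (cmod (q w * u w)) \<partial>lborel)\<^sup>2 \<partial>lborel)
     \<le> ennreal C * sq_norm (weighted 2) u"
    then show thesis by (rule that)
  qed
  note C = C0(2)[OF borel_measurable_const[of 1]]
  have m_fin: "(\<integral>\<^sup>+z. (m z)\<^sup>2 \<partial>lborel) < \<infinity>"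
  proof -
    have "(\<integral>\<^sup>+z. (m z)\<^sup>2 \<partial>lborel) = (ennreal (1/\<delta>))\<^sup>2 * (\<integral>\<^sup>+z. (\<integral>\<^sup>+w. ennreal (jbr z powr - \<epsilon> * (1 / cmod (z - w))) * ennreal (cmod (q w * 1)) \<partial>lborel)\<^sup>2 \<partial>lborel)"
      unfolding m_def power_mult_distrib by (rule nn_integral_cmult) measurable
    also have "\<dots> \<le> (ennreal (1/\<delta>))\<^sup>2 * (ennreal C * sq_norm (weighted 2) (\<lambda>_. 1))" by (intro mult_left_mono C) auto
    also have "\<dots> < \<infinity>" using one_sq_int \<delta> by (auto simp: sq_int_def ennreal_mult_less_top ennreal_power)
    finally show ?thesis .
  qed
  have far_far_kernel_le: "ennreal (jbr z powr - \<epsilon> * cmod (far_far_kernel \<delta> k z w')) \<le> m z" for z w' k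
  proof -
    have "ennreal (cmod (far_far_kernel \<delta> k z w')) \<le> (\<integral>\<^sup>+w. ennreal (cmod (phase k w * (farc \<delta> (z - w) * q w * cnj (farc \<delta> (w - w'))))) \<partial>lborel)"
      unfolding far_far_kernel_def by (rule ennreal_norm_integral_le)
    then have "ennreal (jbr z powr - \<epsilon> * cmod (far_far_kernel \<delta> k z w')) \<le> ennreal (jbr z powr - \<epsilon>) * (\<integral>\<^sup>+w. ennreal (cmod (phase k w * (farc \<delta> (z - w) * q w * cnj (farc \<delta> (w - w'))))) \<partial>lborel)"
      by (simp add: ennreal_mult mult_left_mono)
    also have "\<dots> = (\<integral>\<^sup>+w. ennreal (jbr z powr - \<epsilon>) * ennreal (cmod (phase k w * (farc \<delta> (z - w) * q w * cnj (farc \<delta> (w - w'))))) \<partial>lborel)"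
      by (rule nn_integral_cmult[symmetric]) measurable
    also have "\<dots> \<le> (\<integral>\<^sup>+w. ennreal (1/\<delta>) * (ennreal (jbr z powr - \<epsilon> * (1 / cmod (z - w))) * ennreal (cmod (q w * 1))) \<partial>lborel)"
    proof (rule nn_integral_mono)
      fix w
      have "far_kernel \<delta> (z - w) \<le> 1 / cmod (z - w)" by (simp add: far_kernel_def)
      then have "far_kernel \<delta> (w - w') * (jbr z powr - \<epsilon> * far_kernel \<delta> (z - w) * cmod (q w)) \<le> (1/\<delta>) * (jbr z powr - \<epsilon> * (1 / cmod (z - w)) * cmod (q w))"
        using \<delta> by (intro mult_mono far_kernel_le) auto
      then show "ennreal (jbr z powr - \<epsilon>) * ennreal (cmod (phase k w * (farc \<delta> (z - w) * q w * cnj (farc \<delta> (w - w')))))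
        \<le> ennreal (1/\<delta>) * (ennreal (jbr z powr - \<epsilon> * (1 / cmod (z - w))) * ennreal (cmod (q w * 1)))"
        using \<delta> by (simp add: norm_mult cmod_cker ennreal_mult[symmetric] mult_ac ennreal_leI)
    qed
    also have "\<dots> = m z" unfolding m_def by (rule nn_integral_cmult) measurable
    finally show ?thesis .
  qed
  have far_far_hs_eq: "far_far_hs \<delta> k = (\<integral>\<^sup>+p. (ennreal (jbr (fst p) powr - \<epsilon> * cmod (far_far_kernel \<delta> k (fst p) (snd p))) * ennreal (Q (snd p)))\<^sup>2 \<partial>(lborel \<Otimes>\<^sub>M lborel))" for k
    unfolding far_far_hs_def by (subst lborel.nn_integral_fst[symmetric]) auto
  have "(\<lambda>n. far_far_hs \<delta> (k n)) \<longlonglongrightarrow> (\<integral>\<^sup>+p. 0 \<partial>((lborel :: complex measure) \<Otimes>\<^sub>M (lborel :: complex measure)))"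
    unfolding far_far_hs_eq
  proof (rule nn_integral_dominated_convergence[where w="\<lambda>p. (m (fst p) * ennreal (Q (snd p)))\<^sup>2"])
    show "AE p in lborel \<Otimes>\<^sub>M lborel. (ennreal (jbr (fst p) powr - \<epsilon> * cmod (far_far_kernel \<delta> (k j) (fst p) (snd p))) * ennreal (Q (snd p)))\<^sup>2
       \<le> (m (fst p) * ennreal (Q (snd p)))\<^sup>2" for j
      by (intro AE_I2 power_mono mult_right_mono far_far_kernel_le) auto
    have "(\<integral>\<^sup>+p. (m (fst p) * ennreal (Q (snd p)))\<^sup>2 \<partial>(lborel \<Otimes>\<^sub>M lborel))
       = (\<integral>\<^sup>+z. (\<integral>\<^sup>+w. (m z)\<^sup>2 * (ennreal (Q w))\<^sup>2 \<partial>lborel) \<partial>lborel)"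
      by (subst lborel.nn_integral_fst[symmetric]) (auto simp: power_mult_distrib)
    also have "\<dots> = (\<integral>\<^sup>+z. (m z)\<^sup>2 \<partial>lborel) * (\<integral>\<^sup>+w. (ennreal (Q w))\<^sup>2 \<partial>lborel)"
      by (simp add: nn_integral_cmult nn_integral_multc)
    also have "\<dots> < \<infinity>" using m_fin q_L2 by (auto simp: ennreal_mult_less_top)
    finally show "(\<integral>\<^sup>+p. (m (fst p) * ennreal (Q (snd p)))\<^sup>2 \<partial>(lborel \<Otimes>\<^sub>M lborel)) < \<infinity>" .
    show "AE p in lborel \<Otimes>\<^sub>M lborel. (\<lambda>n. (ennreal (jbr (fst p) powr - \<epsilon> * cmod (far_far_kernel \<delta> (k n) (fst p) (snd p))) * ennreal (Q (snd p)))\<^sup>2) \<longlonglongrightarrow> 0"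
    proof (intro AE_I2)
      fix p :: "complex \<times> complex"
      obtain z w' where p: "p = (z, w')" by (cases p)
      have "integrable lborel (\<lambda>w. farc \<delta> (z - w) * q w * cnj (farc \<delta> (w - w')))"
      proof (rule Bochner_Integration.integrable_bound)
        show "integrable lborel (\<lambda>w. of_real ((1/\<delta>) * (1/\<delta>)) * q w)" using q_integrable by simp
        show "AE w in lborel. norm (farc \<delta> (z - w) * q w * cnj (farc \<delta> (w - w'))) \<le> norm (of_real ((1/\<delta>) * (1/\<delta>)) * q w)"
        proof (intro AE_I2)
          fix w
          have "far_kernel \<delta> (z - w) * far_kernel \<delta> (w - w') \<le> (1/\<delta>) * (1/\<delta>)"
            using \<delta> by (intro mult_mono far_kernel_le) auto
          then have "(far_kernel \<delta> (z - w) * far_kernel \<delta> (w - w')) * cmod (q w) \<le> ((1/\<delta>) * (1/\<delta>)) * cmod (q w)"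
            by (rule mult_right_mono) auto
          then show "norm (farc \<delta> (z - w) * q w * cnj (farc \<delta> (w - w'))) \<le> norm (of_real ((1/\<delta>) * (1/\<delta>)) * q w)"
            using \<delta> by (simp add: norm_mult norm_divide cmod_cker mult_ac)
        qed
      qed measurable
      from riemann_lebesgue[OF this k]
      have "(\<lambda>n. far_far_kernel \<delta> (k n) z w') \<longlonglongrightarrow> 0" unfolding far_far_kernel_def .
      then have "(\<lambda>n. (jbr z powr - \<epsilon> * cmod (far_far_kernel \<delta> (k n) z w') * Q w')\<^sup>2) \<longlonglongrightarrow> (jbr z powr - \<epsilon> * cmod 0 * Q w')\<^sup>2"
        by (intro tendsto_intros)
      then have "(\<lambda>n. ennreal ((jbr z powr - \<epsilon> * cmod (far_far_kernel \<delta> (k n) z w') * Q w')\<^sup>2)) \<longlonglongrightarrow> ennreal 0"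
        by (intro tendsto_ennrealI) simp
      then show "(\<lambda>n. (ennreal (jbr (fst p) powr - \<epsilon> * cmod (far_far_kernel \<delta> (k n) (fst p) (snd p))) * ennreal (Q (snd p)))\<^sup>2) \<longlonglongrightarrow> 0"
        by (simp add: p ennreal_mult[symmetric] ennreal_power)
    qed
  qed measurable
  then show ?thesis by simp
qed

text \<open>Dominated convergence speaks of sequences. A threshold for |k| follows by contradiction,
  from a sequence with |k n| > n along which the bound fails.\<close>

lemma far_far_hs_small:
  assumes \<delta>: "0 < \<delta>" and \<eta>: "0 < \<eta>"
  obtains K where "\<And>k. K < cmod k \<Longrightarrow> far_far_hs \<delta> k \<le> ennreal \<eta>"
proof (rule ccontr)
  assume "\<not> thesis"
  with that have "\<forall>n::nat. \<exists>k. real n < cmod k \<and> \<not> far_far_hs \<delta> k \<le> ennreal \<eta>" by blast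
  from choice[OF this] obtain k where k: "\<And>n::nat. real n < cmod (k n)" "\<And>n. \<not> far_far_hs \<delta> (k n) \<le> ennreal \<eta>" by blast
  have "filterlim (\<lambda>n. cmod (k n)) at_top sequentially"
    by (rule filterlim_at_top_mono[OF filterlim_real_sequentially]) (intro always_eventually allI less_imp_le k(1))
  from far_far_hs_tendsto_0[OF \<delta> this] have "\<forall>\<^sub>F n in sequentially. far_far_hs \<delta> (k n) < ennreal \<eta>"
    using \<eta> by (intro order_tendstoD) auto
  then obtain n where "far_far_hs \<delta> (k n) < ennreal \<eta>" by (auto simp: eventually_sequentially)
  then show False using k(2)[of n] by simp
qed

text \<open>Three terms arise: near after full, far after near, far after far, with a conjugation in
  between. The first two are small with \<delta>, uniformly in k, so \<delta> is fixed first and the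
  threshold for |k| is chosen afterwards for the third.\<close>

lemma kernel_op_conj_T_small:
  assumes \<eta>: "0 < \<eta>"
  obtains K where "\<And>k x. K < cmod k \<Longrightarrow> x \<in> sq_int (weighted 2) \<Longrightarrow>
    sq_norm (weighted \<epsilon>) (kernel_op cker k (\<lambda>w. cnj (kernel_op cker k x w))) \<le> ennreal \<eta> * sq_norm (weighted 2) x"
proof -
  obtain C where C: "0 \<le> C"
   "\<And>J k u. J \<in> borel_measurable borel \<Longrightarrow> u \<in> borel_measurable borel \<Longrightarrow> (\<And>z. cmod (J z) \<le> 1 / cmod z) \<Longrightarrow>
     sq_norm (weighted \<epsilon>) (kernel_op J k u) \<le> ennreal C * sq_norm (weighted 2) u"
  proof (rule kernel_op_norm_bound)
    fix C assume "0 \<le> C" "\<And>J k u. J \<in> borel_measurable borel \<Longrightarrow> u \<in> borel_measurable borel \<Longrightarrow> (\<And>z. cmod (J z) \<le> 1 / cmod z) \<Longrightarrow>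
     sq_norm (weighted \<epsilon>) (kernel_op J k u) \<le> ennreal C * sq_norm (weighted 2) u"
    then show thesis by (rule that)
  qed
  \<comment> \<open>Two applications of |a + b|^2 \<le> 2|a|^2 + 2|b|^2 lead to the total 2 d C + 4
    C d + 4 (\<eta>/8) with d = (4 pi \<delta> M)^2, and this \<delta> makes the terms with d at
    most \<eta>/2. The summand 1 guards against C M = 0.\<close>
  define \<delta> where "\<delta> = sqrt (\<eta> / (12 * (C * (4 * pi * M)\<^sup>2 + 1)))"
  have Cp: "0 < 12 * (C * (4 * pi * M)\<^sup>2 + 1)" using C by (intro mult_pos_pos add_nonneg_pos) auto
  have \<delta>: "0 < \<delta>" using \<eta> Cp by (simp add: \<delta>_def)
  define d where "d = (4 * pi * \<delta> * M)\<^sup>2"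
  have d0: "0 \<le> d" by (simp add: d_def)
  have Cd: "6 * (C * d) \<le> \<eta> / 2"
  proof -
    have "d = \<delta>\<^sup>2 * (4 * pi * M)\<^sup>2" by (simp add: d_def power_mult_distrib)
    also have "\<delta>\<^sup>2 = \<eta> / (12 * (C * (4 * pi * M)\<^sup>2 + 1))" using \<eta> Cp by (simp add: \<delta>_def)
    finally have d: "d = \<eta> / (12 * (C * (4 * pi * M)\<^sup>2 + 1)) * (4 * pi * M)\<^sup>2" .
    have frac: "6 * (C * (\<eta> / (12 * (C * X + 1)) * X)) = (\<eta> / 2) * (C * X / (C * X + 1))" if "C * X + 1 \<noteq> 0" for X
      using that by (simp add: divide_simps)
    have "6 * (C * d) = (\<eta> / 2) * (C * (4 * pi * M)\<^sup>2 / (C * (4 * pi * M)\<^sup>2 + 1))"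
      unfolding d using Cp by (intro frac) auto
    also have "\<dots> \<le> (\<eta> / 2) * 1" using \<eta> Cp by (intro mult_left_mono) auto
    finally show ?thesis by simp
  qed
  obtain K where K: "\<And>k. K < cmod k \<Longrightarrow> far_far_hs \<delta> k \<le> ennreal (\<eta> / 8)"
    using far_far_hs_small[OF \<delta>, of "\<eta> / 8"] \<eta> by auto
  have nb: "cmod (nearc \<delta> z) \<le> 1 / cmod z" "cmod (farc \<delta> z) \<le> 1 / cmod z" "cmod (cker z) \<le> 1 / cmod z" for z
    by (auto simp: cmod_cker near_kernel_def far_kernel_def)
  have sub: "sq_int (weighted a) \<subseteq> sq_int (weighted 2)" if "a \<le> 2" for a
    using sq_norm_weighted_antimono[OF that] by (auto simp: sq_int_def intro: le_less_trans)
  show thesis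
  proof (rule that)
    fix k x assume k: "K < cmod k" and x: "x \<in> sq_int (weighted 2)"
    have xm[measurable]: "x \<in> borel_measurable borel" using x by (simp add: sq_int_def)
    define y where "y = kernel_op cker k x"
    define yn where "yn = kernel_op (nearc \<delta>) k x"
    define yf where "yf = kernel_op (farc \<delta>) k x"
    have [measurable]: "y \<in> borel_measurable borel" "yn \<in> borel_measurable borel" "yf \<in> borel_measurable borel"
      unfolding y_def yn_def yf_def by measurable
    let ?N = "sq_norm (weighted 2) x"
    have Nfin: "?N < \<infinity>" using x by (simp add: sq_int_def)
    have ck: "cker = (\<lambda>z. nearc \<delta> z + farc \<delta> z)" using cker_split by auto
    have y_split: "AE z in lborel. y z = yn z + yf z"
      unfolding y_def yn_def yf_def ck by (rule kernel_op_add_kernel[OF x]) (auto simp: nb)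
    have y_norm: "sq_norm (weighted \<epsilon>) y \<le> ennreal C * ?N" "sq_norm (weighted \<epsilon>) yf \<le> ennreal C * ?N"
      unfolding y_def yf_def by (auto intro!: C nb)
    have yn_norm: "sq_norm (weighted 0) yn \<le> ennreal d * ?N"
      unfolding yn_def d_def by (rule kernel_op_near_bound[OF xm \<delta>])
    have le2: "sq_norm (weighted 2) u \<le> sq_norm (weighted \<epsilon>) u" "sq_norm (weighted 2) u \<le> sq_norm (weighted 0) u"
      "sq_norm (weighted \<epsilon>) u \<le> sq_norm (weighted 0) u" if "u \<in> borel_measurable borel" for u
      using eps by (auto intro!: sq_norm_weighted_antimono that)
    have int: "(\<lambda>w. cnj (y w)) \<in> sq_int (weighted 2)" "(\<lambda>w. cnj (yn w)) \<in> sq_int (weighted 2)" "(\<lambda>w. cnj (yf w)) \<in> sq_int (weighted 2)"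
    proof -
      have fin: "ennreal s * ?N < \<infinity>" for s using Nfin by (auto simp: ennreal_mult_less_top)
      have "sq_norm (weighted 2) y < \<infinity>" "sq_norm (weighted 2) yf < \<infinity>" "sq_norm (weighted 2) yn < \<infinity>"
        using le_less_trans[OF order_trans[OF le2(1) y_norm(1)] fin] le_less_trans[OF order_trans[OF le2(1) y_norm(2)] fin]
          le_less_trans[OF order_trans[OF le2(2) yn_norm] fin] by simp_all
      then show "(\<lambda>w. cnj (y w)) \<in> sq_int (weighted 2)" "(\<lambda>w. cnj (yn w)) \<in> sq_int (weighted 2)" "(\<lambda>w. cnj (yf w)) \<in> sq_int (weighted 2)"
        by (simp_all add: sq_int_def)
    qed
    let ?a = "kernel_op (nearc \<delta>) k (\<lambda>w. cnj (y w))"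
    let ?b = "kernel_op (farc \<delta>) k (\<lambda>w. cnj (yn w))"
    let ?c = "kernel_op (farc \<delta>) k (\<lambda>w. cnj (yf w))"
    have 1: "AE z in lborel. kernel_op cker k (\<lambda>w. cnj (y w)) z = ?a z + kernel_op (farc \<delta>) k (\<lambda>w. cnj (y w)) z"
      unfolding ck by (rule kernel_op_add_kernel[OF int(1)]) (auto simp: nb)
    have 2: "kernel_op (farc \<delta>) k (\<lambda>w. cnj (y w)) = kernel_op (farc \<delta>) k (\<lambda>w. cnj (yn w) + cnj (yf w))"
      using y_split by (intro kernel_op_cong_AE) auto
    have 3: "AE z in lborel. kernel_op (farc \<delta>) k (\<lambda>w. cnj (yn w) + cnj (yf w)) z = ?b z + ?c z"
      by (rule kernel_op_add[OF int(2,3)]) (auto simp: nb)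
    have "AE z in weighted \<epsilon>. kernel_op cker k (\<lambda>w. cnj (y w)) z = ?a z + (?b z + ?c z)"
      unfolding AE_weighted_iff using 1 3 by eventually_elim (simp add: 2)
    then have "sq_norm (weighted \<epsilon>) (kernel_op cker k (\<lambda>w. cnj (y w))) = sq_norm (weighted \<epsilon>) (\<lambda>z. ?a z + (?b z + ?c z))"
      by (rule sq_norm_cong_AE)
    also have "\<dots> \<le> 2 * sq_norm (weighted \<epsilon>) ?a + 2 * sq_norm (weighted \<epsilon>) (\<lambda>z. ?b z + ?c z)"
      by (rule sq_norm_add_le) simp_all
    also have "\<dots> \<le> 2 * sq_norm (weighted \<epsilon>) ?a + 2 * (2 * sq_norm (weighted \<epsilon>) ?b + 2 * sq_norm (weighted \<epsilon>) ?c)"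
      by (intro add_mono mult_left_mono sq_norm_add_le) simp_all
    also have "\<dots> \<le> 2 * (ennreal d * (ennreal C * ?N)) + 2 * (2 * (ennreal C * (ennreal d * ?N)) + 2 * (ennreal (\<eta> / 8) * ?N))"
    proof (intro add_mono mult_left_mono)
      have "sq_norm (weighted \<epsilon>) ?a \<le> sq_norm (weighted 0) ?a" by (rule le2) simp
      also have "\<dots> \<le> ennreal d * sq_norm (weighted 2) (\<lambda>w. cnj (y w))" unfolding d_def by (rule kernel_op_near_bound[OF _ \<delta>]) simp
      also have "\<dots> \<le> ennreal d * (ennreal C * ?N)"
        using order_trans[OF le2(1) y_norm(1)] by (intro mult_left_mono) auto
      finally show "sq_norm (weighted \<epsilon>) ?a \<le> ennreal d * (ennreal C * ?N)" .
      have "sq_norm (weighted \<epsilon>) ?b \<le> ennreal C * sq_norm (weighted 2) (\<lambda>w. cnj (yn w))"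
        by (rule C(2)) (auto simp: nb)
      also have "\<dots> \<le> ennreal C * (ennreal d * ?N)"
        using order_trans[OF le2(2) yn_norm] by (intro mult_left_mono) auto
      finally show "sq_norm (weighted \<epsilon>) ?b \<le> ennreal C * (ennreal d * ?N)" .
      have "sq_norm (weighted \<epsilon>) ?c \<le> far_far_hs \<delta> k * ?N" unfolding yf_def by (rule farfar_bound[OF x \<delta>])
      also have "\<dots> \<le> ennreal (\<eta> / 8) * ?N" by (intro mult_right_mono K[OF k]) auto
      finally show "sq_norm (weighted \<epsilon>) ?c \<le> ennreal (\<eta> / 8) * ?N" .
    qed auto
    also have "\<dots> = ennreal (6 * (C * d) + \<eta> / 2) * ?N"
    proof -
      obtain n where n: "?N = ennreal n" "0 \<le> n" using Nfin by (cases ?N) auto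
      have m: "2 * ennreal t = ennreal (2 * t)" if "0 \<le> t" for t using that by (simp add: ennreal_mult)
      show ?thesis using n C d0 \<eta>
        by (simp add: m ennreal_mult[symmetric] ennreal_plus[symmetric] algebra_simps del: ennreal_plus)
    qed
    also have "\<dots> \<le> ennreal \<eta> * ?N" using Cd by (intro mult_right_mono ennreal_leI) auto
    finally show "sq_norm (weighted \<epsilon>) (kernel_op cker k (\<lambda>w. cnj (kernel_op cker k x w))) \<le> ennreal \<eta> * ?N"
      unfolding y_def .
  qed
qed

end

section \<open>The Cauchy-Pompeiu formula\<close>

lemma integrable_ball_indicator:
  fixes b :: "'b::{banach, second_countable_topology}"
  shows "integrable lborel (\<lambda>x. indicator (ball (c::'a::euclidean_space) r) x *\<^sub>R b)"
  using emeasure_lborel_ball_finite[of c r] by (intro integrable_scaleR_left integrable_real_indicator) auto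

text \<open>A translate of \<phi> has the same integral, so every difference quotient integrates to
  0; the Lipschitz bound and the bounded support allow the limit under the integral.
  Differentiability is asked only almost everywhere, to cover functions with a kink along a
  circle.\<close>

lemma integral_directional_derivative_eq_0:
  fixes \<phi> :: "'a::euclidean_space \<Rightarrow> complex"
  assumes lip: "\<And>x y. cmod (\<phi> x - \<phi> y) \<le> L * norm (x - y)"
    and supp: "\<And>x. R \<le> norm x \<Longrightarrow> \<phi> x = 0"
    and D[measurable]: "D \<in> borel_measurable borel"
    and der: "AE x in lborel. \<exists>F. (\<phi> has_derivative F) (at x) \<and> F v = D x"
  shows "(\<integral>x. D x \<partial>lborel) = 0"
proof (cases "v = 0")
  case True
  have "AE x in lborel. D x = 0"
    using der by eventually_elim (metis True has_derivative_linear linear_0)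
  then show ?thesis by (simp add: integral_eq_zero_AE)
next
  case False
  have L0: "0 \<le> L * norm v" using lip[of v 0] by (simp add: order_trans[OF norm_ge_zero])
  have "continuous_on UNIV \<phi>"
  proof (rule continuous_onI)
    fix x e assume "0 < (e::real)"
    show "\<exists>d>0. \<forall>x'\<in>UNIV. dist x' x < d \<longrightarrow> dist (\<phi> x') (\<phi> x) \<le> e"
    proof (intro exI conjI ballI impI)
      show "0 < e / (\<bar>L\<bar> + 1)" using \<open>0 < e\<close> by simp
      fix x' assume "dist x' x < e / (\<bar>L\<bar> + 1)"
      then have "(\<bar>L\<bar> + 1) * dist x' x \<le> e" by (simp add: field_simps)
      moreover have "L * dist x' x \<le> (\<bar>L\<bar> + 1) * dist x' x" by (intro mult_right_mono) auto
      ultimately show "dist (\<phi> x') (\<phi> x) \<le> e" using lip[of x' x] by (simp add: dist_norm)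
    qed
  qed
  then have [measurable]: "\<phi> \<in> borel_measurable borel" by (rule borel_measurable_continuous_onI)
  have int_ball: "integrable lborel (\<lambda>x. indicator (ball 0 r) x *\<^sub>R c)" for r and c :: real
    by (rule integrable_ball_indicator)
  have \<phi>_int: "integrable lborel \<phi>"
  proof (rule Bochner_Integration.integrable_bound[OF int_ball[of R "\<bar>L\<bar> * 2 * R"]])
    show "AE x in lborel. norm (\<phi> x) \<le> norm (indicator (ball 0 R) x *\<^sub>R (\<bar>L\<bar> * 2 * R))"
    proof (intro AE_I2)
      fix x
      show "norm (\<phi> x) \<le> norm (indicator (ball 0 R) x *\<^sub>R (\<bar>L\<bar> * 2 * R))"
      proof (cases "norm x < R")
        case True
        then have R: "0 < R" using norm_ge_zero[of x] by linarith
        \<comment> \<open>A point on the sphere of radius R, where \<phi> vanishes; comparison with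
          it bounds \<phi> on the ball by 2 R |L|.\<close>
        define y where "y = (R / norm v) *\<^sub>R v"
        have ny: "norm y = R" using R False by (simp add: y_def)
        have "norm (x - y) \<le> 2 * R" using norm_triangle_ineq4[of x y] True ny by linarith
        then have "\<bar>L\<bar> * norm (x - y) \<le> \<bar>L\<bar> * (2 * R)" by (intro mult_left_mono) auto
        moreover have "L * norm (x - y) \<le> \<bar>L\<bar> * norm (x - y)" by (intro mult_right_mono) auto
        ultimately show ?thesis using lip[of x y] supp[of y] ny True R by (simp add: indicator_def abs_mult)
      qed (simp add: supp)
    qed
  qed measurable
  define t where "t n = 1 / (real n + 1)" for n :: nat
  have t: "0 < t n" "t n \<le> 1" for n by (auto simp: t_def)
  have t_lim: "t \<longlonglongrightarrow> 0" unfolding t_def using LIMSEQ_inverse_real_of_nat by (simp add: inverse_eq_divide add.commute)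
  define Dq where "Dq n x = (1 / t n) *\<^sub>R (\<phi> (x + t n *\<^sub>R v) - \<phi> x)" for n x
  have "(\<lambda>n. \<integral>x. Dq n x \<partial>lborel) \<longlonglongrightarrow> (\<integral>x. D x \<partial>lborel)"
  proof (rule integral_dominated_convergence[where w="\<lambda>x. indicator (ball 0 (\<bar>R\<bar> + norm v)) x *\<^sub>R (L * norm v)"])
    show "AE x in lborel. (\<lambda>n. Dq n x) \<longlonglongrightarrow> D x"
      using der
    proof eventually_elim
      case (elim x)
      then obtain F where F: "(\<phi> has_derivative F) (at x)" "F v = D x" by blast
      then have bl: "bounded_linear F" and lim: "((\<lambda>h. norm (\<phi> (x + h) - \<phi> x - F h) / norm h) \<longlongrightarrow> 0) (at 0)"
        by (auto simp: has_derivative_at)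
      have "(\<lambda>n. t n *\<^sub>R v) \<longlonglongrightarrow> 0 *\<^sub>R v" by (intro tendsto_intros t_lim)
      then have "filterlim (\<lambda>n. t n *\<^sub>R v) (at 0) sequentially"
        using t(1) False by (auto simp: filterlim_at less_imp_neq[OF t(1), symmetric])
      from filterlim_compose[OF lim this]
      have "(\<lambda>n. norm v * (norm (\<phi> (x + t n *\<^sub>R v) - \<phi> x - F (t n *\<^sub>R v)) / norm (t n *\<^sub>R v))) \<longlonglongrightarrow> norm v * 0"
        by (intro tendsto_intros)
      moreover have "norm v * (norm (\<phi> (x + t n *\<^sub>R v) - \<phi> x - F (t n *\<^sub>R v)) / norm (t n *\<^sub>R v)) = norm (Dq n x - D x)" for n
      proof -
        have "\<phi> (x + t n *\<^sub>R v) - \<phi> x - F (t n *\<^sub>R v) = t n *\<^sub>R (Dq n x - D x)"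
          using t(1)[of n] bl F(2) by (simp add: Dq_def scaleR_diff_right linear_simps)
        then have "norm (\<phi> (x + t n *\<^sub>R v) - \<phi> x - F (t n *\<^sub>R v)) = t n * norm (Dq n x - D x)"
          using t(1)[of n] by simp
        then show ?thesis using t(1)[of n] False by simp
      qed
      ultimately show ?case by (simp add: tendsto_norm_zero_iff LIM_zero_iff)
    qed
    show "AE x in lborel. norm (Dq n x) \<le> indicator (ball 0 (\<bar>R\<bar> + norm v)) x *\<^sub>R (L * norm v)" for n
    proof (intro AE_I2)
      fix x
      show "norm (Dq n x) \<le> indicator (ball 0 (\<bar>R\<bar> + norm v)) x *\<^sub>R (L * norm v)"
      proof (cases "norm x < \<bar>R\<bar> + norm v")
        case True
        have "norm (\<phi> (x + t n *\<^sub>R v) - \<phi> x) \<le> t n * (L * norm v)" using lip[of "x + t n *\<^sub>R v" x] t(1)[of n] by (simp add: mult_ac)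
        then show ?thesis unfolding Dq_def norm_scaleR using True t(1)[of n] by (simp add: field_simps)
      next
        case f: False
        have "norm (t n *\<^sub>R v) \<le> norm v" using t[of n] by (simp add: mult_left_le_one_le)
        then have "R \<le> norm (x + t n *\<^sub>R v)" using f norm_diff_ineq[of x "t n *\<^sub>R v"] by linarith
        moreover have "R \<le> norm x" using f norm_ge_zero[of v] by linarith
        ultimately show ?thesis using f by (simp add: Dq_def supp)
      qed
    qed
    show "integrable lborel (\<lambda>x. indicator (ball 0 (\<bar>R\<bar> + norm v)) x *\<^sub>R (L * norm v))" by (rule int_ball)
  qed (auto simp: Dq_def)
  moreover have "(\<integral>x. Dq n x \<partial>lborel) = 0" for n
    using \<phi>_int integrable_lborel_translate[of \<phi> "t n *\<^sub>R v"] integral_lborel_translate[of \<phi> "t n *\<^sub>R v"]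
    by (simp add: Dq_def)
  ultimately show ?thesis by (simp add: LIMSEQ_const_iff)
qed

section \<open>Test functions and their derivatives\<close>

lemma Ck_Suc_imp: "Ck (Suc n) f \<Longrightarrow> Ck n f"
  by (induction n arbitrary: f) auto

lemma smooth_deriv: "smooth f \<Longrightarrow> smooth (\<lambda>x. frechet_derivative f (at x) v)"
  unfolding smooth_def by (metis Ck.simps(2))

lemma smooth_differentiable: "smooth f \<Longrightarrow> f differentiable (at x)"
  unfolding smooth_def by (metis Ck.simps(2))

lemma smooth_continuous: "smooth f \<Longrightarrow> continuous_on UNIV f"
  unfolding smooth_def by (metis Ck.simps(1))

lemma frechet_derivative_outside:
  assumes "x \<notin> closure {z. f z \<noteq> 0}"
  shows "frechet_derivative f (at x) = (\<lambda>_. 0)"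
proof -
  let ?S = "- closure {z. f z \<noteq> 0}"
  have "(f has_derivative (\<lambda>_. 0)) (at x)"
    by (rule has_derivative_transform_within_open[where s="?S" and f="\<lambda>_. 0"])
       (use assms closure_subset[of "{z. f z \<noteq> 0}"] in auto)
  then show ?thesis by (rule frechet_derivative_at[symmetric])
qed

lemma test_fun_deriv: "test_fun f \<Longrightarrow> test_fun (\<lambda>x. frechet_derivative f (at x) v)"
proof -
  assume f: "test_fun f"
  have "{z. frechet_derivative f (at z) v \<noteq> 0} \<subseteq> closure {z. f z \<noteq> 0}"
    using frechet_derivative_outside[of _ f] by force
  then have "closure {z. frechet_derivative f (at z) v \<noteq> 0} \<subseteq> closure {z. f z \<noteq> 0}"
    by (rule closure_minimal) simp
  then have "compact (closure {z. frechet_derivative f (at z) v \<noteq> 0})"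
    using f compact_Int_closed[of "closure {z. f z \<noteq> 0}" "closure {z. frechet_derivative f (at z) v \<noteq> 0}"]
    by (simp add: test_fun_def Int_absorb1)
  then show ?thesis using f by (simp add: test_fun_def smooth_deriv)
qed

lemma test_fun_continuous: "test_fun f \<Longrightarrow> continuous_on UNIV f"
  by (simp add: test_fun_def smooth_continuous)

lemma test_fun_measurable: "test_fun f \<Longrightarrow> f \<in> borel_measurable borel"
  by (intro borel_measurable_continuous_onI test_fun_continuous)

lemma test_fun_support:
  assumes "test_fun f"
  obtains R where "0 < R" "\<And>z. R \<le> cmod z \<Longrightarrow> f z = 0"
proof -
  have "bounded {z. f z \<noteq> 0}" using assms bounded_subset[OF compact_imp_bounded closure_subset]
    by (auto simp: test_fun_def)
  then obtain R where R: "0 < R" "\<And>z. f z \<noteq> 0 \<Longrightarrow> cmod z < R"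
    by (auto simp: bounded_pos_less)
  then show thesis using that[of R] by force
qed

lemma test_fun_bounded:
  assumes "test_fun f"
  obtains B where "0 < B" "\<And>z. cmod (f z) \<le> B"
proof -
  let ?K = "closure {z. f z \<noteq> 0}"
  have "compact (f ` ?K)" using assms
    by (intro compact_continuous_image continuous_on_subset[OF test_fun_continuous[OF assms]]) (auto simp: test_fun_def)
  then obtain B where B: "0 < B" "\<And>z. z \<in> ?K \<Longrightarrow> cmod (f z) \<le> B"
    using compact_imp_bounded bounded_pos[of "f ` ?K"] by auto
  have "cmod (f z) \<le> B" for z
    using B closure_subset[of "{z. f z \<noteq> 0}"] by (cases "f z = 0") auto
  then show thesis using that B by blast
qed

lemma test_fun_integrable:
  assumes "test_fun f" shows "integrable lborel f"
proof -
  obtain R where R: "0 < R" "\<And>z. R \<le> cmod z \<Longrightarrow> f z = 0" using test_fun_support[OF assms] by blast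
  obtain B where B: "0 < B" "\<And>z. cmod (f z) \<le> B" using test_fun_bounded[OF assms] by blast
  have [measurable]: "f \<in> borel_measurable borel" by (rule test_fun_measurable[OF assms])
  show ?thesis
  proof (rule Bochner_Integration.integrable_bound)
    show "integrable lborel (\<lambda>x. indicator (ball (0::complex) R) x *\<^sub>R B)"
      by (rule integrable_ball_indicator)
    show "AE z in lborel. norm (f z) \<le> norm (indicator (ball (0::complex) R) z *\<^sub>R B)"
      using R B by (intro AE_I2) (auto simp: indicator_def not_less)
  qed measurable
qed

lemma complex_linear_expand:
  fixes F :: "complex \<Rightarrow> complex"
  assumes "linear F"
  shows "F h = Re h *\<^sub>R F 1 + Im h *\<^sub>R F \<i>"
proof -
  have "h = Re h *\<^sub>R 1 + Im h *\<^sub>R \<i>" by (simp add: complex_eq_iff)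
  then have "F h = F (Re h *\<^sub>R 1 + Im h *\<^sub>R \<i>)" by simp
  also have "\<dots> = Re h *\<^sub>R F 1 + Im h *\<^sub>R F \<i>"
    using assms by (simp add: linear_add linear_scale del: scaleR_conv_of_real)
  finally show ?thesis .
qed

text \<open>The derivative at a point is determined by the two partial derivatives, which are again
  test functions and hence bounded; the mean value inequality does the rest.\<close>

lemma test_fun_lipschitz:
  assumes "test_fun f"
  obtains L where "0 < L" "\<And>x y. cmod (f x - f y) \<le> L * cmod (x - y)"
proof -
  have d: "(f has_derivative frechet_derivative f (at x)) (at x)" for x
    using assms smooth_differentiable frechet_derivative_works by (auto simp: test_fun_def)
  obtain B where B: "0 < B" "\<And>z. cmod (frechet_derivative f (at z) 1) \<le> B"
    using test_fun_bounded[OF test_fun_deriv[OF assms]] by blast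
  obtain B' where B': "0 < B'" "\<And>z. cmod (frechet_derivative f (at z) \<i>) \<le> B'"
    using test_fun_bounded[OF test_fun_deriv[OF assms]] by blast
  have on: "onorm (frechet_derivative f (at x)) \<le> B + B'" for x
  proof (rule onorm_le)
    fix h
    have "cmod (frechet_derivative f (at x) h) \<le> \<bar>Re h\<bar> * cmod (frechet_derivative f (at x) 1) + \<bar>Im h\<bar> * cmod (frechet_derivative f (at x) \<i>)"
      by (subst complex_linear_expand[OF has_derivative_linear[OF d]]) (auto intro!: order_trans[OF norm_triangle_ineq])
    also have "\<dots> \<le> cmod h * B + cmod h * B'"
      by (intro add_mono mult_mono B B' abs_Re_le_cmod abs_Im_le_cmod) auto
    finally show "cmod (frechet_derivative f (at x) h) \<le> (B + B') * cmod h" by (simp add: algebra_simps)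
  qed
  have "cmod (f x - f y) \<le> (B + B') * cmod (x - y)" for x y
    using differentiable_bound[of UNIV f "\<lambda>x. frechet_derivative f (at x)" "B + B'" x y] d on by auto
  then show thesis using that[of "B + B'"] B B' by auto
qed

lemma test_fun_has_derivative: "test_fun f \<Longrightarrow> (f has_derivative frechet_derivative f (at x)) (at x)"
  using smooth_differentiable frechet_derivative_works by (auto simp: test_fun_def)

lemma test_fun_integral_deriv:
  assumes "test_fun f"
  shows "(\<integral>x. frechet_derivative f (at x) v \<partial>lborel) = 0"
proof -
  obtain R where R: "0 < R" "\<And>z. R \<le> cmod z \<Longrightarrow> f z = 0" using test_fun_support[OF assms] by blast
  obtain L where L: "0 < L" "\<And>x y. cmod (f x - f y) \<le> L * cmod (x - y)" using test_fun_lipschitz[OF assms] by blast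
  show ?thesis
    by (rule integral_directional_derivative_eq_0[OF L(2) R(2)])
       (auto intro!: test_fun_measurable test_fun_deriv assms AE_I2 test_fun_has_derivative)
qed

lemma dbar_eq: "(f has_derivative F) (at z) \<Longrightarrow> dbar f z = (F 1 + \<i> * F \<i>) / 2"
  unfolding dbar_def by (simp add: frechet_derivative_at[symmetric])

lemma dbar_test_fun:
  assumes "test_fun \<psi>"
  shows "dbar \<psi> \<in> borel_measurable borel" "(\<integral>z. dbar \<psi> z \<partial>lborel) = 0"
    "\<exists>B R. 0 < B \<and> 0 < R \<and> (\<forall>z. cmod (dbar \<psi> z) \<le> B * indicator (ball 0 R) z)"
proof -
  note t = test_fun_deriv[OF assms]
  show "dbar \<psi> \<in> borel_measurable borel"
    unfolding dbar_def[abs_def] using test_fun_measurable[OF t] by measurable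
  show "(\<integral>z. dbar \<psi> z \<partial>lborel) = 0"
    unfolding dbar_def using test_fun_integrable[OF t] by (simp add: test_fun_integral_deriv[OF assms])
  obtain B1 where B1: "0 < B1" "\<And>z. cmod (frechet_derivative \<psi> (at z) 1) \<le> B1" using test_fun_bounded[OF t] by blast
  obtain B2 where B2: "0 < B2" "\<And>z. cmod (frechet_derivative \<psi> (at z) \<i>) \<le> B2" using test_fun_bounded[OF t] by blast
  obtain R1 where R1: "0 < R1" "\<And>z. R1 \<le> cmod z \<Longrightarrow> frechet_derivative \<psi> (at z) 1 = 0" using test_fun_support[OF t] by blast
  obtain R2 where R2: "0 < R2" "\<And>z. R2 \<le> cmod z \<Longrightarrow> frechet_derivative \<psi> (at z) \<i> = 0" using test_fun_support[OF t] by blast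
  have "cmod (dbar \<psi> z) \<le> (B1 + B2) * indicator (ball 0 (R1 + R2)) z" for z
  proof (cases "cmod z < R1 + R2")
    case True
    have "cmod (dbar \<psi> z) \<le> (cmod (frechet_derivative \<psi> (at z) 1) + cmod (frechet_derivative \<psi> (at z) \<i>)) / 2"
      unfolding dbar_def norm_divide using norm_triangle_ineq[of "frechet_derivative \<psi> (at z) 1" "\<i> * frechet_derivative \<psi> (at z) \<i>"]
      by (simp add: norm_mult)
    also have "\<dots> \<le> B1 + B2"
    proof -
      have "(a + b) / 2 \<le> B1 + B2" if "a \<le> B1" "b \<le> B2" for a b using that B1(1) B2(1) by (simp add: field_simps)
      then show ?thesis using B1(2)[of z] B2(2)[of z] by blast
    qed
    finally show ?thesis using True by simp
  next
    case False
    then show ?thesis using R1 R2 by (simp add: dbar_def)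
  qed
  then show "\<exists>B R. 0 < B \<and> 0 < R \<and> (\<forall>z. cmod (dbar \<psi> z) \<le> B * indicator (ball 0 R) z)"
    using B1(1) B2(1) R1(1) R2(1) by (intro exI[of _ "B1 + B2"] exI[of _ "R1 + R2"]) auto
qed

text \<open>Uniformity in w is the point. Within distance 1 of w the bound on dbar \<psi> meets the
  integrable near kernel; beyond that the kernel is at most 1, on a disc of finite area.\<close>

lemma dbar_over_bound:
  assumes "test_fun \<psi>"
  obtains S where "0 \<le> S" "\<And>w. (\<integral>\<^sup>+z. ennreal (cmod (dbar \<psi> z) / cmod (z - w)) \<partial>lborel) \<le> ennreal S"
proof -
  obtain B R where B: "0 < B" "0 < R" "\<And>z. cmod (dbar \<psi> z) \<le> B * indicator (ball 0 R) z"
    using dbar_test_fun(3)[OF assms] by blast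
  have [measurable]: "ball (0::complex) R \<in> sets borel" by simp
  have "(\<integral>\<^sup>+z. ennreal (cmod (dbar \<psi> z) / cmod (z - w)) \<partial>lborel) \<le> ennreal (B * (4 * pi) + B * (pi * R\<^sup>2))" for w
  proof -
    have "(\<integral>\<^sup>+z. ennreal (cmod (dbar \<psi> z) / cmod (z - w)) \<partial>lborel)
      \<le> (\<integral>\<^sup>+z. ennreal B * ennreal (near_kernel 1 (z - w)) + ennreal B * indicator (ball 0 R) z \<partial>lborel)"
    proof (rule nn_integral_mono)
      fix z
      have "cmod (dbar \<psi> z) / cmod (z - w) = cmod (dbar \<psi> z) * near_kernel 1 (z - w) + cmod (dbar \<psi> z) * far_kernel 1 (z - w)"
        using near_far_kernel[of 1 "z - w"] by (simp add: divide_inverse distrib_left[symmetric])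
      also have "\<dots> \<le> B * near_kernel 1 (z - w) + (B * indicator (ball 0 R) z) * 1"
      proof (intro add_mono mult_mono)
        have "B * indicator (ball 0 R) z \<le> B * 1" using B(1) by (intro mult_left_mono) (auto simp: indicator_def)
        then show "cmod (dbar \<psi> z) \<le> B" using B(3)[of z] by linarith
      qed (use B far_kernel_le[of 1 "z - w"] in auto)
      finally have "ennreal (cmod (dbar \<psi> z) / cmod (z - w)) \<le> ennreal (B * near_kernel 1 (z - w) + B * indicator (ball 0 R) z)"
        by (intro ennreal_leI) simp
      also have "\<dots> = ennreal B * ennreal (near_kernel 1 (z - w)) + ennreal B * indicator (ball 0 R) z"
        using B(1) by (simp add: ennreal_plus ennreal_mult indicator_def)
      finally show "ennreal (cmod (dbar \<psi> z) / cmod (z - w)) \<le> \<dots>" .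
    qed
    also have "\<dots> = ennreal B * (\<integral>\<^sup>+z. ennreal (near_kernel 1 (z - w)) \<partial>lborel) + ennreal B * ennreal (pi * R\<^sup>2)"
      using B by (subst nn_integral_add) (auto simp: nn_integral_cmult nn_integral_cmult_indicator emeasure_complex_ball)
    also have "(\<integral>\<^sup>+z. ennreal (near_kernel 1 (z - w)) \<partial>lborel) = (\<integral>\<^sup>+z. ennreal (near_kernel 1 z) \<partial>lborel)"
      by (rule nn_integral_lborel_shift[where f="\<lambda>z. ennreal (near_kernel 1 z)"]) measurable
    also have "ennreal B * (\<integral>\<^sup>+z. ennreal (near_kernel 1 z) \<partial>lborel) + ennreal B * ennreal (pi * R\<^sup>2)
      \<le> ennreal B * ennreal (4 * pi * 1) + ennreal B * ennreal (pi * R\<^sup>2)"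
      by (intro add_mono mult_left_mono nn_integral_near_kernel) auto
    also have "\<dots> = ennreal (B * (4 * pi) + B * (pi * R\<^sup>2))"
      using B by (simp add: ennreal_mult ennreal_plus)
    finally show ?thesis .
  qed
  then show thesis using that[of "B * (4 * pi) + B * (pi * R\<^sup>2)"] B by simp
qed

text \<open>The two formulas agree on the circle |z| = t, where 1/z = conj(z)/t^2. Hence the
  function is continuous, and even Lipschitz, although not differentiable across the circle.\<close>

definition cut_kernel :: "real \<Rightarrow> complex \<Rightarrow> complex" where
  "cut_kernel t z = (if cmod z < t then cnj z / of_real (t\<^sup>2) else 1 / z)"

text \<open>Writing conj(a) b - t^2 = conj(a) (b - a) - (t^2 - |a|^2) and using t - |a| \<le> |a -
  b| bounds the numerator by (|a| + 2t) |a - b|; the constant 3 comes from |a| \<le> |b| and t \<le>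
  |b|.\<close>

lemma cut_kernel_lipschitz_aux:
  assumes t: "0 < t" and a: "cmod a < t" and b: "t \<le> cmod b"
  shows "cmod (cnj a / of_real (t\<^sup>2) - 1 / b) \<le> 3 / t\<^sup>2 * cmod (a - b)"
proof -
  have b0: "b \<noteq> 0" "0 < cmod b" using t b by auto
  have "cnj a / of_real (t\<^sup>2) - 1 / b = (cnj a * b - of_real (t\<^sup>2)) / (of_real (t\<^sup>2) * b)"
    using t b0 by (simp add: field_simps)
  also have "cmod \<dots> = cmod (cnj a * b - of_real (t\<^sup>2)) / (t\<^sup>2 * cmod b)"
    by (simp add: norm_divide norm_mult norm_power)
  also have "\<dots> \<le> (3 * cmod b * cmod (a - b)) / (t\<^sup>2 * cmod b)"
  proof (rule divide_right_mono)
    have "cnj a * b - of_real (t\<^sup>2) = cnj a * (b - a) - of_real (t\<^sup>2 - (cmod a)\<^sup>2)"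
      using complex_norm_square[of a] by (simp add: algebra_simps)
    then have "cmod (cnj a * b - of_real (t\<^sup>2)) \<le> cmod (cnj a * (b - a)) + cmod (of_real (t\<^sup>2 - (cmod a)\<^sup>2))"
      using norm_triangle_ineq4 by metis
    also have "\<dots> = cmod a * cmod (a - b) + \<bar>t\<^sup>2 - (cmod a)\<^sup>2\<bar>"
      by (simp add: norm_mult norm_minus_commute del: of_real_diff of_real_power)
    also have "t\<^sup>2 - (cmod a)\<^sup>2 = (t - cmod a) * (t + cmod a)" by (simp add: power2_eq_square algebra_simps)
    also have "\<bar>(t - cmod a) * (t + cmod a)\<bar> = (t - cmod a) * (t + cmod a)" using a t by simp
    also have "(t - cmod a) * (t + cmod a) \<le> cmod (a - b) * (2 * t)"
      using a b t norm_triangle_ineq2[of b a] by (intro mult_mono) (auto simp: norm_minus_commute)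
    also have "cmod a * cmod (a - b) + cmod (a - b) * (2 * t) = (cmod a + 2 * t) * cmod (a - b)" by (simp add: algebra_simps)
    also have "\<dots> \<le> (3 * cmod b) * cmod (a - b)" using a b by (intro mult_right_mono) auto
    finally show "cmod (cnj a * b - of_real (t\<^sup>2)) \<le> 3 * cmod b * cmod (a - b)" by simp
  qed (use t in simp)
  also have "\<dots> = 3 / t\<^sup>2 * cmod (a - b)" using b0 by simp
  finally show ?thesis .
qed

lemma cut_kernel_lipschitz:
  assumes t: "0 < t"
  shows "cmod (cut_kernel t a - cut_kernel t b) \<le> 3 / t\<^sup>2 * cmod (a - b)"
proof -
  consider "cmod a < t" "cmod b < t" | "cmod a < t" "t \<le> cmod b" | "t \<le> cmod a" "cmod b < t" | "t \<le> cmod a" "t \<le> cmod b" by linarith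
  then show ?thesis
  proof cases
    case 1
    then have "cmod (cut_kernel t a - cut_kernel t b) = cmod (cnj (a - b)) / t\<^sup>2"
      by (simp add: cut_kernel_def diff_divide_distrib[symmetric] norm_divide norm_power del: complex_mod_cnj)
    also have "cmod (cnj (a - b)) = cmod (a - b)" by (rule complex_mod_cnj)
    also have "cmod (a - b) / t\<^sup>2 \<le> 3 / t\<^sup>2 * cmod (a - b)" using t by (simp add: field_simps)
    finally show ?thesis .
  next
    case 2
    then show ?thesis using cut_kernel_lipschitz_aux[OF t, of a b] by (simp add: cut_kernel_def)
  next
    case 3
    then show ?thesis using cut_kernel_lipschitz_aux[OF t, of b a]
      by (simp add: cut_kernel_def norm_minus_commute)
  next
    case 4
    then have n: "a \<noteq> 0" "b \<noteq> 0" using t by auto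
    have "cut_kernel t a - cut_kernel t b = (b - a) / (a * b)" using 4 n by (simp add: cut_kernel_def field_simps)
    then have "cmod (cut_kernel t a - cut_kernel t b) = cmod (a - b) / (cmod a * cmod b)" by (simp add: norm_divide norm_mult norm_minus_commute)
    also have "\<dots> \<le> cmod (a - b) / (t * t)" using 4 t n by (intro divide_left_mono mult_mono) (auto intro!: mult_pos_pos)
    also have "\<dots> \<le> 3 / t\<^sup>2 * cmod (a - b)" using t by (simp add: field_simps power2_eq_square)
    finally show ?thesis .
  qed
qed

lemma cut_kernel_measurable [measurable]: "cut_kernel t \<in> borel_measurable borel"
  unfolding cut_kernel_def[abs_def] by measurable

lemma cut_kernel_bounds:
  assumes "0 < t"
  shows "cmod (cut_kernel t z) \<le> 1 / t" "cmod (cut_kernel t z) \<le> 1 / cmod z"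
proof -
  show "cmod (cut_kernel t z) \<le> 1 / t"
  proof (cases "cmod z < t")
    case True
    have "cmod z / t\<^sup>2 \<le> t / t\<^sup>2" using True by (intro divide_right_mono) auto
    moreover have "t / t\<^sup>2 = 1 / t" by (simp add: power2_eq_square)
    ultimately show ?thesis using True assms by (simp add: cut_kernel_def norm_divide norm_power)
  qed (use assms in \<open>auto simp: cut_kernel_def norm_divide intro!: frac_le\<close>)
  show "cmod (cut_kernel t z) \<le> 1 / cmod z"
  proof (cases "cmod z < t \<and> z \<noteq> 0")
    case True
    then have "cmod z * cmod z \<le> t * t" using assms by (intro mult_mono) auto
    then show ?thesis using True assms by (simp add: cut_kernel_def norm_divide norm_mult field_simps power2_eq_square)
  qed (auto simp: cut_kernel_def norm_divide)
qed

lemma AE_not_sphere: "AE z in lborel. cmod (z - w) \<noteq> t"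
proof -
  have "negligible (sphere w t)" by (rule negligible_sphere)
  then have "sphere w t \<in> null_sets lborel" by (simp add: negligible_iff_null_sets null_sets_completion_iff)
  then show ?thesis by (rule AE_I'[where N="sphere w t"]) (auto simp: dist_norm norm_minus_commute)
qed

text \<open>Regularising \<open>1/(z - w)\<close> to \<open>cnj (z - w) / t\<^sup>2\<close> on the disc of radius \<open>t\<close> keeps it Lipschitz,
  and turns the point mass of its \<open>\<partial>\<close>-bar derivative into the mean over that disc.\<close>
lemma dbar_cut_kernel:
  assumes \<psi>: "test_fun \<psi>" and t: "0 < t"
  shows "(\<integral>z. dbar \<psi> z * cut_kernel t (z - w) \<partial>lborel) = - (\<integral>z. \<psi> z * of_real (indicator (ball w t) z / t\<^sup>2) \<partial>lborel)"
proof -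
  obtain R where R: "0 < R" "\<And>z. R \<le> cmod z \<Longrightarrow> \<psi> z = 0" using test_fun_support[OF \<psi>] by blast
  obtain L where L: "0 < L" "\<And>x y. cmod (\<psi> x - \<psi> y) \<le> L * cmod (x - y)" using test_fun_lipschitz[OF \<psi>] by blast
  obtain B where B: "0 < B" "\<And>z. cmod (\<psi> z) \<le> B" using test_fun_bounded[OF \<psi>] by blast
  have [measurable]: "\<psi> \<in> borel_measurable borel" by (rule test_fun_measurable[OF \<psi>])
  have [measurable]: "(\<lambda>z. frechet_derivative \<psi> (at z) v) \<in> borel_measurable borel" for v
    by (rule test_fun_measurable[OF test_fun_deriv[OF \<psi>]])
  define \<phi> where "\<phi> z = \<psi> z * cut_kernel t (z - w)" for z
  \<comment> \<open>The derivative of the cut kernel off the circle: conjugate-linear in v inside,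
    complex-linear outside.\<close>
  define E where "E z v = (if cmod (z - w) < t then cnj v / of_real (t\<^sup>2) else - v / (z - w)\<^sup>2)" for z v
  define D where "D v z = frechet_derivative \<psi> (at z) v * cut_kernel t (z - w) + \<psi> z * E z v" for v z
  have E_meas[measurable]: "(\<lambda>z. E z v) \<in> borel_measurable borel" for v unfolding E_def by measurable
  have D_meas[measurable]: "D v \<in> borel_measurable borel" for v unfolding D_def by measurable
  have lip: "cmod (\<phi> x - \<phi> y) \<le> (L / t + B * (3 / t\<^sup>2)) * cmod (x - y)" for x y
  proof -
    have "\<phi> x - \<phi> y = (\<psi> x - \<psi> y) * cut_kernel t (x - w) + \<psi> y * (cut_kernel t (x - w) - cut_kernel t (y - w))"
      by (simp add: \<phi>_def algebra_simps)
    then have "cmod (\<phi> x - \<phi> y) \<le> cmod (\<psi> x - \<psi> y) * cmod (cut_kernel t (x - w)) + cmod (\<psi> y) * cmod (cut_kernel t (x - w) - cut_kernel t (y - w))"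
      by (metis norm_mult norm_triangle_ineq)
    also have "\<dots> \<le> (L * cmod (x - y)) * (1 / t) + B * (3 / t\<^sup>2 * cmod (x - y))"
      using cut_kernel_lipschitz[OF t, of "x - w" "y - w"] L(1) B(1) t
      by (intro add_mono mult_mono L(2) B(2) cut_kernel_bounds(1)) auto
    finally show ?thesis by (simp add: algebra_simps)
  qed
  have der: "(\<phi> has_derivative (\<lambda>v. D v z)) (at z)" if z: "cmod (z - w) \<noteq> t" for z
  proof -
    have "((\<lambda>z. cut_kernel t (z - w)) has_derivative E z) (at z)"
    proof (cases "cmod (z - w) < t")
      case True
      have "((\<lambda>z. cnj (z - w) / of_real (t\<^sup>2)) has_derivative (\<lambda>v. cnj v / of_real (t\<^sup>2))) (at z)"
      proof -
        have "((\<lambda>z. cnj (z - w) * c) has_derivative (\<lambda>v. cnj v * c)) (at z)" for c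
          by (auto intro!: derivative_eq_intros)
        from this[of "1 / of_real (t\<^sup>2)"] show ?thesis by simp
      qed
      then have "((\<lambda>z. cut_kernel t (z - w)) has_derivative (\<lambda>v. cnj v / of_real (t\<^sup>2))) (at z)"
        by (rule has_derivative_transform_within_open[where s="ball w t"])
           (use True in \<open>auto simp: cut_kernel_def dist_norm norm_minus_commute\<close>)
      then show ?thesis using True by (simp add: E_def[abs_def])
    next
      case False
      then have n: "z - w \<noteq> 0" using t by auto
      have "((\<lambda>z. 1 / (z - w)) has_derivative (\<lambda>v. - v / (z - w)\<^sup>2)) (at z)"
        using n by (auto intro!: derivative_eq_intros simp: power2_eq_square field_simps)
      then have "((\<lambda>z. cut_kernel t (z - w)) has_derivative (\<lambda>v. - v / (z - w)\<^sup>2)) (at z)"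
        by (rule has_derivative_transform_within_open[where s="- cball w t"])
           (use False z in \<open>auto simp: cut_kernel_def dist_norm norm_minus_commute\<close>)
      then show ?thesis using False by (simp add: E_def[abs_def])
    qed
    from has_derivative_mult[OF test_fun_has_derivative[OF \<psi>] this]
    show ?thesis unfolding \<phi>_def[abs_def] D_def by (simp add: algebra_simps)
  qed
  have zero: "(\<integral>z. D v z \<partial>lborel) = 0" for v
  proof (rule integral_directional_derivative_eq_0[OF lip])
    show "\<phi> x = 0" if "R \<le> cmod x" for x using R(2)[OF that] by (simp add: \<phi>_def)
    show "AE z in lborel. \<exists>F. (\<phi> has_derivative F) (at z) \<and> F v = D v z"
      using AE_not_sphere[of w t] der by (auto elim!: eventually_mono)
  qed measurable
  have E_le: "cmod (E z v) \<le> cmod v / t\<^sup>2" for z v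
  proof (cases "cmod (z - w) < t")
    case False
    then have "t\<^sup>2 \<le> (cmod (z - w))\<^sup>2" using t by (intro power_mono) auto
    then have "cmod v / (cmod (z - w))\<^sup>2 \<le> cmod v / t\<^sup>2" using t by (intro divide_left_mono) (auto simp: zero_less_mult_iff intro!: mult_pos_pos)
    then show ?thesis using False by (simp add: E_def norm_divide norm_power)
  qed (simp add: E_def norm_divide norm_power)
  have i1: "integrable lborel (\<lambda>z. frechet_derivative \<psi> (at z) v * cut_kernel t (z - w))" for v
  proof (rule Bochner_Integration.integrable_bound)
    show "integrable lborel (\<lambda>z. of_real (1 / t) * frechet_derivative \<psi> (at z) v)"
      using test_fun_integrable[OF test_fun_deriv[OF \<psi>]] by simp
    show "AE z in lborel. norm (frechet_derivative \<psi> (at z) v * cut_kernel t (z - w)) \<le> norm (of_real (1 / t) * frechet_derivative \<psi> (at z) v)"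
    proof (intro AE_I2)
      fix z
      have "cmod (cut_kernel t (z - w)) * cmod (frechet_derivative \<psi> (at z) v) \<le> (1 / t) * cmod (frechet_derivative \<psi> (at z) v)"
        by (intro mult_right_mono cut_kernel_bounds t) auto
      then show "norm (frechet_derivative \<psi> (at z) v * cut_kernel t (z - w)) \<le> norm (of_real (1 / t) * frechet_derivative \<psi> (at z) v)"
        using t by (simp add: norm_mult norm_divide mult.commute)
    qed
  qed measurable
  have i2: "integrable lborel (\<lambda>z. \<psi> z * E z v)" for v
  proof (rule Bochner_Integration.integrable_bound)
    show "integrable lborel (\<lambda>z. of_real (cmod v / t\<^sup>2) * \<psi> z)" using test_fun_integrable[OF \<psi>] by simp
    show "AE z in lborel. norm (\<psi> z * E z v) \<le> norm (of_real (cmod v / t\<^sup>2) * \<psi> z)"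
    proof (intro AE_I2)
      fix z
      have "cmod (E z v) * cmod (\<psi> z) \<le> (cmod v / t\<^sup>2) * cmod (\<psi> z)" by (intro mult_right_mono E_le) auto
      then show "norm (\<psi> z * E z v) \<le> norm (of_real (cmod v / t\<^sup>2) * \<psi> z)"
        by (simp add: norm_mult norm_divide norm_power mult.commute)
    qed
  qed measurable
  have D_int: "integrable lborel (D v)" for v
    unfolding D_def using i1 i2 by (rule Bochner_Integration.integrable_add)
  have pt: "(D 1 z + \<i> * D \<i> z) / 2 = dbar \<psi> z * cut_kernel t (z - w) + \<psi> z * of_real (indicator (ball w t) z / t\<^sup>2)" for z
  proof -
    \<comment> \<open>The combination E 1 + i E i annihilates complex-linear maps, so the outside
      contributes nothing; for the map conj(v)/t^2 half of it is 1/t^2.\<close>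
    have "(E z 1 + \<i> * E z \<i>) / 2 = of_real (indicator (ball w t) z / t\<^sup>2)"
      by (simp add: E_def dist_norm norm_minus_commute indicator_def)
    moreover have "(D 1 z + \<i> * D \<i> z) / 2 = dbar \<psi> z * cut_kernel t (z - w) + \<psi> z * ((E z 1 + \<i> * E z \<i>) / 2)"
      by (simp add: D_def dbar_def algebra_simps add_divide_distrib)
    ultimately show ?thesis by simp
  qed
  have j1: "integrable lborel (\<lambda>z. dbar \<psi> z * cut_kernel t (z - w))"
  proof -
    have "integrable lborel (\<lambda>z. (frechet_derivative \<psi> (at z) 1 * cut_kernel t (z - w) + \<i> * (frechet_derivative \<psi> (at z) \<i> * cut_kernel t (z - w))) / 2)"
      using i1 by simp
    then show ?thesis by (simp add: dbar_def algebra_simps add_divide_distrib)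
  qed
  have j2: "integrable lborel (\<lambda>z. \<psi> z * of_real (indicator (ball w t) z / t\<^sup>2))"
  proof -
    have "integrable lborel (\<lambda>z. (D 1 z + \<i> * D \<i> z) / 2 - dbar \<psi> z * cut_kernel t (z - w))"
      using D_int j1 by simp
    then show ?thesis unfolding pt by simp
  qed
  have "0 = (\<integral>z. (D 1 z + \<i> * D \<i> z) / 2 \<partial>lborel)" using D_int zero by simp
  also have "\<dots> = (\<integral>z. dbar \<psi> z * cut_kernel t (z - w) \<partial>lborel) + (\<integral>z. \<psi> z * of_real (indicator (ball w t) z / t\<^sup>2) \<partial>lborel)"
    unfolding pt using j1 j2 by (rule Bochner_Integration.integral_add)
  finally show ?thesis by (simp add: eq_neg_iff_add_eq_0)
qed

text \<open>The indicator of the disc divided by s^2 has mass pi for every s, and \<psi> varies by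
  at most L s on the disc; the error is therefore at most pi L s.\<close>

lemma disc_means_tendsto:
  fixes \<psi> :: "complex \<Rightarrow> complex"
  assumes \<psi>: "test_fun \<psi>" and t: "\<And>n. 0 < t n" "t \<longlonglongrightarrow> 0"
  shows "(\<lambda>n. \<integral>z. \<psi> z * of_real (indicator (ball w (t n)) z / (t n)\<^sup>2) \<partial>lborel) \<longlonglongrightarrow> pi * \<psi> w"
proof -
  obtain L where L: "0 < L" "\<And>x y. cmod (\<psi> x - \<psi> y) \<le> L * cmod (x - y)" using test_fun_lipschitz[OF \<psi>] by blast
  obtain B where B: "0 < B" "\<And>z. cmod (\<psi> z) \<le> B" using test_fun_bounded[OF \<psi>] by blast
  have [measurable]: "\<psi> \<in> borel_measurable borel" by (rule test_fun_measurable[OF \<psi>])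
  have bnd: "cmod ((\<integral>z. \<psi> z * of_real (indicator (ball w s) z / s\<^sup>2) \<partial>lborel) - pi * \<psi> w) \<le> pi * L * s" if s: "0 < s" for s
  proof -
    have ind: "integrable lborel (\<lambda>z. indicator (ball w s) z / s\<^sup>2)"
      using integrable_ball_indicator[of w s "1 / s\<^sup>2"] by simp
    have mass: "(\<integral>z. indicator (ball w s) z / s\<^sup>2 \<partial>lborel) = pi"
      using s by (simp add: measure_def emeasure_complex_ball)
    have [measurable]: "ball w s \<in> sets borel" by simp
    have i1: "integrable lborel (\<lambda>z. \<psi> z * of_real (indicator (ball w s) z / s\<^sup>2))"
    proof (rule Bochner_Integration.integrable_bound)
      show "integrable lborel (\<lambda>z. B * (indicator (ball w s) z / s\<^sup>2))" using ind by (rule integrable_mult_right)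
      show "AE z in lborel. norm (\<psi> z * of_real (indicator (ball w s) z / s\<^sup>2)) \<le> norm (B * (indicator (ball w s) z / s\<^sup>2))"
        using B(2) B(1) by (intro AE_I2) (auto simp: indicator_def norm_mult norm_divide norm_power intro!: divide_right_mono)
    qed measurable
    have i2: "integrable lborel (\<lambda>z. \<psi> w * complex_of_real (indicator (ball w s) z / s\<^sup>2))"
      by (intro integrable_mult_right integrable_of_real ind)
    have "pi * \<psi> w = (\<integral>z. \<psi> w * complex_of_real (indicator (ball w s) z / s\<^sup>2) \<partial>lborel)"
      using mass by (simp only: integral_mult_right_zero integral_complex_of_real) simp
    then have "(\<integral>z. \<psi> z * of_real (indicator (ball w s) z / s\<^sup>2) \<partial>lborel) - pi * \<psi> w
      = (\<integral>z. \<psi> z * of_real (indicator (ball w s) z / s\<^sup>2) - \<psi> w * of_real (indicator (ball w s) z / s\<^sup>2) \<partial>lborel)"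
      using i1 i2 by simp
    also have "cmod \<dots> \<le> (\<integral>z. cmod (\<psi> z * of_real (indicator (ball w s) z / s\<^sup>2) - \<psi> w * of_real (indicator (ball w s) z / s\<^sup>2)) \<partial>lborel)"
      by (rule integral_norm_bound)
    also have "\<dots> \<le> (\<integral>z. (L * s) * (indicator (ball w s) z / s\<^sup>2) \<partial>lborel)"
    proof (rule integral_mono)
      show "integrable lborel (\<lambda>z. cmod (\<psi> z * of_real (indicator (ball w s) z / s\<^sup>2) - \<psi> w * of_real (indicator (ball w s) z / s\<^sup>2)))"
        using i1 i2 by (intro integrable_norm Bochner_Integration.integrable_diff)
      show "integrable lborel (\<lambda>z. (L * s) * (indicator (ball w s) z / s\<^sup>2))" by (rule integrable_mult_right[OF ind])
      fix z
      show "cmod (\<psi> z * of_real (indicator (ball w s) z / s\<^sup>2) - \<psi> w * of_real (indicator (ball w s) z / s\<^sup>2)) \<le> (L * s) * (indicator (ball w s) z / s\<^sup>2)"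
      proof (cases "z \<in> ball w s")
        case True
        then have "L * cmod (z - w) \<le> L * s" using L(1) by (intro mult_left_mono) (auto simp: dist_norm norm_minus_commute)
        then have "cmod (\<psi> z - \<psi> w) \<le> L * s" using L(2)[of z w] by linarith
        then have "cmod (\<psi> z - \<psi> w) / s\<^sup>2 \<le> L * s / s\<^sup>2" by (rule divide_right_mono) simp
        then show ?thesis using True
          by (simp add: diff_divide_distrib[symmetric] norm_divide norm_power del: of_real_power)
      qed simp
    qed
    also have "\<dots> = pi * L * s" by (simp only: integral_mult_right_zero mass) simp
    finally show ?thesis .
  qed
  have "(\<lambda>n. (\<integral>z. \<psi> z * of_real (indicator (ball w (t n)) z / (t n)\<^sup>2) \<partial>lborel) - pi * \<psi> w) \<longlonglongrightarrow> 0"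
  proof (rule Lim_null_comparison)
    show "\<forall>\<^sub>F n in sequentially. norm ((\<integral>z. \<psi> z * of_real (indicator (ball w (t n)) z / (t n)\<^sup>2) \<partial>lborel) - pi * \<psi> w) \<le> pi * L * t n"
      using bnd t(1) by (intro always_eventually) auto
    show "(\<lambda>n. pi * L * t n) \<longlonglongrightarrow> 0" by (rule tendsto_mult_right_zero[OF t(2)])
  qed
  then show ?thesis by (simp add: LIM_zero_iff)
qed

text \<open>The cut kernels coincide with 1/(z - w) outside shrinking discs and are dominated by it
  in modulus, so the regularised identity passes to the limit t -> 0.\<close>

lemma cauchy_pompeiu:
  fixes \<psi> :: "complex \<Rightarrow> complex"
  assumes \<psi>: "test_fun \<psi>"
  shows "(\<integral>z. dbar \<psi> z / (z - w) \<partial>lborel) = - pi * \<psi> w"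
proof -
  define t where "t n = 1 / (real n + 1)" for n :: nat
  have t: "0 < t n" for n by (auto simp: t_def)
  have t_lim: "t \<longlonglongrightarrow> 0" unfolding t_def using LIMSEQ_inverse_real_of_nat by (simp add: inverse_eq_divide add.commute)
  have [measurable]: "dbar \<psi> \<in> borel_measurable borel" by (rule dbar_test_fun[OF \<psi>])
  obtain S where S: "0 \<le> S" "\<And>w. (\<integral>\<^sup>+z. ennreal (cmod (dbar \<psi> z) / cmod (z - w)) \<partial>lborel) \<le> ennreal S"
    using dbar_over_bound[OF \<psi>] by blast
  have "(\<lambda>n. \<integral>z. dbar \<psi> z * cut_kernel (t n) (z - w) \<partial>lborel) \<longlonglongrightarrow> (\<integral>z. dbar \<psi> z / (z - w) \<partial>lborel)"
  proof (rule integral_dominated_convergence[where w="\<lambda>z. cmod (dbar \<psi> z) / cmod (z - w)"])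
    show "integrable lborel (\<lambda>z. cmod (dbar \<psi> z) / cmod (z - w))"
      using S(2)[of w] by (intro integrableI_bounded) (auto intro: le_less_trans)
    show "AE z in lborel. norm (dbar \<psi> z * cut_kernel (t n) (z - w)) \<le> cmod (dbar \<psi> z) / cmod (z - w)" for n
    proof (intro AE_I2)
      fix z
      show "norm (dbar \<psi> z * cut_kernel (t n) (z - w)) \<le> cmod (dbar \<psi> z) / cmod (z - w)"
        using mult_left_mono[OF cut_kernel_bounds(2)[OF t[of n], of "z - w"], of "cmod (dbar \<psi> z)"]
        by (simp add: norm_mult)
    qed
    show "AE z in lborel. (\<lambda>n. dbar \<psi> z * cut_kernel (t n) (z - w)) \<longlonglongrightarrow> dbar \<psi> z / (z - w)"
      using AE_not_sphere[of w 0]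
    proof eventually_elim
      case (elim z)
      have "\<forall>\<^sub>F n in sequentially. t n < cmod (z - w)"
        using elim by (intro order_tendstoD(2)[OF t_lim]) auto
      then have "\<forall>\<^sub>F n in sequentially. dbar \<psi> z * cut_kernel (t n) (z - w) = dbar \<psi> z / (z - w)"
        by eventually_elim (simp add: cut_kernel_def)
      then show ?case by (rule tendsto_eventually)
    qed
  qed measurable
  moreover have "(\<lambda>n. \<integral>z. dbar \<psi> z * cut_kernel (t n) (z - w) \<partial>lborel) \<longlonglongrightarrow> - (pi * \<psi> w)"
    unfolding dbar_cut_kernel[OF \<psi> t] by (intro tendsto_minus disc_means_tendsto[OF \<psi> t t_lim])
  ultimately show ?thesis using LIMSEQ_unique by fastforce
qed

text \<open>The weak form of the fact that 1/(pi z) is a fundamental solution of dbar. Fubini,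
  justified by the bound uniform in w, reduces it to the Cauchy-Pompeiu formula at each w.\<close>

lemma cauchy_transform_weak_dbar:
  fixes \<psi> G :: "complex \<Rightarrow> complex"
  assumes \<psi>: "test_fun \<psi>" and G: "integrable lborel G"
  shows "(\<integral>z. conv cker G z * dbar \<psi> z \<partial>lborel) = - pi * (\<integral>w. G w * \<psi> w \<partial>lborel)"
    "integrable lborel (\<lambda>z. conv cker G z * dbar \<psi> z)"
proof -
  have [measurable]: "dbar \<psi> \<in> borel_measurable borel" by (rule dbar_test_fun[OF \<psi>])
  have [measurable]: "G \<in> borel_measurable borel" using G by (auto dest: borel_measurable_integrable)
  obtain S where S: "0 \<le> S" "\<And>w. (\<integral>\<^sup>+z. ennreal (cmod (dbar \<psi> z) / cmod (z - w)) \<partial>lborel) \<le> ennreal S"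
    using dbar_over_bound[OF \<psi>] by blast
  let ?f = "\<lambda>z w. G w * (dbar \<psi> z / (z - w))"
  have int: "integrable (lborel \<Otimes>\<^sub>M lborel) (\<lambda>(z, w). ?f z w)"
  proof (intro integrableI_bounded)
    have "(\<integral>\<^sup>+p. ennreal (norm (case p of (z, w) \<Rightarrow> ?f z w)) \<partial>(lborel \<Otimes>\<^sub>M lborel))
      = (\<integral>\<^sup>+w. (\<integral>\<^sup>+z. ennreal (cmod (G w)) * ennreal (cmod (dbar \<psi> z) / cmod (z - w)) \<partial>lborel) \<partial>lborel)"
      by (subst lborel_pair.nn_integral_snd[symmetric]) (auto simp: norm_mult norm_divide ennreal_mult[symmetric])
    also have "\<dots> = (\<integral>\<^sup>+w. ennreal (cmod (G w)) * (\<integral>\<^sup>+z. ennreal (cmod (dbar \<psi> z) / cmod (z - w)) \<partial>lborel) \<partial>lborel)"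
      by (intro nn_integral_cong nn_integral_cmult) measurable
    also have "\<dots> \<le> (\<integral>\<^sup>+w. ennreal (cmod (G w)) * ennreal S \<partial>lborel)"
      by (intro nn_integral_mono mult_left_mono S) auto
    also have "\<dots> = (\<integral>\<^sup>+w. ennreal (cmod (G w)) \<partial>lborel) * ennreal S" by (rule nn_integral_multc) measurable
    also have "\<dots> < \<infinity>" using G by (auto simp: integrable_iff_bounded ennreal_mult_less_top)
    finally show "(\<integral>\<^sup>+p. ennreal (norm (case p of (z, w) \<Rightarrow> ?f z w)) \<partial>(lborel \<Otimes>\<^sub>M lborel)) < \<infinity>" .
  qed measurable
  have eq: "conv cker G z * dbar \<psi> z = (\<integral>w. ?f z w \<partial>lborel)" for z
    unfolding conv_def by (simp only: integral_mult_left_zero[symmetric]) (simp add: cker_def field_simps)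
  show "integrable lborel (\<lambda>z. conv cker G z * dbar \<psi> z)"
    unfolding eq using lborel_pair.integrable_fst'[OF int] by simp
  have "(\<integral>z. conv cker G z * dbar \<psi> z \<partial>lborel) = (\<integral>w. (\<integral>z. ?f z w \<partial>lborel) \<partial>lborel)"
    unfolding eq by (rule lborel_pair.Fubini_integral[symmetric, OF int])
  also have "\<dots> = (\<integral>w. G w * (- pi * \<psi> w) \<partial>lborel)"
    by (simp only: integral_mult_right_zero cauchy_pompeiu[OF \<psi>])
  also have "\<dots> = (\<integral>w. - pi * (G w * \<psi> w) \<partial>lborel)"
    by (intro Bochner_Integration.integral_cong) simp_all
  also have "\<dots> = - pi * (\<integral>w. G w * \<psi> w \<partial>lborel)" by (rule integral_mult_right_zero)
  finally show "(\<integral>z. conv cker G z * dbar \<psi> z \<partial>lborel) = - pi * (\<integral>w. G w * \<psi> w \<partial>lborel)" .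
qed

section \<open>Bump functions\<close>

lemma Ck_const: "Ck n (\<lambda>_::'a::euclidean_space. c)"
  by (induction n arbitrary: c) auto

lemma Ck_bounded_linear: "bounded_linear f \<Longrightarrow> Ck n f"
proof (cases n)
  case (Suc m)
  assume f: "bounded_linear f"
  have d: "(f has_derivative f) (at x)" for x using f by (rule bounded_linear_imp_has_derivative)
  then have "frechet_derivative f (at x) = f" for x by (rule frechet_derivative_at[symmetric])
  then show ?thesis using f d
    by (auto simp: Suc Ck_const linear_continuous_on intro: differentiableI)
qed (auto simp: linear_continuous_on)

text \<open>Allows any explicit formula for the derivative in place of
  \<open>frechet_derivative\<close>, so that inductions on the order can work with formulas.\<close>

lemma Ck_SucI:
  assumes "\<And>x. (f has_derivative f' x) (at x)" "\<And>v. Ck n (\<lambda>x. f' x v)"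
  shows "Ck (Suc n) f"
proof -
  have "frechet_derivative f (at x) = f' x" for x using assms(1) by (rule frechet_derivative_at[symmetric])
  moreover have "continuous_on UNIV f"
    using assms(1) by (auto intro!: continuous_at_imp_continuous_on has_derivative_continuous)
  ultimately show ?thesis using assms by (auto intro: differentiableI)
qed

lemma Ck_SucD:
  assumes "Ck (Suc n) f"
  shows "(f has_derivative frechet_derivative f (at x)) (at x)" "Ck n (\<lambda>x. frechet_derivative f (at x) v)"
  using assms by (auto simp: frechet_derivative_works[symmetric])

lemma Ck_add: "Ck n f \<Longrightarrow> Ck n g \<Longrightarrow> Ck n (\<lambda>x. f x + g x)"
proof (induction n arbitrary: f g)
  case (Suc n)
  note f = Ck_SucD[OF Suc.prems(1)] and g = Ck_SucD[OF Suc.prems(2)]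
  show ?case by (rule Ck_SucI[OF has_derivative_add[OF f(1) g(1)] Suc.IH[OF f(2) g(2)]])
qed (auto intro: continuous_on_add)

lemma (in bounded_bilinear) Ck_bilinear: "Ck n f \<Longrightarrow> Ck n g \<Longrightarrow> Ck n (\<lambda>x. prod (f x) (g x))"
proof (induction n arbitrary: f g)
  case (Suc n)
  note f = Ck_SucD[OF Suc.prems(1)] and g = Ck_SucD[OF Suc.prems(2)]
  show ?case
    by (rule Ck_SucI[OF FDERIV[OF f(1) g(1)]])
       (intro Ck_add Suc.IH f(2) g(2) Ck_Suc_imp[OF Suc.prems(1)] Ck_Suc_imp[OF Suc.prems(2)])
qed (auto intro: continuous_on)

lemmas Ck_mult = bounded_bilinear.Ck_bilinear[OF bounded_bilinear_mult]

lemma Ck_affine: "Ck n f \<Longrightarrow> Ck n (\<lambda>x. f (a + c *\<^sub>R x))"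
proof (induction n arbitrary: f)
  case 0
  then show ?case by (auto intro!: continuous_on_compose2[of UNIV f] continuous_intros)
next
  case (Suc n)
  note f = Ck_SucD[OF Suc.prems]
  show ?case
  proof (rule Ck_SucI)
    show "((\<lambda>x. f (a + c *\<^sub>R x)) has_derivative (\<lambda>v. frechet_derivative f (at (a + c *\<^sub>R x)) (c *\<^sub>R v))) (at x)" for x
      by (rule has_derivative_compose[OF _ f(1), of "\<lambda>x. a + c *\<^sub>R x" "\<lambda>v. c *\<^sub>R v"]) (auto intro!: derivative_eq_intros)
    show "Ck n (\<lambda>x. frechet_derivative f (at (a + c *\<^sub>R x)) (c *\<^sub>R v))" for v by (rule Suc.IH[OF f(2)])
  qed
qed

lemma smooth_mult:
  fixes f g :: "'a::euclidean_space \<Rightarrow> complex"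
  shows "smooth f \<Longrightarrow> smooth g \<Longrightarrow> smooth (\<lambda>x. f x * g x)"
  by (simp add: smooth_def Ck_mult)

text \<open>The powers of s in the denominator are there because differentiation produces them: the
  family is closed under derivatives up to linear combinations, which is what an induction for
  smoothness needs.\<close>

definition flat_exp :: "nat \<Rightarrow> real \<Rightarrow> real" where
  "flat_exp m s = (if 0 < s then exp (- (1 / s)) / s ^ m else 0)"

text \<open>The term of order m + 2 of the exponential series gives exp(1/s) \<ge> s^(-m-2)/(m+2)!.
  Two surplus powers are kept so that the function is quadratically small at 0.\<close>

lemma flat_exp_le: "0 \<le> flat_exp m s" "flat_exp m s \<le> fact (m + 2) * s\<^sup>2"
proof -
  show "0 \<le> flat_exp m s" by (simp add: flat_exp_def)
  show "flat_exp m s \<le> fact (m + 2) * s\<^sup>2"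
  proof (cases "0 < s")
    case True
    have "(1 / s) ^ (m + 2) / fact (m + 2) \<le> exp (1 / s)"
      using True sum_le_suminf[OF summable_exp_generic[of "1 / s"], of "{m + 2}"]
      by (simp add: exp_def divide_inverse mult.commute)
    moreover have "1 / E \<le> N * P" if "1 / P / N \<le> E" "0 < E" "0 < P" "0 < N" for E P N :: real
      using that by (simp add: field_simps)
    ultimately have "1 / exp (1 / s) \<le> fact (m + 2) * s ^ (m + 2)"
      using True by (simp add: power_one_over del: fact_Suc power_Suc power_add_numeral add_2_eq_Suc')
    then have "exp (- (1 / s)) \<le> fact (m + 2) * s ^ (m + 2)" by (simp only: exp_minus inverse_eq_divide)
    then have "exp (- (1 / s)) / s ^ m \<le> fact (m + 2) * s ^ (m + 2) / s ^ m"
      using True by (intro divide_right_mono) auto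
    also have "\<dots> = fact (m + 2) * s\<^sup>2" using True by (simp add: power_add power2_eq_square)
    finally show ?thesis using True by (simp add: flat_exp_def)
  qed (auto simp: flat_exp_def)
qed

text \<open>Away from 0 this is calculus; at 0 the quadratic bound makes the difference quotient at
  most (m+2)! |h|.\<close>

lemma flat_exp_deriv:
  "(flat_exp m has_real_derivative flat_exp (m + 2) s - real m * flat_exp (m + 1) s) (at s)"
proof -
  consider "0 < s" | "s < 0" | "s = 0" by linarith
  then show ?thesis
  proof cases
    case 1
    have "((\<lambda>s. exp (- (1 / s)) / s ^ m) has_real_derivative flat_exp (m + 2) s - real m * flat_exp (m + 1) s) (at s)"
    proof -
      have e: "((\<lambda>s. exp (- (1 / s))) has_real_derivative exp (- (1 / s)) / s\<^sup>2) (at s)"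
        using 1 by (auto intro!: derivative_eq_intros simp: power2_eq_square)
      have p: "((\<lambda>s. inverse (s ^ m)) has_real_derivative - (real m * s ^ (m - 1)) / (s ^ m)\<^sup>2) (at s)"
        using 1 by (auto intro!: derivative_eq_intros simp: power2_eq_square field_simps)
      have r: "- (real m * s ^ (m - 1)) / (s ^ m)\<^sup>2 = - real m / s ^ (m + 1)"
        using 1 by (cases m) (auto simp: power2_eq_square field_simps)
      have "((\<lambda>s. exp (- (1 / s)) * inverse (s ^ m)) has_real_derivative
         (exp (- (1 / s)) / s\<^sup>2) * inverse (s ^ m) + (- real m / s ^ (m + 1)) * exp (- (1 / s))) (at s)"
        using DERIV_mult[OF e p] unfolding r .
      moreover have "(exp (- (1 / s)) / s\<^sup>2) * inverse (s ^ m) + (- real m / s ^ (m + 1)) * exp (- (1 / s))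
        = flat_exp (m + 2) s - real m * flat_exp (m + 1) s"
        using 1 by (simp add: flat_exp_def power_add divide_inverse power2_eq_square mult_ac)
      ultimately show ?thesis by (simp add: divide_inverse)
    qed
    then show ?thesis
      by (rule has_field_derivative_transform_within_open[where S="{0<..}"]) (use 1 in \<open>auto simp: flat_exp_def\<close>)
  next
    case 2
    have "((\<lambda>_. 0) has_real_derivative 0) (at s)" by simp
    then have "(flat_exp m has_real_derivative 0) (at s)"
      by (rule has_field_derivative_transform_within_open[where S="{..<0}"]) (use 2 in \<open>auto simp: flat_exp_def\<close>)
    then show ?thesis using 2 by (simp add: flat_exp_def)
  next
    case 3
    have "((\<lambda>h. (flat_exp m (0 + h) - flat_exp m 0) / h) \<longlongrightarrow> 0) (at 0)"
    proof (rule Lim_null_comparison)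
      show "\<forall>\<^sub>F h in at 0. norm ((flat_exp m (0 + h) - flat_exp m 0) / h) \<le> fact (m + 2) * \<bar>h\<bar>"
      proof (intro eventually_at_filter[THEN iffD2] always_eventually allI impI)
        fix h :: real assume "h \<noteq> 0"
        then show "norm ((flat_exp m (0 + h) - flat_exp m 0) / h) \<le> fact (m + 2) * \<bar>h\<bar>"
          using flat_exp_le[of m h] by (simp add: flat_exp_def[of m 0] pos_divide_le_eq mult.assoc abs_mult_self_eq power2_eq_square)
      qed
      show "((\<lambda>h. fact (m + 2) * \<bar>h\<bar>) \<longlongrightarrow> 0) (at (0::real))"
        by (rule tendsto_mult_right_zero) (simp add: tendsto_rabs_zero_iff tendsto_ident_at)
    qed
    then show ?thesis using 3 by (simp add: DERIV_def flat_exp_def)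
  qed
qed

text \<open>For m = 0 this is the standard bump exp(-1/(1 - |z|^2)) on the unit disc; larger m occur
  in its derivatives.\<close>

definition bump_pow :: "nat \<Rightarrow> complex \<Rightarrow> complex" where
  "bump_pow m z = of_real (flat_exp m (1 - (cmod z)\<^sup>2))"

abbreviation "bump \<equiv> bump_pow 0"

lemma bump_pow_deriv:
  "(bump_pow m has_derivative (\<lambda>v. (bump_pow (m + 2) z + of_real (- real m) * bump_pow (m + 1) z) * of_real (- 2 * (z \<bullet> v)))) (at z)"
proof -
  have i: "((\<lambda>z. 1 - z \<bullet> z) has_derivative (\<lambda>v. - (2 * (z \<bullet> v)))) (at z)"
    by (auto intro!: derivative_eq_intros simp: inner_commute)
  have "(flat_exp m has_derivative (*) (flat_exp (m + 2) (1 - z \<bullet> z) - real m * flat_exp (m + 1) (1 - z \<bullet> z))) (at (1 - z \<bullet> z))"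
    using flat_exp_deriv by (simp add: has_field_derivative_def)
  from has_derivative_of_real[OF has_derivative_compose[OF i this]]
  show ?thesis by (simp add: bump_pow_def[abs_def] power2_norm_eq_inner)
qed

text \<open>Each derivative raises the index m by one or two, so the induction on the order keeps m
  arbitrary.\<close>

lemma Ck_bump_pow: "Ck n (bump_pow m)"
proof (induction n arbitrary: m)
  case 0
  then show ?case
    using bump_pow_deriv by (auto intro!: continuous_at_imp_continuous_on has_derivative_continuous)
next
  case (Suc n)
  have "bounded_linear (\<lambda>z. complex_of_real (- 2 * (z \<bullet> v)))" for v :: complex
    by (intro bounded_linear_compose[OF bounded_linear_of_real] bounded_linear_const_mult bounded_linear_inner_left)
  then show ?case
    by (intro Ck_SucI[OF bump_pow_deriv] Ck_mult Ck_add Suc Ck_const Ck_bounded_linear)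
qed

lemma test_funI:
  assumes "smooth f" "\<And>z. R < cmod z \<Longrightarrow> f z = 0"
  shows "test_fun f"
proof -
  have "{z. f z \<noteq> 0} \<subseteq> cball 0 R" using assms(2) by (force simp: not_less)
  then have "bounded (closure {z. f z \<noteq> 0})"
    by (intro bounded_closure) (rule bounded_subset[OF bounded_cball])
  then show ?thesis using assms(1) by (simp add: test_fun_def compact_eq_bounded_closed)
qed

lemma test_fun_bump: "test_fun bump"
proof (rule test_funI[of _ 1])
  show "smooth bump" by (simp add: smooth_def Ck_bump_pow)
  fix z :: complex assume "1 < cmod z"
  then have "1\<^sup>2 < (cmod z)\<^sup>2" by (intro power_strict_mono) auto
  then show "bump z = 0" by (simp add: bump_pow_def flat_exp_def)
qed

lemma bump_outside: "1 \<le> cmod z \<Longrightarrow> bump_pow m z = 0"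
proof -
  assume "1 \<le> cmod z"
  then have "1\<^sup>2 \<le> (cmod z)\<^sup>2" by (intro power_mono) auto
  then show ?thesis by (simp add: bump_pow_def flat_exp_def)
qed

lemma test_fun_affine:
  assumes f: "test_fun f" and c: "c \<noteq> 0"
  shows "test_fun (\<lambda>z. f (a + c *\<^sub>R z))"
proof -
  obtain R where R: "0 < R" "\<And>z. R \<le> cmod z \<Longrightarrow> f z = 0" using test_fun_support[OF f] by blast
  show ?thesis
  proof (rule test_funI[of _ "(R + cmod a) / \<bar>c\<bar>"])
    show "smooth (\<lambda>z. f (a + c *\<^sub>R z))" using f by (simp add: test_fun_def smooth_def Ck_affine)
    fix z assume "(R + cmod a) / \<bar>c\<bar> < cmod z"
    then have "R + cmod a < cmod (c *\<^sub>R z)" using c by (simp add: field_simps)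
    then have "R \<le> cmod (a + c *\<^sub>R z)" using norm_diff_ineq[of "c *\<^sub>R z" a] by (simp add: add.commute)
    then show "f (a + c *\<^sub>R z) = 0" by (rule R(2))
  qed
qed

lemma test_fun_mult: "smooth g \<Longrightarrow> test_fun f \<Longrightarrow> test_fun (\<lambda>z. g z * f z)"
proof -
  assume g: "smooth g" and f: "test_fun f"
  obtain R where R: "0 < R" "\<And>z. R \<le> cmod z \<Longrightarrow> f z = 0" using test_fun_support[OF f] by blast
  show ?thesis by (rule test_funI[of _ R]) (use g f R in \<open>auto simp: test_fun_def smooth_mult\<close>)
qed

section \<open>Approximate identities\<close>

text \<open>By Vitali's covering theorem U is a countable disjoint union of balls, up to a Lebesgue
  null set, which \<open>ac\<close> makes null for \<open>N1\<close> as well. Countable additivity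
  carries the inequality from balls to U.\<close>

lemma open_emeasure_le:
  fixes N1 N2 :: "'a::euclidean_space measure"
  assumes sets: "sets N1 = sets borel" "sets N2 = sets borel"
    and ac: "absolutely_continuous lborel N1"
    and balls: "\<And>c r. 0 < r \<Longrightarrow> ball c r \<subseteq> U \<Longrightarrow> emeasure N1 (ball c r) \<le> emeasure N2 (ball c r)"
    and U: "open U"
  shows "emeasure N1 U \<le> emeasure N2 U"
proof -
  define K where "K = {(c, r). 0 < r \<and> ball c r \<subseteq> U}"
  have cover: "\<exists>i. i \<in> K \<and> x \<in> ball (fst i) (snd i) \<and> snd i < d" if x: "x \<in> U" and d: "0 < d" for x d
  proof -
    obtain e where e: "0 < e" "ball x e \<subseteq> U" by (rule openE[OF U x])
    \<comment> \<open>The cap d/2 on the radius meets the demand of the covering theorem for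
      arbitrarily small balls around each point.\<close>
    have "ball x (min e (d/2)) \<subseteq> U" using e(2) subset_ball[of "min e (d/2)" e x] by force
    then have "(x, min e (d/2)) \<in> K" using e(1) d by (simp add: K_def)
    then show ?thesis using e(1) d by (intro exI[of _ "(x, min e (d/2))"]) simp
  qed
  obtain C where C: "countable C" "C \<subseteq> K"
     "pairwise (\<lambda>i j. disjnt (ball (fst i) (snd i)) (ball (fst j) (snd j))) C"
     "negligible (U - (\<Union>i\<in>C. ball (fst i) (snd i)))"
  proof (rule Vitali_covering_theorem_balls[of U K fst snd, OF cover])
    fix C assume "countable C" "C \<subseteq> K"
     "pairwise (\<lambda>i j. disjnt (ball (fst i) (snd i)) (ball (fst j) (snd j))) C"
     "negligible (U - (\<Union>i\<in>C. ball (fst i) (snd i)))"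
    then show thesis by (rule that)
  qed
  let ?V = "\<Union>i\<in>C. ball (fst i) (snd i)"
  have VU: "?V \<subseteq> U"
  proof (rule UN_least)
    fix i assume "i \<in> C"
    then show "ball (fst i) (snd i) \<subseteq> U" using subsetD[OF C(2)] by (simp add: K_def case_prod_beta)
  qed
  have Vo: "open ?V" by auto
  have "U - ?V \<in> null_sets lborel"
  proof -
    have "U - ?V \<in> null_sets lebesgue" using C(4) by (simp add: negligible_iff_null_sets)
    moreover have "U - ?V \<in> sets lborel" using U Vo by auto
    ultimately show ?thesis by (simp add: null_sets_completion_iff)
  qed
  then have null: "U - ?V \<in> null_sets N1" using ac by (auto simp: absolutely_continuous_def)
  have dj: "disjoint_family_on (\<lambda>i. ball (fst i) (snd i)) C"
    using C(3) by (simp add: disjoint_family_on_def pairwise_def disjnt_def)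
  have "emeasure N1 U = emeasure N1 ?V"
  proof -
    have "U = ?V \<union> (U - ?V)" using VU by auto
    then show ?thesis using emeasure_Un_null_set[OF _ null, of ?V] Vo sets by auto
  qed
  also have "\<dots> = (\<integral>\<^sup>+i. emeasure N1 (ball (fst i) (snd i)) \<partial>count_space C)"
    by (rule emeasure_UN_countable[OF _ C(1) dj]) (auto simp: sets)
  also have "\<dots> \<le> (\<integral>\<^sup>+i. emeasure N2 (ball (fst i) (snd i)) \<partial>count_space C)"
  proof (intro nn_integral_mono balls)
    fix i assume "i \<in> space (count_space C)"
    then have "i \<in> K" using C(2) by auto
    then show "0 < snd i" "ball (fst i) (snd i) \<subseteq> U" by (simp_all add: K_def case_prod_beta)
  qed
  also have "\<dots> = emeasure N2 ?V"
    by (rule emeasure_UN_countable[OF _ C(1) dj, symmetric]) (auto simp: sets)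
  also have "\<dots> \<le> emeasure N2 U" using VU U sets by (intro emeasure_mono) auto
  finally show ?thesis .
qed

text \<open>Inside a large ball the positive and negative parts of f are densities of finite
  measures. The hypothesis compares them on balls, the covering argument on open sets, and outer
  regularity on the set where f is negative; the first measure vanishes there, hence so does the
  second.\<close>

lemma AE_nonneg_of_ball_integrals:
  fixes f :: "'a::euclidean_space \<Rightarrow> real"
  assumes f[measurable]: "f \<in> borel_measurable borel"
    and int: "\<And>R. integrable lborel (\<lambda>z. indicator (ball 0 R) z * f z)"
    and balls: "\<And>c r. 0 < r \<Longrightarrow> 0 \<le> (\<integral>z. indicator (ball c r) z * f z \<partial>lborel)"
  shows "AE z in lborel. 0 \<le> f z"
proof -
  have main: "AE z in lborel. z \<in> ball 0 R \<longrightarrow> 0 \<le> f z" for R :: real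
  proof -
    let ?B = "ball (0::'a) R"
    have [measurable]: "?B \<in> sets borel" by simp
    define p where "p z = ennreal (indicator ?B z * f z)" for z
    define m where "m z = ennreal (- (indicator ?B z * f z))" for z
    have [measurable]: "p \<in> borel_measurable borel" "m \<in> borel_measurable borel" unfolding p_def m_def by measurable
    define Np where "Np = density lborel p"
    define Nm where "Nm = density lborel m"
    have sets: "sets Np = sets borel" "sets Nm = sets borel" by (auto simp: Np_def Nm_def)
    have fin: "(\<integral>\<^sup>+z. p z \<partial>lborel) < \<infinity>" "(\<integral>\<^sup>+z. m z \<partial>lborel) < \<infinity>"
      using int[of R] by (auto simp: real_integrable_def p_def m_def less_top)
    have ac: "absolutely_continuous lborel Nm" unfolding Nm_def by (rule absolutely_continuousI_density) measurable
    have b: "emeasure Nm (ball c r) \<le> emeasure Np (ball c r)" if "0 < r" "ball c r \<subseteq> ?B" for c r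
    proof -
      have [measurable]: "ball c r \<in> sets borel" by simp
      let ?g = "\<lambda>z. indicator (ball c r) z * f z"
      have "integrable lborel (\<lambda>z. indicator (ball c r) z * (indicator ?B z * f z))"
        by (rule Bochner_Integration.integrable_bound[OF int[of R]]) (auto simp: indicator_def)
      moreover have "(\<lambda>z. indicator (ball c r) z * (indicator ?B z * f z)) = ?g"
      proof
        fix z show "indicator (ball c r) z * (indicator ?B z * f z) = ?g z"
          using that(2) by (cases "z \<in> ball c r") (auto simp del: mem_ball mem_ball_0)
      qed
      ultimately have ig: "integrable lborel ?g" by simp
      have eqs: "emeasure Np (ball c r) = (\<integral>\<^sup>+z. ennreal (?g z) \<partial>lborel)" "emeasure Nm (ball c r) = (\<integral>\<^sup>+z. ennreal (- ?g z) \<partial>lborel)"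
      proof -
        have "p z * indicator (ball c r) z = ennreal (?g z)" "m z * indicator (ball c r) z = ennreal (- ?g z)" for z
          using that(2) by (cases "z \<in> ball c r"; auto simp: p_def m_def simp del: mem_ball mem_ball_0)+
        then show "emeasure Np (ball c r) = (\<integral>\<^sup>+z. ennreal (?g z) \<partial>lborel)" "emeasure Nm (ball c r) = (\<integral>\<^sup>+z. ennreal (- ?g z) \<partial>lborel)"
          unfolding Np_def Nm_def by (simp_all add: emeasure_density)
      qed
      have fin2: "(\<integral>\<^sup>+z. ennreal (?g z) \<partial>lborel) < \<infinity>" "(\<integral>\<^sup>+z. ennreal (- ?g z) \<partial>lborel) < \<infinity>"
        using ig by (auto simp: real_integrable_def less_top)
      have "0 \<le> enn2real (\<integral>\<^sup>+z. ennreal (?g z) \<partial>lborel) - enn2real (\<integral>\<^sup>+z. ennreal (- ?g z) \<partial>lborel)"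
        using balls[OF that(1), of c] real_lebesgue_integral_def[OF ig] by simp
      then have "enn2real (\<integral>\<^sup>+z. ennreal (- ?g z) \<partial>lborel) \<le> enn2real (\<integral>\<^sup>+z. ennreal (?g z) \<partial>lborel)" by simp
      then have "ennreal (enn2real (\<integral>\<^sup>+z. ennreal (- ?g z) \<partial>lborel)) \<le> ennreal (enn2real (\<integral>\<^sup>+z. ennreal (?g z) \<partial>lborel))"
        by (rule ennreal_leI)
      then show ?thesis using fin2 by (simp only: eqs ennreal_enn2real infinity_ennreal_def)
    qed
    define S where "S = {z \<in> ?B. f z < 0}"
    have [measurable]: "S \<in> sets borel" unfolding S_def by measurable
    have NpS: "emeasure Np S = 0"
      unfolding Np_def by (auto simp: emeasure_density nn_integral_0_iff_AE p_def S_def indicator_def ennreal_eq_0_iff)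
    have "emeasure Np (space Np) \<noteq> \<infinity>" using fin(1) by (simp add: Np_def emeasure_density)
    then have outer: "emeasure Np S = (INF U\<in>{U. S \<subseteq> U \<and> open U}. emeasure Np U)"
      by (intro outer_regular) (auto simp: sets)
    have "emeasure Nm S \<le> emeasure Np U" if "S \<subseteq> U" "open U" for U
    proof -
      have "emeasure Nm S \<le> emeasure Nm (U \<inter> ?B)" using that sets by (intro emeasure_mono) (auto simp: S_def)
      also have "\<dots> \<le> emeasure Np (U \<inter> ?B)"
      proof (rule open_emeasure_le[OF sets(2,1) ac])
        fix c r assume r: "0 < r" and "ball c r \<subseteq> U \<inter> ?B"
        then have "ball c r \<subseteq> ?B" by blast
        with r show "emeasure Nm (ball c r) \<le> emeasure Np (ball c r)" by (rule b)
      qed (intro open_Int open_ball that)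
      also have "\<dots> \<le> emeasure Np U" using that sets by (intro emeasure_mono) auto
      finally show ?thesis .
    qed
    then have "emeasure Nm S \<le> (INF U\<in>{U. S \<subseteq> U \<and> open U}. emeasure Np U)"
      by (intro INF_greatest) simp
    then have "emeasure Nm S \<le> 0" unfolding outer[symmetric] NpS .
    then have "(\<integral>\<^sup>+z. m z * indicator S z \<partial>lborel) = 0" by (simp add: Nm_def emeasure_density)
    then have "AE z in lborel. m z * indicator S z = 0" by (subst (asm) nn_integral_0_iff_AE) auto
    then show ?thesis
    proof eventually_elim
      case (elim z)
      then show ?case by (auto simp: m_def S_def indicator_def ennreal_eq_0_iff split: if_splits)
    qed
  qed
  have "AE z in lborel. \<forall>n::nat. z \<in> ball 0 (real n) \<longrightarrow> 0 \<le> f z" using main by (subst AE_all_countable) auto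
  then show ?thesis
  proof eventually_elim
    case (elim z)
    obtain n :: nat where "norm z < real n" using reals_Archimedean2 by blast
    then show ?case using elim by auto
  qed
qed

text \<open>Nonnegativity is applied to C minus each of Re u, -Re u, Im u and -Im u; the factor 2 is
  |u| \<le> |Re u| + |Im u|. At C = 0 it says that a function with vanishing ball integrals is
  null.\<close>

lemma AE_bounded_of_ball_integrals:
  fixes u :: "complex \<Rightarrow> complex"
  assumes u[measurable]: "u \<in> borel_measurable borel"
    and int: "\<And>R. integrable lborel (\<lambda>z. indicator (ball 0 R) z *\<^sub>R u z)"
    and balls: "\<And>c r. 0 < r \<Longrightarrow> cmod (\<integral>z. indicator (ball c r) z *\<^sub>R u z \<partial>lborel) \<le> C * measure lborel (ball c r)"
  shows "AE z in lborel. cmod (u z) \<le> 2 * C"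
proof -
  have [measurable]: "ball c r \<in> sets borel" for c :: complex and r by simp
  have int': "integrable lborel (\<lambda>z. indicator (ball c r) z *\<^sub>R u z)" for c r
  proof (rule Bochner_Integration.integrable_bound[OF int[of "cmod c + r"]])
    show "AE z in lborel. norm (indicator (ball c r) z *\<^sub>R u z) \<le> norm (indicator (ball 0 (cmod c + r)) z *\<^sub>R u z)"
    proof (intro AE_I2)
      fix z
      have "z \<in> ball c r \<Longrightarrow> z \<in> ball 0 (cmod c + r)" using norm_triangle_ineq[of c "z - c"] by (auto simp: dist_norm norm_minus_commute)
      then show "norm (indicator (ball c r) z *\<^sub>R u z) \<le> norm (indicator (ball 0 (cmod c + r)) z *\<^sub>R u z)" by (auto simp: indicator_def)
    qed
  qed auto
  have one: "AE z in lborel. 0 \<le> C - \<theta> (u z)" if \<theta>: "bounded_linear \<theta>" "\<And>w. \<theta> w \<le> cmod w" for \<theta> :: "complex \<Rightarrow> real"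
  proof (rule AE_nonneg_of_ball_integrals)
    interpret \<theta>: bounded_linear \<theta> by fact
    have [measurable]: "\<theta> \<in> borel_measurable borel" by (intro borel_measurable_continuous_onI linear_continuous_on \<theta>(1))
    show "(\<lambda>z. C - \<theta> (u z)) \<in> borel_measurable borel" by measurable
    have i1: "integrable lborel (\<lambda>z. \<theta> (indicator (ball c r) z *\<^sub>R u z))" for c r by (rule integrable_bounded_linear[OF \<theta>(1) int'])
    have i2: "integrable lborel (\<lambda>z. indicator (ball c r) z * C)" for c :: complex and r using integrable_ball_indicator[of c r C] by simp
    have eq: "indicator (ball c r) z * (C - \<theta> (u z)) = indicator (ball c r) z * C - \<theta> (indicator (ball c r) z *\<^sub>R u z)" for c r z
      by (simp add: \<theta>.scaleR algebra_simps)
    show "integrable lborel (\<lambda>z. indicator (ball 0 R) z * (C - \<theta> (u z)))" for R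
      unfolding eq by (intro Bochner_Integration.integrable_diff i1 i2)
    fix c :: complex and r :: real assume r: "0 < r"
    have "(\<integral>z. \<theta> (indicator (ball c r) z *\<^sub>R u z) \<partial>lborel) = \<theta> (\<integral>z. indicator (ball c r) z *\<^sub>R u z \<partial>lborel)"
      by (rule integral_bounded_linear[OF \<theta>(1) int'])
    also have "\<dots> \<le> C * measure lborel (ball c r)" using \<theta>(2) balls[OF r, of c] by (rule order_trans)
    finally have "(\<integral>z. \<theta> (indicator (ball c r) z *\<^sub>R u z) \<partial>lborel) \<le> C * measure lborel (ball c r)" .
    moreover have "(\<integral>z. indicator (ball c r) z * C \<partial>lborel) = C * measure lborel (ball c r)" by simp
    ultimately show "0 \<le> (\<integral>z. indicator (ball c r) z * (C - \<theta> (u z)) \<partial>lborel)"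
      unfolding eq using i1[of c r] i2[of c r] by (simp add: mult.commute)
  qed
  have "AE z in lborel. 0 \<le> C - Re (u z)" by (intro one bounded_linear_Re complex_Re_le_cmod)
  moreover have "AE z in lborel. 0 \<le> C - - Re (u z)"
    by (intro one bounded_linear_minus bounded_linear_Re) (use abs_Re_le_cmod in \<open>smt (verit)\<close>)
  moreover have "AE z in lborel. 0 \<le> C - Im (u z)"
    by (intro one bounded_linear_Im) (use abs_Im_le_cmod in \<open>smt (verit)\<close>)
  moreover have "AE z in lborel. 0 \<le> C - - Im (u z)"
    by (intro one bounded_linear_minus bounded_linear_Im) (use abs_Im_le_cmod in \<open>smt (verit)\<close>)
  ultimately show ?thesis
  proof eventually_elim
    case (elim z)
    then have "\<bar>Re (u z)\<bar> \<le> C" "\<bar>Im (u z)\<bar> \<le> C" by auto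
    then show ?case using cmod_le[of "u z"] by linarith
  qed
qed

text \<open>Convergence of smoothings of u, tested on one ball only. Fubini turns the left side into
  the integral of U(t y) K(y), where U(s) integrates a translate of u over the ball, and U is
  continuous at 0 by L1 continuity of translations. As K need not have bounded support, the majorant
  comes from the bound \<open>S\<close>, uniform in the translation.\<close>

lemma approximate_identity_ball:
  fixes u K :: "complex \<Rightarrow> complex"
  assumes u[measurable]: "u \<in> borel_measurable borel"
    and int: "\<And>R. integrable lborel (\<lambda>z. indicator (ball 0 R) z *\<^sub>R u z)"
    and S: "\<And>s. (\<integral>\<^sup>+a. indicator (ball c r) a * ennreal (cmod (u (a + s))) \<partial>lborel) \<le> ennreal S" "0 \<le> S"
    and K: "integrable lborel K"
    and t: "t \<longlonglongrightarrow> 0"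
  shows "(\<lambda>n. \<integral>a. indicator (ball c r) a *\<^sub>R (\<integral>y. u (a + t n *\<^sub>R y) * K y \<partial>lborel) \<partial>lborel)
     \<longlonglongrightarrow> (\<integral>y. K y \<partial>lborel) * (\<integral>a. indicator (ball c r) a *\<^sub>R u a \<partial>lborel)"
proof -
  have [measurable]: "ball c r \<in> sets borel" by simp
  have [measurable]: "K \<in> borel_measurable borel" using K by (auto dest: borel_measurable_integrable)
  define U where "U s = (\<integral>a. indicator (ball c r) a *\<^sub>R u (a + s) \<partial>lborel)" for s
  have U_meas[measurable]: "U \<in> borel_measurable borel" unfolding U_def by measurable
  have U_le: "cmod (U s) \<le> S" for s
  proof -
    have "ennreal (cmod (U s)) \<le> (\<integral>\<^sup>+a. ennreal (norm (indicator (ball c r) a *\<^sub>R u (a + s))) \<partial>lborel)"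
      unfolding U_def by (rule ennreal_norm_integral_le)
    also have "\<dots> = (\<integral>\<^sup>+a. indicator (ball c r) a * ennreal (cmod (u (a + s))) \<partial>lborel)"
      by (intro nn_integral_cong) (auto simp: indicator_def)
    also have "\<dots> \<le> ennreal S" by (rule S)
    finally show ?thesis using S(2) by (simp add: ennreal_le_iff)
  qed
  have swap: "(\<integral>a. indicator (ball c r) a *\<^sub>R (\<integral>y. u (a + s *\<^sub>R y) * K y \<partial>lborel) \<partial>lborel) = (\<integral>y. U (s *\<^sub>R y) * K y \<partial>lborel)" for s
  proof -
    let ?f = "\<lambda>a y. indicator (ball c r) a *\<^sub>R (u (a + s *\<^sub>R y) * K y)"
    have int: "integrable (lborel \<Otimes>\<^sub>M lborel) (\<lambda>(a, y). ?f a y)"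
    proof (intro integrableI_bounded)
      have "(\<integral>\<^sup>+p. ennreal (norm (case p of (a, y) \<Rightarrow> ?f a y)) \<partial>(lborel \<Otimes>\<^sub>M lborel))
        = (\<integral>\<^sup>+y. (\<integral>\<^sup>+a. (indicator (ball c r) a * ennreal (cmod (u (a + s *\<^sub>R y)))) * ennreal (cmod (K y)) \<partial>lborel) \<partial>lborel)"
        by (subst lborel_pair.nn_integral_snd[symmetric], measurable)
           (auto simp: norm_mult ennreal_mult indicator_def intro!: nn_integral_cong)
      also have "\<dots> = (\<integral>\<^sup>+y. (\<integral>\<^sup>+a. (indicator (ball c r) a * ennreal (cmod (u (a + s *\<^sub>R y)))) \<partial>lborel) * ennreal (cmod (K y)) \<partial>lborel)"
        by (intro nn_integral_cong nn_integral_multc) measurable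
      also have "\<dots> \<le> (\<integral>\<^sup>+y. ennreal S * ennreal (cmod (K y)) \<partial>lborel)"
        by (intro nn_integral_mono mult_right_mono S) auto
      also have "\<dots> = ennreal S * (\<integral>\<^sup>+y. ennreal (cmod (K y)) \<partial>lborel)" by (rule nn_integral_cmult) measurable
      also have "\<dots> < \<infinity>" using K by (auto simp: integrable_iff_bounded ennreal_mult_less_top)
      finally show "(\<integral>\<^sup>+p. ennreal (norm (case p of (a, y) \<Rightarrow> ?f a y)) \<partial>(lborel \<Otimes>\<^sub>M lborel)) < \<infinity>" .
    qed measurable
    have "(\<integral>a. indicator (ball c r) a *\<^sub>R (\<integral>y. u (a + s *\<^sub>R y) * K y \<partial>lborel) \<partial>lborel) = (\<integral>a. (\<integral>y. ?f a y \<partial>lborel) \<partial>lborel)"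
      by simp
    also have "\<dots> = (\<integral>y. (\<integral>a. ?f a y \<partial>lborel) \<partial>lborel)" by (rule lborel_pair.Fubini_integral[symmetric, OF int])
    also have "\<dots> = (\<integral>y. U (s *\<^sub>R y) * K y \<partial>lborel)"
      unfolding U_def by (simp only: integral_mult_left_zero[symmetric] mult_scaleR_left)
    finally show ?thesis .
  qed
  have U_lim: "(\<lambda>n. U (s n)) \<longlonglongrightarrow> U 0" if s: "s \<longlonglongrightarrow> 0" for s
  proof -
    \<comment> \<open>The additional 1 leaves room for translations by less than 1, for which u may
      be replaced by its integrable truncation \<open>v\<close>.\<close>
    define R where "R = cmod c + \<bar>r\<bar> + 1"
    define v where "v z = indicator (ball 0 R) z *\<^sub>R u z" for z
    have v: "integrable lborel v" unfolding v_def by (rule int)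
    have v_eq: "indicator (ball c r) a *\<^sub>R u (a + x) = indicator (ball c r) a *\<^sub>R v (a + x)" if "cmod x < 1" for a x
    proof (cases "a \<in> ball c r")
      case True
      have "cmod (a + x) \<le> cmod c + cmod (a - c) + cmod x"
        using norm_triangle_ineq[of "c + (a - c)" x] norm_triangle_ineq[of c "a - c"] by simp
      then have "cmod (a + x) < R" using True that by (simp add: R_def dist_norm norm_minus_commute)
      then show ?thesis by (simp add: v_def)
    qed simp
    have iv: "integrable lborel (\<lambda>a. indicator (ball c r) a *\<^sub>R v (a + x))" for x
    proof -
      have "integrable lborel (\<lambda>a. v (a + x))" using v integrable_lborel_translate[of v] by simp
      then show ?thesis by (rule Bochner_Integration.integrable_bound) (use v in \<open>auto simp: indicator_def dest!: borel_measurable_integrable\<close>)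
    qed
    have "(\<lambda>n. U (s n) - U 0) \<longlonglongrightarrow> 0"
    proof (rule Lim_null_comparison)
      show "(\<lambda>n. \<integral>a. norm (v (a + s n) - v a) \<partial>lborel) \<longlonglongrightarrow> 0" by (rule L1_translation[OF v s])
      have "\<forall>\<^sub>F n in sequentially. cmod (s n) < 1"
        using order_tendstoD(2)[OF tendsto_norm_zero[OF s], of 1] by simp
      then show "\<forall>\<^sub>F n in sequentially. norm (U (s n) - U 0) \<le> (\<integral>a. norm (v (a + s n) - v a) \<partial>lborel)"
      proof eventually_elim
        case (elim n)
        have "U (s n) - U 0 = (\<integral>a. indicator (ball c r) a *\<^sub>R v (a + s n) \<partial>lborel) - (\<integral>a. indicator (ball c r) a *\<^sub>R v (a + 0) \<partial>lborel)"
        proof -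
          have z: "cmod 0 < 1" by simp
          show ?thesis unfolding U_def v_eq[OF elim] v_eq[OF z] ..
        qed
        also have "\<dots> = (\<integral>a. indicator (ball c r) a *\<^sub>R v (a + s n) - indicator (ball c r) a *\<^sub>R v (a + 0) \<partial>lborel)"
          using iv by (intro Bochner_Integration.integral_diff[symmetric])
        also have "norm \<dots> \<le> (\<integral>a. norm (indicator (ball c r) a *\<^sub>R v (a + s n) - indicator (ball c r) a *\<^sub>R v (a + 0)) \<partial>lborel)"
          by (rule integral_norm_bound)
        also have "\<dots> \<le> (\<integral>a. norm (v (a + s n) - v a) \<partial>lborel)"
        proof (rule integral_mono)
          show "integrable lborel (\<lambda>a. norm (indicator (ball c r) a *\<^sub>R v (a + s n) - indicator (ball c r) a *\<^sub>R v (a + 0)))"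
            by (intro integrable_norm Bochner_Integration.integrable_diff iv)
          show "integrable lborel (\<lambda>a. norm (v (a + s n) - v a))" using v integrable_lborel_translate[of v] by auto
        qed (auto simp: indicator_def)
        finally show ?case .
      qed
    qed
    then show ?thesis by (simp add: LIM_zero_iff)
  qed
  have "(\<lambda>n. \<integral>y. U (t n *\<^sub>R y) * K y \<partial>lborel) \<longlonglongrightarrow> (\<integral>y. U 0 * K y \<partial>lborel)"
  proof (rule integral_dominated_convergence[where w="\<lambda>y. S * cmod (K y)"])
    show "AE y in lborel. (\<lambda>n. U (t n *\<^sub>R y) * K y) \<longlonglongrightarrow> U 0 * K y"
    proof (intro AE_I2 tendsto_mult tendsto_const U_lim)
      fix y :: complex
      have "(\<lambda>n. t n *\<^sub>R y) \<longlonglongrightarrow> 0 *\<^sub>R y" by (intro tendsto_intros t)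
      then show "(\<lambda>n. t n *\<^sub>R y) \<longlonglongrightarrow> 0" by simp
    qed
    show "AE y in lborel. norm (U (t n *\<^sub>R y) * K y) \<le> S * cmod (K y)" for n
      by (intro AE_I2) (simp add: norm_mult mult_right_mono U_le)
  qed (use K in auto)
  then show ?thesis unfolding swap by (simp add: U_def mult.commute)
qed

text \<open>A pointwise bound on all smoothings survives in the limit as a bound on the ball
  integral of u. Both the Liouville theorem and the Sobolev embedding use the approximate identity
  in this form.\<close>

lemma approximate_identity_bound:
  fixes u K :: "complex \<Rightarrow> complex"
  assumes u[measurable]: "u \<in> borel_measurable borel"
    and int: "\<And>R. integrable lborel (\<lambda>z. indicator (ball 0 R) z *\<^sub>R u z)"
    and S: "\<And>s. (\<integral>\<^sup>+a. indicator (ball c r) a * ennreal (cmod (u (a + s))) \<partial>lborel) \<le> ennreal S" "0 \<le> S"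
    and K: "integrable lborel K"
    and bound: "\<And>a t. a \<in> ball c r \<Longrightarrow> 0 < t \<Longrightarrow> t \<le> 1 \<Longrightarrow> cmod (\<integral>y. u (a + t *\<^sub>R y) * K y \<partial>lborel) \<le> C"
    and C: "0 \<le> C"
  shows "cmod (\<integral>y. K y \<partial>lborel) * cmod (\<integral>a. indicator (ball c r) a *\<^sub>R u a \<partial>lborel) \<le> C * measure lborel (ball c r)"
proof -
  define t where "t n = 1 / (real n + 1)" for n :: nat
  have t: "0 < t n" "t n \<le> 1" for n by (auto simp: t_def)
  have t_lim: "t \<longlonglongrightarrow> 0" unfolding t_def using LIMSEQ_inverse_real_of_nat by (simp add: inverse_eq_divide add.commute)
  note lim = approximate_identity_ball[OF u int S K t_lim]
  have "cmod (\<integral>a. indicator (ball c r) a *\<^sub>R (\<integral>y. u (a + t n *\<^sub>R y) * K y \<partial>lborel) \<partial>lborel) \<le> C * measure lborel (ball c r)" for n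
  proof -
    have "cmod (\<integral>a. indicator (ball c r) a *\<^sub>R (\<integral>y. u (a + t n *\<^sub>R y) * K y \<partial>lborel) \<partial>lborel)
      \<le> (\<integral>a. norm (indicator (ball c r) a *\<^sub>R (\<integral>y. u (a + t n *\<^sub>R y) * K y \<partial>lborel)) \<partial>lborel)"
      by (rule integral_norm_bound)
    also have "\<dots> \<le> (\<integral>a. indicator (ball c r) a *\<^sub>R C \<partial>lborel)"
      using bound t C by (intro integral_mono' integrable_ball_indicator) (auto simp: indicator_def)
    also have "\<dots> = C * measure lborel (ball c r)" by simp
    finally show ?thesis .
  qed
  then have "cmod ((\<integral>y. K y \<partial>lborel) * (\<integral>a. indicator (ball c r) a *\<^sub>R u a \<partial>lborel)) \<le> C * measure lborel (ball c r)"
    by (intro LIMSEQ_le_const2[OF tendsto_norm[OF lim]]) auto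
  then show ?thesis by (simp add: norm_mult)
qed

section \<open>A Liouville theorem for weak solutions\<close>

lemma integral_lborel_affine:
  fixes f :: "'a::euclidean_space \<Rightarrow> 'b::{banach, second_countable_topology}"
  assumes [measurable]: "f \<in> borel_measurable borel" and t: "t \<noteq> 0"
  shows "(\<integral>x. f x \<partial>lborel) = \<bar>t\<bar> ^ DIM('a) *\<^sub>R (\<integral>x. f (c + t *\<^sub>R x) \<partial>lborel)"
  by (subst lborel_affine[OF t, of c]) (simp add: integral_density integral_distr)

lemma ennreal_power2_le_imp_le:
  fixes a b :: ennreal
  assumes "a\<^sup>2 \<le> b\<^sup>2" shows "a \<le> b"
proof (cases "b = \<infinity>")
  case False
  then have "b\<^sup>2 < \<infinity>" by (auto simp: power2_eq_square ennreal_mult_less_top less_top)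
  from ennreal_power2_less_topD[OF le_less_trans[OF assms this]] have "a < \<infinity>" .
  then obtain x y where xy: "a = ennreal x" "b = ennreal y" "0 \<le> x" "0 \<le> y"
    using False by (cases a; cases b) auto
  then have "x\<^sup>2 \<le> y\<^sup>2" using assms by (simp add: ennreal_power)
  then have "x \<le> y" using xy(4) by (rule power2_le_imp_le)
  then show ?thesis unfolding xy by (rule ennreal_leI)
qed simp

lemma flat_exp_le_1: "flat_exp 0 s \<le> 1"
  by (simp add: flat_exp_def)

lemma flat_exp_0_mono: "s \<le> s' \<Longrightarrow> flat_exp 0 s \<le> flat_exp 0 s'"
  by (auto simp: flat_exp_def frac_le)

lemma flat_exp_measurable [measurable]: "flat_exp m \<in> borel_measurable borel"
  unfolding flat_exp_def[abs_def] by measurable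

lemma flat_exp_bounded: "s \<le> 1 \<Longrightarrow> flat_exp m s \<le> fact (m + 2)"
proof (cases "0 < s")
  case True
  assume "s \<le> 1"
  then have "s\<^sup>2 \<le> 1" using True by (simp add: power_le_one)
  then have "fact (m + 2) * s\<^sup>2 \<le> fact (m + 2) * 1" by (intro mult_left_mono) auto
  then show ?thesis using flat_exp_le(2)[of m s] by linarith
qed (simp add: flat_exp_def)

lemma bump_real: "bump z = of_real (flat_exp 0 (1 - (cmod z)\<^sup>2))"
  by (simp add: bump_pow_def)

lemma bump_lower: "cmod z \<le> 1 / 2 \<Longrightarrow> flat_exp 0 (3 / 4) \<le> flat_exp 0 (1 - (cmod z)\<^sup>2)"
proof (rule flat_exp_0_mono)
  assume "cmod z \<le> 1 / 2"
  then have "(cmod z)\<^sup>2 \<le> (1 / 2)\<^sup>2" by (intro power_mono) auto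
  then show "3 / 4 \<le> 1 - (cmod z)\<^sup>2" by (simp add: power2_eq_square)
qed

lemma integral_bump_pos: "0 < (\<integral>z. flat_exp 0 (1 - (cmod z)\<^sup>2) \<partial>lborel)"
proof -
  have i: "integrable lborel (\<lambda>z. flat_exp 0 (1 - (cmod z)\<^sup>2))"
    using integrable_Re[OF test_fun_integrable[OF test_fun_bump]] by (simp add: bump_real)
  have "0 < flat_exp 0 (3 / 4) * measure lborel (ball (0::complex) (1 / 2))"
    by (simp add: flat_exp_def measure_def emeasure_complex_ball)
  also have "\<dots> = (\<integral>z. indicator (ball (0::complex) (1 / 2)) z *\<^sub>R flat_exp 0 (3 / 4) \<partial>lborel)" by simp
  also have "\<dots> \<le> (\<integral>z. flat_exp 0 (1 - (cmod z)\<^sup>2) \<partial>lborel)"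
    by (rule integral_mono[OF integrable_ball_indicator i]) (auto simp: indicator_def flat_exp_le intro!: bump_lower)
  finally show ?thesis .
qed

text \<open>X is a scale factor, used with 1 and with R^(-2). In the latter case the right-hand side
  stays bounded as R grows but does not decay, because the integral of <z>^2 over a disc grows like
  R^4.\<close>

lemma ball_weight:
  assumes "0 \<le> R" "0 \<le> X"
  shows "(\<integral>\<^sup>+z. (ennreal (X * (indicator (ball a R) z * jbr z)))\<^sup>2 \<partial>lborel) \<le> ennreal (X\<^sup>2 * ((1 + (cmod a + R)\<^sup>2) * (pi * R\<^sup>2)))"
proof -
  have [measurable]: "ball a R \<in> sets borel" by simp
  have "(\<integral>\<^sup>+z. (ennreal (X * (indicator (ball a R) z * jbr z)))\<^sup>2 \<partial>lborel) \<le> (\<integral>\<^sup>+z. ennreal (X\<^sup>2 * (1 + (cmod a + R)\<^sup>2)) * indicator (ball a R) z \<partial>lborel)"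
  proof (rule nn_integral_mono)
    fix z
    show "(ennreal (X * (indicator (ball a R) z * jbr z)))\<^sup>2 \<le> ennreal (X\<^sup>2 * (1 + (cmod a + R)\<^sup>2)) * indicator (ball a R) z"
    proof (cases "z \<in> ball a R")
      case True
      have "cmod z \<le> cmod a + R" using True norm_triangle_ineq[of a "z - a"] by (simp add: dist_norm norm_minus_commute)
      then have "(cmod z)\<^sup>2 \<le> (cmod a + R)\<^sup>2" by (intro power_mono) auto
      then have "X\<^sup>2 * (jbr z)\<^sup>2 \<le> X\<^sup>2 * (1 + (cmod a + R)\<^sup>2)" by (intro mult_left_mono) (auto simp: jbr_power2)
      then have "(X * jbr z)\<^sup>2 \<le> X\<^sup>2 * (1 + (cmod a + R)\<^sup>2)" by (simp only: power_mult_distrib)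
      then show ?thesis using True assms by (simp add: ennreal_power ennreal_leI del: mem_ball)
    qed simp
  qed
  also have "\<dots> = ennreal (X\<^sup>2 * (1 + (cmod a + R)\<^sup>2)) * ennreal (pi * R\<^sup>2)"
    using assms by (simp add: nn_integral_cmult_indicator emeasure_complex_ball)
  also have "\<dots> = ennreal (X\<^sup>2 * ((1 + (cmod a + R)\<^sup>2) * (pi * R\<^sup>2)))"
    by (subst ennreal_mult[symmetric]) (auto simp: mult_ac)
  finally show ?thesis .
qed

lemma sq_int_ball_integrable:
  assumes f: "f \<in> sq_int (weighted 1)"
  shows "integrable lborel (\<lambda>z. indicator (ball a R) z *\<^sub>R f z)"
proof (cases "0 \<le> R")
  case True
  have fm[measurable]: "f \<in> borel_measurable borel" using f by (simp add: sq_int_def)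
  have [measurable]: "ball a R \<in> sets borel" by simp
  have "(\<integral>\<^sup>+z. ennreal (norm (indicator (ball a R) z *\<^sub>R f z)) \<partial>lborel)
      = (\<integral>\<^sup>+z. ennreal (jbr z powr - 1 * cmod (f z)) * ennreal (1 * (indicator (ball a R) z * jbr z)) \<partial>lborel)"
    by (intro nn_integral_cong) (simp add: ennreal_mult[symmetric] powr_minus indicator_def)
  then have "(\<integral>\<^sup>+z. ennreal (norm (indicator (ball a R) z *\<^sub>R f z)) \<partial>lborel)\<^sup>2
     \<le> sq_norm (weighted 1) f * (\<integral>\<^sup>+z. (ennreal (1 * (indicator (ball a R) z * jbr z)))\<^sup>2 \<partial>lborel)"
    unfolding sq_norm_weighted[OF fm] by (simp only:) (rule Cauchy_Schwarz_nn_integral; measurable)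
  also have "\<dots> \<le> sq_norm (weighted 1) f * ennreal (1\<^sup>2 * ((1 + (cmod a + R)\<^sup>2) * (pi * R\<^sup>2)))"
    using True by (intro mult_left_mono ball_weight) auto
  also have "\<dots> < \<infinity>" using f by (auto simp: sq_int_def ennreal_mult_less_top)
  finally have "(\<integral>\<^sup>+z. ennreal (norm (indicator (ball a R) z *\<^sub>R f z)) \<partial>lborel) < \<infinity>" by (rule ennreal_power2_less_topD)
  then show ?thesis by (intro integrableI_bounded) auto
next
  case False
  then have "ball a R = {}" by simp
  then show ?thesis by (simp del: ball_eq_empty)
qed

text \<open>The bump rescaled to radius r about a, normalised so that its mass does not depend on
  r.\<close>

definition mean_kernel :: "complex \<Rightarrow> real \<Rightarrow> complex \<Rightarrow> real" where
  "mean_kernel a r z = flat_exp 0 (1 - (cmod (z - a) / r)\<^sup>2) / r\<^sup>2"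

text \<open>Two derivatives in one: up to the factor -2/r^3 it is the derivative of
  \<open>mean_kernel a r z\<close> in r, and it is also the dbar derivative in z of conj(z - a)
  times the rescaled bump. This coincidence makes the means of a weak solution independent of
  r.\<close>

definition mean_deriv :: "complex \<Rightarrow> real \<Rightarrow> complex \<Rightarrow> real" where
  "mean_deriv a r z = flat_exp 0 (1 - (cmod (z - a) / r)\<^sup>2) - flat_exp 2 (1 - (cmod (z - a) / r)\<^sup>2) * (cmod (z - a) / r)\<^sup>2"

lemma mean_kernel_has_derivative:
  assumes "0 < r"
  shows "((\<lambda>r. mean_kernel a r z) has_real_derivative (- 2 / r ^ 3 * mean_deriv a r z)) (at r)"
proof -
  let ?p = "cmod (z - a)"
  have i: "((\<lambda>r. 1 - (?p / r)\<^sup>2) has_real_derivative 2 * ?p\<^sup>2 / r ^ 3) (at r)"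
    using assms by (auto intro!: derivative_eq_intros simp: power2_eq_square power3_eq_cube field_simps)
  have g: "(flat_exp 0 has_real_derivative flat_exp 2 (1 - (?p / r)\<^sup>2)) (at (1 - (?p / r)\<^sup>2))"
    using flat_exp_deriv[of 0] by (simp add: numeral_2_eq_2)
  have c: "((\<lambda>r. flat_exp 0 (1 - (?p / r)\<^sup>2)) has_real_derivative flat_exp 2 (1 - (?p / r)\<^sup>2) * (2 * ?p\<^sup>2 / r ^ 3)) (at r)"
    by (rule DERIV_chain2[OF g i])
  have d: "((\<lambda>r. 1 / r\<^sup>2) has_real_derivative - 2 / r ^ 3) (at r)"
    using assms by (auto intro!: derivative_eq_intros simp: power2_eq_square power3_eq_cube field_simps)
  have "((\<lambda>r. flat_exp 0 (1 - (?p / r)\<^sup>2) * (1 / r\<^sup>2)) has_real_derivative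
     flat_exp 2 (1 - (?p / r)\<^sup>2) * (2 * ?p\<^sup>2 / r ^ 3) * (1 / r\<^sup>2) + (- 2 / r ^ 3) * flat_exp 0 (1 - (?p / r)\<^sup>2)) (at r)"
    by (rule DERIV_mult[OF c d])
  moreover have "flat_exp 2 (1 - (?p / r)\<^sup>2) * (2 * ?p\<^sup>2 / r ^ 3) * (1 / r\<^sup>2) + (- 2 / r ^ 3) * flat_exp 0 (1 - (?p / r)\<^sup>2)
    = - 2 / r ^ 3 * mean_deriv a r z"
    by (simp add: mean_deriv_def power_divide algebra_simps)
  ultimately show ?thesis by (simp add: mean_kernel_def)
qed

text \<open>26 = 2 + 4!: the first term is at most 1, generously 2, and \<open>flat_exp 2\<close> is
  at most 4! on arguments up to 1.\<close>

lemma mean_deriv_bound: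
  assumes "0 < r" "r \<le> R"
  shows "\<bar>mean_deriv a r z\<bar> \<le> 26 * indicator (ball a R) z"
proof (cases "cmod (z - a) < r")
  case True
  then have x: "(cmod (z - a) / r)\<^sup>2 \<le> 1" using assms by (intro power_le_one) (auto simp: field_simps)
  have 1: "flat_exp 0 (1 - (cmod (z - a) / r)\<^sup>2) \<le> 2" using flat_exp_le_1[of "1 - (cmod (z - a) / r)\<^sup>2"] by linarith
  have 2: "flat_exp 2 (1 - (cmod (z - a) / r)\<^sup>2) * (cmod (z - a) / r)\<^sup>2 \<le> 24 * 1"
    using flat_exp_bounded[of "1 - (cmod (z - a) / r)\<^sup>2" 2] x
    by (intro mult_mono) (auto simp: fact_numeral flat_exp_le)
  have 3: "0 \<le> flat_exp 2 (1 - (cmod (z - a) / r)\<^sup>2) * (cmod (z - a) / r)\<^sup>2" by (simp add: flat_exp_le)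
  have "\<bar>mean_deriv a r z\<bar> \<le> 26"
    using 1 2 3 flat_exp_le(1)[of 0 "1 - (cmod (z - a) / r)\<^sup>2"] unfolding mean_deriv_def by linarith
  moreover have "z \<in> ball a R" using True assms by (simp add: dist_norm norm_minus_commute)
  ultimately show ?thesis by (simp del: mem_ball)
next
  case False
  then have "1\<^sup>2 \<le> (cmod (z - a) / r)\<^sup>2" using assms by (intro power_mono) auto
  then show ?thesis by (simp add: mean_deriv_def flat_exp_def)
qed

lemma mean_deriv_measurable [measurable]: "(\<lambda>p. mean_deriv a (fst p) (snd p)) \<in> borel_measurable (borel \<Otimes>\<^sub>M borel)"
  unfolding mean_deriv_def by measurable

text \<open>The factor conj(z - a) has dbar derivative 1, and multiplied with the dbar derivative of
  the radial bump it produces the real factor |z - a|^2/r^2.\<close>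

lemma dbar_test_bump:
  assumes r: "0 < r"
  shows "test_fun (\<lambda>z. cnj (z - a) * bump ((z - a) /\<^sub>R r))"
    "dbar (\<lambda>z. cnj (z - a) * bump ((z - a) /\<^sub>R r)) z = of_real (mean_deriv a r z)"
proof -
  have e: "(z - a) /\<^sub>R r = (- a /\<^sub>R r) + (1 / r) *\<^sub>R z" for z by (simp add: scaleR_diff_right divide_inverse)
  have t: "test_fun (\<lambda>z. bump ((z - a) /\<^sub>R r))"
    unfolding e using r by (intro test_fun_affine test_fun_bump) auto
  have s: "smooth (\<lambda>z. cnj (z - a))"
  proof -
    have "(\<lambda>z. cnj (z - a)) = (\<lambda>z. cnj z + - cnj a)" by auto
    then show ?thesis
      by (simp only: smooth_def) (intro allI Ck_add Ck_const Ck_bounded_linear bounded_linear_cnj)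
  qed
  show "test_fun (\<lambda>z. cnj (z - a) * bump ((z - a) /\<^sub>R r))" by (rule test_fun_mult[OF s t])
  let ?w = "(z - a) /\<^sub>R r"
  have "((\<lambda>z. bump ((z - a) /\<^sub>R r)) has_derivative (\<lambda>v. bump_pow 2 ?w * of_real (- 2 * (?w \<bullet> (v /\<^sub>R r))))) (at z)"
  proof -
    have i: "((\<lambda>z. (z - a) /\<^sub>R r) has_derivative (\<lambda>v. v /\<^sub>R r)) (at z)"
      by (auto intro!: derivative_eq_intros)
    from has_derivative_compose[OF i bump_pow_deriv[of 0]] show ?thesis by (simp add: numeral_2_eq_2)
  qed
  moreover have "((\<lambda>z. cnj (z - a)) has_derivative cnj) (at z)"
    by (auto intro!: derivative_eq_intros)
  ultimately have D: "((\<lambda>z. cnj (z - a) * bump ((z - a) /\<^sub>R r)) has_derivative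
      (\<lambda>v. cnj (z - a) * (bump_pow 2 ?w * of_real (- 2 * (?w \<bullet> (v /\<^sub>R r)))) + cnj v * bump ?w)) (at z)"
    by (rule has_derivative_mult[rotated])
  \<comment> \<open>The expression (D 1 + i D i)/2 for the derivative D found above, with \<alpha>
    and \<beta> standing for the inner products with the directions 1 and i.\<close>
  have alg: "(c * (p * of_real (- 2 * \<alpha>)) + cnj 1 * g + \<i> * (c * (p * of_real (- 2 * \<beta>)) + cnj \<i> * g)) / 2
     = g - p * (c * (of_real \<alpha> + \<i> * of_real \<beta>))" for c p g :: complex and \<alpha> \<beta>
    by (simp add: algebra_simps add_divide_distrib diff_divide_distrib)
  note dbar_eq[OF D]
  also have "(cnj (z - a) * (bump_pow 2 ?w * of_real (- 2 * (?w \<bullet> (1 /\<^sub>R r)))) + cnj 1 * bump ?w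
     + \<i> * (cnj (z - a) * (bump_pow 2 ?w * of_real (- 2 * (?w \<bullet> (\<i> /\<^sub>R r)))) + cnj \<i> * bump ?w)) / 2
     = bump ?w - bump_pow 2 ?w * (cnj (z - a) * (of_real (?w \<bullet> (1 /\<^sub>R r)) + \<i> * of_real (?w \<bullet> (\<i> /\<^sub>R r))))"
    by (rule alg)
  also have "of_real (?w \<bullet> (1 /\<^sub>R r)) + \<i> * of_real (?w \<bullet> (\<i> /\<^sub>R r)) = (z - a) / of_real (r\<^sup>2)"
  proof -
    have 1: "?w \<bullet> (1 /\<^sub>R r) = Re (z - a) / r\<^sup>2" "?w \<bullet> (\<i> /\<^sub>R r) = Im (z - a) / r\<^sup>2"
      by (simp_all add: inner_complex_def power2_eq_square divide_inverse)
    have "of_real (Re (z - a) / r\<^sup>2) + \<i> * of_real (Im (z - a) / r\<^sup>2) = (of_real (Re (z - a)) + \<i> * of_real (Im (z - a))) / of_real (r\<^sup>2)"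
      by (simp only: of_real_divide times_divide_eq_right add_divide_distrib)
    also have "\<dots> = (z - a) / of_real (r\<^sup>2)" by (simp only: complex_eq[symmetric])
    finally show ?thesis unfolding 1 .
  qed
  also have "cnj (z - a) * ((z - a) / of_real (r\<^sup>2)) = of_real ((cmod (z - a) / r)\<^sup>2)"
    using complex_norm_square[of "z - a"] by (simp add: power_divide mult.commute)
  also have "cmod ?w = cmod (z - a) / r" using r by (simp add: divide_inverse mult.commute)
  then have "bump ?w - bump_pow 2 ?w * of_real ((cmod (z - a) / r)\<^sup>2) = of_real (mean_deriv a r z)"
    by (simp add: bump_pow_def mean_deriv_def del: norm_scaleR)
  finally show "dbar (\<lambda>z. cnj (z - a) * bump ((z - a) /\<^sub>R r)) z = of_real (mean_deriv a r z)" .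
qed

lemma mean_kernel_le: "0 < r \<Longrightarrow> \<bar>mean_kernel a r z\<bar> \<le> 1 / r\<^sup>2 * indicator (ball a r) z"
proof (cases "cmod (z - a) < r")
  case True
  assume "0 < r"
  then show ?thesis using True flat_exp_le_1 flat_exp_le(1)[of 0]
    by (simp add: mean_kernel_def divide_right_mono dist_norm norm_minus_commute)
next
  case False
  assume "0 < r"
  then have "1\<^sup>2 \<le> (cmod (z - a) / r)\<^sup>2" using False by (intro power_mono) auto
  then show ?thesis by (simp add: mean_kernel_def flat_exp_def)
qed

text \<open>The fundamental theorem of calculus in r writes the difference of the two kernels as an
  integral of \<open>mean_deriv\<close>. After Fubini the inner integral is f tested against a dbar
  derivative, which vanishes.\<close>

lemma mean_kernel_constant:
  assumes f: "f \<in> sq_int (weighted 1)"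
    and weak: "\<And>\<psi>. test_fun \<psi> \<Longrightarrow> (\<integral>z. f z * dbar \<psi> z \<partial>lborel) = 0"
    and t: "0 < t" "t \<le> R"
  shows "(\<integral>z. f z * of_real (mean_kernel a t z) \<partial>lborel) = (\<integral>z. f z * of_real (mean_kernel a R z) \<partial>lborel)"
proof -
  have fm[measurable]: "f \<in> borel_measurable borel" using f by (simp add: sq_int_def)
  have [measurable]: "ball a R \<in> sets borel" by simp
  have lint: "integrable lborel (\<lambda>z. indicator (ball a R) z *\<^sub>R f z)" by (rule sq_int_ball_integrable[OF f])
  let ?g = "\<lambda>r z. (indicator {t..R} r * (- 2 / r ^ 3 * mean_deriv a r z)) *\<^sub>R f z"
  have [measurable]: "(\<lambda>p. mean_deriv a (g p) (h p)) \<in> borel_measurable N"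
    if "g \<in> borel_measurable N" "h \<in> borel_measurable N" for g h N
    using measurable_compose[OF measurable_Pair[OF that] mean_deriv_measurable] by simp
  have int: "integrable (lborel \<Otimes>\<^sub>M lborel) (\<lambda>(r, z). ?g r z)"
  proof (intro integrableI_bounded)
    have "(\<integral>\<^sup>+p. ennreal (norm (case p of (r, z) \<Rightarrow> ?g r z)) \<partial>(lborel \<Otimes>\<^sub>M lborel))
      \<le> (\<integral>\<^sup>+p. (ennreal (52 / t ^ 3) * indicator {t..R} (fst p)) * ennreal (norm (indicator (ball a R) (snd p) *\<^sub>R f (snd p))) \<partial>(lborel \<Otimes>\<^sub>M lborel))"
    proof (rule nn_integral_mono)
      fix p :: "real \<times> complex"
      obtain r z where p: "p = (r, z)" by (cases p)
      show "ennreal (norm (case p of (r, z) \<Rightarrow> ?g r z)) \<le> (ennreal (52 / t ^ 3) * indicator {t..R} (fst p)) * ennreal (norm (indicator (ball a R) (snd p) *\<^sub>R f (snd p)))"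
      proof (cases "r \<in> {t..R}")
        case True
        then have r: "0 < r" "t \<le> r" "r \<le> R" using t by auto
        have r3: "t ^ 3 \<le> r ^ 3" "0 < t ^ 3" using r t by (auto intro!: power_mono)
        have "\<bar>- 2 / r ^ 3 * mean_deriv a r z\<bar> = (2 / r ^ 3) * \<bar>mean_deriv a r z\<bar>" using r by (simp add: abs_mult)
        also have "\<dots> \<le> (2 / t ^ 3) * (26 * indicator (ball a R) z)"
          using r r3 by (intro mult_mono mean_deriv_bound divide_left_mono) (auto intro!: mult_pos_pos)
        finally have "\<bar>- 2 / r ^ 3 * mean_deriv a r z\<bar> * cmod (f z) \<le> (2 / t ^ 3) * (26 * indicator (ball a R) z) * cmod (f z)"
          by (rule mult_right_mono) simp
        \<comment> \<open>52 is twice the 26 of \<open>mean_deriv_bound\<close>, the 2 coming from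
          the derivative in r.\<close>
        then have "norm (?g r z) \<le> (52 / t ^ 3) * norm (indicator (ball a R) z *\<^sub>R f z)"
          using True by (simp add: mult_ac)
        then have "ennreal (norm (?g r z)) \<le> ennreal ((52 / t ^ 3) * norm (indicator (ball a R) z *\<^sub>R f z))" by (rule ennreal_leI)
        also have "\<dots> = ennreal (52 / t ^ 3) * ennreal (norm (indicator (ball a R) z *\<^sub>R f z))"
          using t by (intro ennreal_mult) auto
        finally show ?thesis using True by (simp only: p fst_conv snd_conv prod.case indicator_simps mult_1_right)
      qed (simp add: p)
    qed
    also have "\<dots> = (\<integral>\<^sup>+r. (\<integral>\<^sup>+z. (ennreal (52 / t ^ 3) * indicator {t..R} r) * ennreal (norm (indicator (ball a R) z *\<^sub>R f z)) \<partial>lborel) \<partial>lborel)"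
      by (subst lborel.nn_integral_fst[symmetric]) auto
    also have "\<dots> = (\<integral>\<^sup>+r. (ennreal (52 / t ^ 3) * indicator {t..R} r) \<partial>lborel) * (\<integral>\<^sup>+z. ennreal (norm (indicator (ball a R) z *\<^sub>R f z)) \<partial>lborel)"
    proof -
      have "(\<integral>\<^sup>+r. (\<integral>\<^sup>+z. (ennreal (52 / t ^ 3) * indicator {t..R} r) * ennreal (norm (indicator (ball a R) z *\<^sub>R f z)) \<partial>lborel) \<partial>lborel)
        = (\<integral>\<^sup>+r. (ennreal (52 / t ^ 3) * indicator {t..R} r) * (\<integral>\<^sup>+z. ennreal (norm (indicator (ball a R) z *\<^sub>R f z)) \<partial>lborel) \<partial>lborel)"
        by (intro nn_integral_cong nn_integral_cmult) measurable
      also have "\<dots> = (\<integral>\<^sup>+r. (ennreal (52 / t ^ 3) * indicator {t..R} r) \<partial>lborel) * (\<integral>\<^sup>+z. ennreal (norm (indicator (ball a R) z *\<^sub>R f z)) \<partial>lborel)"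
        by (intro nn_integral_multc) measurable
      finally show ?thesis .
    qed
    also have "\<dots> < \<infinity>"
      using lint t by (auto simp: nn_integral_cmult_indicator ennreal_mult_less_top integrable_iff_bounded)
    finally show "(\<integral>\<^sup>+p. ennreal (norm (case p of (r, z) \<Rightarrow> ?g r z)) \<partial>(lborel \<Otimes>\<^sub>M lborel)) < \<infinity>" .
  qed measurable
  have inner0: "(\<integral>z. ?g r z \<partial>lborel) = 0" for r
  proof (cases "r \<in> {t..R}")
    case True
    then have r: "0 < r" using t by auto
    have "(\<integral>z. ?g r z \<partial>lborel) = (\<integral>z. of_real (indicator {t..R} r * (- 2 / r ^ 3)) * (f z * dbar (\<lambda>z. cnj (z - a) * bump ((z - a) /\<^sub>R r)) z) \<partial>lborel)"
      unfolding dbar_test_bump(2)[OF r] by (intro Bochner_Integration.integral_cong) (simp_all add: scaleR_conv_of_real)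
    also have "\<dots> = 0"
      unfolding integral_mult_right_zero by (simp only: weak[OF dbar_test_bump(1)[OF r]] mult_zero_right)
    finally show ?thesis .
  qed simp
  have inner1: "(\<integral>r. ?g r z \<partial>lborel) = (mean_kernel a R z - mean_kernel a t z) *\<^sub>R f z" for z
  proof -
    have "has_bochner_integral lborel (\<lambda>r. indicator {t..R} r *\<^sub>R (- 2 / r ^ 3 * mean_deriv a r z)) (mean_kernel a R z - mean_kernel a t z)"
    proof (rule has_bochner_integral_FTC_Icc[OF t(2)])
      show "((\<lambda>r. mean_kernel a r z) has_vector_derivative - 2 / x ^ 3 * mean_deriv a x z) (at x within {t..R})" if "t \<le> x" "x \<le> R" for x
        using mean_kernel_has_derivative[of x a z] t that
        by (auto simp: has_real_derivative_iff_has_vector_derivative intro: has_vector_derivative_at_within)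
      have "isCont (flat_exp m) s" for m s by (rule DERIV_isCont[OF flat_exp_deriv])
      then have fc: "continuous_on UNIV (flat_exp m)" for m by (simp add: continuous_at_imp_continuous_on)
      show "continuous_on {t..R} (\<lambda>r. - 2 / r ^ 3 * mean_deriv a r z)"
        unfolding mean_deriv_def using t
        by (intro continuous_intros continuous_on_compose2[OF fc]) auto
    qed
    then have "(\<integral>r. indicator {t..R} r *\<^sub>R (- 2 / r ^ 3 * mean_deriv a r z) \<partial>lborel) = mean_kernel a R z - mean_kernel a t z"
      and i: "integrable lborel (\<lambda>r. indicator {t..R} r *\<^sub>R (- 2 / r ^ 3 * mean_deriv a r z))"
      by (auto simp: has_bochner_integral_iff)
    moreover have "integrable lborel (\<lambda>r. indicator {t..R} r * (- 2 / r ^ 3 * mean_deriv a r z))" using i by simp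
    then have "(\<integral>r. ?g r z \<partial>lborel) = (\<integral>r. indicator {t..R} r * (- 2 / r ^ 3 * mean_deriv a r z) \<partial>lborel) *\<^sub>R f z"
      by (rule integral_scaleR_left)
    ultimately show ?thesis by simp
  qed
  have "0 = (\<integral>r. (\<integral>z. ?g r z \<partial>lborel) \<partial>lborel)" by (simp only: inner0) simp
  also have "\<dots> = (\<integral>z. (\<integral>r. ?g r z \<partial>lborel) \<partial>lborel)" by (rule lborel_pair.Fubini_integral[symmetric, OF int])
  also have "\<dots> = (\<integral>z. (mean_kernel a R z - mean_kernel a t z) *\<^sub>R f z \<partial>lborel)" by (simp only: inner1)
  also have "\<dots> = (\<integral>z. f z * of_real (mean_kernel a R z) - f z * of_real (mean_kernel a t z) \<partial>lborel)"
    by (intro Bochner_Integration.integral_cong) (simp_all add: scaleR_conv_of_real algebra_simps)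
  also have "\<dots> = (\<integral>z. f z * of_real (mean_kernel a R z) \<partial>lborel) - (\<integral>z. f z * of_real (mean_kernel a t z) \<partial>lborel)"
  proof (rule Bochner_Integration.integral_diff)
    have int_s: "integrable lborel (\<lambda>z. f z * of_real (mean_kernel a s z))" if "s \<in> {t, R}" for s
    proof (rule Bochner_Integration.integrable_bound)
      show "integrable lborel (\<lambda>z. (1 / s\<^sup>2) *\<^sub>R (indicator (ball a R) z *\<^sub>R f z))" using lint by (rule integrable_scaleR_right)
      show "AE z in lborel. norm (f z * of_real (mean_kernel a s z)) \<le> norm ((1 / s\<^sup>2) *\<^sub>R (indicator (ball a R) z *\<^sub>R f z))"
      proof (intro AE_I2)
        fix z
        have s: "0 < s" "s \<le> R" using that t by auto
        have "\<bar>mean_kernel a s z\<bar> \<le> 1 / s\<^sup>2 * indicator (ball a R) z"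
          by (rule order_trans[OF mean_kernel_le[OF s(1)]]) (use s in \<open>auto simp: indicator_def\<close>)
        then have "cmod (f z) * \<bar>mean_kernel a s z\<bar> \<le> cmod (f z) * (1 / s\<^sup>2 * indicator (ball a R) z)"
          by (rule mult_left_mono) simp
        then show "norm (f z * of_real (mean_kernel a s z)) \<le> norm ((1 / s\<^sup>2) *\<^sub>R (indicator (ball a R) z *\<^sub>R f z))"
          by (simp add: norm_mult mult_ac)
      qed
    qed (unfold mean_kernel_def, measurable)
    show "integrable lborel (\<lambda>z. f z * of_real (mean_kernel a R z))" "integrable lborel (\<lambda>z. f z * of_real (mean_kernel a t z))"
      by (rule int_s, simp)+
  qed
  finally show ?thesis by simp
qed

text \<open>Plain Cauchy-Schwarz on a disc of radius R gives a bounded mean but no decay, since <z>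
  L2 is the borderline. So f is split at a large fixed radius: the inner part contributes at most
  L/R^2, and the outer part is small through the tail of its weighted norm, uniformly in R.\<close>

lemma mean_kernel_eq_0:
  assumes f: "f \<in> sq_int (weighted 1)"
    and weak: "\<And>\<psi>. test_fun \<psi> \<Longrightarrow> (\<integral>z. f z * dbar \<psi> z \<partial>lborel) = 0"
    and t: "0 < t"
  shows "(\<integral>z. f z * of_real (mean_kernel a t z) \<partial>lborel) = 0"
proof -
  have fm[measurable]: "f \<in> borel_measurable borel" using f by (simp add: sq_int_def)
  have bm[measurable]: "ball x r \<in> sets borel" for x :: complex and r by simp
  let ?w = "\<lambda>z. ennreal (jbr z powr - 1 * cmod (f z))"
  define tail where "tail n = (\<integral>\<^sup>+z. (?w z * indicator (- ball 0 (real n)) z)\<^sup>2 \<partial>lborel)" for n :: nat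
  have Nfin: "(\<integral>\<^sup>+z. (?w z)\<^sup>2 \<partial>lborel) < \<infinity>" 
  proof -
    have "sq_norm (weighted 1) f < \<infinity>" using f by (simp add: sq_int_def)
    then show ?thesis by (simp only: sq_norm_weighted[OF fm])
  qed
  have tail_lim: "tail \<longlonglongrightarrow> 0"
  proof -
    have "tail \<longlonglongrightarrow> (\<integral>\<^sup>+z. 0 \<partial>(lborel::complex measure))" unfolding tail_def
    proof (rule nn_integral_dominated_convergence[where w="\<lambda>z. (?w z)\<^sup>2"])
      show "AE z in lborel. (?w z * indicator (- ball 0 (real n)) z)\<^sup>2 \<le> (?w z)\<^sup>2" for n
        by (intro AE_I2) (auto simp: indicator_def)
      show "AE z in lborel. (\<lambda>n. (?w z * indicator (- ball 0 (real n)) z)\<^sup>2) \<longlonglongrightarrow> 0"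
      proof (intro AE_I2 tendsto_eventually)
        fix z :: complex
        obtain N :: nat where N: "cmod z < real N" using reals_Archimedean2 by blast
        have "\<forall>n\<ge>N. (?w z * indicator (- ball 0 (real n)) z)\<^sup>2 = 0"
        proof (intro allI impI)
          fix n assume "N \<le> n"
          then have "real N \<le> real n" by simp
          then have "z \<in> ball 0 (real n)" using N by simp
          then show "(?w z * indicator (- ball 0 (real n)) z)\<^sup>2 = 0" by (simp del: mem_ball mem_ball_0)
        qed
        then show "\<forall>\<^sub>F n in sequentially. (?w z * indicator (- ball 0 (real n)) z)\<^sup>2 = 0"
          by (auto simp: eventually_sequentially)
      qed
    qed (use Nfin in measurable)
    then show ?thesis by simp
  qed
  have small: "cmod (\<integral>z. f z * of_real (mean_kernel a t z) \<partial>lborel) \<le> e" if e: "0 < e" for e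
  proof -
    have "\<forall>\<^sub>F n in sequentially. tail n < ennreal ((e / 2)\<^sup>2 / (5 * pi))"
      using e by (intro order_tendstoD[OF tail_lim]) auto
    \<comment> \<open>5 pi bounds R^(-4) times the integral of <z>^2 over the disc, because 1 + (|a|
      + R)^2 \<le> 5 R^2 once R \<ge> 1 + |a|.\<close>
    then obtain n where n: "tail n < ennreal ((e / 2)\<^sup>2 / (5 * pi))" by (auto simp: eventually_sequentially)
    define L where "L = (\<integral>z. norm (indicator (ball 0 (real n)) z *\<^sub>R f z) \<partial>lborel)"
    have Li: "integrable lborel (\<lambda>z. norm (indicator (ball 0 (real n)) z *\<^sub>R f z))"
      by (intro integrable_norm sq_int_ball_integrable f)
    have L0: "0 \<le> L" by (simp add: L_def)
    \<comment> \<open>The three lower bounds give in turn R \<ge> 1 together with |a| \<le> R, the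
      comparison with radius t, and L/R^2 \<le> e/2.\<close>
    define R where "R = max (1 + cmod a) (max t (2 * L / e))"
    have R: "1 + cmod a \<le> R" "t \<le> R" "2 * L / e \<le> R" by (auto simp: R_def)
    have R1: "1 \<le> R" using R(1) norm_ge_zero[of a] by linarith
    let ?I = "indicator (ball a R)"
    have "cmod (\<integral>z. f z * of_real (mean_kernel a R z) \<partial>lborel) \<le> e"
    proof -
      let ?t2 = "\<integral>\<^sup>+z. (?w z * indicator (- ball 0 (real n)) z) * ennreal (1 / R\<^sup>2 * (?I z * jbr z)) \<partial>lborel"
      have "ennreal (cmod (\<integral>z. f z * of_real (mean_kernel a R z) \<partial>lborel))
        \<le> (\<integral>\<^sup>+z. ennreal (cmod (f z * of_real (mean_kernel a R z))) \<partial>lborel)"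
        by (rule ennreal_norm_integral_le)
      also have "\<dots> \<le> (\<integral>\<^sup>+z. ennreal (1 / R\<^sup>2) * ennreal (norm (indicator (ball 0 (real n)) z *\<^sub>R f z))
           + (?w z * indicator (- ball 0 (real n)) z) * ennreal (1 / R\<^sup>2 * (?I z * jbr z)) \<partial>lborel)"
      proof (rule nn_integral_mono)
        fix z
        have "cmod (f z * of_real (mean_kernel a R z)) \<le> cmod (f z) * (1 / R\<^sup>2 * ?I z)"
          using mult_left_mono[OF mean_kernel_le[of R a z], of "cmod (f z)"] R1 by (simp add: norm_mult del: mem_ball)
        also have "\<dots> \<le> 1 / R\<^sup>2 * norm (indicator (ball 0 (real n)) z *\<^sub>R f z)
            + (jbr z powr - 1 * cmod (f z) * indicator (- ball 0 (real n)) z) * (1 / R\<^sup>2 * (?I z * jbr z))"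
        proof -
          have "jbr z powr - 1 * cmod (f z) * jbr z = cmod (f z)" by (simp add: powr_minus)
          then show ?thesis
            by (cases "z \<in> ball 0 (real n)"; cases "z \<in> ball a R") (simp_all add: mult.assoc[symmetric] del: mem_ball mem_ball_0)
        qed
        finally have "ennreal (cmod (f z * of_real (mean_kernel a R z))) \<le> ennreal (1 / R\<^sup>2 * norm (indicator (ball 0 (real n)) z *\<^sub>R f z)
            + (jbr z powr - 1 * cmod (f z) * indicator (- ball 0 (real n)) z) * (1 / R\<^sup>2 * (?I z * jbr z)))"
          by (rule ennreal_leI)
        also have "\<dots> = ennreal (1 / R\<^sup>2) * ennreal (norm (indicator (ball 0 (real n)) z *\<^sub>R f z))
           + (?w z * indicator (- ball 0 (real n)) z) * ennreal (1 / R\<^sup>2 * (?I z * jbr z))"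
        proof -
          have i: "(indicator (- ball 0 (real n)) z :: ennreal) = ennreal (indicator (- ball 0 (real n)) z)"
            by (simp add: indicator_def)
          have "ennreal (A * N + (W * I) * X) = ennreal A * ennreal N + (ennreal W * ennreal I) * ennreal X"
            if "0 \<le> A" "0 \<le> N" "0 \<le> W" "0 \<le> I" "0 \<le> X" for A N W I X :: real
            using that by (simp add: ennreal_mult)
          then show ?thesis unfolding i by this simp_all
        qed
        finally show "ennreal (cmod (f z * of_real (mean_kernel a R z))) \<le> \<dots>" .
      qed
      also have "\<dots> = ennreal (1 / R\<^sup>2) * (\<integral>\<^sup>+z. ennreal (norm (indicator (ball 0 (real n)) z *\<^sub>R f z)) \<partial>lborel) + ?t2"
        by (subst nn_integral_add; (measurable)?) (subst nn_integral_cmult; simp)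
      also have "(\<integral>\<^sup>+z. ennreal (norm (indicator (ball 0 (real n)) z *\<^sub>R f z)) \<partial>lborel) = ennreal L"
        unfolding L_def by (rule nn_integral_eq_integral[OF Li]) simp
      also have "ennreal (1 / R\<^sup>2) * ennreal L + ?t2 \<le> ennreal (e / 2) + ennreal (e / 2)"
      proof (rule add_mono)
        have "L \<le> e / 2 * R" using R(3) e by (simp add: field_simps)
        also have "\<dots> \<le> e / 2 * (R * R)" using R1 e by (intro mult_left_mono) auto
        finally have "1 / R\<^sup>2 * L \<le> e / 2" using R1 by (simp add: field_simps power2_eq_square)
        then show "ennreal (1 / R\<^sup>2) * ennreal L \<le> ennreal (e / 2)"
          using L0 by (simp add: ennreal_mult[symmetric] ennreal_leI)
        have "?t2\<^sup>2 \<le> tail n * (\<integral>\<^sup>+z. (ennreal (1 / R\<^sup>2 * (?I z * jbr z)))\<^sup>2 \<partial>lborel)"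
          unfolding tail_def by (rule Cauchy_Schwarz_nn_integral; measurable)
        also have "\<dots> \<le> ennreal ((e / 2)\<^sup>2 / (5 * pi)) * ennreal (5 * pi)"
        proof (rule mult_mono)
          have "cmod a + R \<le> 2 * R" using R(1) by linarith
          then have "(cmod a + R)\<^sup>2 \<le> (2 * R)\<^sup>2" using R1 by (intro power_mono) auto
          moreover have "1 \<le> R\<^sup>2" using R1 by simp
          ultimately have "1 + (cmod a + R)\<^sup>2 \<le> 5 * R\<^sup>2" by (simp add: power_mult_distrib)
          then have "(1 + (cmod a + R)\<^sup>2) / R\<^sup>2 \<le> 5" using R1 by (simp add: field_simps)
          then have "(1 + (cmod a + R)\<^sup>2) / R\<^sup>2 * pi \<le> 5 * pi" by (intro mult_right_mono) auto
          moreover have "(1 / R\<^sup>2)\<^sup>2 * ((1 + (cmod a + R)\<^sup>2) * (pi * R\<^sup>2)) = (1 + (cmod a + R)\<^sup>2) / R\<^sup>2 * pi"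
            using R1 by (simp add: field_simps power2_eq_square)
          ultimately have "ennreal ((1 / R\<^sup>2)\<^sup>2 * ((1 + (cmod a + R)\<^sup>2) * (pi * R\<^sup>2))) \<le> ennreal (5 * pi)"
            by (simp only: ennreal_leI)
          then show "(\<integral>\<^sup>+z. (ennreal (1 / R\<^sup>2 * (?I z * jbr z)))\<^sup>2 \<partial>lborel) \<le> ennreal (5 * pi)"
            using R1 by (intro order_trans[OF ball_weight]) auto
        qed (use n in auto)
        also have "\<dots> = (ennreal (e / 2))\<^sup>2"
          using e by (simp add: ennreal_mult[symmetric] ennreal_power del: ennreal_half)
        finally have "?t2\<^sup>2 \<le> (ennreal (e / 2))\<^sup>2" .
        then show "?t2 \<le> ennreal (e / 2)" by (rule ennreal_power2_le_imp_le)
      qed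
      also have "\<dots> = ennreal e" using e by (simp add: ennreal_plus[symmetric] del: ennreal_plus)
      finally show ?thesis using e by (simp add: ennreal_le_iff)
    qed
    then show ?thesis using mean_kernel_constant[OF f weak t R(2)] by simp
  qed
  then have "cmod (\<integral>z. f z * of_real (mean_kernel a t z) \<partial>lborel) \<le> 0" by (rule field_le_epsilon) (simp add: small)
  then show ?thesis by simp
qed

text \<open>The vanishing means say that the smoothing of f by the bump is 0 at every point and
  every scale. Letting the scale tend to 0 gives vanishing integrals over all balls.\<close>

lemma weak_dbar_eq_0:
  assumes f: "f \<in> sq_int (weighted 1)"
    and weak: "\<And>\<psi>. test_fun \<psi> \<Longrightarrow> (\<integral>z. f z * dbar \<psi> z \<partial>lborel) = 0"
  shows "AE z in lborel. f z = 0"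
proof -
  have fm[measurable]: "f \<in> borel_measurable borel" using f by (simp add: sq_int_def)
  have bm[measurable]: "ball x r \<in> sets borel" for x :: complex and r by simp
  have [measurable]: "bump \<in> borel_measurable borel" by (rule test_fun_measurable[OF test_fun_bump])
  have conv0: "(\<integral>y. f (a + t *\<^sub>R y) * bump y \<partial>lborel) = 0" if t: "0 < t" for a t
  proof -
    have "0 = (\<integral>z. f z * of_real (mean_kernel a t z) \<partial>lborel)" using mean_kernel_eq_0[OF f weak t] by simp
    also have "\<dots> = t\<^sup>2 *\<^sub>R (\<integral>y. f (a + t *\<^sub>R y) * of_real (mean_kernel a t (a + t *\<^sub>R y)) \<partial>lborel)"
      using t by (subst integral_lborel_affine[of _ t a]) (auto simp: mean_kernel_def)
    also have "\<dots> = (\<integral>y. of_real (t\<^sup>2) * (f (a + t *\<^sub>R y) * of_real (mean_kernel a t (a + t *\<^sub>R y))) \<partial>lborel)"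
      by (simp only: integral_mult_right_zero scaleR_conv_of_real)
    also have "\<dots> = (\<integral>y. f (a + t *\<^sub>R y) * bump y \<partial>lborel)"
      using t by (intro Bochner_Integration.integral_cong) (simp_all add: mean_kernel_def bump_real)
    finally show ?thesis by simp
  qed
  have "AE z in lborel. cmod (f z) \<le> 2 * 0"
  proof (rule AE_bounded_of_ball_integrals[OF fm])
    show "integrable lborel (\<lambda>z. indicator (ball 0 R) z *\<^sub>R f z)" for R by (rule sq_int_ball_integrable[OF f])
    fix c :: complex and r :: real assume r: "0 < r"
    \<comment> \<open>The truncation makes u integrable over the plane, and its radius is large
      enough that smoothing at scales up to 1 does not notice it at points of the ball.\<close>
    define \<rho> where "\<rho> = cmod c + r + 1"
    define u where "u z = indicator (ball 0 \<rho>) z *\<^sub>R f z" for z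
    have u: "integrable lborel u" unfolding u_def by (rule sq_int_ball_integrable[OF f])
    have um[measurable]: "u \<in> borel_measurable borel" unfolding u_def by measurable
    define S where "S = (\<integral>z. norm (u z) \<partial>lborel)"
    have "cmod (\<integral>y. bump y \<partial>lborel) * cmod (\<integral>a. indicator (ball c r) a *\<^sub>R u a \<partial>lborel) \<le> 0 * measure lborel (ball c r)"
    proof (rule approximate_identity_bound[where S=S])
      show "integrable lborel (\<lambda>z. indicator (ball 0 R) z *\<^sub>R u z)" for R
        by (rule Bochner_Integration.integrable_bound[OF u]) (auto simp: indicator_def)
      show "(\<integral>\<^sup>+a. indicator (ball c r) a * ennreal (cmod (u (a + s))) \<partial>lborel) \<le> ennreal S" for s
      proof -
        have "(\<integral>\<^sup>+a. indicator (ball c r) a * ennreal (cmod (u (a + s))) \<partial>lborel) \<le> (\<integral>\<^sup>+a. ennreal (cmod (u (s + a))) \<partial>lborel)"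
          by (intro nn_integral_mono) (auto simp: indicator_def add.commute)
        also have "\<dots> = (\<integral>\<^sup>+a. ennreal (cmod (u a)) \<partial>lborel)"
          by (rule nn_integral_lborel_translate[where f="\<lambda>a. ennreal (cmod (u a))"]) measurable
        also have "\<dots> = ennreal S" unfolding S_def using u by (intro nn_integral_eq_integral) auto
        finally show ?thesis .
      qed
      show "0 \<le> S" by (simp add: S_def)
      show "integrable lborel bump" by (rule test_fun_integrable[OF test_fun_bump])
      fix a t assume a: "a \<in> ball c r" and t: "0 < t" "t \<le> (1::real)"
      have cut: "u (a + t *\<^sub>R y) * bump y = f (a + t *\<^sub>R y) * bump y" for y
      proof (cases "cmod y < 1")
        case True
        have "t * cmod y \<le> 1 * cmod y" using t by (intro mult_right_mono) auto
        then have ty: "cmod (t *\<^sub>R y) < 1" using True t by simp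
        have "cmod a \<le> cmod c + cmod (a - c)" using norm_triangle_ineq[of c "a - c"] by simp
        then have "cmod (a + t *\<^sub>R y) < \<rho>"
          using norm_triangle_ineq[of a "t *\<^sub>R y"] ty a by (simp add: \<rho>_def dist_norm norm_minus_commute)
        then show ?thesis by (simp add: u_def)
      qed (simp add: bump_outside)
      show "cmod (\<integral>y. u (a + t *\<^sub>R y) * bump y \<partial>lborel) \<le> 0" unfolding cut conv0[OF t(1)] by simp
    qed auto
    moreover have "(\<integral>y. bump y \<partial>lborel) \<noteq> 0"
      using integral_bump_pos by (simp add: bump_real)
    ultimately have "(\<integral>a. indicator (ball c r) a *\<^sub>R u a \<partial>lborel) = 0"
      by (simp add: mult_le_0_iff)
    moreover have "indicator (ball c r) a *\<^sub>R u a = indicator (ball c r) a *\<^sub>R f a" for a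
    proof (cases "a \<in> ball c r")
      case True
      have "cmod a \<le> cmod c + cmod (a - c)" using norm_triangle_ineq[of c "a - c"] by simp
      then have "cmod a < \<rho>" using True by (simp add: \<rho>_def dist_norm norm_minus_commute)
      then show ?thesis by (simp add: u_def)
    qed simp
    ultimately show "cmod (\<integral>z. indicator (ball c r) z *\<^sub>R f z \<partial>lborel) \<le> 0 * measure lborel (ball c r)" by simp
  qed
  then show ?thesis by simp
qed

section \<open>Sobolev embedding\<close>

lemma fourier_kernel_norm [simp]: "cmod (exp (- \<i> * of_real r)) = 1"
  by (simp add: norm_exp_eq_Re)

lemma fourier_kernel_measurable [measurable]:
  "f \<in> borel_measurable M \<Longrightarrow> (\<lambda>x. exp (- \<i> * of_real (f x))) \<in> borel_measurable M"
  by measurable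

lemma fourier_integrable: "integrable lborel \<psi> \<Longrightarrow> integrable lborel (\<lambda>x. \<psi> x * exp (- \<i> * of_real (x \<bullet> \<xi>)))"
  by (rule Bochner_Integration.integrable_bound[of _ \<psi>]) (auto simp: norm_mult dest!: borel_measurable_integrable)

lemma fourier_bounded:
  "cmod (fourier \<psi> \<xi>) \<le> (\<integral>x. cmod (\<psi> x) \<partial>lborel)"
  unfolding fourier_def by (rule order_trans[OF integral_norm_bound]) (simp add: norm_mult)

lemma fourier_measurable [measurable]:
  assumes [measurable]: "\<psi> \<in> borel_measurable borel"
  shows "fourier \<psi> \<in> borel_measurable borel"
  unfolding fourier_def[abs_def] by measurable

lemma fourier_swap:
  assumes f: "integrable lborel f" and g: "integrable lborel g"
  shows "(\<integral>x. g x * fourier f x \<partial>lborel) = (\<integral>\<xi>. f \<xi> * fourier g \<xi> \<partial>lborel)"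
proof -
  have [measurable]: "f \<in> borel_measurable borel" "g \<in> borel_measurable borel"
    using f g by (auto dest: borel_measurable_integrable)
  let ?h = "\<lambda>x \<xi>. g x * (f \<xi> * exp (- \<i> * of_real (\<xi> \<bullet> x)))"
  have int: "integrable (lborel \<Otimes>\<^sub>M lborel) (\<lambda>(x, \<xi>). ?h x \<xi>)"
  proof -
    have "integrable (lborel \<Otimes>\<^sub>M lborel) (\<lambda>p. ?h (fst p) (snd p))"
    proof (rule lborel_pair.Fubini_integrable)
      show "integrable lborel (\<lambda>x. \<integral>y. norm (?h (fst (x, y)) (snd (x, y))) \<partial>lborel)"
        using g by (simp add: norm_mult)
      show "AE x in lborel. integrable lborel (\<lambda>y. ?h (fst (x, y)) (snd (x, y)))"
        using fourier_integrable[OF f] by (intro AE_I2) (simp only: fst_conv snd_conv, rule integrable_mult_right)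
    qed measurable
    then show ?thesis by (simp only: case_prod_unfold)
  qed
  have "(\<integral>x. g x * fourier f x \<partial>lborel) = (\<integral>x. (\<integral>\<xi>. ?h x \<xi> \<partial>lborel) \<partial>lborel)"
    unfolding fourier_def by (simp only: integral_mult_right_zero)
  also have "\<dots> = (\<integral>\<xi>. (\<integral>x. ?h x \<xi> \<partial>lborel) \<partial>lborel)" by (rule lborel_pair.Fubini_integral[symmetric, OF int])
  also have "\<dots> = (\<integral>\<xi>. (\<integral>x. f \<xi> * (g x * exp (- \<i> * of_real (x \<bullet> \<xi>))) \<partial>lborel) \<partial>lborel)"
    by (simp only: inner_commute mult.left_commute)
  also have "\<dots> = (\<integral>\<xi>. f \<xi> * fourier g \<xi> \<partial>lborel)"
    unfolding fourier_def by (simp only: integral_mult_right_zero)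
  finally show ?thesis .
qed

lemma character_has_derivative:
  "((\<lambda>x. exp (- \<i> * of_real (x \<bullet> \<xi>))) has_derivative (\<lambda>v. (- \<i> * of_real (v \<bullet> \<xi>)) * exp (- \<i> * of_real (x \<bullet> \<xi>)))) (at x)"
proof -
  have "((\<lambda>x. - \<i> * complex_of_real (x \<bullet> \<xi>)) has_derivative (\<lambda>v. - \<i> * of_real (v \<bullet> \<xi>))) (at x)"
    by (auto intro!: derivative_eq_intros)
  moreover have "(exp has_derivative (*) (exp w)) (at w)" for w :: complex
    using DERIV_exp[of w] by (simp add: has_field_derivative_def)
  ultimately have "((\<lambda>x. exp (- \<i> * complex_of_real (x \<bullet> \<xi>))) has_derivative (\<lambda>v. exp (- \<i> * of_real (x \<bullet> \<xi>)) * (- \<i> * of_real (v \<bullet> \<xi>)))) (at x)"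
    by (rule has_derivative_compose)
  then show ?thesis by (simp only: mult.commute)
qed

lemma smooth_character: "smooth (\<lambda>x::complex. exp (- \<i> * of_real (x \<bullet> \<xi>)))"
proof -
  have "Ck n (\<lambda>x::complex. exp (- \<i> * of_real (x \<bullet> \<xi>)))" for n
  proof (induction n)
    case 0
    then show ?case by (auto intro!: continuous_intros)
  next
    case (Suc n)
    show ?case by (rule Ck_SucI[OF character_has_derivative]) (intro Ck_mult Ck_const Suc)
  qed
  then show ?thesis by (simp add: smooth_def)
qed

text \<open>Integration by parts: \<psi> times the character is again a test function, so its
  derivative integrates to 0.\<close>

lemma fourier_deriv:
  assumes \<psi>: "test_fun \<psi>"
  shows "fourier (\<lambda>x. frechet_derivative \<psi> (at x) v) \<xi> = \<i> * of_real (v \<bullet> \<xi>) * fourier \<psi> \<xi>"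
proof -
  let ?e = "\<lambda>x. exp (- \<i> * of_real (x \<bullet> \<xi>))"
  let ?D = "\<lambda>x. frechet_derivative \<psi> (at x) v"
  have t: "test_fun (\<lambda>x. ?e x * \<psi> x)" by (rule test_fun_mult[OF smooth_character \<psi>])
  have "((\<lambda>x. ?e x * \<psi> x) has_derivative (\<lambda>v. ?e x * frechet_derivative \<psi> (at x) v + ((- \<i> * of_real (v \<bullet> \<xi>)) * ?e x) * \<psi> x)) (at x)" for x
    by (rule has_derivative_mult[OF character_has_derivative test_fun_has_derivative[OF \<psi>]])
  from frechet_derivative_at[OF this]
  have d: "frechet_derivative (\<lambda>x. ?e x * \<psi> x) (at x) v = ?D x * ?e x - (\<i> * of_real (v \<bullet> \<xi>)) * (\<psi> x * ?e x)" for x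
    by (simp add: fun_eq_iff mult_ac)
  have "0 = (\<integral>x. ?D x * ?e x - (\<i> * of_real (v \<bullet> \<xi>)) * (\<psi> x * ?e x) \<partial>lborel)"
    using test_fun_integral_deriv[OF t, of v] unfolding d by simp
  also have "\<dots> = (\<integral>x. ?D x * ?e x \<partial>lborel) - (\<integral>x. (\<i> * of_real (v \<bullet> \<xi>)) * (\<psi> x * ?e x) \<partial>lborel)"
    by (intro Bochner_Integration.integral_diff integrable_mult_right fourier_integrable test_fun_integrable test_fun_deriv \<psi>)
  also have "\<dots> = fourier ?D \<xi> - \<i> * of_real (v \<bullet> \<xi>) * fourier \<psi> \<xi>"
    by (simp only: fourier_def integral_mult_right_zero)
  finally show ?thesis by simp
qed

lemma test_fun_add: "test_fun f \<Longrightarrow> test_fun g \<Longrightarrow> test_fun (\<lambda>x. f x + g x)"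
proof -
  assume f: "test_fun f" and g: "test_fun g"
  obtain R where R: "0 < R" "\<And>z. R \<le> cmod z \<Longrightarrow> f z = 0" using test_fun_support[OF f] by blast
  obtain R' where R': "0 < R'" "\<And>z. R' \<le> cmod z \<Longrightarrow> g z = 0" using test_fun_support[OF g] by blast
  show ?thesis
    by (rule test_funI[of _ "max R R'"]) (use f g R R' in \<open>auto simp: test_fun_def smooth_def Ck_add\<close>)
qed

definition laplace :: "(complex \<Rightarrow> complex) \<Rightarrow> complex \<Rightarrow> complex" where
  "laplace f x = frechet_derivative (\<lambda>x. frechet_derivative f (at x) 1) (at x) 1
     + frechet_derivative (\<lambda>x. frechet_derivative f (at x) \<i>) (at x) \<i>"

lemma test_fun_laplace: "test_fun f \<Longrightarrow> test_fun (laplace f)"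
  unfolding laplace_def[abs_def] by (intro test_fun_add test_fun_deriv)

lemma fourier_laplace:
  assumes \<psi>: "test_fun \<psi>"
  shows "fourier (laplace \<psi>) \<xi> = - of_real ((cmod \<xi>)\<^sup>2) * fourier \<psi> \<xi>"
proof -
  let ?D = "\<lambda>v x. frechet_derivative (\<lambda>x. frechet_derivative \<psi> (at x) v) (at x) v"
  have "fourier (laplace \<psi>) \<xi> = fourier (?D 1) \<xi> + fourier (?D \<i>) \<xi>"
    unfolding fourier_def laplace_def distrib_right
    by (intro Bochner_Integration.integral_add fourier_integrable test_fun_integrable test_fun_deriv \<psi>)
  also have "\<dots> = (\<i> * of_real (1 \<bullet> \<xi>)) * ((\<i> * of_real (1 \<bullet> \<xi>)) * fourier \<psi> \<xi>)
      + (\<i> * of_real (\<i> \<bullet> \<xi>)) * ((\<i> * of_real (\<i> \<bullet> \<xi>)) * fourier \<psi> \<xi>)"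
    by (simp only: fourier_deriv[OF test_fun_deriv[OF \<psi>]] fourier_deriv[OF \<psi>])
  also have "\<dots> = - (of_real ((Re \<xi>)\<^sup>2 + (Im \<xi>)\<^sup>2)) * fourier \<psi> \<xi>"
    by (simp add: inner_complex_def power2_eq_square algebra_simps)
  also have "(Re \<xi>)\<^sup>2 + (Im \<xi>)\<^sup>2 = (cmod \<xi>)\<^sup>2" by (rule cmod_power2[symmetric])
  finally show ?thesis .
qed

text \<open>Two Laplacians give decay of order -4 in the weight, which is integrable over the plane;
  a single one would give only the borderline order -2.\<close>

lemma fourier_test_fun_integrable:
  assumes \<psi>: "test_fun \<psi>"
  shows "integrable lborel (fourier \<psi>)"
proof -
  define C where "C = 2 * (\<integral>x. cmod (\<psi> x) \<partial>lborel) + 2 * (\<integral>x. cmod (laplace (laplace \<psi>) x) \<partial>lborel)"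
  have C0: "0 \<le> C" by (simp add: C_def)
  have [measurable]: "\<psi> \<in> borel_measurable borel" by (rule test_fun_measurable[OF \<psi>])
  have bnd: "cmod (fourier \<psi> \<xi>) \<le> C * jbr \<xi> powr - 4" for \<xi>
  proof -
    have 1: "cmod (fourier \<psi> \<xi>) \<le> (\<integral>x. cmod (\<psi> x) \<partial>lborel)" by (rule fourier_bounded)
    have "fourier (laplace (laplace \<psi>)) \<xi> = of_real ((cmod \<xi>) ^ 4) * fourier \<psi> \<xi>"
      by (simp add: fourier_laplace[OF test_fun_laplace[OF \<psi>]] fourier_laplace[OF \<psi>])
    then have "cmod (fourier (laplace (laplace \<psi>)) \<xi>) = (cmod \<xi>) ^ 4 * cmod (fourier \<psi> \<xi>)"
      by (simp add: norm_mult norm_power)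
    then have 2: "(cmod \<xi>) ^ 4 * cmod (fourier \<psi> \<xi>) \<le> (\<integral>x. cmod (laplace (laplace \<psi>) x) \<partial>lborel)"
      using fourier_bounded[of "laplace (laplace \<psi>)" \<xi>] by simp
    have "(1 + (cmod \<xi>)\<^sup>2)\<^sup>2 \<le> 2 + 2 * (cmod \<xi>) ^ 4"
    proof -
      have "0 \<le> (1 - (cmod \<xi>)\<^sup>2)\<^sup>2" by simp
      then show ?thesis by (simp add: power2_eq_square algebra_simps power4_eq_xxxx)
    qed
    then have "(1 + (cmod \<xi>)\<^sup>2)\<^sup>2 * cmod (fourier \<psi> \<xi>) \<le> (2 + 2 * (cmod \<xi>) ^ 4) * cmod (fourier \<psi> \<xi>)"
      by (rule mult_right_mono) simp
    also have "\<dots> \<le> C" using 1 2 by (simp add: C_def algebra_simps)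
    finally have "(jbr \<xi>) ^ 4 * cmod (fourier \<psi> \<xi>) \<le> C"
      by (simp add: jbr_power2[symmetric] power_mult[symmetric])
    then show ?thesis by (simp add: powr_minus_divide powr_numeral field_simps)
  qed
  show ?thesis
  proof (intro integrableI_bounded)
    have "(\<integral>\<^sup>+\<xi>. ennreal (cmod (fourier \<psi> \<xi>)) \<partial>lborel) \<le> (\<integral>\<^sup>+\<xi>. ennreal C * ennreal (jbr \<xi> powr - 4) \<partial>lborel)"
      using bnd C0 by (intro nn_integral_mono) (simp add: ennreal_mult[symmetric] ennreal_leI)
    also have "\<dots> = ennreal C * (\<integral>\<^sup>+\<xi>. ennreal (jbr \<xi> powr - 4) \<partial>lborel)" by (rule nn_integral_cmult) measurable
    also have "\<dots> < \<infinity>" using nn_integral_jbr_powr_finite[of 4] by (simp add: ennreal_mult_less_top)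
    finally show "(\<integral>\<^sup>+\<xi>. ennreal (norm (fourier \<psi> \<xi>)) \<partial>lborel) < \<infinity>" .
  qed measurable
qed

text \<open>For t > 0 its Fourier transform at x is t^(-2) times that of \<eta> at (x - a)/t: an
  approximate identity centred at a that is the transform of a test function. The summand 0 matches
  the form of the affine substitution lemmas.\<close>

definition modulated :: "(complex \<Rightarrow> complex) \<Rightarrow> real \<Rightarrow> complex \<Rightarrow> complex \<Rightarrow> complex" where
  "modulated \<eta> t a \<xi> = exp (- \<i> * of_real (\<xi> \<bullet> (- a))) * \<eta> (0 + t *\<^sub>R \<xi>)"

lemma test_fun_modulated: "test_fun \<eta> \<Longrightarrow> t \<noteq> 0 \<Longrightarrow> test_fun (modulated \<eta> t a)"
  unfolding modulated_def[abs_def] by (intro test_fun_mult smooth_character test_fun_affine)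

text \<open>The substitution x = a + t y brings the smoothing of u to the shape in which the
  distributional Fourier transform of u is defined.\<close>

lemma convolution_eq_fourier_modulated:
  assumes \<eta>: "test_fun \<eta>" and t: "0 < t" and [measurable]: "u \<in> borel_measurable borel"
  shows "(\<integral>y. u (a + t *\<^sub>R y) * fourier \<eta> y \<partial>lborel) = (\<integral>x. u x * fourier (modulated \<eta> t a) x \<partial>lborel)"
proof -
  have [measurable]: "\<eta> \<in> borel_measurable borel" "modulated \<eta> t a \<in> borel_measurable borel"
    using t by (auto intro!: test_fun_measurable test_fun_modulated \<eta>)
  have k: "fourier \<eta> y = of_real (t\<^sup>2) * fourier (modulated \<eta> t a) (a + t *\<^sub>R y)" for y
  proof -
    have "fourier \<eta> y = t\<^sup>2 *\<^sub>R (\<integral>\<xi>. \<eta> (0 + t *\<^sub>R \<xi>) * exp (- \<i> * of_real ((0 + t *\<^sub>R \<xi>) \<bullet> y)) \<partial>lborel)"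
      unfolding fourier_def using t by (subst integral_lborel_affine[of _ t 0]) auto
    also have "(\<integral>\<xi>. \<eta> (0 + t *\<^sub>R \<xi>) * exp (- \<i> * of_real ((0 + t *\<^sub>R \<xi>) \<bullet> y)) \<partial>lborel) = fourier (modulated \<eta> t a) (a + t *\<^sub>R y)"
      unfolding fourier_def modulated_def
      by (intro Bochner_Integration.integral_cong) (simp_all add: inner_add_right exp_add[symmetric] algebra_simps)
    finally show ?thesis by (simp add: scaleR_conv_of_real)
  qed
  have "(\<integral>x. u x * fourier (modulated \<eta> t a) x \<partial>lborel) = t\<^sup>2 *\<^sub>R (\<integral>y. u (a + t *\<^sub>R y) * fourier (modulated \<eta> t a) (a + t *\<^sub>R y) \<partial>lborel)"
    using t by (subst integral_lborel_affine[of _ t a]) auto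
  also have "\<dots> = (\<integral>y. of_real (t\<^sup>2) * (u (a + t *\<^sub>R y) * fourier (modulated \<eta> t a) (a + t *\<^sub>R y)) \<partial>lborel)"
    by (simp only: integral_mult_right_zero scaleR_conv_of_real)
  also have "\<dots> = (\<integral>y. u (a + t *\<^sub>R y) * fourier \<eta> y \<partial>lborel)"
    unfolding k by (simp only: mult_ac)
  finally show ?thesis ..
qed

lemma cmod_exp_minus_1_le: "cmod (exp (- \<i> * of_real r) - 1) \<le> \<bar>r\<bar>"
proof -
  have "exp (- \<i> * of_real r) = exp (\<i> * of_real (- r))" by simp
  then have "cmod (exp (- \<i> * of_real r) - 1) = 2 * \<bar>sin (- r / 2)\<bar>"
    by (simp only: dist_exp_i_1)
  also have "\<dots> \<le> 2 * \<bar>- r / 2\<bar>" by (intro mult_left_mono abs_sin_x_le_abs_x) auto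
  finally show ?thesis by simp
qed

text \<open>An auxiliary function for proving that the transform of the bump has nonzero integral.
  Fourier inversion would give 4 pi^2 times the value of the bump at 0, but only nonvanishing
  matters.\<close>

definition disc :: "complex \<Rightarrow> complex" where "disc z = of_real (indicator (ball 0 1) z)"

lemma disc_integrable: "integrable lborel disc"
  unfolding disc_def[abs_def] using integrable_ball_indicator[of 0 1 "1::real"] by (intro integrable_of_real) simp

lemma disc_measurable [measurable]: "disc \<in> borel_measurable borel"
  using disc_integrable by (auto dest: borel_measurable_integrable)

text \<open>For x in the unit disc the inner product with \<xi> is at most 1/2 in modulus, so the
  exponential is within 1/2 of 1 and the transform within pi/2 of the area pi.\<close>

lemma fourier_disc_lower:
  assumes "cmod \<xi> \<le> 1 / 2"
  shows "pi / 2 \<le> cmod (fourier disc \<xi>)"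
proof -
  have mass: "(\<integral>x. disc x \<partial>lborel) = of_real pi"
    unfolding disc_def by (simp add: measure_def emeasure_complex_ball)
  have "fourier disc \<xi> - of_real pi = (\<integral>x. disc x * exp (- \<i> * of_real (x \<bullet> \<xi>)) - disc x \<partial>lborel)"
    unfolding fourier_def mass[symmetric]
    by (intro Bochner_Integration.integral_diff[symmetric] fourier_integrable disc_integrable)
  also have "cmod \<dots> \<le> (\<integral>x. cmod (disc x * exp (- \<i> * of_real (x \<bullet> \<xi>)) - disc x) \<partial>lborel)" by (rule integral_norm_bound)
  also have "\<dots> \<le> (\<integral>x. indicator (ball (0::complex) 1) x *\<^sub>R (1 / 2) \<partial>lborel)"
  proof (rule integral_mono)
    show "integrable lborel (\<lambda>x. cmod (disc x * exp (- \<i> * of_real (x \<bullet> \<xi>)) - disc x))"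
      by (intro integrable_norm Bochner_Integration.integrable_diff fourier_integrable disc_integrable)
    show "integrable lborel (\<lambda>x. indicator (ball (0::complex) 1) x *\<^sub>R (1 / 2 :: real))" by (rule integrable_ball_indicator)
    fix x :: complex
    show "cmod (disc x * exp (- \<i> * of_real (x \<bullet> \<xi>)) - disc x) \<le> indicator (ball 0 1) x *\<^sub>R (1 / 2)"
    proof (cases "x \<in> ball 0 1")
      case True
      have "\<bar>x \<bullet> \<xi>\<bar> \<le> cmod x * cmod \<xi>" by (rule Cauchy_Schwarz_ineq2)
      also have "\<dots> \<le> 1 * (1 / 2)" using True assms by (intro mult_mono) auto
      finally have "cmod (exp (- \<i> * of_real (x \<bullet> \<xi>)) - 1) \<le> 1 / 2" using cmod_exp_minus_1_le[of "x \<bullet> \<xi>"] by linarith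
      then show ?thesis using True by (simp add: disc_def)
    qed (simp add: disc_def)
  qed
  also have "\<dots> = pi / 2" by (simp add: measure_def emeasure_complex_ball)
  finally have "cmod (fourier disc \<xi> - of_real pi) \<le> pi / 2" .
  then show ?thesis using norm_triangle_ineq2[of "of_real pi" "fourier disc \<xi>"] by (simp add: norm_minus_commute)
qed

lemma fourier_disc_cnj: "(\<integral>a. disc a * exp (- \<i> * of_real (\<xi> \<bullet> (- a))) \<partial>lborel) = cnj (fourier disc \<xi>)"
  unfolding fourier_def Bochner_Integration.integral_cnj[symmetric]
  by (intro Bochner_Integration.integral_cong) (simp_all add: disc_def exp_cnj inner_commute)

text \<open>The multiplication formula and Fubini exhibit the pairing of the disc with its smoothing
  as an integral of |fourier disc|^2 against the dilated bump. Since the bump is nonnegative, this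
  can be bounded from below.\<close>

lemma bump_disc_form:
  assumes t: "0 < t"
  shows "(\<integral>a. indicator (ball 0 1) a *\<^sub>R (\<integral>y. disc (a + t *\<^sub>R y) * fourier bump y \<partial>lborel) \<partial>lborel)
    = of_real (\<integral>\<xi>. flat_exp 0 (1 - (cmod (t *\<^sub>R \<xi>))\<^sup>2) * (cmod (fourier disc \<xi>))\<^sup>2 \<partial>lborel)"
    "integrable lborel (\<lambda>\<xi>. flat_exp 0 (1 - (cmod (t *\<^sub>R \<xi>))\<^sup>2) * (cmod (fourier disc \<xi>))\<^sup>2)"
proof -
  note b = test_fun_bump
  have [measurable]: "bump \<in> borel_measurable borel" by (rule test_fun_measurable[OF b])
  have bt: "integrable lborel (\<lambda>\<xi>. bump (0 + t *\<^sub>R \<xi>))"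
    using t by (intro test_fun_integrable test_fun_affine b) auto
  define g where "g \<xi> = bump (0 + t *\<^sub>R \<xi>) * fourier disc \<xi>" for \<xi>
  have [measurable]: "g \<in> borel_measurable borel" unfolding g_def by measurable
  define B where "B = (\<integral>x. cmod (disc x) \<partial>lborel)"
  have B: "cmod (fourier disc \<xi>) \<le> B" for \<xi> unfolding B_def by (rule fourier_bounded)
  have gi: "integrable lborel g"
  proof (rule Bochner_Integration.integrable_bound)
    show "integrable lborel (\<lambda>\<xi>. of_real B * bump (0 + t *\<^sub>R \<xi>))" using bt by simp
    show "AE \<xi> in lborel. norm (g \<xi>) \<le> norm (of_real B * bump (0 + t *\<^sub>R \<xi>))"
    proof (intro AE_I2)
      fix \<xi>
      have "cmod (fourier disc \<xi>) * cmod (bump (0 + t *\<^sub>R \<xi>)) \<le> \<bar>B\<bar> * cmod (bump (0 + t *\<^sub>R \<xi>))"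
        using B[of \<xi>] by (intro mult_right_mono) auto
      then show "norm (g \<xi>) \<le> norm (of_real B * bump (0 + t *\<^sub>R \<xi>))" by (simp add: g_def norm_mult mult.commute)
    qed
  qed measurable
  let ?h = "\<lambda>a \<xi>. disc a * exp (- \<i> * of_real (\<xi> \<bullet> (- a))) * g \<xi>"
  have int: "integrable (lborel \<Otimes>\<^sub>M lborel) (\<lambda>(a, \<xi>). ?h a \<xi>)"
  proof -
    have "integrable (lborel \<Otimes>\<^sub>M lborel) (\<lambda>p. ?h (fst p) (snd p))"
    proof (rule lborel_pair.Fubini_integrable)
      show "integrable lborel (\<lambda>x. \<integral>y. norm (?h (fst (x, y)) (snd (x, y))) \<partial>lborel)"
        using disc_integrable unfolding fst_conv snd_conv norm_mult fourier_kernel_norm by simp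
      show "AE x in lborel. integrable lborel (\<lambda>y. ?h (fst (x, y)) (snd (x, y)))"
      proof (intro AE_I2)
        fix x
        have "integrable lborel (\<lambda>y. disc x * (g y * exp (- \<i> * of_real (y \<bullet> (- x)))))"
          by (intro integrable_mult_right fourier_integrable gi)
        then show "integrable lborel (\<lambda>y. ?h (fst (x, y)) (snd (x, y)))" by (simp only: fst_conv snd_conv mult_ac)
      qed
    qed measurable
    then show ?thesis by (simp only: case_prod_unfold)
  qed
  have eq: "cnj (fourier disc \<xi>) * g \<xi> = of_real (flat_exp 0 (1 - (cmod (t *\<^sub>R \<xi>))\<^sup>2) * (cmod (fourier disc \<xi>))\<^sup>2)" for \<xi>
    using complex_norm_square[of "fourier disc \<xi>"] by (simp add: g_def bump_real mult_ac)
  have "(\<integral>a. indicator (ball 0 1) a *\<^sub>R (\<integral>y. disc (a + t *\<^sub>R y) * fourier bump y \<partial>lborel) \<partial>lborel)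
     = (\<integral>a. disc a * (\<integral>\<xi>. modulated bump t a \<xi> * fourier disc \<xi> \<partial>lborel) \<partial>lborel)"
  proof (intro Bochner_Integration.integral_cong refl)
    fix a
    have "(\<integral>y. disc (a + t *\<^sub>R y) * fourier bump y \<partial>lborel) = (\<integral>x. disc x * fourier (modulated bump t a) x \<partial>lborel)"
      by (rule convolution_eq_fourier_modulated[OF b t]) measurable
    also have "\<dots> = (\<integral>\<xi>. modulated bump t a \<xi> * fourier disc \<xi> \<partial>lborel)"
      using t by (intro fourier_swap disc_integrable test_fun_integrable test_fun_modulated b) auto
    finally show "indicator (ball 0 1) a *\<^sub>R (\<integral>y. disc (a + t *\<^sub>R y) * fourier bump y \<partial>lborel) = disc a * (\<integral>\<xi>. modulated bump t a \<xi> * fourier disc \<xi> \<partial>lborel)"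
      by (simp only: disc_def[of a] scaleR_conv_of_real)
  qed
  also have "\<dots> = (\<integral>a. (\<integral>\<xi>. ?h a \<xi> \<partial>lborel) \<partial>lborel)"
    by (simp only: integral_mult_right_zero[symmetric] modulated_def g_def mult.assoc)
  also have "\<dots> = (\<integral>\<xi>. (\<integral>a. ?h a \<xi> \<partial>lborel) \<partial>lborel)" by (rule lborel_pair.Fubini_integral[symmetric, OF int])
  also have "\<dots> = (\<integral>\<xi>. cnj (fourier disc \<xi>) * g \<xi> \<partial>lborel)"
    by (simp only: integral_mult_left_zero fourier_disc_cnj)
  also have "\<dots> = (\<integral>\<xi>. of_real (flat_exp 0 (1 - (cmod (t *\<^sub>R \<xi>))\<^sup>2) * (cmod (fourier disc \<xi>))\<^sup>2) \<partial>lborel)"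
    by (simp only: eq)
  finally show "(\<integral>a. indicator (ball 0 1) a *\<^sub>R (\<integral>y. disc (a + t *\<^sub>R y) * fourier bump y \<partial>lborel) \<partial>lborel)
    = of_real (\<integral>\<xi>. flat_exp 0 (1 - (cmod (t *\<^sub>R \<xi>))\<^sup>2) * (cmod (fourier disc \<xi>))\<^sup>2 \<partial>lborel)"
    by (simp only: integral_complex_of_real)
  have "integrable lborel (\<lambda>\<xi>. cnj (fourier disc \<xi>) * g \<xi>)"
  proof (rule Bochner_Integration.integrable_bound)
    show "integrable lborel (\<lambda>\<xi>. of_real B * g \<xi>)" using gi by simp
    show "AE \<xi> in lborel. norm (cnj (fourier disc \<xi>) * g \<xi>) \<le> norm (of_real B * g \<xi>)"
    proof (intro AE_I2)
      fix \<xi>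
      have "cmod (fourier disc \<xi>) * cmod (g \<xi>) \<le> \<bar>B\<bar> * cmod (g \<xi>)"
        using B[of \<xi>] by (intro mult_right_mono) auto
      then show "norm (cnj (fourier disc \<xi>) * g \<xi>) \<le> norm (of_real B * g \<xi>)" by (simp add: norm_mult)
    qed
  qed measurable
  from integrable_Re[OF this[unfolded eq]]
  show "integrable lborel (\<lambda>\<xi>. flat_exp 0 (1 - (cmod (t *\<^sub>R \<xi>))\<^sup>2) * (cmod (fourier disc \<xi>))\<^sup>2)" by (simp only: Re_complex_of_real)
qed

text \<open>If the integral vanished, the forms \<open>\<integral> bump (t \<xi>) |fourier disc \<xi>|\<^sup>2\<close> would tend to \<open>0\<close> as \<open>t\<close> does.\<close>
lemma integral_fourier_bump_nonzero: "(\<integral>y. fourier bump y \<partial>lborel) \<noteq> 0"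
proof
  assume z: "(\<integral>y. fourier bump y \<partial>lborel) = 0"
  define t where "t n = 1 / (real n + 1)" for n :: nat
  have t: "0 < t n" "t n \<le> 1" for n by (auto simp: t_def)
  have t_lim: "t \<longlonglongrightarrow> 0" unfolding t_def using LIMSEQ_inverse_real_of_nat by (simp add: inverse_eq_divide add.commute)
  define S where "S = (\<integral>x. cmod (disc x) \<partial>lborel)"
  define J where "J n = (\<integral>a. indicator (ball 0 1) a *\<^sub>R (\<integral>y. disc (a + t n *\<^sub>R y) * fourier bump y \<partial>lborel) \<partial>lborel)" for n
  have "J \<longlonglongrightarrow> (\<integral>y. fourier bump y \<partial>lborel) * (\<integral>a. indicator (ball 0 1) a *\<^sub>R disc a \<partial>lborel)"
    unfolding J_def
  proof (rule approximate_identity_ball[where S=S])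
    show "integrable lborel (\<lambda>z. indicator (ball 0 R) z *\<^sub>R disc z)" for R
      by (rule Bochner_Integration.integrable_bound[OF disc_integrable]) (auto simp: indicator_def)
    show "(\<integral>\<^sup>+a. indicator (ball 0 1) a * ennreal (cmod (disc (a + s))) \<partial>lborel) \<le> ennreal S" for s
    proof -
      have "(\<integral>\<^sup>+a. indicator (ball 0 1) a * ennreal (cmod (disc (a + s))) \<partial>lborel) \<le> (\<integral>\<^sup>+a. ennreal (cmod (disc (s + a))) \<partial>lborel)"
        by (intro nn_integral_mono) (auto simp: indicator_def add.commute)
      also have "\<dots> = (\<integral>\<^sup>+a. ennreal (cmod (disc a)) \<partial>lborel)"
        by (rule nn_integral_lborel_translate[where f="\<lambda>a. ennreal (cmod (disc a))"]) measurable
      also have "\<dots> = ennreal S" unfolding S_def using disc_integrable by (intro nn_integral_eq_integral) auto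
      finally show ?thesis .
    qed
  qed (use t_lim fourier_test_fun_integrable[OF test_fun_bump] in \<open>auto simp: S_def\<close>)
  then have lim: "(\<lambda>n. cmod (J n)) \<longlonglongrightarrow> 0" by (simp add: z tendsto_norm_zero)
  \<comment> \<open>For |\<xi>| < 1/2 and t n \<le> 1 the dilated bump is at least
    \<open>flat_exp 0 (3 / 4)\<close> = exp(-4/3) and |fourier disc| is at least pi/2, so the forms
    stay above a positive constant independent of n.\<close>
  define \<kappa> where "\<kappa> = flat_exp 0 (3 / 4) * (pi / 2)\<^sup>2 * measure lborel (ball (0::complex) (1 / 2))"
  have \<kappa>: "0 < \<kappa>" by (simp add: \<kappa>_def flat_exp_def measure_def emeasure_complex_ball)
  have "\<kappa> \<le> cmod (J n)" for n
  proof -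
    let ?f = "\<lambda>\<xi>. flat_exp 0 (1 - (cmod (t n *\<^sub>R \<xi>))\<^sup>2) * (cmod (fourier disc \<xi>))\<^sup>2"
    have "\<kappa> = (\<integral>\<xi>. indicator (ball (0::complex) (1 / 2)) \<xi> *\<^sub>R (flat_exp 0 (3 / 4) * (pi / 2)\<^sup>2) \<partial>lborel)"
      by (simp add: \<kappa>_def)
    also have "\<dots> \<le> (\<integral>\<xi>. ?f \<xi> \<partial>lborel)"
    proof (rule integral_mono[OF integrable_ball_indicator bump_disc_form(2)[OF t(1)]])
      fix \<xi> :: complex
      show "indicator (ball (0::complex) (1 / 2)) \<xi> *\<^sub>R (flat_exp 0 (3 / 4) * (pi / 2)\<^sup>2) \<le> ?f \<xi>"
      proof (cases "\<xi> \<in> ball 0 (1 / 2)")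
        case True
        then have x: "cmod \<xi> \<le> 1 / 2" by simp
        have "t n * cmod \<xi> \<le> 1 * cmod \<xi>" using t by (intro mult_right_mono) auto
        then have "cmod (t n *\<^sub>R \<xi>) \<le> 1 / 2" using x t(1)[of n] by simp
        then have "flat_exp 0 (3 / 4) * (pi / 2)\<^sup>2 \<le> ?f \<xi>"
          by (intro mult_mono bump_lower power_mono fourier_disc_lower x) (auto simp: flat_exp_le)
        then show ?thesis using True by (simp del: mem_ball_0 mem_ball)
      qed (simp add: flat_exp_le)
    qed
    also have "\<dots> \<le> cmod (J n)" unfolding J_def bump_disc_form(1)[OF t(1)] by simp
    finally show ?thesis .
  qed
  then have "\<kappa> \<le> 0" by (intro LIMSEQ_le_const[OF lim]) auto
  then show False using \<kappa> by simp
qed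

text \<open>For s > 1 Cauchy-Schwarz gives F in L1, as the power -2s of the weight is integrable.
  Each smoothing of v is F paired with a function of modulus at most 1, hence bounded by the L1 norm
  of F independently of scale and centre; dividing by the nonzero integral of K bounds v.\<close>

lemma Hs_AE_bounded:
  assumes v: "v \<in> Hs s" and s: "1 < s"
  shows "\<exists>M\<ge>0. AE z in lborel. cmod (v z) \<le> M"
proof -
  from v obtain F where vL2: "v \<in> L2" and [measurable]: "F \<in> borel_measurable borel"
    and F2: "integrable lborel (\<lambda>\<xi>. (jbr \<xi> powr s * cmod (F \<xi>))\<^sup>2)"
    and dual: "\<And>\<psi>. test_fun \<psi> \<Longrightarrow> (\<integral>\<xi>. F \<xi> * \<psi> \<xi> \<partial>lborel) = (\<integral>x. v x * fourier \<psi> x \<partial>lborel)"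
    by (auto simp: Hs_def)
  have vm[measurable]: "v \<in> borel_measurable borel" using vL2 by (simp add: L2_def)
  have v2: "(\<integral>\<^sup>+z. (ennreal (cmod (v z)))\<^sup>2 \<partial>lborel) < \<infinity>"
    using vL2 by (simp add: L2_def integrable_iff_bounded ennreal_power)
  have Fi: "integrable lborel F"
  proof (intro integrableI_bounded)
    have "(\<integral>\<^sup>+\<xi>. ennreal (norm (F \<xi>)) \<partial>lborel) = (\<integral>\<^sup>+\<xi>. ennreal (jbr \<xi> powr s * cmod (F \<xi>)) * ennreal (jbr \<xi> powr - s) \<partial>lborel)"
      by (intro nn_integral_cong) (simp add: ennreal_mult[symmetric] powr_minus)
    then have "(\<integral>\<^sup>+\<xi>. ennreal (norm (F \<xi>)) \<partial>lborel)\<^sup>2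
      \<le> (\<integral>\<^sup>+\<xi>. (ennreal (jbr \<xi> powr s * cmod (F \<xi>)))\<^sup>2 \<partial>lborel) * (\<integral>\<^sup>+\<xi>. (ennreal (jbr \<xi> powr - s))\<^sup>2 \<partial>lborel)"
      by (simp only:) (rule Cauchy_Schwarz_nn_integral; measurable)
    also have "(\<integral>\<^sup>+\<xi>. (ennreal (jbr \<xi> powr - s))\<^sup>2 \<partial>lborel) = (\<integral>\<^sup>+\<xi>. ennreal (jbr \<xi> powr - (2 * s)) \<partial>lborel)"
    proof (intro nn_integral_cong)
      fix \<xi>
      have "jbr \<xi> powr - (2 * s) = (jbr \<xi> powr - s)\<^sup>2" by (simp add: power2_eq_square powr_add[symmetric])
      then show "(ennreal (jbr \<xi> powr - s))\<^sup>2 = ennreal (jbr \<xi> powr - (2 * s))" by (simp add: ennreal_power)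
    qed
    also have "(\<integral>\<^sup>+\<xi>. (ennreal (jbr \<xi> powr s * cmod (F \<xi>)))\<^sup>2 \<partial>lborel) * (\<integral>\<^sup>+\<xi>. ennreal (jbr \<xi> powr - (2 * s)) \<partial>lborel) < \<infinity>"
      using F2 nn_integral_jbr_powr_finite[of "2 * s"] s
      by (simp add: ennreal_mult_less_top integrable_iff_bounded ennreal_power)
    finally show "(\<integral>\<^sup>+\<xi>. ennreal (norm (F \<xi>)) \<partial>lborel) < \<infinity>" by (rule ennreal_power2_less_topD)
  qed measurable
  define C where "C = (\<integral>\<xi>. cmod (F \<xi>) \<partial>lborel)"
  have C0: "0 \<le> C" by (simp add: C_def)
  define K where "K = fourier bump"
  have Ki: "integrable lborel K" unfolding K_def by (rule fourier_test_fun_integrable[OF test_fun_bump])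
  define c where "c = cmod (\<integral>y. K y \<partial>lborel)"
  have c: "0 < c" using integral_fourier_bump_nonzero by (simp add: c_def K_def)
  have conv: "cmod (\<integral>y. v (a + t *\<^sub>R y) * K y \<partial>lborel) \<le> C" if t: "0 < t" for a t
  proof -
    have tm: "test_fun (modulated bump t a)" using t by (intro test_fun_modulated test_fun_bump) auto
    have "(\<integral>y. v (a + t *\<^sub>R y) * K y \<partial>lborel) = (\<integral>\<xi>. F \<xi> * modulated bump t a \<xi> \<partial>lborel)"
      unfolding K_def convolution_eq_fourier_modulated[OF test_fun_bump t vm] by (rule dual[OF tm, symmetric])
    also have "cmod \<dots> \<le> (\<integral>\<xi>. cmod (F \<xi> * modulated bump t a \<xi>) \<partial>lborel)" by (rule integral_norm_bound)
    also have "\<dots> \<le> C" unfolding C_def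
    proof (rule integral_mono')
      show "integrable lborel (\<lambda>\<xi>. cmod (F \<xi>))" using Fi by (rule integrable_norm)
      fix \<xi>
      have "cmod (modulated bump t a \<xi>) \<le> 1"
        unfolding modulated_def norm_mult fourier_kernel_norm using flat_exp_le(1)[of 0] flat_exp_le_1 by (simp add: bump_real)
      then have "cmod (F \<xi>) * cmod (modulated bump t a \<xi>) \<le> cmod (F \<xi>) * 1" by (rule mult_left_mono) simp
      then show "cmod (F \<xi> * modulated bump t a \<xi>) \<le> cmod (F \<xi>)" by (simp add: norm_mult)
    qed simp
    finally show ?thesis .
  qed
  have vint: "integrable lborel (\<lambda>z. indicator (ball 0 R) z *\<^sub>R v z)" for R
  proof (rule sq_int_ball_integrable)
    have "sq_norm (weighted 1) v \<le> sq_norm (weighted 0) v" by (intro sq_norm_weighted_antimono vm) simp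
    also have "\<dots> = (\<integral>\<^sup>+z. (ennreal (cmod (v z)))\<^sup>2 \<partial>lborel)" by (simp add: sq_norm_weighted[OF vm])
    finally show "v \<in> sq_int (weighted 1)" using v2 by (auto simp: sq_int_def intro: le_less_trans)
  qed
  have "AE z in lborel. cmod (v z) \<le> 2 * (C / c)"
  proof (rule AE_bounded_of_ball_integrals[OF vm vint])
    fix x :: complex and r :: real assume r: "0 < r"
    have [measurable]: "ball x r \<in> sets borel" by simp
    obtain X where X: "(\<integral>\<^sup>+z. (ennreal (cmod (v z)))\<^sup>2 \<partial>lborel) = ennreal X" "0 \<le> X"
      using v2 by (cases "\<integral>\<^sup>+z. (ennreal (cmod (v z)))\<^sup>2 \<partial>lborel") auto
    have "c * cmod (\<integral>a. indicator (ball x r) a *\<^sub>R v a \<partial>lborel) \<le> C * measure lborel (ball x r)"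
      unfolding c_def
    \<comment> \<open>Cauchy-Schwarz on a ball of area pi r^2, with X the squared L2 norm of v,
      gives a local L1 bound that is the same for all translates.\<close>
    proof (rule approximate_identity_bound[OF vm vint, where S="sqrt (pi * r\<^sup>2 * X)"])
      show "(\<integral>\<^sup>+a. indicator (ball x r) a * ennreal (cmod (v (a + s))) \<partial>lborel) \<le> ennreal (sqrt (pi * r\<^sup>2 * X))" for s
      proof (rule ennreal_power2_le_imp_le)
        have "(\<integral>\<^sup>+a. indicator (ball x r) a * ennreal (cmod (v (a + s))) \<partial>lborel)\<^sup>2
          \<le> (\<integral>\<^sup>+a. (indicator (ball x r) a)\<^sup>2 \<partial>lborel) * (\<integral>\<^sup>+a. (ennreal (cmod (v (a + s))))\<^sup>2 \<partial>lborel)"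
          by (rule Cauchy_Schwarz_nn_integral) measurable
        also have "(\<integral>\<^sup>+a. (ennreal (cmod (v (a + s))))\<^sup>2 \<partial>lborel) = ennreal X"
          unfolding X(1)[symmetric] using nn_integral_lborel_translate[of "\<lambda>z. (ennreal (cmod (v z)))\<^sup>2" s] by (simp add: add.commute)
        also have "(\<integral>\<^sup>+a. (indicator (ball x r) a)\<^sup>2 \<partial>lborel) = (\<integral>\<^sup>+a. indicator (ball x r) a \<partial>lborel)"
          by (intro nn_integral_cong) (simp add: indicator_def)
        also have "\<dots> = ennreal (pi * r\<^sup>2)" using r by (simp add: emeasure_complex_ball)
        also have "ennreal (pi * r\<^sup>2) * ennreal X = (ennreal (sqrt (pi * r\<^sup>2 * X)))\<^sup>2"
          using X(2) by (simp add: ennreal_power ennreal_mult[symmetric])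
        finally show "(\<integral>\<^sup>+a. indicator (ball x r) a * ennreal (cmod (v (a + s))) \<partial>lborel)\<^sup>2 \<le> \<dots>" .
      qed
      show "cmod (\<integral>y. v (a + t *\<^sub>R y) * K y \<partial>lborel) \<le> C" if "a \<in> ball x r" "0 < t" "t \<le> 1" for a t
        by (rule conv[OF that(2)])
    qed (use Ki C0 X in auto)
    then show "cmod (\<integral>z. indicator (ball x r) z *\<^sub>R v z \<partial>lborel) \<le> C / c * measure lborel (ball x r)"
      using c by (simp add: field_simps)
  qed
  then show ?thesis using C0 c by (intro exI[of _ "2 * (C / c)"]) simp
qed

section \<open>The system\<close>

lemma Ck_linear_compose:
  assumes L: "bounded_linear L"
  shows "Ck n f \<Longrightarrow> Ck n (\<lambda>x. L (f x))"
proof (induction n arbitrary: f)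
  case 0
  then show ?case by (auto intro: bounded_linear.continuous_on[OF L])
next
  case (Suc n)
  note f = Ck_SucD[OF Suc.prems]
  show ?case by (rule Ck_SucI[OF bounded_linear.has_derivative[OF L f(1)] Suc.IH[OF f(2)]])
qed

lemma test_fun_cnj: "test_fun f \<Longrightarrow> test_fun (\<lambda>x. cnj (f x))"
  by (simp add: test_fun_def smooth_def Ck_linear_compose[OF bounded_linear_cnj])

lemma dbar_cnj:
  assumes "test_fun f" shows "dbar (\<lambda>x. cnj (f x)) z = cnj (dz f z)"
proof -
  have "((\<lambda>x. cnj (f x)) has_derivative (\<lambda>v. cnj (frechet_derivative f (at z) v))) (at z)"
    by (rule bounded_linear.has_derivative[OF bounded_linear_cnj test_fun_has_derivative[OF assms]])
  from dbar_eq[OF this] show ?thesis by (simp add: dz_def)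
qed

lemma integrable_mult_dbar:
  assumes f: "f \<in> sq_int (weighted 1)" and \<psi>: "test_fun \<psi>"
  shows "integrable lborel (\<lambda>z. f z * dbar \<psi> z)"
proof -
  have [measurable]: "f \<in> borel_measurable borel" using f by (simp add: sq_int_def)
  have [measurable]: "dbar \<psi> \<in> borel_measurable borel" by (rule dbar_test_fun[OF \<psi>])
  obtain B R where B: "0 < B" "0 < R" "\<And>z. cmod (dbar \<psi> z) \<le> B * indicator (ball 0 R) z"
    using dbar_test_fun(3)[OF \<psi>] by blast
  show ?thesis
  proof (rule Bochner_Integration.integrable_bound)
    show "integrable lborel (\<lambda>z. B *\<^sub>R (indicator (ball 0 R) z *\<^sub>R f z))"
      by (rule integrable_scaleR_right) (rule sq_int_ball_integrable[OF f])
    show "AE z in lborel. norm (f z * dbar \<psi> z) \<le> norm (B *\<^sub>R (indicator (ball 0 R) z *\<^sub>R f z))"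
    proof (intro AE_I2)
      fix z
      have "cmod (f z) * cmod (dbar \<psi> z) \<le> cmod (f z) * (B * indicator (ball 0 R) z)" by (intro mult_left_mono B) simp
      then show "norm (f z * dbar \<psi> z) \<le> norm (B *\<^sub>R (indicator (ball 0 R) z *\<^sub>R f z))"
        using B(1) by (simp add: norm_mult mult_ac)
    qed
  qed measurable
qed

text \<open>Both sides carry the factor h = 1/|k|, which is divided out; as in the operators, k then
  remains only in the phase.\<close>

lemma solves_system_iff:
  assumes k: "k \<noteq> 0"
  shows "solves_system \<sigma> k q \<phi>1 \<phi>2 \<longleftrightarrow> (\<forall>\<psi>. test_fun \<psi> \<longrightarrow>
     (\<integral>z. \<phi>1 z * dbar \<psi> z \<partial>lborel) = - (1 / 2) * (\<integral>z. phase k z * q z * \<phi>2 z * \<psi> z \<partial>lborel) \<and>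
     (\<integral>z. \<phi>2 z * dz \<psi> z \<partial>lborel) = - (1 / 2) * (\<integral>z. \<sigma> * (cnj (phase k z) * cnj (q z) * \<phi>1 z * \<psi> z) \<partial>lborel))"
proof -
  define h where "h = complex_of_real (1 / cmod k)"
  have h: "h \<noteq> 0" using k by (simp add: h_def)
  have 1: "(\<integral>z. exp (cnj (k * z) - k * z) * (h * q z / 2) * \<phi>2 z * \<psi> z \<partial>lborel)
     = h / 2 * (\<integral>z. phase k z * q z * \<phi>2 z * \<psi> z \<partial>lborel)" for \<psi>
  proof -
    have "(\<integral>z. exp (cnj (k * z) - k * z) * (h * q z / 2) * \<phi>2 z * \<psi> z \<partial>lborel) = (\<integral>z. h / 2 * (phase k z * q z * \<phi>2 z * \<psi> z) \<partial>lborel)"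
      by (intro Bochner_Integration.integral_cong) (simp_all add: phase_def)
    then show ?thesis by (simp only: integral_mult_right_zero)
  qed
  have 2: "(\<integral>z. \<sigma> * exp (k * z - cnj (k * z)) * (h * cnj (q z) / 2) * \<phi>1 z * \<psi> z \<partial>lborel)
     = h / 2 * (\<integral>z. \<sigma> * (cnj (phase k z) * cnj (q z) * \<phi>1 z * \<psi> z) \<partial>lborel)" for \<psi>
  proof -
    have "(\<integral>z. \<sigma> * exp (k * z - cnj (k * z)) * (h * cnj (q z) / 2) * \<phi>1 z * \<psi> z \<partial>lborel)
      = (\<integral>z. h / 2 * (\<sigma> * (cnj (phase k z) * cnj (q z) * \<phi>1 z * \<psi> z)) \<partial>lborel)"
      by (intro Bochner_Integration.integral_cong) (simp_all add: cnj_phase)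
    then show ?thesis by (simp only: integral_mult_right_zero)
  qed
  have alg: "- h * X = h / 2 * Y \<longleftrightarrow> X = - (1 / 2) * Y" for X Y
  proof -
    have e: "h / 2 * Y - (- h * X) = h * (X + 1 / 2 * Y)" by (simp add: algebra_simps)
    have "- h * X = h / 2 * Y \<longleftrightarrow> h / 2 * Y - (- h * X) = 0" by (metis right_minus_eq)
    also have "\<dots> \<longleftrightarrow> h * (X + 1 / 2 * Y) = 0" unfolding e ..
    also have "\<dots> \<longleftrightarrow> X = - (1 / 2) * Y" using h by (simp add: eq_neg_iff_add_eq_0)
    finally show ?thesis .
  qed
  show ?thesis unfolding solves_system_def h_def[symmetric] 1 2 alg ..
qed

lemma sq_int_mono: "a \<le> b \<Longrightarrow> sq_int (weighted a) \<subseteq> sq_int (weighted b)"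
  using sq_norm_weighted_antimono[of a b] by (auto simp: sq_int_def intro: le_less_trans)

lemma sq_int_cnj: "u \<in> sq_int (weighted a) \<Longrightarrow> (\<lambda>z. cnj (u z)) \<in> sq_int (weighted a)"
  by (auto simp: sq_int_def)

section \<open>The operator A on the weighted spaces\<close>

context admissible
begin

lemma opA_eq: "k \<noteq> 0 \<Longrightarrow> opA k q u = (\<lambda>z. of_real (1 / (2 * pi)) * kernel_op cker k u z)"
  by (simp add: opA_eq_conv kernel_op_def fun_eq_iff)

lemma cker_le: "cmod (cker z) \<le> 1 / cmod z"
  by (simp add: cmod_cker)

text \<open>In contrast to additivity this holds at every point, because a constant factor can be
  pulled out of a Bochner integral even when it diverges.\<close>

lemma kernel_op_scale: "kernel_op J k (\<lambda>z. c * u z) = (\<lambda>z. c * kernel_op J k u z)"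
proof
  fix z
  have "(\<integral>w. J (z - w) * (phase k w * q w * (c * u w)) \<partial>lborel) = (\<integral>w. c * (J (z - w) * (phase k w * q w * u w)) \<partial>lborel)"
    by (intro Bochner_Integration.integral_cong) simp_all
  then show "kernel_op J k (\<lambda>z. c * u z) z = c * kernel_op J k u z" unfolding kernel_op_def conv_def by (simp only: integral_mult_right_zero)
qed

lemma sq_int_measurable: "u \<in> sq_int (weighted a) \<Longrightarrow> u \<in> borel_measurable borel"
  by (simp add: sq_int_def)

lemma opA_measurable: "k \<noteq> 0 \<Longrightarrow> u \<in> borel_measurable borel \<Longrightarrow> opA k q u \<in> borel_measurable borel"
  by (simp add: opA_eq)

lemma opA_cong:
  "k \<noteq> 0 \<Longrightarrow> u \<in> borel_measurable borel \<Longrightarrow> v \<in> borel_measurable borel \<Longrightarrow> AE z in lborel. u z = v z \<Longrightarrow> opA k q u = opA k q v"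
  using kernel_op_cong_AE[of cker u v k] by (simp add: opA_eq)

lemma opA_add:
  assumes "k \<noteq> 0" "u \<in> sq_int (weighted 2)" "v \<in> sq_int (weighted 2)"
  shows "AE z in lborel. opA k q (\<lambda>z. u z + v z) z = opA k q u z + opA k q v z"
  using kernel_op_add[OF assms(2,3) cker_measurable(1) cker_le, of k]
  by eventually_elim (simp add: opA_eq[OF assms(1)] add_divide_distrib)

lemma opA_diff:
  assumes "k \<noteq> 0" "u \<in> sq_int (weighted 2)" "v \<in> sq_int (weighted 2)"
  shows "AE z in lborel. opA k q (\<lambda>z. u z - v z) z = opA k q u z - opA k q v z"
  using kernel_op_diff[OF assms(2,3) cker_measurable(1) cker_le, of k]
  by eventually_elim (simp add: opA_eq[OF assms(1)] diff_divide_distrib)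

lemma opA_bound:
  obtains C where "0 \<le> C"
    "\<And>k u. k \<noteq> 0 \<Longrightarrow> u \<in> borel_measurable borel \<Longrightarrow> sq_norm (weighted \<epsilon>) (opA k q u) \<le> ennreal C * sq_norm (weighted 2) u"
proof (rule kernel_op_norm_bound)
  fix C assume C: "0 \<le> C" "\<And>J k u. J \<in> borel_measurable borel \<Longrightarrow> u \<in> borel_measurable borel \<Longrightarrow> (\<And>z. cmod (J z) \<le> 1 / cmod z) \<Longrightarrow>
     sq_norm (weighted \<epsilon>) (kernel_op J k u) \<le> ennreal C * sq_norm (weighted 2) u"
  show thesis
  proof (rule that)
    show "0 \<le> (1 / (2 * pi))\<^sup>2 * C" using C by simp
    fix k :: complex and u :: "complex \<Rightarrow> complex" assume k: "k \<noteq> 0" and u[measurable]: "u \<in> borel_measurable borel"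
    have "sq_norm (weighted \<epsilon>) (opA k q u) = ennreal ((cmod (of_real (1 / (2 * pi))))\<^sup>2) * sq_norm (weighted \<epsilon>) (kernel_op cker k u)"
      unfolding opA_eq[OF k] by (rule sq_norm_cmult) simp
    also have "\<dots> \<le> ennreal ((cmod (of_real (1 / (2 * pi))))\<^sup>2) * (ennreal C * sq_norm (weighted 2) u)"
      by (intro mult_left_mono C cker_le) simp_all
    also have "cmod (of_real (1 / (2 * pi))) = 1 / (2 * pi)" by (simp only: norm_of_real) simp
    also have "ennreal ((1 / (2 * pi))\<^sup>2) * (ennreal C * sq_norm (weighted 2) u) = ennreal ((1 / (2 * pi))\<^sup>2 * C) * sq_norm (weighted 2) u"
      using C(1) by (simp add: ennreal_mult mult.assoc)
    finally show "sq_norm (weighted \<epsilon>) (opA k q u) \<le> ennreal ((1 / (2 * pi))\<^sup>2 * C) * sq_norm (weighted 2) u" .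
  qed
qed

lemma opA_sq_int:
  assumes "k \<noteq> 0" "u \<in> sq_int (weighted 2)" shows "opA k q u \<in> sq_int (weighted \<epsilon>)"
proof -
  obtain C where C: "0 \<le> C"
    "\<And>k u. k \<noteq> 0 \<Longrightarrow> u \<in> borel_measurable borel \<Longrightarrow> sq_norm (weighted \<epsilon>) (opA k q u) \<le> ennreal C * sq_norm (weighted 2) u"
    using opA_bound by blast
  have um: "u \<in> borel_measurable borel" using assms(2) by (rule sq_int_measurable)
  have "ennreal C * sq_norm (weighted 2) u < \<infinity>" using assms(2) by (auto simp: sq_int_def ennreal_mult_less_top)
  from le_less_trans[OF C(2)[OF assms(1) um] this] show ?thesis
    using opA_measurable[OF assms(1) um] by (simp add: sq_int_def)
qed

text \<open>The constant -1/2 is the factor -pi of the Cauchy-Pompeiu formula times the 1/(2 pi) of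
  the normalisation of A.\<close>

lemma opA_weak:
  assumes k: "k \<noteq> 0" and u: "u \<in> sq_int (weighted 2)" and \<psi>: "test_fun \<psi>"
  shows "(\<integral>z. opA k q u z * dbar \<psi> z \<partial>lborel) = - (1 / 2) * (\<integral>z. phase k z * q z * u z * \<psi> z \<partial>lborel)"
proof -
  have "(\<integral>z. opA k q u z * dbar \<psi> z \<partial>lborel) = (\<integral>z. of_real (1 / (2 * pi)) * (kernel_op cker k u z * dbar \<psi> z) \<partial>lborel)"
    by (simp only: opA_eq[OF k] mult.assoc)
  also have "\<dots> = of_real (1 / (2 * pi)) * (- pi * (\<integral>z. phase k z * q z * u z * \<psi> z \<partial>lborel))"
    unfolding integral_mult_right_zero kernel_op_def cauchy_transform_weak_dbar(1)[OF \<psi> kernel_op_density_integrable[OF u]] ..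
  finally show ?thesis by simp
qed

end

section \<open>Both operators, their compositions and the system\<close>

locale admissible_system = admissible +
  fixes \<sigma> :: complex
  assumes sigma: "\<sigma> = 1 \<or> \<sigma> = -1"
begin

abbreviation "A k \<equiv> opA k q"
abbreviation "B k \<equiv> opB \<sigma> k q"

lemma B_eq: "B k u = (\<lambda>z. \<sigma> * cnj (A k (\<lambda>w. cnj (u w)) z))"
  by (rule ext) (rule opB_eq)

lemma eps_le_2: "sq_int (weighted \<epsilon>) \<subseteq> sq_int (weighted 2)"
  using eps by (intro sq_int_mono) simp

lemma eps_le_1: "sq_int (weighted \<epsilon>) \<subseteq> sq_int (weighted 1)"
  using eps by (intro sq_int_mono) simp

lemma sigma_norm: "cmod \<sigma> = 1" "cnj \<sigma> = \<sigma>" "\<sigma> * \<sigma> = 1"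
  using sigma by auto

lemma B_measurable: "k \<noteq> 0 \<Longrightarrow> u \<in> borel_measurable borel \<Longrightarrow> B k u \<in> borel_measurable borel"
  unfolding B_eq using opA_measurable[of k "\<lambda>w. cnj (u w)"] by simp

lemma B_norm:
  assumes k: "k \<noteq> 0" and [measurable]: "u \<in> borel_measurable borel"
  shows "sq_norm N (B k u) = sq_norm N (A k (\<lambda>w. cnj (u w)))"
  unfolding B_eq sq_norm_def by (simp add: norm_mult sigma_norm)

lemma B_sq_int: "k \<noteq> 0 \<Longrightarrow> u \<in> sq_int (weighted 2) \<Longrightarrow> B k u \<in> sq_int (weighted \<epsilon>)"
  using opA_sq_int[OF _ sq_int_cnj, of k u] B_norm[of k u] B_measurable[of k u]
  by (simp add: sq_int_def)

lemma B_cong: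
  assumes "k \<noteq> 0" "u \<in> borel_measurable borel" "v \<in> borel_measurable borel" "AE z in lborel. u z = v z"
  shows "B k u = B k v"
proof -
  have "A k (\<lambda>w. cnj (u w)) = A k (\<lambda>w. cnj (v w))"
    by (rule opA_cong[OF assms(1)]) (use assms in \<open>auto elim: eventually_mono\<close>)
  then show ?thesis by (simp add: B_eq)
qed

lemma B_add:
  assumes "k \<noteq> 0" "u \<in> sq_int (weighted 2)" "v \<in> sq_int (weighted 2)"
  shows "AE z in lborel. B k (\<lambda>z. u z + v z) z = B k u z + B k v z"
  using opA_add[OF assms(1) sq_int_cnj[OF assms(2)] sq_int_cnj[OF assms(3)]]
  by eventually_elim (simp add: B_eq distrib_left)

lemma B_diff:
  assumes "k \<noteq> 0" "u \<in> sq_int (weighted 2)" "v \<in> sq_int (weighted 2)"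
  shows "AE z in lborel. B k (\<lambda>z. u z - v z) z = B k u z - B k v z"
  using opA_diff[OF assms(1) sq_int_cnj[OF assms(2)] sq_int_cnj[OF assms(3)]]
  by eventually_elim (simp add: B_eq right_diff_distrib)

lemma opA_sigma: "k \<noteq> 0 \<Longrightarrow> A k (\<lambda>z. \<sigma> * u z) = (\<lambda>z. \<sigma> * A k u z)"
  by (simp add: opA_eq kernel_op_scale mult.left_commute)

text \<open>B is A with a conjugation on either side, so AB is, up to \<sigma>, the square of the
  antilinear map taking u to A(conj u), applied to u; this is the shape for which smallness was
  shown.\<close>

lemma AB_eq: "k \<noteq> 0 \<Longrightarrow> A k (B k u) = (\<lambda>z. \<sigma> * A k (\<lambda>w. cnj (A k (\<lambda>w. cnj (u w)) w)) z)"
  unfolding B_eq by (rule opA_sigma)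

lemma BA_eq: "k \<noteq> 0 \<Longrightarrow> B k (A k u) = (\<lambda>z. cnj (A k (B k (\<lambda>w. cnj (u w))) z))"
  by (simp add: AB_eq B_eq[of k "A k u"] sigma_norm fun_eq_iff)

text \<open>Smallness is taken with \<eta> = 1/16, the contraction constant for squares. The factor
  1/(2 pi) of each operator is below 1 and is discarded, and the input norm in
  \<open>weighted 2\<close> is at most that in \<open>weighted \<epsilon>\<close>.\<close>

lemma AB_small:
  obtains K where "\<And>k u. K < cmod k \<Longrightarrow> k \<noteq> 0 \<Longrightarrow> u \<in> sq_int (weighted \<epsilon>) \<Longrightarrow>
    16 * sq_norm (weighted \<epsilon>) (A k (B k u)) \<le> sq_norm (weighted \<epsilon>) u"
proof -
  obtain K where K: "\<And>k x. K < cmod k \<Longrightarrow> x \<in> sq_int (weighted 2) \<Longrightarrow>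
    sq_norm (weighted \<epsilon>) (kernel_op cker k (\<lambda>w. cnj (kernel_op cker k x w))) \<le> ennreal (1 / 16) * sq_norm (weighted 2) x"
    using kernel_op_conj_T_small[of "1 / 16"] by auto
  show thesis
  proof (rule that)
    fix k u assume k: "K < cmod k" "k \<noteq> 0" and u: "u \<in> sq_int (weighted \<epsilon>)"
    have um[measurable]: "u \<in> borel_measurable borel" using u by (rule sq_int_measurable)
    define c where "c = 1 / (2 * pi)"
    have c1: "c \<le> 1" using pi_ge_two by (simp add: c_def)
    have c: "0 \<le> c" "c * c \<le> 1 * 1" using c1 by (simp add: c_def, intro mult_mono) (auto simp: c_def)
    let ?x = "\<lambda>w. cnj (u w)"
    let ?TT = "kernel_op cker k (\<lambda>w. cnj (kernel_op cker k ?x w))"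
    have "A k (B k u) = (\<lambda>z. \<sigma> * A k (\<lambda>w. cnj (A k ?x w)) z)" by (rule AB_eq[OF k(2)])
    also have "\<dots> = (\<lambda>z. (\<sigma> * of_real (c * c)) * ?TT z)"
      unfolding opA_eq[OF k(2)] c_def[symmetric] by (simp add: kernel_op_scale mult_ac)
    finally have "sq_norm (weighted \<epsilon>) (A k (B k u)) = ennreal ((cmod (\<sigma> * of_real (c * c)))\<^sup>2) * sq_norm (weighted \<epsilon>) ?TT"
      by (simp only:) (rule sq_norm_cmult; simp)
    also have "cmod (\<sigma> * of_real (c * c)) = c * c" using c by (simp add: norm_mult sigma_norm)
    also have "ennreal ((c * c)\<^sup>2) * sq_norm (weighted \<epsilon>) ?TT \<le> 1 * (ennreal (1 / 16) * sq_norm (weighted 2) ?x)"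
    proof (intro mult_mono K k(1))
      have "(c * c)\<^sup>2 \<le> 1" using c by (intro power_le_one) auto
      then show "ennreal ((c * c)\<^sup>2) \<le> 1" by (simp add: ennreal_le_1)
      show "?x \<in> sq_int (weighted 2)" using u eps_le_2 by (intro sq_int_cnj) auto
    qed auto
    also have "\<dots> \<le> ennreal (1 / 16) * sq_norm (weighted \<epsilon>) u"
      using eps sq_norm_weighted_antimono[of \<epsilon> 2 u] by (simp add: mult_left_mono)
    finally have "16 * sq_norm (weighted \<epsilon>) (A k (B k u)) \<le> 16 * (ennreal (1 / 16) * sq_norm (weighted \<epsilon>) u)"
      by (rule mult_left_mono) simp
    also have "16 * (ennreal (1 / 16) * sq_norm (weighted \<epsilon>) u) = sq_norm (weighted \<epsilon>) u"
    proof -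
      have "(16::ennreal) * ennreal (1 / 16) = ennreal (16 * (1 / 16))" by (subst ennreal_mult) auto
      then show ?thesis by (simp add: mult.assoc[symmetric])
    qed
    finally show "16 * sq_norm (weighted \<epsilon>) (A k (B k u)) \<le> sq_norm (weighted \<epsilon>) u" .
  qed
qed

text \<open>Conjugation turns dz \<psi> into dbar of conj \<psi>, which reduces the claim to the one
  for A.\<close>

lemma B_weak:
  assumes k: "k \<noteq> 0" and u: "u \<in> sq_int (weighted 2)" and \<psi>: "test_fun \<psi>"
  shows "(\<integral>z. B k u z * dz \<psi> z \<partial>lborel) = - (1 / 2) * (\<integral>z. \<sigma> * (cnj (phase k z) * cnj (q z) * u z * \<psi> z) \<partial>lborel)"
proof -
  have "(\<integral>z. B k u z * dz \<psi> z \<partial>lborel) = (\<integral>z. \<sigma> * cnj (A k (\<lambda>w. cnj (u w)) z * dbar (\<lambda>x. cnj (\<psi> x)) z) \<partial>lborel)"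
    by (simp add: B_eq dbar_cnj[OF \<psi>] mult.assoc)
  also have "\<dots> = \<sigma> * cnj (- (1 / 2) * (\<integral>z. phase k z * q z * cnj (u z) * cnj (\<psi> z) \<partial>lborel))"
    unfolding integral_mult_right_zero Bochner_Integration.integral_cnj opA_weak[OF k sq_int_cnj[OF u] test_fun_cnj[OF \<psi>]] ..
  also have "\<dots> = - (1 / 2) * (\<sigma> * (\<integral>z. cnj (phase k z * q z * cnj (u z) * cnj (\<psi> z)) \<partial>lborel))"
    unfolding Bochner_Integration.integral_cnj by simp
  also have "\<sigma> * (\<integral>z. cnj (phase k z * q z * cnj (u z) * cnj (\<psi> z)) \<partial>lborel) = (\<integral>z. \<sigma> * (cnj (phase k z) * cnj (q z) * u z * \<psi> z) \<partial>lborel)"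
    unfolding integral_mult_right_zero[symmetric] by (simp only: complex_cnj_mult complex_cnj_cnj)
  finally show ?thesis .
qed

text \<open>From right to left these are the weak equations of A and B. From left to right, \<psi>1
  - A \<psi>2 and the conjugate of \<psi>2 - B(1 + \<psi>1) are weak solutions of dbar f = 0 and lie
  in <z> L2 because \<epsilon> \<le> 1, so the Liouville theorem makes them null.\<close>

lemma solves_system_fixed_point:
  assumes k: "k \<noteq> 0" and \<psi>1: "\<psi>1 \<in> sq_int (weighted \<epsilon>)" and \<psi>2: "\<psi>2 \<in> sq_int (weighted \<epsilon>)"
  shows "solves_system \<sigma> k q (\<lambda>z. 1 + \<psi>1 z) \<psi>2 \<longleftrightarrow>
    (AE z in lborel. \<psi>1 z = A k \<psi>2 z) \<and> (AE z in lborel. \<psi>2 z = B k (\<lambda>z. 1 + \<psi>1 z) z)"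
proof -
  have \<psi>1': "(\<lambda>z. 1 + \<psi>1 z) \<in> sq_int (weighted 2)" using \<psi>1 eps_le_2 by (intro sq_int_add one_sq_int) auto
  have \<psi>2': "\<psi>2 \<in> sq_int (weighted 2)" using \<psi>2 eps_le_2 by auto
  have [measurable]: "\<psi>1 \<in> borel_measurable borel" "\<psi>2 \<in> borel_measurable borel"
    using \<psi>1 \<psi>2 by (auto intro: sq_int_measurable)
  have A2: "A k \<psi>2 \<in> sq_int (weighted \<epsilon>)" by (rule opA_sq_int[OF k \<psi>2'])
  have B1: "B k (\<lambda>z. 1 + \<psi>1 z) \<in> sq_int (weighted \<epsilon>)" by (rule B_sq_int[OF k \<psi>1'])
  have [measurable]: "A k \<psi>2 \<in> borel_measurable borel" "B k (\<lambda>z. 1 + \<psi>1 z) \<in> borel_measurable borel"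
    using A2 B1 by (auto intro: sq_int_measurable)
  \<comment> \<open>The constant 1 is outside <z> L2; it disappears because dbar \<psi> has integral
    0.\<close>
  have one_plus: "(\<integral>z. (1 + \<psi>1 z) * dbar \<psi> z \<partial>lborel) = (\<integral>z. \<psi>1 z * dbar \<psi> z \<partial>lborel)" if \<psi>: "test_fun \<psi>" for \<psi>
  proof -
    have "integrable lborel (\<lambda>z. \<psi>1 z * dbar \<psi> z)" using \<psi>1 eps_le_1 by (intro integrable_mult_dbar \<psi>) auto
    moreover have "integrable lborel (dbar \<psi>)"
    proof -
      have "integrable lborel (\<lambda>z. (\<lambda>_. 1) z * dbar \<psi> z)"
      proof -
        obtain B R where B: "0 < B" "0 < R" "\<And>z. cmod (dbar \<psi> z) \<le> B * indicator (ball 0 R) z"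
          using dbar_test_fun(3)[OF \<psi>] by blast
        have "integrable lborel (dbar \<psi>)"
          by (rule Bochner_Integration.integrable_bound[OF integrable_ball_indicator[of 0 R B]])
             (use B dbar_test_fun(1)[OF \<psi>] in \<open>auto simp: mult.commute\<close>)
        then show ?thesis by simp
      qed
      then show ?thesis by simp
    qed
    ultimately show ?thesis using dbar_test_fun(2)[OF \<psi>] by (simp add: distrib_right)
  qed
  show ?thesis
  proof
    assume "solves_system \<sigma> k q (\<lambda>z. 1 + \<psi>1 z) \<psi>2"
    then have e1: "(\<integral>z. \<psi>1 z * dbar \<psi> z \<partial>lborel) = - (1 / 2) * (\<integral>z. phase k z * q z * \<psi>2 z * \<psi> z \<partial>lborel)"
      and e2: "(\<integral>z. \<psi>2 z * dz \<psi> z \<partial>lborel) = - (1 / 2) * (\<integral>z. \<sigma> * (cnj (phase k z) * cnj (q z) * (1 + \<psi>1 z) * \<psi> z) \<partial>lborel)"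
      if "test_fun \<psi>" for \<psi> using that one_plus[OF that] unfolding solves_system_iff[OF k] by auto
    have "AE z in lborel. \<psi>1 z - A k \<psi>2 z = 0"
    proof (rule weak_dbar_eq_0)
      show "(\<lambda>z. \<psi>1 z - A k \<psi>2 z) \<in> sq_int (weighted 1)" using sq_int_diff[OF \<psi>1 A2] eps_le_1 by auto
      fix \<psi> assume \<psi>: "test_fun \<psi>"
      have "(\<integral>z. (\<psi>1 z - A k \<psi>2 z) * dbar \<psi> z \<partial>lborel) = (\<integral>z. \<psi>1 z * dbar \<psi> z \<partial>lborel) - (\<integral>z. A k \<psi>2 z * dbar \<psi> z \<partial>lborel)"
        unfolding left_diff_distrib using \<psi>1 A2 eps_le_1
        by (intro Bochner_Integration.integral_diff integrable_mult_dbar \<psi>) auto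
      then show "(\<integral>z. (\<psi>1 z - A k \<psi>2 z) * dbar \<psi> z \<partial>lborel) = 0" by (simp only: e1[OF \<psi>] opA_weak[OF k \<psi>2' \<psi>]) simp
    qed
    moreover have "AE z in lborel. cnj (\<psi>2 z - B k (\<lambda>z. 1 + \<psi>1 z) z) = 0"
    proof (rule weak_dbar_eq_0)
      have d: "(\<lambda>z. cnj (\<psi>2 z)) \<in> sq_int (weighted 1)" "(\<lambda>z. cnj (B k (\<lambda>z. 1 + \<psi>1 z) z)) \<in> sq_int (weighted 1)"
        using \<psi>2 B1 eps_le_1 by (auto intro!: sq_int_cnj)
      show "(\<lambda>z. cnj (\<psi>2 z - B k (\<lambda>z. 1 + \<psi>1 z) z)) \<in> sq_int (weighted 1)" using sq_int_diff[OF d] by simp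
      fix \<psi> assume \<psi>: "test_fun \<psi>"
      have c: "cnj u * dbar \<psi> z = cnj (u * dz (\<lambda>x. cnj (\<psi> x)) z)" for u z
        using dbar_cnj[OF test_fun_cnj[OF \<psi>], of z] by simp
      have "(\<integral>z. cnj (\<psi>2 z - B k (\<lambda>z. 1 + \<psi>1 z) z) * dbar \<psi> z \<partial>lborel)
        = (\<integral>z. cnj (\<psi>2 z) * dbar \<psi> z \<partial>lborel) - (\<integral>z. cnj (B k (\<lambda>z. 1 + \<psi>1 z) z) * dbar \<psi> z \<partial>lborel)"
        unfolding complex_cnj_diff left_diff_distrib
        by (intro Bochner_Integration.integral_diff integrable_mult_dbar \<psi> d)
      also have "\<dots> = cnj ((\<integral>z. \<psi>2 z * dz (\<lambda>x. cnj (\<psi> x)) z \<partial>lborel) - (\<integral>z. B k (\<lambda>z. 1 + \<psi>1 z) z * dz (\<lambda>x. cnj (\<psi> x)) z \<partial>lborel))"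
        unfolding c Bochner_Integration.integral_cnj by simp
      also have "\<dots> = 0" by (simp only: e2[OF test_fun_cnj[OF \<psi>]] B_weak[OF k \<psi>1' test_fun_cnj[OF \<psi>]]) simp
      finally show "(\<integral>z. cnj (\<psi>2 z - B k (\<lambda>z. 1 + \<psi>1 z) z) * dbar \<psi> z \<partial>lborel) = 0" .
    qed
    ultimately show "(AE z in lborel. \<psi>1 z = A k \<psi>2 z) \<and> (AE z in lborel. \<psi>2 z = B k (\<lambda>z. 1 + \<psi>1 z) z)"
      by simp
  next
    assume ae: "(AE z in lborel. \<psi>1 z = A k \<psi>2 z) \<and> (AE z in lborel. \<psi>2 z = B k (\<lambda>z. 1 + \<psi>1 z) z)"
    show "solves_system \<sigma> k q (\<lambda>z. 1 + \<psi>1 z) \<psi>2"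
      unfolding solves_system_iff[OF k]
    proof (intro allI impI conjI)
      fix \<psi> assume \<psi>: "test_fun \<psi>"
      have [measurable]: "dbar \<psi> \<in> borel_measurable borel" by (rule dbar_test_fun[OF \<psi>])
      have [measurable]: "dz \<psi> \<in> borel_measurable borel"
        unfolding dz_def[abs_def] using test_fun_measurable[OF test_fun_deriv[OF \<psi>]] by measurable
      have "(\<integral>z. \<psi>1 z * dbar \<psi> z \<partial>lborel) = (\<integral>z. A k \<psi>2 z * dbar \<psi> z \<partial>lborel)"
        using ae by (intro integral_cong_AE) (auto elim: eventually_mono)
      then show "(\<integral>z. (1 + \<psi>1 z) * dbar \<psi> z \<partial>lborel) = - (1 / 2) * (\<integral>z. phase k z * q z * \<psi>2 z * \<psi> z \<partial>lborel)"
        unfolding one_plus[OF \<psi>] opA_weak[OF k \<psi>2' \<psi>] .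
      have "(\<integral>z. \<psi>2 z * dz \<psi> z \<partial>lborel) = (\<integral>z. B k (\<lambda>z. 1 + \<psi>1 z) z * dz \<psi> z \<partial>lborel)"
        using ae by (intro integral_cong_AE) (auto elim: eventually_mono)
      then show "(\<integral>z. \<psi>2 z * dz \<psi> z \<partial>lborel) = - (1 / 2) * (\<integral>z. \<sigma> * (cnj (phase k z) * cnj (q z) * (1 + \<psi>1 z) * \<psi> z) \<partial>lborel)"
        unfolding B_weak[OF k \<psi>1' \<psi>] .
    qed
  qed
qed

text \<open>Only 1 - AB has to be solved: from that solution the second component, and then the
  first one again, arise by applying B and A. Uniqueness goes back to injectivity of 1 - AB.\<close>

lemma solution:
  assumes k: "k \<noteq> 0"
    and small: "\<And>u. u \<in> sq_int (weighted \<epsilon>) \<Longrightarrow> 16 * sq_norm (weighted \<epsilon>) (A k (B k u)) \<le> sq_norm (weighted \<epsilon>) u"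
  shows "L2_contraction (weighted \<epsilon>) (\<lambda>u. A k (B k u))" "L2_contraction (weighted \<epsilon>) (\<lambda>u. B k (A k u))"
    "\<exists>\<phi>1\<in>sq_int (weighted \<epsilon>). \<exists>\<phi>2\<in>sq_int (weighted \<epsilon>).
        (AE z in lborel. \<phi>1 z - A k (B k \<phi>1) z = A k (B k (\<lambda>_. 1)) z) \<and>
        (AE z in lborel. \<phi>2 z - B k (A k \<phi>2) z = B k (\<lambda>_. 1) z) \<and>
        solves_system \<sigma> k q (\<lambda>z. 1 + \<phi>1 z) \<phi>2 \<and>
        (\<forall>\<psi>1\<in>sq_int (weighted \<epsilon>). \<forall>\<psi>2\<in>sq_int (weighted \<epsilon>). solves_system \<sigma> k q (\<lambda>z. 1 + \<psi>1 z) \<psi>2 \<longrightarrow>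
           (AE z in lborel. \<psi>1 z = \<phi>1 z) \<and> (AE z in lborel. \<psi>2 z = \<phi>2 z))"
proof -
  have e2: "u \<in> sq_int (weighted 2)" if "u \<in> sq_int (weighted \<epsilon>)" for u using that eps_le_2 by auto
  have Ai: "A k u \<in> sq_int (weighted \<epsilon>)" if "u \<in> sq_int (weighted 2)" for u using opA_sq_int[OF k that] .
  have Bi: "B k u \<in> sq_int (weighted \<epsilon>)" if "u \<in> sq_int (weighted 2)" for u using B_sq_int[OF k that] .
  have m: "u \<in> borel_measurable borel" if "u \<in> sq_int (weighted a)" for u a using sq_int_measurable[OF that] .
  show AB: "L2_contraction (weighted \<epsilon>) (\<lambda>u. A k (B k u))"
  proof
    fix f g assume f: "f \<in> sq_int (weighted \<epsilon>)" and g: "g \<in> sq_int (weighted \<epsilon>)"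
    show "A k (B k f) \<in> borel_measurable (weighted \<epsilon>)" using m[OF Ai[OF e2[OF Bi[OF e2[OF f]]]]] by simp
    show "16 * sq_norm (weighted \<epsilon>) (A k (B k f)) \<le> sq_norm (weighted \<epsilon>) f" by (rule small[OF f])
    have "A k (B k (\<lambda>z. f z - g z)) = A k (\<lambda>z. B k f z - B k g z)"
    proof (rule opA_cong[OF k _ _ B_diff[OF k e2[OF f] e2[OF g]]])
      show "B k (\<lambda>z. f z - g z) \<in> borel_measurable borel" by (rule m[OF Bi[OF sq_int_diff[OF e2[OF f] e2[OF g]]]])
      show "(\<lambda>z. B k f z - B k g z) \<in> borel_measurable borel" by (rule m[OF sq_int_diff[OF Bi[OF e2[OF f]] Bi[OF e2[OF g]]]])
    qed
    then show "AE z in weighted \<epsilon>. A k (B k (\<lambda>z. f z - g z)) z = A k (B k f) z - A k (B k g) z"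
      using opA_diff[OF k e2[OF Bi[OF e2[OF f]]] e2[OF Bi[OF e2[OF g]]]] by (simp add: AE_weighted_iff)
  qed
  show BA: "L2_contraction (weighted \<epsilon>) (\<lambda>u. B k (A k u))"
  proof
    fix f g assume f: "f \<in> sq_int (weighted \<epsilon>)" and g: "g \<in> sq_int (weighted \<epsilon>)"
    show "B k (A k f) \<in> borel_measurable (weighted \<epsilon>)" using m[OF Bi[OF e2[OF Ai[OF e2[OF f]]]]] by simp
    show "16 * sq_norm (weighted \<epsilon>) (B k (A k f)) \<le> sq_norm (weighted \<epsilon>) f"
      using small[OF sq_int_cnj[OF f]] by (simp add: BA_eq[OF k])
    have "B k (A k (\<lambda>z. f z - g z)) = B k (\<lambda>z. A k f z - A k g z)"
    proof (rule B_cong[OF k _ _ opA_diff[OF k e2[OF f] e2[OF g]]])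
      show "A k (\<lambda>z. f z - g z) \<in> borel_measurable borel" by (rule m[OF Ai[OF sq_int_diff[OF e2[OF f] e2[OF g]]]])
      show "(\<lambda>z. A k f z - A k g z) \<in> borel_measurable borel" by (rule m[OF sq_int_diff[OF Ai[OF e2[OF f]] Ai[OF e2[OF g]]]])
    qed
    then show "AE z in weighted \<epsilon>. B k (A k (\<lambda>z. f z - g z)) z = B k (A k f) z - B k (A k g) z"
      using B_diff[OF k e2[OF Ai[OF e2[OF f]]] e2[OF Ai[OF e2[OF g]]]] by (simp add: AE_weighted_iff)
  qed
  interpret AB: L2_contraction "weighted \<epsilon>" "\<lambda>u. A k (B k u)" by (rule AB)
  let ?one = "\<lambda>_::complex. 1::complex"
  have expand: "AE z in lborel. A k (B k (\<lambda>z. 1 + u z)) z = A k (B k ?one) z + A k (B k u) z" if u: "u \<in> sq_int (weighted \<epsilon>)" for u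
  proof -
    have "A k (B k (\<lambda>z. 1 + u z)) = A k (\<lambda>z. B k ?one z + B k u z)"
    proof (rule opA_cong[OF k _ _ B_add[OF k one_sq_int e2[OF u]]])
      show "B k (\<lambda>z. 1 + u z) \<in> borel_measurable borel" by (rule m[OF Bi[OF sq_int_add[OF one_sq_int e2[OF u]]]])
      show "(\<lambda>z. B k ?one z + B k u z) \<in> borel_measurable borel" by (rule m[OF sq_int_add[OF Bi[OF one_sq_int] Bi[OF e2[OF u]]]])
    qed
    then show ?thesis using opA_add[OF k e2[OF Bi[OF one_sq_int]] e2[OF Bi[OF e2[OF u]]]] by simp
  qed
  have AB1: "A k (B k ?one) \<in> sq_int (weighted \<epsilon>)" by (rule Ai[OF e2[OF Bi[OF one_sq_int]]])
  obtain \<phi> where \<phi>: "\<phi> \<in> sq_int (weighted \<epsilon>)" "AE z in lborel. \<phi> z - A k (B k \<phi>) z = A k (B k ?one) z"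
    using AB.one_minus_surj[OF AB1] by (auto simp: AE_weighted_iff)
  have op: "(\<lambda>z. 1 + u z) \<in> sq_int (weighted 2)" if "u \<in> sq_int (weighted \<epsilon>)" for u
    by (rule sq_int_add[OF one_sq_int e2[OF that]])
  \<comment> \<open>The first component is recomputed from the second so that \<phi>1 = A \<phi>2
    holds at every point; it differs from \<phi> only on a null set.\<close>
  define \<phi>2 where "\<phi>2 = B k (\<lambda>z. 1 + \<phi> z)"
  define \<phi>1 where "\<phi>1 = A k \<phi>2"
  have i2: "\<phi>2 \<in> sq_int (weighted \<epsilon>)" unfolding \<phi>2_def by (rule Bi[OF op[OF \<phi>(1)]])
  have i1: "\<phi>1 \<in> sq_int (weighted \<epsilon>)" unfolding \<phi>1_def by (rule Ai[OF e2[OF i2]])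
  have ae: "AE z in lborel. \<phi>1 z = \<phi> z"
    unfolding \<phi>1_def \<phi>2_def using expand[OF \<phi>(1)] \<phi>(2) by eventually_elim (simp add: diff_eq_eq)
  have B1: "B k (\<lambda>z. 1 + \<phi>1 z) = \<phi>2" unfolding \<phi>2_def
    by (rule B_cong[OF k m[OF op[OF i1]] m[OF op[OF \<phi>(1)]]]) (use ae in \<open>auto elim: eventually_mono\<close>)
  have Bc: "B k \<phi>1 = B k \<phi>" by (rule B_cong[OF k m[OF i1] m[OF \<phi>(1)] ae])
  have eq1: "AE z in lborel. \<phi>1 z - A k (B k \<phi>1) z = A k (B k ?one) z"
    unfolding Bc using ae \<phi>(2) by eventually_elim simp
  have eq2: "AE z in lborel. \<phi>2 z - B k (A k \<phi>2) z = B k ?one z"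
    using B_add[OF k one_sq_int e2[OF i1]] unfolding B1 \<phi>1_def[symmetric] by eventually_elim simp
  have sol: "solves_system \<sigma> k q (\<lambda>z. 1 + \<phi>1 z) \<phi>2"
    unfolding solves_system_fixed_point[OF k i1 i2] B1 by (simp add: \<phi>1_def)
  have uniq: "(AE z in lborel. \<psi>1 z = \<phi>1 z) \<and> (AE z in lborel. \<psi>2 z = \<phi>2 z)"
    if p1: "\<psi>1 \<in> sq_int (weighted \<epsilon>)" and p2: "\<psi>2 \<in> sq_int (weighted \<epsilon>)" and s: "solves_system \<sigma> k q (\<lambda>z. 1 + \<psi>1 z) \<psi>2" for \<psi>1 \<psi>2
  proof -
    from s have s1: "AE z in lborel. \<psi>1 z = A k \<psi>2 z" and s2: "AE z in lborel. \<psi>2 z = B k (\<lambda>z. 1 + \<psi>1 z) z"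
      by (auto simp: solves_system_fixed_point[OF k p1 p2])
    \<comment> \<open>Eliminating \<psi>2 shows that \<psi>1 solves (1 - AB) \<psi>1 = AB(1), as
      \<phi>1 does.\<close>
    have "A k \<psi>2 = A k (B k (\<lambda>z. 1 + \<psi>1 z))" by (rule opA_cong[OF k m[OF p2] m[OF Bi[OF op[OF p1]]] s2])
    with s1 expand[OF p1] have "AE z in lborel. \<psi>1 z - A k (B k \<psi>1) z = A k (B k ?one) z"
      by (auto elim: eventually_elim2)
    with eq1 have "AE z in weighted \<epsilon>. \<psi>1 z - A k (B k \<psi>1) z = \<phi>1 z - A k (B k \<phi>1) z"
      unfolding AE_weighted_iff by eventually_elim simp
    from AB.one_minus_inj[OF p1 i1 this] have u1: "AE z in lborel. \<psi>1 z = \<phi>1 z" by (simp add: AE_weighted_iff)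
    have "B k (\<lambda>z. 1 + \<psi>1 z) = \<phi>2" unfolding B1[symmetric]
      by (rule B_cong[OF k m[OF op[OF p1]] m[OF op[OF i1]]]) (use u1 in \<open>auto elim: eventually_mono\<close>)
    with s2 u1 show ?thesis by simp
  qed
  show "\<exists>\<phi>1\<in>sq_int (weighted \<epsilon>). \<exists>\<phi>2\<in>sq_int (weighted \<epsilon>).
        (AE z in lborel. \<phi>1 z - A k (B k \<phi>1) z = A k (B k (\<lambda>_. 1)) z) \<and>
        (AE z in lborel. \<phi>2 z - B k (A k \<phi>2) z = B k (\<lambda>_. 1) z) \<and>
        solves_system \<sigma> k q (\<lambda>z. 1 + \<phi>1 z) \<phi>2 \<and>
        (\<forall>\<psi>1\<in>sq_int (weighted \<epsilon>). \<forall>\<psi>2\<in>sq_int (weighted \<epsilon>). solves_system \<sigma> k q (\<lambda>z. 1 + \<psi>1 z) \<psi>2 \<longrightarrow>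
           (AE z in lborel. \<psi>1 z = \<phi>1 z) \<and> (AE z in lborel. \<psi>2 z = \<phi>2 z))"
    using i1 i2 eq1 eq2 sol uniq by blast
qed

text \<open>The bound for A is uniform in k, and 1 lies in <z>^2 L2, so applying it once or twice
  gives constants independent of k.\<close>

lemma B_one_bound:
  obtains C where
    "\<And>k. k \<noteq> 0 \<Longrightarrow> wnorm \<epsilon> (B k (\<lambda>_. 1)) \<le> C" "\<And>k. k \<noteq> 0 \<Longrightarrow> wnorm \<epsilon> (A k (B k (\<lambda>_. 1))) \<le> C"
proof -
  obtain C where C: "0 \<le> C"
    "\<And>k u. k \<noteq> 0 \<Longrightarrow> u \<in> borel_measurable borel \<Longrightarrow> sq_norm (weighted \<epsilon>) (A k u) \<le> ennreal C * sq_norm (weighted 2) u"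
    using opA_bound by blast
  let ?one = "\<lambda>_::complex. 1::complex"
  obtain n where n: "sq_norm (weighted 2) ?one = ennreal n" "0 \<le> n"
    using one_sq_int by (cases "sq_norm (weighted 2) ?one") (auto simp: sq_int_def)
  have B: "sq_norm (weighted \<epsilon>) (B k ?one) \<le> ennreal (C * n)" if k: "k \<noteq> 0" for k
    using C(2)[OF k, of ?one] C(1) n by (simp add: B_norm[OF k] ennreal_mult)
  have AB: "sq_norm (weighted \<epsilon>) (A k (B k ?one)) \<le> ennreal (C * (C * n))" if k: "k \<noteq> 0" for k
  proof -
    have bm: "B k ?one \<in> borel_measurable borel" by (rule B_measurable[OF k]) simp
    have "sq_norm (weighted \<epsilon>) (A k (B k ?one)) \<le> ennreal C * sq_norm (weighted 2) (B k ?one)" by (rule C(2)[OF k bm])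
    also have "\<dots> \<le> ennreal C * ennreal (C * n)"
      using eps by (intro mult_left_mono order_trans[OF sq_norm_weighted_antimono[OF _ bm, of \<epsilon>] B[OF k]]) auto
    also have "\<dots> = ennreal (C * (C * n))" using C(1) n by (intro ennreal_mult[symmetric]) auto
    finally show ?thesis .
  qed
  have w: "wnorm \<epsilon> u \<le> sqrt x" if "u \<in> borel_measurable borel" "sq_norm (weighted \<epsilon>) u \<le> ennreal x" "0 \<le> x" for u x
    unfolding wnorm_eq[OF that(1)] using enn2real_mono[OF that(2)] that(3) by simp
  show thesis
  proof (rule that)
    fix k :: complex assume k: "k \<noteq> 0"
    have bm: "B k ?one \<in> borel_measurable borel" by (rule B_measurable[OF k]) simp
    have "wnorm \<epsilon> (B k ?one) \<le> sqrt (C * n)" using B[OF k] C(1) n by (intro w bm) auto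
    then show "wnorm \<epsilon> (B k ?one) \<le> max (sqrt (C * n)) (sqrt (C * (C * n)))" by simp
    have "wnorm \<epsilon> (A k (B k ?one)) \<le> sqrt (C * (C * n))" using AB[OF k] C(1) n by (intro w opA_measurable k bm) auto
    then show "wnorm \<epsilon> (A k (B k ?one)) \<le> max (sqrt (C * n)) (sqrt (C * (C * n)))" by simp
  qed
qed

end

text \<open>In the Sobolev case the essential bound is the embedding for s > 1, and square
  integrability is part of H^s. For an indicator the weight <z>^2 is at most 1 + R^2 on a disc of
  radius R containing the domain.\<close>

lemma admissible_potential:
  fixes q :: "complex \<Rightarrow> complex"
  assumes "(\<exists>s. 1 < s \<and> s \<le> 2 \<and> (\<lambda>z. of_real ((jbr z)\<^sup>2) * q z) \<in> Hs s)
             \<or> (\<exists>\<Omega>. smooth_strictly_convex_domain \<Omega> \<and> q = indicator \<Omega>)"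
    and "0 < \<epsilon>" "\<epsilon> \<le> 1"
  shows "\<exists>M. admissible q M \<epsilon>"
  using assms(1)
proof (elim disjE exE conjE)
  fix s assume s: "1 < s" and Q: "(\<lambda>z. of_real ((jbr z)\<^sup>2) * q z) \<in> Hs s"
  define Qf where "Qf = (\<lambda>z. of_real ((jbr z)\<^sup>2) * q z)"
  note Q = Q[folded Qf_def]
  have L2: "Qf \<in> L2" using Q by (simp add: Hs_def)
  have [measurable]: "Qf \<in> borel_measurable borel" using L2 by (simp add: L2_def)
  have "q = (\<lambda>z. Qf z / of_real ((jbr z)\<^sup>2))" by (simp add: fun_eq_iff Qf_def)
  then have qm: "q \<in> borel_measurable borel" by (rule ssubst) measurable
  obtain M where M: "0 \<le> M" "AE z in lborel. cmod (Qf z) \<le> M" using Hs_AE_bounded[OF Q s] by blast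
  have n: "cmod (Qf z) = (jbr z)\<^sup>2 * cmod (q z)" for z by (simp add: Qf_def norm_mult norm_power)
  have "admissible q M \<epsilon>"
  proof
    show "AE z in lborel. (jbr z)\<^sup>2 * cmod (q z) \<le> M" using M(2) unfolding n .
    have "(\<integral>\<^sup>+z. ennreal ((cmod (Qf z))\<^sup>2) \<partial>lborel) < \<infinity>" using L2 by (simp add: L2_def integrable_iff_bounded)
    then show "(\<integral>\<^sup>+z. (ennreal ((jbr z)\<^sup>2 * cmod (q z)))\<^sup>2 \<partial>lborel) < \<infinity>"
      unfolding n by (simp add: ennreal_power)
  qed (use qm M assms in auto)
  then show ?thesis ..
next
  fix \<Omega> assume \<Omega>: "smooth_strictly_convex_domain \<Omega>" and q: "q = indicator \<Omega>"
  have o: "open \<Omega>" "bounded \<Omega>" using \<Omega> by (auto simp: smooth_strictly_convex_domain_def)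
  then obtain R where R: "0 < R" "\<And>z. z \<in> \<Omega> \<Longrightarrow> cmod z < R" by (auto simp: bounded_pos_less)
  have [measurable]: "\<Omega> \<in> sets borel" "ball (0::complex) R \<in> sets borel" using o by auto
  have le: "(jbr z)\<^sup>2 * cmod (q z) \<le> (1 + R\<^sup>2) * indicator (ball 0 R) z" for z
  proof (cases "z \<in> \<Omega>")
    case True
    then have "(cmod z)\<^sup>2 \<le> R\<^sup>2" using R(2)[OF True] by (intro power_mono) auto
    then show ?thesis using True R(2)[OF True] by (simp add: q jbr_power2)
  qed (simp add: q)
  have "admissible q (1 + R\<^sup>2) \<epsilon>"
  proof
    show "q \<in> borel_measurable borel" unfolding q by measurable
    show "AE z in lborel. (jbr z)\<^sup>2 * cmod (q z) \<le> 1 + R\<^sup>2"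
    proof (intro AE_I2 order_trans[OF le])
      fix z :: complex show "(1 + R\<^sup>2) * indicator (ball 0 R) z \<le> 1 + R\<^sup>2" by (simp add: indicator_def)
    qed
    have "(\<integral>\<^sup>+z. (ennreal ((jbr z)\<^sup>2 * cmod (q z)))\<^sup>2 \<partial>lborel) \<le> (\<integral>\<^sup>+z. ennreal ((1 + R\<^sup>2)\<^sup>2) * indicator (ball (0::complex) R) z \<partial>lborel)"
    proof (rule nn_integral_mono)
      fix z
      have "((jbr z)\<^sup>2 * cmod (q z))\<^sup>2 \<le> ((1 + R\<^sup>2) * indicator (ball 0 R) z)\<^sup>2" by (intro power_mono le) simp
      then show "(ennreal ((jbr z)\<^sup>2 * cmod (q z)))\<^sup>2 \<le> ennreal ((1 + R\<^sup>2)\<^sup>2) * indicator (ball (0::complex) R) z"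
        by (cases "z \<in> ball 0 R") (auto simp: ennreal_power ennreal_leI simp del: mem_ball mem_ball_0)
    qed
    also have "\<dots> < \<infinity>"
      using R by (simp add: nn_integral_cmult_indicator emeasure_complex_ball ennreal_mult_less_top)
    finally show "(\<integral>\<^sup>+z. (ennreal ((jbr z)\<^sup>2 * cmod (q z)))\<^sup>2 \<partial>lborel) < \<infinity>" .
  qed (use assms in auto)
  then show ?thesis ..
qed

theorem mainTheorem2:
  fixes q :: "complex \<Rightarrow> complex" and \<sigma> :: complex and \<epsilon> :: real
  assumes hq: "(\<exists>s. 1 < s \<and> s \<le> 2 \<and> (\<lambda>z. of_real ((jbr z)\<^sup>2) * q z) \<in> Hs s)
             \<or> (\<exists>\<Omega>. smooth_strictly_convex_domain \<Omega> \<and> q = indicator \<Omega>)"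
    and h\<sigma>: "\<sigma> = 1 \<or> \<sigma> = -1"
    and h\<epsilon>: "0 < \<epsilon>" "\<epsilon> \<le> 1"
  shows "\<exists>h0>0. \<exists>C. \<forall>k::complex. k \<noteq> 0 \<and> 1 / cmod k < h0 \<longrightarrow>
    (let AB = (\<lambda>u. opA k q (opB \<sigma> k q u));
         BA = (\<lambda>u. opB \<sigma> k q (opA k q u));
         one = (\<lambda>_. 1 :: complex)
     in
       \<comment> \<open>B(1) and AB(1) are O(1) in <.>^eps L^2\<close>
       opB \<sigma> k q one \<in> wL2 \<epsilon> \<and> wnorm \<epsilon> (opB \<sigma> k q one) \<le> C \<and>
       AB one \<in> wL2 \<epsilon> \<and> wnorm \<epsilon> (AB one) \<le> C \<and>
       \<comment> \<open>1 - AB and 1 - BA are invertible on <.>^eps L^2 (functions modulo a.e. equality)\<close>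
       (\<forall>g\<in>wL2 \<epsilon>. AB g \<in> wL2 \<epsilon> \<and> BA g \<in> wL2 \<epsilon>) \<and>
       (\<forall>f\<in>wL2 \<epsilon>. \<exists>g\<in>wL2 \<epsilon>. AE z in lborel. g z - AB g z = f z) \<and>
       (\<forall>g1\<in>wL2 \<epsilon>. \<forall>g2\<in>wL2 \<epsilon>. (AE z in lborel. g1 z - AB g1 z = g2 z - AB g2 z)
            \<longrightarrow> (AE z in lborel. g1 z = g2 z)) \<and>
       (\<forall>f\<in>wL2 \<epsilon>. \<exists>g\<in>wL2 \<epsilon>. AE z in lborel. g z - BA g z = f z) \<and>
       (\<forall>g1\<in>wL2 \<epsilon>. \<forall>g2\<in>wL2 \<epsilon>. (AE z in lborel. g1 z - BA g1 z = g2 z - BA g2 z)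
            \<longrightarrow> (AE z in lborel. g1 z = g2 z)) \<and>
       \<comment> \<open>phi1^1 = (1-AB)^{-1} AB(1), phi2^1 = (1-BA)^{-1} B(1) give a solution ...\<close>
       (\<exists>\<phi>11\<in>wL2 \<epsilon>. \<exists>\<phi>21\<in>wL2 \<epsilon>.
          (AE z in lborel. \<phi>11 z - AB \<phi>11 z = AB one z) \<and>
          (AE z in lborel. \<phi>21 z - BA \<phi>21 z = opB \<sigma> k q one z) \<and>
          solves_system \<sigma> k q (\<lambda>z. 1 + \<phi>11 z) \<phi>21 \<and>
          \<comment> \<open>... which is the unique one with phi1^1, phi2^1 in <.>^eps L^2\<close>
          (\<forall>\<psi>1\<in>wL2 \<epsilon>. \<forall>\<psi>2\<in>wL2 \<epsilon>. solves_system \<sigma> k q (\<lambda>z. 1 + \<psi>1 z) \<psi>2 \<longrightarrow>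
              (AE z in lborel. \<psi>1 z = \<phi>11 z) \<and> (AE z in lborel. \<psi>2 z = \<phi>21 z))))"
proof -
  obtain M where "admissible q M \<epsilon>" using admissible_potential[OF hq h\<epsilon>] by blast
  then interpret admissible_system q M \<epsilon> \<sigma>
    using h\<sigma> by (simp add: admissible_system_def admissible_system_axioms_def)
  obtain K where K: "\<And>k u. K < cmod k \<Longrightarrow> k \<noteq> 0 \<Longrightarrow> u \<in> sq_int (weighted \<epsilon>) \<Longrightarrow>
    16 * sq_norm (weighted \<epsilon>) (A k (B k u)) \<le> sq_norm (weighted \<epsilon>) u" using AB_small by blast
  obtain C where C: "\<And>k. k \<noteq> 0 \<Longrightarrow> wnorm \<epsilon> (B k (\<lambda>_. 1)) \<le> C" "\<And>k. k \<noteq> 0 \<Longrightarrow> wnorm \<epsilon> (A k (B k (\<lambda>_. 1))) \<le> C"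
    using B_one_bound by blast
  show ?thesis
    unfolding Let_def wL2_eq
  \<comment> \<open>The threshold \<open>1 / (\<bar>K\<bar> + 1)\<close> is positive for every real
    K, and |k| > |K| + 1 implies |k| > K.\<close>
  proof (rule exI[of _ "1 / (\<bar>K\<bar> + 1)"], rule conjI, simp, rule exI[of _ C], rule allI, rule impI)
    fix k :: complex assume "k \<noteq> 0 \<and> 1 / cmod k < 1 / (\<bar>K\<bar> + 1)"
    then have k: "k \<noteq> 0" and "\<bar>K\<bar> + 1 < cmod k" by (auto simp: field_simps)
    then have Kk: "K < cmod k" by linarith
    note sol = solution[OF k K[OF Kk k]]
    interpret AB: L2_contraction "weighted \<epsilon>" "\<lambda>u. A k (B k u)" by (rule sol(1))
    interpret BA: L2_contraction "weighted \<epsilon>" "\<lambda>u. B k (A k u)" by (rule sol(2))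
    have B1: "B k (\<lambda>_. 1) \<in> sq_int (weighted \<epsilon>)" by (rule B_sq_int[OF k one_sq_int])
    have AB1: "A k (B k (\<lambda>_. 1)) \<in> sq_int (weighted \<epsilon>)" using B1 eps_le_2 by (intro opA_sq_int k) auto
    show "B k (\<lambda>_. 1) \<in> sq_int (weighted \<epsilon>) \<and> wnorm \<epsilon> (B k (\<lambda>_. 1)) \<le> C \<and>
       A k (B k (\<lambda>_. 1)) \<in> sq_int (weighted \<epsilon>) \<and> wnorm \<epsilon> (A k (B k (\<lambda>_. 1))) \<le> C \<and>
       (\<forall>g\<in>sq_int (weighted \<epsilon>). A k (B k g) \<in> sq_int (weighted \<epsilon>) \<and> B k (A k g) \<in> sq_int (weighted \<epsilon>)) \<and>
       (\<forall>f\<in>sq_int (weighted \<epsilon>). \<exists>g\<in>sq_int (weighted \<epsilon>). AE z in lborel. g z - A k (B k g) z = f z) \<and>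
       (\<forall>g1\<in>sq_int (weighted \<epsilon>). \<forall>g2\<in>sq_int (weighted \<epsilon>).
          (AE z in lborel. g1 z - A k (B k g1) z = g2 z - A k (B k g2) z) \<longrightarrow> (AE z in lborel. g1 z = g2 z)) \<and>
       (\<forall>f\<in>sq_int (weighted \<epsilon>). \<exists>g\<in>sq_int (weighted \<epsilon>). AE z in lborel. g z - B k (A k g) z = f z) \<and>
       (\<forall>g1\<in>sq_int (weighted \<epsilon>). \<forall>g2\<in>sq_int (weighted \<epsilon>).
          (AE z in lborel. g1 z - B k (A k g1) z = g2 z - B k (A k g2) z) \<longrightarrow> (AE z in lborel. g1 z = g2 z)) \<and>
       (\<exists>\<phi>1\<in>sq_int (weighted \<epsilon>). \<exists>\<phi>2\<in>sq_int (weighted \<epsilon>).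
          (AE z in lborel. \<phi>1 z - A k (B k \<phi>1) z = A k (B k (\<lambda>_. 1)) z) \<and>
          (AE z in lborel. \<phi>2 z - B k (A k \<phi>2) z = B k (\<lambda>_. 1) z) \<and>
          solves_system \<sigma> k q (\<lambda>z. 1 + \<phi>1 z) \<phi>2 \<and>
          (\<forall>\<psi>1\<in>sq_int (weighted \<epsilon>). \<forall>\<psi>2\<in>sq_int (weighted \<epsilon>). solves_system \<sigma> k q (\<lambda>z. 1 + \<psi>1 z) \<psi>2 \<longrightarrow>
             (AE z in lborel. \<psi>1 z = \<phi>1 z) \<and> (AE z in lborel. \<psi>2 z = \<phi>2 z)))"
    proof (intro conjI ballI impI)
      show "\<exists>g\<in>sq_int (weighted \<epsilon>). AE z in lborel. g z - A k (B k g) z = f z" if "f \<in> sq_int (weighted \<epsilon>)" for f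
        using AB.one_minus_surj[OF that] by (simp add: AE_weighted_iff)
      show "\<exists>g\<in>sq_int (weighted \<epsilon>). AE z in lborel. g z - B k (A k g) z = f z" if "f \<in> sq_int (weighted \<epsilon>)" for f
        using BA.one_minus_surj[OF that] by (simp add: AE_weighted_iff)
      show "AE z in lborel. g1 z = g2 z" if "g1 \<in> sq_int (weighted \<epsilon>)" "g2 \<in> sq_int (weighted \<epsilon>)"
        "AE z in lborel. g1 z - A k (B k g1) z = g2 z - A k (B k g2) z" for g1 g2
        using AB.one_minus_inj[of g1 g2] that by (simp add: AE_weighted_iff)
      show "AE z in lborel. g1 z = g2 z" if "g1 \<in> sq_int (weighted \<epsilon>)" "g2 \<in> sq_int (weighted \<epsilon>)"
        "AE z in lborel. g1 z - B k (A k g1) z = g2 z - B k (A k g2) z" for g1 g2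
        using BA.one_minus_inj[of g1 g2] that by (simp add: AE_weighted_iff)
    qed (use B1 AB1 C[OF k] AB.P_sq_int BA.P_sq_int sol(3) in simp_all)
  qed
qed

end
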